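(* Let $n\ge 1$, let $V=\mathbb{C}^n$, and let $W\subset \mathrm{GL}(V)$ be a finite complex reflection group with degrees $d_1\leq\cdots\leq d_n$. Suppose that the largest degree $d_n$ is a regular number for $W$. (In particular, this hypothesis holds for every $W$ that is an irreducible real reflection group.) Let $f=f_W$ be the defining equation of the reflection multi-arrangement of $W$. Then the Waring rank of $f$ is $$r(f)=d_1\cdots d_{n-1}=\frac{|W|}{d_n}.$$
   Context: A non-identity element $t\in\mathrm{GL}(V)$ of finite order is a pseudo-reflection (or reflection) if it fixes a hyperplane $H_t\subset V$ pointwise, so that it has eigenvalue $1$ with multiplicity $n-1$ and exactly one further eigenvalue, which is $\neq 1$ (the exceptional eigenvalue). A complex reflection group is a finite subgroup $W\subset \mathrm{GL}(V)$ generated by pseudo-reflections. It is a real reflection group if $V$ has a basis in which every element of $W$ has a real matrix, and it is irreducible if $V$ is an irreducible representation of $W$. The action of $W$ is not assumed to be essential (that is, $W$ may fix nonzero vectors). Let $S=\mathrm{Sym}(V)$, identified with $\mathbb{C}[x_1,\dots,x_n]$ by choosing a basis $x_1,\dots,x_n$ of $V$, with the induced action of $W$. The invariant ring $S^W$ is a polynomial ring generated by $n$ homogeneous algebraically independent invariants; their degrees $d_1\le\cdots\le d_n$ (uniquely determined) are the degrees of $W$. For each pseudo-reflection $t\in W$, let $L_t\in V$ be an eigenvector of $t$ for its exceptional eigenvalue, regarded as a linear form in $S$. The defining equation of the reflection multi-arrangement of $W$ (in $V^*$) is $f_W=\prod_t L_t\in S$, the product being over all pseudo-reflections $t\in W$;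 it is defined up to a nonzero scalar, which does not affect the ranks considered. A vector $v\in V$ is regular if it lies on none of the reflecting hyperplanes $H_t\subset V$ ($t$ a pseudo-reflection in $W$). A positive integer $d$ is a regular number for $W$ if some $g\in W$ has a regular eigenvector with eigenvalue $e^{2\pi i/d}$. The Waring rank $r(f)$ of a homogeneous polynomial $f\in S$ of degree $d$ is the smallest positive integer $r$ such that $f=\ell_1^d+\cdots+\ell_r^d$ for some linear forms $\ell_1,\dots,\ell_r\in S$. An empty product equals $1$. *)

theory Defs
  imports
    "HOL-Analysis.Analysis"
    "HOL-Algebra.Generated_Groups"
    "HOL-Library.Poly_Mapping"
begin

section \<open>The polynomial ring \<open>S = Sym(V)\<close> for \<open>V = \<complex>\<^sup>n\<close>\<close>

text \<open>
  The multiplication of \<^typ>\<open>'a \<Rightarrow>\<^sub>0 'b\<close> is convolution, so the following is the ring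
  \<open>\<complex>[x\<^sub>i | i :: 'n]\<close>; a key \<open>m :: 'n \<Rightarrow>\<^sub>0 nat\<close> stands for the monomial
  \<open>\<Prod>i. x\<^sub>i ^ lookup m i\<close>.
\<close>

type_synonym 'n cpoly = "('n \<Rightarrow>\<^sub>0 nat) \<Rightarrow>\<^sub>0 complex"

definition pconst :: "complex \<Rightarrow> 'n cpoly" where
  "pconst c = Poly_Mapping.single 0 c"

definition pvar :: "'n \<Rightarrow> 'n cpoly" where
  "pvar i = Poly_Mapping.single (Poly_Mapping.single i 1) 1"

definition homogeneous :: "nat \<Rightarrow> 'n::finite cpoly \<Rightarrow> bool" where
  "homogeneous d p \<longleftrightarrow>
     (\<forall>m\<in>Poly_Mapping.keys p. (\<Sum>i\<in>UNIV. Poly_Mapping.lookup m i) = d)"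

text \<open>The variables \<open>x\<^sub>i\<close> are the standard basis of \<open>V\<close>, so \<open>lin\<close> is the embedding of \<open>V\<close>
  into \<open>S\<close> as the space of linear forms.\<close>

definition lin :: "complex ^ 'n \<Rightarrow> 'n::finite cpoly" where
  "lin v = (\<Sum>i\<in>UNIV. pconst (v $ i) * pvar i)"

text \<open>\<open>psubst s\<close> is the \<open>\<complex>\<close>-algebra homomorphism with \<open>x\<^sub>i \<mapsto> s i\<close>.\<close>

definition psubst :: "('m \<Rightarrow> 'n cpoly) \<Rightarrow> 'm::finite cpoly \<Rightarrow> 'n::finite cpoly" where
  "psubst s p = (\<Sum>m\<in>Poly_Mapping.keys p.
     pconst (Poly_Mapping.lookup p m) * (\<Prod>i\<in>UNIV. s i ^ Poly_Mapping.lookup m i))"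

text \<open>For a homogeneous polynomial \<open>f \<noteq> 0\<close> the \<open>d\<close> below can only be the degree of \<open>f\<close>.
  For \<open>d = 0\<close> all the powers are \<open>1\<close>; in particular the constant \<open>1\<close> has rank \<open>1\<close>.\<close>

definition waring_rank :: "'n::finite cpoly \<Rightarrow> nat" where
  "waring_rank f = (LEAST r. 0 < r \<and>
     (\<exists>d v. homogeneous d f \<and> f = (\<Sum>j<r. lin (v j) ^ d)))"


section \<open>Complex reflection groups\<close>

text \<open>Elements of \<open>GL(V)\<close> are matrices with respect to the standard basis. (The type
  \<^typ>\<open>complex ^ 'n ^ 'n\<close> also carries a componentwise multiplication, so powers have to
  be taken in \<open>GL\<close>.)\<close>

definition GL :: "(complex ^ 'n ^ 'n) monoid" where
  "GL = \<lparr>carrier = {A. invertible A}, mult = (**), one = mat 1\<rparr>"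

definition pseudo_reflection :: "complex ^ 'n ^ 'n \<Rightarrow> bool" where
  "pseudo_reflection t \<longleftrightarrow>
     t \<in> carrier GL \<and> t \<noteq> mat 1 \<and> (\<exists>k::nat. k > 0 \<and> t [^]\<^bsub>GL\<^esub> k = \<one>\<^bsub>GL\<^esub>) \<and>
     (\<exists>H. vec.subspace H \<and> vec.dim H = CARD('n) - 1 \<and> (\<forall>v\<in>H. t *v v = v))"

definition reflections :: "(complex ^ 'n ^ 'n) set \<Rightarrow> (complex ^ 'n ^ 'n) set" where
  "reflections W = {t \<in> W. pseudo_reflection t}"

text \<open>Since \<open>t \<noteq> 1\<close>, the hyperplane fixed by \<open>t\<close> is the whole fixed space of \<open>t\<close>.\<close>

definition reflecting_hyperplane :: "complex ^ 'n ^ 'n \<Rightarrow> (complex ^ 'n) set" where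
  "reflecting_hyperplane t = {v. t *v v = v}"

definition complex_reflection_group :: "(complex ^ 'n ^ 'n) set \<Rightarrow> bool" where
  "complex_reflection_group W \<longleftrightarrow>
     finite W \<and> subgroup W GL \<and> generate GL (reflections W) = W"

text \<open>The columns of \<open>B\<close> are the basis in which all matrices become real.\<close>

definition real_group :: "(complex ^ 'n ^ 'n) set \<Rightarrow> bool" where
  "real_group W \<longleftrightarrow>
     (\<exists>B :: complex ^ 'n ^ 'n. invertible B \<and>
        (\<forall>g\<in>W. \<forall>i j. (matrix_inv B ** g ** B) $ i $ j \<in> \<real>))"

definition irreducible_group :: "(complex ^ 'n ^ 'n) set \<Rightarrow> bool" where
  "irreducible_group W \<longleftrightarrow>
     (\<forall>U. vec.subspace U \<and> (\<forall>g\<in>W. \<forall>u\<in>U. g *v u \<in> U) \<longrightarrow> U = {0} \<or> U = UNIV)"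


section \<open>Invariants and degrees\<close>

definition act :: "complex ^ 'n ^ 'n \<Rightarrow> 'n::finite cpoly \<Rightarrow> 'n cpoly" where
  "act g = psubst (\<lambda>i. lin (g *v axis i 1))"

definition invariants :: "(complex ^ 'n ^ 'n) set \<Rightarrow> 'n::finite cpoly set" where
  "invariants W = {p. \<forall>g\<in>W. act g p = p}"

definition algebraically_independent :: "('m::finite \<Rightarrow> 'n::finite cpoly) \<Rightarrow> bool" where
  "algebraically_independent F \<longleftrightarrow> (\<forall>P. psubst F P = 0 \<longrightarrow> P = 0)"

text \<open>\<open>ds = [d\<^sub>1, \<dots>, d\<^sub>n]\<close> is the increasing list of degrees of \<open>W\<close>. The \<open>n\<close> generators are
  indexed by the type \<open>'n\<close> itself.\<close>

definition degrees_of :: "(complex ^ 'n ^ 'n) set \<Rightarrow> nat list \<Rightarrow> bool" where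
  "degrees_of W ds \<longleftrightarrow> sorted ds \<and>
     (\<exists>(F :: 'n::finite \<Rightarrow> 'n cpoly) deg.
        (\<forall>i. F i \<in> invariants W \<and> homogeneous (deg i) (F i)) \<and>
        algebraically_independent F \<and>
        invariants W = range (psubst F) \<and>
        mset ds = image_mset deg (mset_set UNIV))"


section \<open>Regular numbers and the reflection multi-arrangement\<close>

definition regular_vector :: "(complex ^ 'n ^ 'n) set \<Rightarrow> complex ^ 'n \<Rightarrow> bool" where
  "regular_vector W v \<longleftrightarrow> (\<forall>t\<in>reflections W. v \<notin> reflecting_hyperplane t)"

definition regular_number :: "(complex ^ 'n ^ 'n) set \<Rightarrow> nat \<Rightarrow> bool" where
  "regular_number W d \<longleftrightarrow> d > 0 \<and>
     (\<exists>g\<in>W. \<exists>v. v \<noteq> 0 \<and> regular_vector W v \<and> g *v v = cis (2 * pi / real d) *s v)"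

text \<open>\<open>f\<close> is a defining equation for some choice of the exceptional eigenvectors \<open>L t\<close>.\<close>

definition defining_equation :: "(complex ^ 'n ^ 'n) set \<Rightarrow> 'n::finite cpoly \<Rightarrow> bool" where
  "defining_equation W f \<longleftrightarrow>
     (\<exists>L. (\<forall>t\<in>reflections W. L t \<noteq> 0 \<and> (\<exists>c. c \<noteq> 1 \<and> t *v L t = c *s L t)) \<and>
          f = (\<Prod>t\<in>reflections W. lin (L t)))"

end

theory Submission
  imports Defs "HOL-Computational_Algebra.Polynomial_FPS"
begin

text \<open>Elements of \<open>S\<close> are treated as functions on \<open>V\<^sup>*\<close>, on which \<open>W\<close> acts through the group \<open>G\<close> of
  transposes. Let \<open>N\<close> be the degree of \<open>f\<close>. If a linear functional \<open>Lam\<close> on the forms of degree \<open>N\<close>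
  transforms under \<open>G\<close> like \<open>f\<close> and \<open>Lam f \<noteq> 0\<close>, then by Steinberg's argument the forms \<open>p\<close> with
  \<open>Lam (p * s) = 0\<close> for all \<open>s\<close> of complementary degree are exactly those in the ideal generated by the
  invariants of positive degree. Skew-symmetrized evaluation at a regular point is such a functional,
  so the coinvariant algebra has dimension \<open>|W|\<close>, and comparing Hilbert series gives
  \<open>|W| = \<Prod> d\<^sub>i\<close> and \<open>N = \<Sum> (d\<^sub>i - 1)\<close>.

  A Waring decomposition of \<open>f\<close> with \<open>r\<close> summands gives by apolarity a functional of this kind that is
  a sum of \<open>r\<close> evaluations; hence the coinvariants embed into a space of dimension \<open>d\<^sub>n * r\<close>.
  Conversely, skew-symmetrizing the power \<open>v ^ N\<close> of a regular eigenvector \<open>v\<close> of \<open>g\<close> gives a nonzero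
  multiple of \<open>f\<close>, and the summands in a coset of the group generated by \<open>g\<close> are proportional.

  For an irreducible real group, a two-colouring of the simple roots yields two involutions whose
  product, a Coxeter element, rotates the Coxeter plane by \<open>2 * pi / h\<close>, where the number of roots is
  \<open>n * h\<close>. It has a regular eigenvector, whose image under the gradients of the basic invariants
  determines its eigenvalues and forces \<open>d\<^sub>n = h\<close>.\<close>

text \<open>Apolarity naturally yields functionals on \<open>Sym\<close> of the dual space, whereas
  \<open>f\<close> lies in \<open>Sym(V)\<close>. The averaged Hermitian form gives an equivariant
  antilinear map \<open>sigma\<close> between the two spaces, and a second conjugation keeps
  polynomials polynomial. So evaluations at the points \<open>sigma (v j)\<close> become skew
  functionals on the same ring as evaluations on a regular orbit, and one duality theorem,
  \<open>perp_eq_iideal\<close>, serves both.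

  The number d enters the two bounds for different reasons. The lower bound needs a form of degree d
  in the ideal that vanishes at none of finitely many nonzero points; the basic invariants have no
  common zero but 0, and each can be multiplied up to degree d once d is at least every degree. The
  upper bound needs d group elements on each line of the orbit of a regular eigenvector, hence a
  primitive d-th root of unity as eigenvalue. A regular largest degree meets both demands.

  That a regular point has a trivial stabilizer is a by-product of counting coinvariants; it is used
  again for the gradients and for the order of the Coxeter element.\<close>

section \<open>The pairing of \<open>V\<close> with its dual, without conjugation\<close>

definition bdot :: "complex ^ 'n \<Rightarrow> complex ^ 'n::finite \<Rightarrow> complex" where
  "bdot u y = (\<Sum>i\<in>UNIV. u $ i * y $ i)"

lemma bdot_add_left: "bdot (u + v) y = bdot u y + bdot v y"
  and bdot_add_right: "bdot u (y + z) = bdot u y + bdot u z"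
  and bdot_scale_left: "bdot (c *s u) y = c * bdot u y"
  and bdot_scale_right: "bdot u (c *s y) = c * bdot u y"
  and bdot_diff_left: "bdot (u - v) y = bdot u y - bdot v y"
  and bdot_diff_right: "bdot u (y - z) = bdot u y - bdot u z"
  and bdot_zero_left: "bdot 0 y = 0"
  and bdot_zero_right: "bdot u 0 = 0"
  by (simp_all add: bdot_def sum.distrib sum_subtractf sum_distrib_left algebra_simps)

lemmas bdot_linear = bdot_add_left bdot_add_right bdot_scale_left bdot_scale_right
  bdot_diff_left bdot_diff_right bdot_zero_left bdot_zero_right

lemma bdot_commute: "bdot u y = bdot y u"
  by (simp add: bdot_def mult.commute)

lemma bdot_matrix: "bdot u (A *v y) = bdot (transpose A *v u) y"
proof -
  have "bdot u (A *v y) = (\<Sum>i\<in>UNIV. \<Sum>j\<in>UNIV. u$i * A$i$j * y$j)"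
    by (simp add: bdot_def matrix_vector_mult_def sum_distrib_left mult.assoc)
  also have "\<dots> = (\<Sum>j\<in>UNIV. \<Sum>i\<in>UNIV. u$i * A$i$j * y$j)" by (rule sum.swap)
  also have "\<dots> = bdot (transpose A *v u) y"
    by (simp add: bdot_def matrix_vector_mult_def transpose_def sum_distrib_right sum_distrib_left
        mult.commute mult.left_commute)
  finally show ?thesis .
qed

lemma bdot_axis [simp]: "bdot (axis i 1) y = y $ i"
proof -
  have "bdot (axis i 1) y = (\<Sum>j\<in>UNIV. if j = i then y $ j else 0)"
    unfolding bdot_def by (intro sum.cong) (auto simp: axis_def)
  then show ?thesis by simp
qed

lemma bdot_eq_zero_imp: assumes "\<And>y. bdot u y = 0" shows "u = 0"
  using assms bdot_axis bdot_commute by (metis vec_eq_iff zero_index)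

lemma exists_bdot_eq_1: assumes "u \<noteq> 0" obtains y where "bdot u y = 1"
proof -
  obtain y where "bdot u y \<noteq> 0" using assms bdot_eq_zero_imp by blast
  then have "bdot u ((1 / bdot u y) *s y) = 1" by (simp add: bdot_linear)
  then show ?thesis using that by blast
qed

lemma proportional_if_ker_subset:
  assumes "u \<noteq> 0" "\<And>y. bdot u y = 0 \<Longrightarrow> bdot v y = 0"
  shows "\<exists>c. v = c *s u"
proof -
  obtain z where z: "bdot u z = 1" using exists_bdot_eq_1[OF assms(1)] by blast
  have "bdot (v - bdot v z *s u) y = 0" for y
  proof -
    have "bdot u (y - bdot u y *s z) = 0" by (simp add: bdot_linear z)
    from assms(2)[OF this] show ?thesis by (simp add: bdot_linear algebra_simps)
  qed
  then have "v - bdot v z *s u = 0" by (rule bdot_eq_zero_imp)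
  then show ?thesis by auto
qed

section \<open>Polynomial functions\<close>

text \<open>Inductive, rather than the range of an evaluation map, so that restriction to lines,
  division by a linear form and differentiation can all be proved along the construction of the
  function. \<open>polys_eq_range_ev\<close> identifies it with the evaluations of formal
  polynomials.\<close>

inductive_set polys :: "(complex ^ 'n::finite \<Rightarrow> complex) set" where
  const: "(\<lambda>_. c) \<in> polys"
| coord: "(\<lambda>y. y $ i) \<in> polys"
| add: "p \<in> polys \<Longrightarrow> q \<in> polys \<Longrightarrow> (\<lambda>y. p y + q y) \<in> polys"
| mult: "p \<in> polys \<Longrightarrow> q \<in> polys \<Longrightarrow> (\<lambda>y. p y * q y) \<in> polys"

lemma polys_sum: "(\<And>i. i \<in> A \<Longrightarrow> p i \<in> polys) \<Longrightarrow> (\<lambda>y. \<Sum>i\<in>A. p i y) \<in> polys"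
  by (induction A rule: infinite_finite_induct) (auto intro: polys.intros)

lemma polys_prod: "(\<And>i. i \<in> A \<Longrightarrow> p i \<in> polys) \<Longrightarrow> (\<lambda>y. \<Prod>i\<in>A. p i y) \<in> polys"
  by (induction A rule: infinite_finite_induct) (auto intro: polys.intros)

lemma polys_power: "p \<in> polys \<Longrightarrow> (\<lambda>y. p y ^ k) \<in> polys"
  by (induction k) (auto intro: polys.intros)

lemma polys_scale: "p \<in> polys \<Longrightarrow> (\<lambda>y. c * p y) \<in> polys"
  by (intro polys.intros)

lemma polys_minus: "p \<in> polys \<Longrightarrow> (\<lambda>y. - p y) \<in> polys"
  using polys_scale[of p "-1"] by simp

lemma polys_diff: "p \<in> polys \<Longrightarrow> q \<in> polys \<Longrightarrow> (\<lambda>y. p y - q y) \<in> polys"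
  using polys.add[OF _ polys_minus, of p q] by simp

lemma polys_bdot: "bdot u \<in> polys"
  unfolding bdot_def by (intro polys_sum polys.intros)

lemma polys_compose:
  assumes "p \<in> polys" "\<And>i. (\<lambda>y. h y $ i) \<in> polys"
  shows "(\<lambda>y. p (h y)) \<in> polys"
  using assms(1) by induction (auto intro: polys.intros assms(2))

lemma polys_matrix: "p \<in> polys \<Longrightarrow> (\<lambda>y. p (A *v y)) \<in> polys"
  by (erule polys_compose)
    (auto simp: matrix_vector_mult_def intro!: polys_sum polys.intros)

lemma polys_cnj:
  assumes "p \<in> polys"
  shows "(\<lambda>y. cnj (p (\<chi> i. cnj (y $ i)))) \<in> polys"
  using assms by induction (auto intro: polys.intros)

lemma polys_line:
  assumes "p \<in> polys"
  shows "\<exists>P. \<forall>s. p (a + s *s b) = poly P s"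
  using assms
proof induction
  case (const c) show ?case by (intro exI[of _ "[:c:]"]) simp
next
  case (coord i) show ?case by (intro exI[of _ "[:a$i, b$i:]"]) simp
next
  case (add p q) then show ?case by (metis poly_add)
next
  case (mult p q) then show ?case by (metis poly_mult)
qed

text \<open>On the line through \<open>a\<close> and \<open>b\<close> both functions are nonzero
  polynomials in one variable, so their product is nonzero somewhere. Zero divisors and generic
  points are reduced to this.\<close>

lemma polys_nonzero_both_on_line:
  assumes "p \<in> polys" "q \<in> polys" "p a \<noteq> 0" "q b \<noteq> 0"
  shows "\<exists>s. p (a + s *s (b - a)) \<noteq> 0 \<and> q (a + s *s (b - a)) \<noteq> 0"
proof -
  obtain P Q where P: "\<And>s. p (a + s *s (b - a)) = poly P s"
    and Q: "\<And>s. q (a + s *s (b - a)) = poly Q s"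
    using polys_line[OF assms(1)] polys_line[OF assms(2)] by meson
  have "poly P 0 \<noteq> 0" "poly Q 1 \<noteq> 0" using assms(3,4) P[of 0] Q[of 1] by auto
  then have "P * Q \<noteq> 0" by auto
  then obtain s where "poly (P * Q) s \<noteq> 0" using poly_all_0_iff_0 by blast
  then show ?thesis using P Q by auto
qed

text \<open>The closure condition makes \<open>S\<close> an affine subspace; joining two good points
  by a line adds one polynomial at a time. Besides the whole space this is applied to a reflecting
  hyperplane.\<close>

lemma polys_generic_point_on:
  assumes "finite A" "S \<noteq> {}" "\<And>a b s. a \<in> S \<Longrightarrow> b \<in> S \<Longrightarrow> a + s *s (b - a) \<in> S"
    and "\<And>p. p \<in> A \<Longrightarrow> p \<in> polys \<and> (\<exists>y\<in>S. p y \<noteq> 0)"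
  shows "\<exists>y\<in>S. \<forall>p\<in>A. p y \<noteq> 0"
  using assms(1,4)
proof (induction A)
  case empty then show ?case using assms(2) by auto
next
  case (insert p A)
  obtain a where a: "a \<in> S" "\<forall>q\<in>A. q a \<noteq> 0" using insert by blast
  have "(\<lambda>y. \<Prod>q\<in>A. q y) \<in> polys" using insert by (intro polys_prod) auto
  moreover have "(\<Prod>q\<in>A. q a) \<noteq> 0" using a insert by simp
  moreover obtain b where b: "b \<in> S" "p b \<noteq> 0" using insert by blast
  ultimately obtain s where "(\<Prod>q\<in>A. q (a + s *s (b - a))) \<noteq> 0" "p (a + s *s (b - a)) \<noteq> 0"
    using polys_nonzero_both_on_line insert.prems by blast
  moreover have "a + s *s (b - a) \<in> S" using a b assms(3) by blast
  ultimately show ?case using insert.hyps by (intro bexI[of _ "a + s *s (b - a)"]) auto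
qed

lemma polys_generic_point:
  assumes "finite A" "\<And>p. p \<in> A \<Longrightarrow> p \<in> polys \<and> (\<exists>y. p y \<noteq> 0)"
  shows "\<exists>y. \<forall>p\<in>A. p y \<noteq> 0"
  using polys_generic_point_on[OF assms(1), of UNIV] assms(2) by auto

lemma polys_no_zero_divisors:
  assumes "p \<in> polys" "q \<in> polys" "p a \<noteq> 0" "\<And>y. p y * q y = 0"
  shows "q y = 0"
  using polys_nonzero_both_on_line[OF assms(1,2,3)] assms(4) by (metis mult_eq_0_iff)

lemma polys_cancel:
  assumes "f \<in> polys" "p \<in> polys" "q \<in> polys" "f a \<noteq> 0" "\<And>y. f y * p y = f y * q y"
  shows "p = q"
  using polys_no_zero_divisors[OF assms(1) polys_diff[OF assms(2,3)] assms(4)] assms(5)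
  by (auto simp: algebra_simps fun_eq_iff)

text \<open>\<open>h\<close> is the projection onto the hyperplane along \<open>u\<close>.
  Inductively \<open>p y - p (h y)\<close> is divisible by the linear form, in the product case by
  telescoping, and \<open>p (h y)\<close> vanishes by assumption.\<close>

lemma polys_dvd_bdot:
  assumes "p \<in> polys" "L \<noteq> 0" "\<And>y. bdot L y = 0 \<Longrightarrow> p y = 0"
  shows "\<exists>q\<in>polys. \<forall>y. p y = bdot L y * q y"
proof -
  obtain u where u: "bdot L u = 1" using exists_bdot_eq_1[OF assms(2)] by blast
  define h where "h y = y - bdot L y *s u" for y
  have h: "(\<lambda>y. h y $ i) \<in> polys" for i
    unfolding h_def by (simp, intro polys_diff polys.intros polys_bdot)
  have "\<exists>d\<in>polys. \<forall>y. p y - p (h y) = bdot L y * d y"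
    using assms(1)
  proof induction
    case (const c)
    show ?case by (intro bexI[of _ "\<lambda>_. 0"]) (auto intro: polys.intros)
  next
    case (coord i)
    show ?case by (intro bexI[of _ "\<lambda>_. u $ i"]) (auto intro: polys.intros simp: h_def)
  next
    case (add p q)
    then obtain d e where de: "d \<in> polys" "\<forall>y. p y - p (h y) = bdot L y * d y"
      "e \<in> polys" "\<forall>y. q y - q (h y) = bdot L y * e y" by blast
    have "p y + q y - (p (h y) + q (h y)) = bdot L y * (d y + e y)" for y
      using de(2,4)[THEN spec, of y] by (metis add_diff_add distrib_left)
    then show ?case using polys.add[OF de(1,3)] by (intro bexI[of _ "\<lambda>y. d y + e y"]) auto
  next
    case (mult p q)
    then obtain d e where de: "d \<in> polys" "\<forall>y. p y - p (h y) = bdot L y * d y"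
      "e \<in> polys" "\<forall>y. q y - q (h y) = bdot L y * e y" by blast
    have "p y * q y - p (h y) * q (h y) = bdot L y * (d y * q y + p (h y) * e y)" for y
    proof -
      have "p y * q y - p (h y) * q (h y) = (p y - p (h y)) * q y + p (h y) * (q y - q (h y))"
        by (simp add: algebra_simps)
      also have "\<dots> = (bdot L y * d y) * q y + p (h y) * (bdot L y * e y)"
        using de(2,4) by simp
      finally show ?thesis by (simp add: algebra_simps)
    qed
    moreover have "(\<lambda>y. d y * q y + p (h y) * e y) \<in> polys"
      using de mult polys_compose[OF mult(1) h] by (intro polys.intros)
    ultimately show ?case by (intro bexI[of _ "\<lambda>y. d y * q y + p (h y) * e y"]) auto
  qed
  moreover have "p (h y) = 0" for y by (rule assms(3)) (simp add: h_def bdot_linear u)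
  ultimately show ?thesis by auto
qed

section \<open>Homogeneous polynomial functions\<close>

text \<open>The scaling law includes \<open>s = 0\<close>, where 0 ^ 0 = 1: forms of positive degree
  vanish at the origin and forms of degree 0 are constant. The zero function belongs to every
  degree.\<close>

definition hpolys :: "nat \<Rightarrow> (complex ^ 'n::finite \<Rightarrow> complex) set" where
  "hpolys k = {p \<in> polys. \<forall>s y. p (s *s y) = s ^ k * p y}"

lemma homD: "p \<in> hpolys k \<Longrightarrow> p \<in> polys" "p \<in> hpolys k \<Longrightarrow> p (s *s y) = s ^ k * p y"
  by (auto simp: hpolys_def)

lemma hom_zero: "(\<lambda>_. 0) \<in> hpolys k"
  by (auto simp: hpolys_def intro: polys.intros)

lemma hom_const: "(\<lambda>_. c) \<in> hpolys 0"
  by (auto simp: hpolys_def intro: polys.intros)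

lemma hom_add: "p \<in> hpolys k \<Longrightarrow> q \<in> hpolys k \<Longrightarrow> (\<lambda>y. p y + q y) \<in> hpolys k"
  by (auto simp: hpolys_def algebra_simps intro: polys.intros)

lemma hom_mult: "p \<in> hpolys k \<Longrightarrow> q \<in> hpolys l \<Longrightarrow> (\<lambda>y. p y * q y) \<in> hpolys (k + l)"
  by (auto simp: hpolys_def power_add algebra_simps intro: polys.intros)

lemma hom_scale: "p \<in> hpolys k \<Longrightarrow> (\<lambda>y. c * p y) \<in> hpolys k"
  using hom_mult[OF hom_const, of p k c] by simp

lemma hom_minus: "p \<in> hpolys k \<Longrightarrow> (\<lambda>y. - p y) \<in> hpolys k"
  using hom_scale[of p k "-1"] by simp

lemma hom_diff: "p \<in> hpolys k \<Longrightarrow> q \<in> hpolys k \<Longrightarrow> (\<lambda>y. p y - q y) \<in> hpolys k"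
  using hom_add[OF _ hom_minus, of p k q] by simp

lemma hom_sum: "(\<And>i. i \<in> A \<Longrightarrow> p i \<in> hpolys k) \<Longrightarrow> (\<lambda>y. \<Sum>i\<in>A. p i y) \<in> hpolys k"
  by (induction A rule: infinite_finite_induct) (auto intro: hom_zero hom_add)

lemma hom_prod:
  "finite A \<Longrightarrow> (\<And>i. i \<in> A \<Longrightarrow> p i \<in> hpolys (k i)) \<Longrightarrow> (\<lambda>y. \<Prod>i\<in>A. p i y) \<in> hpolys (\<Sum>i\<in>A. k i)"
  by (induction A rule: finite_induct) (auto intro: hom_const hom_mult)

lemma hom_power: "p \<in> hpolys k \<Longrightarrow> (\<lambda>y. p y ^ j) \<in> hpolys (j * k)"
  by (induction j) (auto intro: hom_const hom_mult)

lemma hom_bdot: "bdot u \<in> hpolys (Suc 0)"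
  by (auto simp: hpolys_def polys_bdot bdot_linear)

lemma hom_coord: "(\<lambda>y. y $ i) \<in> hpolys (Suc 0)"
  by (auto simp: hpolys_def polys.coord)

lemma hom_matrix: "p \<in> hpolys k \<Longrightarrow> (\<lambda>y. p (A *v y)) \<in> hpolys k"
  by (auto simp: hpolys_def polys_matrix vector_scalar_commute)

lemma hom_0_const: assumes "p \<in> hpolys 0" shows "p y = p 0"
  using homD(2)[OF assms, of 0 y] by simp

lemma poly_eq_if_eq_off_0:
  assumes "\<And>s::complex. s \<noteq> 0 \<Longrightarrow> poly P s = poly Q s" shows "P = Q"
proof -
  have "poly ([:0, 1:] * (P - Q)) s = 0" for s using assms[of s] by (cases "s = 0") auto
  then have "[:0, 1:] * (P - Q) = 0" using poly_all_0_iff_0 by blast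
  then show ?thesis by auto
qed

text \<open>The restriction to a line is a polynomial in \<open>s\<close>, so the scaling law at
  \<open>s = 0\<close> follows from the other values.\<close>

lemma polys_eq_zero_if_off_0:
  assumes "p \<in> polys" "\<And>s. s \<noteq> 0 \<Longrightarrow> p (s *s y) = s ^ k * c" shows "p (s *s y) = s ^ k * c"
proof -
  obtain P where P: "\<And>s. p (0 + s *s y) = poly P s" using polys_line[OF assms(1)] by meson
  have "P = monom c k" by (rule poly_eq_if_eq_off_0) (use P assms(2) in \<open>auto simp: poly_monom\<close>)
  then show ?thesis using P[of s] by (simp add: poly_monom)
qed

text \<open>Cancelling \<open>f\<close> leaves \<open>s ^ a * q (s *s y) = s ^ b * q y\<close>. For
  \<open>a \<le> b\<close> one divides by \<open>s ^ a\<close>, which leaves out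
  \<open>s = 0\<close>; for \<open>a > b\<close> one divides by \<open>s ^ b\<close> and the
  resulting polynomial identity at \<open>s = 0\<close> gives \<open>q y = 0\<close>.\<close>

lemma hom_quotient:
  assumes f: "f \<in> hpolys a" "f z \<noteq> 0" and q: "q \<in> polys" and p: "(\<lambda>y. f y * q y) \<in> hpolys b"
  shows "if a \<le> b then q \<in> hpolys (b - a) else (\<forall>y. q y = 0)"
proof -
  have key: "s ^ a * q (s *s y) = s ^ b * q y" for s y
  proof -
    have "(\<lambda>y. s ^ a * q (s *s y)) = (\<lambda>y. s ^ b * q y)"
    proof (rule polys_cancel[OF homD(1)[OF f(1)] _ _ f(2)])
      show "(\<lambda>y. s ^ a * q (s *s y)) \<in> polys"
        by (intro polys_scale polys_compose[OF q]) (simp, intro polys.intros)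
      show "(\<lambda>y. s ^ b * q y) \<in> polys" by (intro polys_scale q)
      show "f y * (s ^ a * q (s *s y)) = f y * (s ^ b * q y)" for y
        using homD(2)[OF p, of s y] homD(2)[OF f(1), of s y] by (simp add: algebra_simps)
    qed
    then show ?thesis by (rule fun_cong)
  qed
  show ?thesis
  proof (cases "a \<le> b")
    case True
    have "q (s *s y) = s ^ (b - a) * q y" for s y
    proof (rule polys_eq_zero_if_off_0[OF q])
      fix s :: complex assume "s \<noteq> 0"
      then show "q (s *s y) = s ^ (b - a) * q y"
        using key[of s y] True by (simp add: power_diff field_simps)
    qed
    then show ?thesis using True q by (simp add: hpolys_def)
  next
    case False
    have "q y = 0" for y
    proof -
      obtain P where P: "\<And>s. q (0 + s *s y) = poly P s" using polys_line[OF q] by meson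
      have "monom 1 (a - b) * P = [:q y:]"
      proof (rule poly_eq_if_eq_off_0)
        fix s :: complex assume "s \<noteq> 0"
        then show "poly (monom 1 (a - b) * P) s = poly [:q y:] s"
          using key[of s y] False P[of s] by (simp add: poly_monom power_diff field_simps)
      qed
      then have "poly (monom 1 (a - b) * P) 0 = q y" by simp
      then show ?thesis using False by (simp add: poly_monom zero_power)
    qed
    then show ?thesis using False by simp
  qed
qed

lemma polys_decompose:
  assumes "p \<in> polys"
  shows "\<exists>h K. (\<forall>k. h k \<in> hpolys k) \<and> (\<forall>k>K. \<forall>y. h k y = 0) \<and> (\<forall>y. p y = (\<Sum>k\<le>K. h k y))"
  using assms
proof induction
  case (const c)
  show ?case
    by (intro exI[of _ "\<lambda>k. if k = 0 then (\<lambda>_. c) else (\<lambda>_. 0)"] exI[of _ 0])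
       (auto intro: hom_const hom_zero)
next
  case (coord i)
  show ?case
    by (intro exI[of _ "\<lambda>k. if k = 1 then (\<lambda>y. y$i) else (\<lambda>_. 0)"] exI[of _ 1])
       (auto intro: hom_coord hom_zero)
next
  case (add p q)
  then obtain h K h' K' where h: "\<And>k. h k \<in> hpolys k" "\<And>k y. k > K \<Longrightarrow> h k y = 0"
      "\<And>y. p y = (\<Sum>k\<le>K. h k y)"
    and h': "\<And>k. h' k \<in> hpolys k" "\<And>k y. k > K' \<Longrightarrow> h' k y = 0" "\<And>y. q y = (\<Sum>k\<le>K'. h' k y)"
    by metis
  have "p y = (\<Sum>k\<le>max K K'. h k y)" for y
    unfolding h(3) by (rule sum.mono_neutral_left) (auto simp: h(2))
  moreover have "q y = (\<Sum>k\<le>max K K'. h' k y)" for y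
    unfolding h'(3) by (rule sum.mono_neutral_left) (auto simp: h'(2))
  ultimately show ?case using h(1,2) h'(1,2)
    by (intro exI[of _ "\<lambda>k y. h k y + h' k y"] exI[of _ "max K K'"])
       (auto simp: sum.distrib intro!: hom_add)
next
  case (mult p q)
  then obtain h K h' K' where h: "\<And>k. h k \<in> hpolys k" "\<And>k y. k > K \<Longrightarrow> h k y = 0"
      "\<And>y. p y = (\<Sum>k\<le>K. h k y)"
    and h': "\<And>k. h' k \<in> hpolys k" "\<And>k y. k > K' \<Longrightarrow> h' k y = 0" "\<And>y. q y = (\<Sum>k\<le>K'. h' k y)"
    by metis
  have "p y * q y = (\<Sum>k\<le>K + K'. \<Sum>i\<le>k. h i y * h' (k - i) y)" for y
    using polynomial_product[of K "\<lambda>k. h k y" K' "\<lambda>k. h' k y" 1] h h' by simp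
  moreover have "(\<lambda>y. \<Sum>i\<le>k. h i y * h' (k - i) y) \<in> hpolys k" for k
    using hom_mult[OF h(1) h'(1)] by (intro hom_sum) (metis atMost_iff le_add_diff_inverse)
  moreover have "(\<Sum>i\<le>k. h i y * h' (k - i) y) = 0" if "k > K + K'" for k y
  proof (rule sum.neutral, rule ballI)
    fix i assume "i \<in> {..k}"
    then have "i > K \<or> k - i > K'" using that by auto
    then show "h i y * h' (k - i) y = 0" using h(2) h'(2) by auto
  qed
  ultimately show ?case
    by (intro exI[of _ "\<lambda>k y. \<Sum>i\<le>k. h i y * h' (k - i) y"] exI[of _ "K + K'"]) auto
qed

text \<open>At \<open>s *s y\<close> the sum is a polynomial in \<open>s\<close> whose coefficients
  are the values \<open>h k y\<close>.\<close>

lemma hom_independent: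
  assumes "\<And>k. k \<in> A \<Longrightarrow> h k \<in> hpolys k" "finite A" "\<And>y. (\<Sum>k\<in>A. h k y) = 0" "k \<in> A"
  shows "h k y = 0"
proof -
  have "poly (\<Sum>k\<in>A. monom (h k y) k) s = 0" for s
  proof -
    have "poly (\<Sum>k\<in>A. monom (h k y) k) s = (\<Sum>k\<in>A. h k (s *s y))"
      by (simp add: poly_sum poly_monom homD(2)[OF assms(1)] mult.commute)
    then show ?thesis using assms(3) by simp
  qed
  then have "(\<Sum>k\<in>A. monom (h k y) k) = 0" using poly_all_0_iff_0 by blast
  then have "coeff (\<Sum>k\<in>A. monom (h k y) k) k = 0" by simp
  then show ?thesis using assms(2,4) by (simp add: coeff_sum)
qed

lemma hom_component:
  assumes "\<And>k. k \<in> A \<Longrightarrow> h k \<in> hpolys k" "finite A" "p \<in> hpolys j" "\<And>y. p y = (\<Sum>k\<in>A. h k y)"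
  shows "p y = (if j \<in> A then h j y else 0)"
proof -
  define h' where "h' k = (\<lambda>y. (if k \<in> A then h k y else 0) - (if k = j then p y else 0))" for k
  have h': "h' k \<in> hpolys k" for k
  proof -
    have "(\<lambda>y. if k \<in> A then h k y else 0) \<in> hpolys k"
      using assms(1) hom_zero by (cases "k \<in> A") auto
    moreover have "(\<lambda>y. if k = j then p y else 0) \<in> hpolys k"
      using assms(3) hom_zero by (cases "k = j") auto
    ultimately show ?thesis unfolding h'_def by (rule hom_diff)
  qed
  have "(\<Sum>k\<in>insert j A. h' k y) = 0" for y
  proof -
    have "(\<Sum>k\<in>insert j A. if k \<in> A then h k y else 0) = (\<Sum>k\<in>A. h k y)"
      using assms(2) by (intro sum.mono_neutral_cong_right) auto
    moreover have "(\<Sum>k\<in>insert j A. if k = j then p y else 0) = p y"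
      using assms(2) by simp
    ultimately show ?thesis using assms(4)[of y] unfolding h'_def by (simp only: sum_subtractf diff_self)
  qed
  from hom_independent[OF h' _ this, of j] assms(2) have "h' j y = 0" by simp
  then show ?thesis unfolding h'_def by simp
qed

section \<open>Evaluation of formal polynomials\<close>

definition powprod :: "('n::finite \<Rightarrow> nat) \<Rightarrow> complex ^ 'n \<Rightarrow> complex" where
  "powprod m y = (\<Prod>i\<in>UNIV. y $ i ^ m i)"

definition ev :: "'n::finite cpoly \<Rightarrow> complex ^ 'n \<Rightarrow> complex" where
  "ev p y = (\<Sum>m\<in>Poly_Mapping.keys p. Poly_Mapping.lookup p m * powprod (Poly_Mapping.lookup m) y)"

lemma hom_mono: "powprod m \<in> hpolys (\<Sum>i\<in>UNIV. m i)"
  unfolding powprod_def using hom_prod[of UNIV "\<lambda>i y. y $ i ^ m i" m] hom_power[OF hom_coord]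
  by auto

lemma ev_superset:
  assumes "finite S" "Poly_Mapping.keys p \<subseteq> S"
  shows "ev p y = (\<Sum>m\<in>S. Poly_Mapping.lookup p m * powprod (Poly_Mapping.lookup m) y)"
  unfolding ev_def
  by (rule sum.mono_neutral_left) (use assms in \<open>auto simp: in_keys_iff\<close>)

lemma ev_add: "ev (p + q) y = ev p y + ev q y"
proof -
  let ?S = "Poly_Mapping.keys p \<union> Poly_Mapping.keys q"
  have "Poly_Mapping.keys (p + q) \<subseteq> ?S" by (rule keys_add)
  then show ?thesis
    by (subst (1 2 3) ev_superset[of ?S]) (auto simp: lookup_add sum.distrib algebra_simps)
qed

lemma ev_zero [simp]: "ev 0 y = 0" by (simp add: ev_def)

lemma ev_sum: "ev (sum p A) y = (\<Sum>i\<in>A. ev (p i) y)"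
  by (induction A rule: infinite_finite_induct) (auto simp: ev_add)

lemma ev_single: "ev (Poly_Mapping.single m c) y = c * powprod (Poly_Mapping.lookup m) y"
  by (cases "c = 0") (auto simp: ev_def)

lemma poly_mapping_sum_single:
  "p = (\<Sum>m\<in>Poly_Mapping.keys p. Poly_Mapping.single m (Poly_Mapping.lookup p m))"
  by (rule poly_mapping_eqI)
     (simp add: lookup_sum lookup_single when_def in_keys_iff)

lemma ev_mult: "ev (p * q) y = ev p y * ev q y"
proof -
  let ?P = "Poly_Mapping.keys p" and ?Q = "Poly_Mapping.keys q"
  let ?s = "\<lambda>p m. Poly_Mapping.single m (Poly_Mapping.lookup p m)"
  have "p * q = (\<Sum>m\<in>?P. ?s p m) * (\<Sum>m\<in>?Q. ?s q m)"
    using poly_mapping_sum_single[of p] poly_mapping_sum_single[of q] by simp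
  also have "\<dots> = (\<Sum>m\<in>?P. \<Sum>m'\<in>?Q. ?s p m * ?s q m')" by (rule sum_product)
  finally have "ev (p * q) y = (\<Sum>m\<in>?P. \<Sum>m'\<in>?Q. ev (?s p m * ?s q m') y)"
    by (simp add: ev_sum)
  also have "\<dots> = (\<Sum>m\<in>?P. \<Sum>m'\<in>?Q. ev (?s p m) y * ev (?s q m') y)"
    by (simp add: mult_single ev_single powprod_def lookup_add power_add prod.distrib algebra_simps)
  also have "\<dots> = ev p y * ev q y" by (simp add: sum_product ev_def[of p] ev_def[of q] ev_single)
  finally show ?thesis .
qed

lemma ev_pconst [simp]: "ev (pconst c) y = c"
  by (simp add: pconst_def ev_single powprod_def)

lemma ev_one [simp]: "ev 1 y = 1"
  using ev_pconst[of 1 y] by (simp add: pconst_def)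

lemma ev_pvar [simp]: "ev (pvar i) y = y $ i"
proof -
  have "powprod (Poly_Mapping.lookup (Poly_Mapping.single i (1::nat))) y = (\<Prod>j\<in>UNIV. if j = i then y $ j else 1)"
    unfolding powprod_def by (intro prod.cong) (auto simp: lookup_single when_def)
  then show ?thesis by (simp add: pvar_def ev_single)
qed

lemma ev_power: "ev (p ^ k) y = ev p y ^ k"
  by (induction k) (auto simp: ev_mult)

lemma ev_prod: "ev (prod p A) y = (\<Prod>i\<in>A. ev (p i) y)"
  by (induction A rule: infinite_finite_induct) (auto simp: ev_mult)

lemma ev_uminus: "ev (- p) y = - ev p y"
  using ev_add[of p "-p" y] by (simp add: eq_neg_iff_add_eq_0 add.commute)

lemma ev_diff: "ev (p - q) y = ev p y - ev q y"
  using ev_add[of p "-q" y] by (simp add: ev_uminus)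

lemma ev_lin: "ev (lin v) y = bdot v y"
  by (simp add: lin_def ev_sum ev_mult bdot_def)

lemma ev_psubst: "ev (psubst s p) y = ev p (\<chi> i. ev (s i) y)"
  by (simp add: psubst_def ev_sum ev_mult ev_prod ev_power) (simp add: ev_def powprod_def)

text \<open>Substituting \<open>g *v axis i 1\<close> for the variables is precomposition with the
  transpose. This is why functions are studied under the group of transposes.\<close>

lemma ev_act: "ev (act g p) y = ev p (transpose g *v y)"
proof -
  have "(\<chi> i. bdot (g *v axis i 1) y) = transpose g *v y"
    using bdot_matrix[of y g "axis _ 1"] by (simp add: vec_eq_iff bdot_commute)
  then show ?thesis by (simp add: act_def ev_psubst ev_lin)
qed

lemma ev_in_polys: "ev p \<in> polys"
  unfolding ev_def powprod_def
  by (intro polys_sum polys_scale polys_prod polys_power polys.intros)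

lemma polys_eq_range_ev: "polys = range ev"
proof
  show "range ev \<subseteq> polys" using ev_in_polys by auto
  show "polys \<subseteq> range ev"
  proof
    fix p :: "complex ^ 'n \<Rightarrow> complex" assume "p \<in> polys"
    then show "p \<in> range ev"
    proof induction
      case (const c) show ?case by (rule range_eqI[of _ _ "pconst c"]) (simp add: fun_eq_iff)
    next
      case (coord i) show ?case by (rule range_eqI[of _ _ "pvar i"]) (simp add: fun_eq_iff)
    next
      case (add p q)
      then obtain P Q where "p = ev P" "q = ev Q" by blast
      then show ?case by (intro range_eqI[of _ _ "P + Q"]) (simp add: fun_eq_iff ev_add)
    next
      case (mult p q)
      then obtain P Q where "p = ev P" "q = ev Q" by blast
      then show ?case by (intro range_eqI[of _ _ "P * Q"]) (simp add: fun_eq_iff ev_mult)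
    qed
  qed
qed

text \<open>A relation between monomials persists when it is restricted to the monomials with a given
  exponent in one variable; restricting variable by variable isolates a single monomial.\<close>

lemma mono_independent:
  fixes M :: "('a \<Rightarrow> 'n::finite \<Rightarrow> nat)"
  assumes "finite K" "\<And>y. (\<Sum>m\<in>K. c m * powprod (M m) y) = 0" "inj_on M K" "m0 \<in> K"
  shows "c m0 = 0"
proof -
  have "(\<Sum>m\<in>{m\<in>K. \<forall>i\<in>A. M m i = M m0 i}. c m * powprod (M m) y) = 0" for A y
  proof (induction A arbitrary: y rule: infinite_finite_induct)
    case (infinite A) then show ?case by simp
  next
    case empty then show ?case using assms(2) by simp
  next
    case (insert i A)
    let ?KA = "{m\<in>K. \<forall>i\<in>A. M m i = M m0 i}"
    let ?y = "\<lambda>s. (\<chi> j. if j = i then s else y $ j) :: complex ^ 'n"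
    let ?d = "\<lambda>m. c m * (\<Prod>j\<in>UNIV - {i}. y $ j ^ M m j)"
    have mono: "powprod (M m) (?y s) = s ^ M m i * (\<Prod>j\<in>UNIV - {i}. y $ j ^ M m j)" for m s
      unfolding powprod_def by (subst prod.remove[of _ i]) auto
    have "poly (\<Sum>m\<in>?KA. monom (?d m) (M m i)) s = 0" for s
      using insert.IH[of "?y s"] by (simp add: mono poly_sum poly_monom algebra_simps)
    then have "(\<Sum>m\<in>?KA. monom (?d m) (M m i)) = 0" using poly_all_0_iff_0 by blast
    then have "coeff (\<Sum>m\<in>?KA. monom (?d m) (M m i)) (M m0 i) = 0" by simp
    then have "(\<Sum>m\<in>?KA. if M m i = M m0 i then ?d m else 0) = 0"
      by (simp add: coeff_sum)
    moreover have "(\<Sum>m\<in>?KA. if M m i = M m0 i then ?d m else 0) =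
        (\<Sum>m\<in>{m\<in>K. \<forall>i\<in>insert i A. M m i = M m0 i}. ?d m)"
      using assms(1) by (intro sum.mono_neutral_cong_right) auto
    moreover have "(\<Sum>m\<in>{m\<in>K. \<forall>i\<in>insert i A. M m i = M m0 i}. c m * powprod (M m) y) =
        (\<Sum>m\<in>{m\<in>K. \<forall>i\<in>insert i A. M m i = M m0 i}. y $ i ^ M m0 i * ?d m)"
    proof (rule sum.cong)
      fix m assume "m \<in> {m\<in>K. \<forall>i\<in>insert i A. M m i = M m0 i}"
      moreover have "?y (y $ i) = y" by (simp add: vec_eq_iff)
      ultimately show "c m * powprod (M m) y = y $ i ^ M m0 i * ?d m"
        using mono[of m "y $ i"] by simp
    qed simp
    ultimately show ?case by (simp add: sum_distrib_left[symmetric])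
  qed
  from this[where A = UNIV and y = "\<chi> i. 1"]
  have "(\<Sum>m\<in>{m\<in>K. M m = M m0}. c m) = 0" by (simp add: powprod_def fun_eq_iff)
  moreover have "{m\<in>K. M m = M m0} = {m0}" using assms(3,4) by (auto dest: inj_onD)
  ultimately show ?thesis by simp
qed

lemma ev_eq_zero_imp: assumes "\<And>y. ev p y = 0" shows "p = 0"
proof -
  have "Poly_Mapping.lookup p m = 0" if "m \<in> Poly_Mapping.keys p" for m
    by (rule mono_independent[of "Poly_Mapping.keys p" "Poly_Mapping.lookup p" Poly_Mapping.lookup])
       (use assms that in \<open>auto simp: ev_def inj_on_def poly_mapping.lookup_inject\<close>)
  then show ?thesis by (intro poly_mapping_eqI) (auto simp: in_keys_iff)
qed

lemma ev_inject: "ev p = ev q \<longleftrightarrow> p = q"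
  using ev_eq_zero_imp[of "p - q"] by (auto simp: ev_diff fun_eq_iff)

lemma homogeneous_imp_hom: assumes "homogeneous d p" shows "ev p \<in> hpolys d"
proof -
  have "(\<lambda>y. \<Sum>m\<in>Poly_Mapping.keys p. Poly_Mapping.lookup p m * powprod (Poly_Mapping.lookup m) y) \<in> hpolys d"
    by (intro hom_sum hom_scale) (use assms hom_mono in \<open>metis homogeneous_def\<close>)
  then show ?thesis by (simp add: ev_def[abs_def])
qed

lemma hom_expand:
  assumes "p \<in> hpolys k"
  shows "\<exists>S a. finite S \<and> (\<forall>m\<in>S. (\<Sum>i\<in>UNIV. m i) = k) \<and> (\<forall>y. p y = (\<Sum>m\<in>S. a m * powprod m y))"
proof -
  obtain P where P: "p = ev P" using assms polys_eq_range_ev homD(1) by blast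
  let ?L = "Poly_Mapping.lookup"
  let ?K = "Poly_Mapping.keys P"
  let ?deg = "\<lambda>m. \<Sum>i\<in>UNIV. ?L m i"
  define h where "h j = (\<lambda>y. \<Sum>m\<in>{m\<in>?K. ?deg m = j}. ?L P m * powprod (?L m) y)" for j
  have h: "h j \<in> hpolys j" for j
    unfolding h_def using hom_mono by (intro hom_sum hom_scale) auto
  have "p y = (\<Sum>j\<in>?deg ` ?K. h j y)" for y
    unfolding P ev_def h_def by (rule sum.image_gen) simp
  from hom_component[OF h _ assms this]
  have "p y = (if k \<in> ?deg ` ?K then h k y else 0)" for y by simp
  moreover have "h k y = 0" if "k \<notin> ?deg ` ?K" for y
    unfolding h_def using that by (intro sum.neutral) auto
  ultimately have 1: "p y = h k y" for y by auto
  let ?S = "{m\<in>?K. ?deg m = k}"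
  have inj: "inj_on ?L ?S" by (auto simp: inj_on_def poly_mapping.lookup_inject)
  show ?thesis
  proof (intro exI conjI allI)
    show "finite (?L ` ?S)" by simp
    show "\<forall>m\<in>?L ` ?S. (\<Sum>i\<in>UNIV. m i) = k" by auto
    show "p y = (\<Sum>m\<in>?L ` ?S. ?L P (the_inv_into ?S ?L m) * powprod m y)" for y
      by (subst sum.reindex[OF inj])
         (auto simp: 1 h_def the_inv_into_f_f[OF inj] intro!: sum.cong)
  qed
qed

section \<open>Comparison of dimensions\<close>

text \<open>Elimination: solve one equation for an unknown \<open>i0\<close> that occurs in it and
  substitute in the others.\<close>

lemma homogeneous_system_nontrivial_solution:
  fixes A :: "'i \<Rightarrow> 'j \<Rightarrow> complex"
  assumes "finite Y" "finite X" "card Y < card X"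
  shows "\<exists>c. (\<exists>i\<in>X. c i \<noteq> 0) \<and> (\<forall>j\<in>Y. (\<Sum>i\<in>X. c i * A i j) = 0)"
  using assms
proof (induction Y arbitrary: X A)
  case empty
  then have "X \<noteq> {}" by auto
  then show ?case by (intro exI[of _ "\<lambda>_. 1"]) auto
next
  case (insert j Y)
  show ?case
  proof (cases "\<forall>i\<in>X. A i j = 0")
    case True
    from insert.IH[of X A] insert.prems insert.hyps obtain c where
      "\<exists>i\<in>X. c i \<noteq> 0" "\<forall>j\<in>Y. (\<Sum>i\<in>X. c i * A i j) = 0" by auto
    then show ?thesis using True by (intro exI[of _ c]) auto
  next
    case False
    then obtain i0 where i0: "i0 \<in> X" "A i0 j \<noteq> 0" by blast
    let ?X = "X - {i0}"
    let ?A = "\<lambda>i l. A i l - A i j / A i0 j * A i0 l"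
    have "card Y < card ?X" using insert.prems insert.hyps i0 by simp
    from insert.IH[OF _ this, of ?A] insert.prems obtain c where
      c: "\<exists>i\<in>?X. c i \<noteq> 0" "\<forall>l\<in>Y. (\<Sum>i\<in>?X. c i * ?A i l) = 0" by auto
    define c0 where "c0 = - (\<Sum>i\<in>?X. c i * A i j) / A i0 j"
    have sum: "(\<Sum>i\<in>X. (c(i0 := c0)) i * A i l) = c0 * A i0 l + (\<Sum>i\<in>?X. c i * A i l)" for l
      using insert.prems i0 by (subst sum.remove[of _ i0]) (auto intro!: sum.cong)
    have "(\<Sum>i\<in>X. (c(i0 := c0)) i * A i j) = 0"
      unfolding sum unfolding c0_def using i0 by simp
    moreover have "(\<Sum>i\<in>X. (c(i0 := c0)) i * A i l) = 0" if "l \<in> Y" for l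
    proof -
      have "(\<Sum>i\<in>?X. c i * ?A i l) = (\<Sum>i\<in>?X. c i * A i l) - (\<Sum>i\<in>?X. c i * A i j) / A i0 j * A i0 l"
        by (simp add: algebra_simps sum_subtractf sum_distrib_left sum_divide_distrib)
      then show ?thesis using c(2) that unfolding sum unfolding c0_def by (simp add: algebra_simps)
    qed
    ultimately show ?thesis using c(1) by (intro exI[of _ "c(i0 := c0)"]) auto
  qed
qed

text \<open>A dimension comparison that avoids forming spaces: independence and span are only
  required of the restrictions to \<open>S\<close>. The dimension counts for polynomial functions
  below, on orbits, on lines and in a fixed degree, all have this shape.\<close>

lemma card_le_if_independent_in_span:
  fixes v :: "'i \<Rightarrow> 'x \<Rightarrow> complex" and w :: "'j \<Rightarrow> 'x \<Rightarrow> complex"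
  assumes "finite X" "finite Y"
    and indep: "\<And>c. (\<And>x. x \<in> S \<Longrightarrow> (\<Sum>i\<in>X. c i * v i x) = 0) \<Longrightarrow> \<forall>i\<in>X. c i = 0"
    and span: "\<And>i. i \<in> X \<Longrightarrow> \<exists>a. \<forall>x\<in>S. v i x = (\<Sum>j\<in>Y. a j * w j x)"
  shows "card X \<le> card Y"
proof (rule ccontr)
  assume less: "\<not> card X \<le> card Y"
  obtain A where A: "\<And>i x. i \<in> X \<Longrightarrow> x \<in> S \<Longrightarrow> v i x = (\<Sum>j\<in>Y. A i j * w j x)"
    using span by metis
  obtain c where c: "\<exists>i\<in>X. c i \<noteq> 0" "\<forall>j\<in>Y. (\<Sum>i\<in>X. c i * A i j) = 0"
    using homogeneous_system_nontrivial_solution[OF assms(2,1), of A] less by auto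
  have "(\<Sum>i\<in>X. c i * v i x) = 0" if "x \<in> S" for x
  proof -
    have "(\<Sum>i\<in>X. c i * v i x) = (\<Sum>i\<in>X. \<Sum>j\<in>Y. c i * A i j * w j x)"
      using A that by (auto simp: sum_distrib_left mult.assoc intro!: sum.cong)
    also have "\<dots> = (\<Sum>j\<in>Y. \<Sum>i\<in>X. c i * A i j * w j x)" by (rule sum.swap)
    also have "\<dots> = (\<Sum>j\<in>Y. (\<Sum>i\<in>X. c i * A i j) * w j x)" by (simp add: sum_distrib_right)
    also have "\<dots> = 0" using c(2) by simp
    finally show ?thesis .
  qed
  from indep[OF this] c(1) show False by blast
qed

section \<open>The ideal generated by the invariants of positive degree\<close>

definition invariant :: "(complex ^ 'n ^ 'n) set \<Rightarrow> (complex ^ 'n::finite \<Rightarrow> complex) \<Rightarrow> bool" where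
  "invariant G p \<longleftrightarrow> (\<forall>g\<in>G. \<forall>y. p (g *v y) = p y)"

text \<open>Recording the degree keeps every statement homogeneous, so that the coinvariant algebra
  can be treated degree by degree without a quotient ring.\<close>

inductive_set iideal :: "(complex ^ 'n ^ 'n) set \<Rightarrow> nat \<Rightarrow> (complex ^ 'n::finite \<Rightarrow> complex) set"
  for G k where
  zero: "(\<lambda>_. 0) \<in> iideal G k"
| add: "p \<in> iideal G k \<Longrightarrow> q \<in> iideal G k \<Longrightarrow> (\<lambda>y. p y + q y) \<in> iideal G k"
| gen: "u \<in> hpolys j \<Longrightarrow> 0 < j \<Longrightarrow> invariant G u \<Longrightarrow> s \<in> hpolys l \<Longrightarrow> j + l = k \<Longrightarrow>
    (\<lambda>y. u y * s y) \<in> iideal G k"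

lemma iideal_hpolys: "p \<in> iideal G k \<Longrightarrow> p \<in> hpolys k"
  by (induction rule: iideal.induct) (auto intro: hom_zero hom_add hom_mult)

lemma iideal_mult: "p \<in> iideal G k \<Longrightarrow> q \<in> hpolys l \<Longrightarrow> (\<lambda>y. p y * q y) \<in> iideal G (k + l)"
proof (induction rule: iideal.induct)
  case zero then show ?case using iideal.zero by simp
next
  case (add p p') then show ?case using iideal.add by (simp add: algebra_simps)
next
  case (gen u j s l')
  have "(\<lambda>y. u y * (s y * q y)) \<in> iideal G (k + l)"
    by (rule iideal.gen[OF gen(1,2,3) hom_mult[OF gen(4)]]) (use gen in auto)
  then show ?case by (simp add: mult.assoc)
qed

lemma iideal_scale: "p \<in> iideal G k \<Longrightarrow> (\<lambda>y. c * p y) \<in> iideal G k"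
  using iideal_mult[OF _ hom_const, of p G k c] by (simp add: mult.commute)

lemma iideal_diff: "p \<in> iideal G k \<Longrightarrow> q \<in> iideal G k \<Longrightarrow> (\<lambda>y. p y - q y) \<in> iideal G k"
  using iideal.add[OF _ iideal_scale, of p G k q "-1"] by simp

lemma iideal_sum: "(\<And>i. i \<in> A \<Longrightarrow> p i \<in> iideal G k) \<Longrightarrow> (\<lambda>y. \<Sum>i\<in>A. p i y) \<in> iideal G k"
  by (induction A rule: infinite_finite_induct) (auto intro: iideal.zero iideal.add)

section \<open>Finite reflection groups, the form \<open>f\<close> and its character\<close>

text \<open>\<open>R_complete\<close> keeps \<open>R\<close> closed under conjugation and under
  nontrivial products of reflections with a common hyperplane. \<open>gen\<close> states generation
  as an induction principle, by left multiplication with reflections.\<close>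

locale refl_group =
  fixes G R :: "(complex ^ 'n::finite ^ 'n) set" and L :: "complex ^ 'n ^ 'n \<Rightarrow> complex ^ 'n"
  assumes fin: "finite G"
    and one: "mat 1 \<in> G"
    and mult: "\<And>g h. g \<in> G \<Longrightarrow> h \<in> G \<Longrightarrow> g ** h \<in> G"
    and inv: "\<And>g. g \<in> G \<Longrightarrow> \<exists>h\<in>G. h ** g = mat 1 \<and> g ** h = mat 1"
    and R_sub: "R \<subseteq> G"
    and L_nz: "\<And>t. t \<in> R \<Longrightarrow> L t \<noteq> 0"
    and R_fix: "\<And>t y. t \<in> R \<Longrightarrow> bdot (L t) y = 0 \<Longrightarrow> t *v y = y"
    and R_eig: "\<And>t. t \<in> R \<Longrightarrow> \<exists>c. c \<noteq> 1 \<and> (\<forall>y. bdot (L t) (t *v y) = c * bdot (L t) y)"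
    and R_complete: "\<And>g u. g \<in> G \<Longrightarrow> g \<noteq> mat 1 \<Longrightarrow> u \<noteq> 0 \<Longrightarrow>
      (\<And>y. bdot u y = 0 \<Longrightarrow> g *v y = y) \<Longrightarrow> g \<in> R"
    and gen: "\<And>X. X \<subseteq> G \<Longrightarrow> mat 1 \<in> X \<Longrightarrow> (\<And>t g. t \<in> R \<Longrightarrow> g \<in> X \<Longrightarrow> t ** g \<in> X) \<Longrightarrow> X = G"
begin

text \<open>The factor by which \<open>t\<close> acts on its linear form; it equals the determinant
  of \<open>t\<close>.\<close>

definition delta where "delta t = (SOME c. c \<noteq> 1 \<and> (\<forall>y. bdot (L t) (t *v y) = c * bdot (L t) y))"

lemma delta: assumes "t \<in> R"
  shows "delta t \<noteq> 1" "bdot (L t) (t *v y) = delta t * bdot (L t) y"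
  using someI_ex[OF R_eig[OF assms]] unfolding delta_def by blast+

lemma delta_nz: assumes "t \<in> R" shows "delta t \<noteq> 0"
proof
  assume 0: "delta t = 0"
  obtain h where h: "t ** h = mat 1" using inv R_sub assms by blast
  obtain y where "bdot (L t) y = 1" using exists_bdot_eq_1[OF L_nz[OF assms]] by blast
  moreover have "bdot (L t) (t *v (h *v y)) = 0" using delta(2)[OF assms] 0 by simp
  ultimately show False by (simp add: matrix_vector_mul_assoc h)
qed

definition N where "N = card R"

definition f where "f y = (\<Prod>t\<in>R. bdot (L t) y)"

lemma finR: "finite R" using fin R_sub finite_subset by blast

lemma f_hom: "f \<in> hpolys N"
proof -
  have "(\<lambda>y. \<Prod>t\<in>R. bdot (L t) y) \<in> hpolys (\<Sum>t\<in>R. Suc 0)"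
    by (rule hom_prod[OF finR hom_bdot])
  then show ?thesis by (simp add: N_def f_def[abs_def])
qed

lemma f_polys: "f \<in> polys" using f_hom homD by blast

lemma f_nz: "\<exists>y. f y \<noteq> 0"
proof -
  have "\<exists>y. \<forall>p\<in>(\<lambda>t. bdot (L t)) ` R. p y \<noteq> 0"
    using finR polys_bdot exists_bdot_eq_1[OF L_nz]
    by (intro polys_generic_point) (auto, metis zero_neq_one)
  then show ?thesis using finR by (auto simp: f_def)
qed

lemma same_ker_proportional:
  assumes "t \<in> R" "u \<noteq> 0" "\<And>y. bdot u y = 0 \<Longrightarrow> t *v y = y"
  shows "\<exists>c. c \<noteq> 0 \<and> u = c *s L t"
proof -
  have "bdot (L t) y = 0" if "bdot u y = 0" for y
    using delta(1)[OF assms(1)] delta(2)[OF assms(1), of y] assms(3)[OF that] by (metis mult_cancel_right1)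
  then obtain c where c: "L t = c *s u" using proportional_if_ker_subset[OF assms(2)] by blast
  have "c \<noteq> 0" using c L_nz[OF assms(1)] by auto
  then show ?thesis using c by (intro exI[of _ "inverse c"]) simp
qed

text \<open>\<open>L t\<close> composed with \<open>g\<close> is a linear form whose kernel is fixed
  by the conjugate. So completeness of \<open>R\<close> applies, and the form is proportional to the
  one chosen for the conjugate.\<close>

lemma conj_refl:
  assumes "t \<in> R" "g \<in> G" "h \<in> G" "h ** g = mat 1" "g ** h = mat 1"
  shows "h ** t ** g \<in> R" "\<exists>c. c \<noteq> 0 \<and> (\<forall>y. bdot (L t) (g *v y) = c * bdot (L (h ** t ** g)) y)"
proof -
  define u where "u = transpose g *v L t"
  have u: "bdot u y = bdot (L t) (g *v y)" for y unfolding u_def by (simp add: bdot_matrix)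
  have "u \<noteq> 0"
  proof
    assume "u = 0"
    obtain y where "bdot (L t) y = 1" using exists_bdot_eq_1[OF L_nz[OF assms(1)]] by blast
    then have "bdot u (h *v y) = 1" by (simp add: u matrix_vector_mul_assoc assms)
    then show False using \<open>u = 0\<close> by (simp add: bdot_linear)
  qed
  have fix': "(h ** t ** g) *v y = y" if "bdot u y = 0" for y
  proof -
    have "t *v (g *v y) = g *v y" using R_fix[OF assms(1)] that u by metis
    then show ?thesis by (metis assms(4) matrix_vector_mul_assoc matrix_vector_mul_lid)
  qed
  have ne: "h ** t ** g \<noteq> mat 1"
  proof
    assume "h ** t ** g = mat 1"
    then have "g ** (h ** t ** g) ** h = mat 1" by (simp add: assms)
    then have t1: "t = mat 1" by (metis assms(5) matrix_mul_assoc matrix_mul_lid matrix_mul_rid)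
    obtain y where "bdot (L t) y = 1" using exists_bdot_eq_1[OF L_nz[OF assms(1)]] by blast
    then show False using delta(1)[OF assms(1)] delta(2)[OF assms(1), of y] t1 by simp
  qed
  have "h ** t ** g \<in> G" using assms R_sub mult by blast
  from R_complete[OF this ne \<open>u \<noteq> 0\<close> fix'] show R: "h ** t ** g \<in> R" by blast
  obtain c where "c \<noteq> 0" "u = c *s L (h ** t ** g)"
    using same_ker_proportional[OF R \<open>u \<noteq> 0\<close> fix'] by blast
  then show "\<exists>c. c \<noteq> 0 \<and> (\<forall>y. bdot (L t) (g *v y) = c * bdot (L (h ** t ** g)) y)"
    using u by (metis bdot_scale_left)
qed

text \<open>Conjugation permutes the reflections, hence the factors of \<open>f\<close> up to
  scalars.\<close>

lemma f_semi_invariant: assumes "g \<in> G" shows "\<exists>k. k \<noteq> 0 \<and> (\<forall>y. f (g *v y) = k * f y)"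
proof -
  obtain h where h: "h \<in> G" "h ** g = mat 1" "g ** h = mat 1" using inv assms by blast
  let ?c = "\<lambda>t. h ** t ** g"
  obtain c where c: "\<And>t. t \<in> R \<Longrightarrow> c t \<noteq> 0"
    "\<And>t y. t \<in> R \<Longrightarrow> bdot (L t) (g *v y) = c t * bdot (L (?c t)) y"
    using conj_refl(2)[OF _ assms h] by metis
  have "inj ?c"
  proof (rule injI)
    fix t t' assume "?c t = ?c t'"
    then have "g ** ?c t ** h = g ** ?c t' ** h" by simp
    then show "t = t'" using h by (metis matrix_mul_assoc matrix_mul_lid matrix_mul_rid)
  qed
  then have inj: "inj_on ?c R" by (rule inj_on_subset) simp
  have "?c ` R = R"
    by (rule card_subset_eq[OF finR]) (use conj_refl(1)[OF _ assms h] card_image[OF inj] in auto)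
  then have "f y = (\<Prod>t\<in>R. bdot (L (?c t)) y)" for y
    unfolding f_def using prod.reindex[OF inj, of "\<lambda>t. bdot (L t) y"] by simp
  moreover have "f (g *v y) = (\<Prod>t\<in>R. c t * bdot (L (?c t)) y)" for y
    unfolding f_def by (intro prod.cong c(2)) auto
  ultimately have "f (g *v y) = (\<Prod>t\<in>R. c t) * f y" for y
    by (simp only: prod.distrib)
  moreover have "(\<Prod>t\<in>R. c t) \<noteq> 0" using c(1) finR by simp
  ultimately show ?thesis by blast
qed

definition kappa where "kappa g = (SOME k. k \<noteq> 0 \<and> (\<forall>y. f (g *v y) = k * f y))"

lemma kappa: assumes "g \<in> G" shows "kappa g \<noteq> 0" "f (g *v y) = kappa g * f y"
  using someI_ex[OF f_semi_invariant[OF assms]] unfolding kappa_def by blast+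

lemma kappa_eqI: assumes "g \<in> G" "\<And>y. f (g *v y) = k * f y" shows "kappa g = k"
  using f_nz kappa(2)[OF assms(1)] assms(2) by (metis mult_cancel_right)

lemma kappa_mult: assumes "g \<in> G" "h \<in> G" shows "kappa (g ** h) = kappa g * kappa h"
  by (rule kappa_eqI)
     (auto simp: assms mult matrix_vector_mul_assoc[symmetric] kappa)

lemma kappa_one: "kappa (mat 1) = 1"
  by (rule kappa_eqI) (auto simp: one)

subsection \<open>The reflections with a common hyperplane\<close>

definition par where "par t0 = {t\<in>R. \<exists>c. L t = c *s L t0}"

lemma parD: assumes "t \<in> par t0" "t0 \<in> R"
  shows "t \<in> R" "bdot (L t0) y = 0 \<Longrightarrow> t *v y = y"
    "bdot (L t0) (t *v y) = delta t * bdot (L t0) y" "\<exists>c. c \<noteq> 0 \<and> L t = c *s L t0"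
proof -
  show t: "t \<in> R" using assms by (auto simp: par_def)
  obtain c where c: "L t = c *s L t0" using assms by (auto simp: par_def)
  have c0: "c \<noteq> 0" using c L_nz[OF t] by auto
  show "t *v y = y" if "bdot (L t0) y = 0" using R_fix[OF t, of y] that c by (simp add: bdot_linear)
  show "bdot (L t0) (t *v y) = delta t * bdot (L t0) y"
    using delta(2)[OF t, of y] c c0 by (simp add: bdot_linear)
  show "\<exists>c. c \<noteq> 0 \<and> L t = c *s L t0" using c c0 by blast
qed

lemma finite_par: "finite (par t0)" using finR by (simp add: par_def)

text \<open>Such an element is a transvection: its powers move \<open>y\<close> through the points y
  + k z, so in a finite group \<open>z = 0\<close>.\<close>

lemma transvection_is_one:
  assumes "s \<in> G" "\<And>y. bdot u y = 0 \<Longrightarrow> s *v y = y" "\<And>y. bdot u (s *v y) = bdot u y"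
  shows "s = mat 1"
proof -
  have "s *v y = y" for y
  proof -
    define z where "z = s *v y - y"
    have sz: "s *v z = z" by (rule assms(2)) (simp add: z_def bdot_linear assms(3))
    have "\<exists>g\<in>G. g *v y = y + of_nat k *s z" for k
    proof (induction k)
      case 0 show ?case using one by (intro bexI[of _ "mat 1"]) auto
    next
      case (Suc k)
      then obtain g where g: "g \<in> G" "g *v y = y + of_nat k *s z" by blast
      have "s *v (of_nat k *s z) = of_nat k *s z" by (simp only: vector_scalar_commute sz)
      moreover have "s *v y = y + z" by (simp add: z_def)
      ultimately have "(s ** g) *v y = y + of_nat (Suc k) *s z"
        by (simp add: matrix_vector_mul_assoc[symmetric] g matrix_vector_right_distrib
            vector_sadd_rdistrib)
      then show ?case using mult assms(1) g(1) by blast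
    qed
    then have "range (\<lambda>k::nat. y + of_nat k *s z) \<subseteq> (\<lambda>g. g *v y) ` G" by (auto simp: image_iff) metis
    then have "finite (range (\<lambda>k::nat. y + of_nat k *s z))" using fin finite_subset by blast
    then have "\<not> inj (\<lambda>k::nat. y + of_nat k *s z)" using finite_imageD by blast
    then have "z = 0" by (auto simp: inj_on_def)
    then show ?thesis by (simp add: z_def)
  qed
  then show ?thesis by (simp add: matrix_eq)
qed

lemma delta_inj: assumes "t0 \<in> R" shows "inj_on delta (par t0)"
proof (rule inj_onI)
  fix t t' assume t: "t \<in> par t0" "t' \<in> par t0" and eq: "delta t = delta t'"
  have tG: "t \<in> G" "t' \<in> G" using parD(1)[OF _ assms] t R_sub by auto
  then obtain h where h: "h \<in> G" "h ** t' = mat 1" "t' ** h = mat 1" using inv by blast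
  have "h ** t = mat 1"
  proof (rule transvection_is_one[of _ "L t0"])
    show "h ** t \<in> G" using mult h tG by blast
    show "(h ** t) *v y = y" if "bdot (L t0) y = 0" for y
    proof -
      have "t *v y = t' *v y" using parD(2)[OF _ assms that] t by simp
      then show ?thesis by (metis h(2) matrix_vector_mul_assoc matrix_vector_mul_lid)
    qed
    show "bdot (L t0) ((h ** t) *v y) = bdot (L t0) y" for y
    proof -
      have "t' *v ((h ** t) *v y) = t *v y" by (simp add: matrix_vector_mul_assoc matrix_mul_assoc h)
      then have "delta t' * bdot (L t0) ((h ** t) *v y) = delta t * bdot (L t0) y"
        using parD(3)[OF t(2) assms] parD(3)[OF t(1) assms] by metis
      then show ?thesis using eq delta_nz[OF parD(1)[OF t(2) assms]] by simp
    qed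
  qed
  then show "t = t'" by (metis h(3) matrix_mul_assoc matrix_mul_lid matrix_mul_rid)
qed

text \<open>The determinants of the pointwise stabilizer of the hyperplane of \<open>t0\<close>.
  They form a finite group of scalars whose order is one more than the multiplicity of the
  hyperplane in \<open>f\<close>.\<close>

definition dset where "dset t0 = insert 1 (delta ` par t0)"

lemma finite_dset: "finite (dset t0)" by (simp add: dset_def finite_par)

lemma card_dset: assumes "t0 \<in> R" shows "card (dset t0) = Suc (card (par t0))"
proof -
  have "1 \<notin> delta ` par t0" using delta(1) parD(1)[OF _ assms] by force
  then show ?thesis by (simp add: dset_def card_image[OF delta_inj[OF assms]] finite_par)
qed

lemma dset_mult: assumes "t0 \<in> R" "a \<in> dset t0" "b \<in> dset t0" shows "a * b \<in> dset t0"
proof (cases "a = 1 \<or> b = 1")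
  case True then show ?thesis using assms by auto
next
  case False
  then obtain t t' where t: "t \<in> par t0" "t' \<in> par t0" "a = delta t" "b = delta t'"
    using assms by (auto simp: dset_def)
  have tG: "t \<in> G" "t' \<in> G" using parD(1)[OF _ assms(1)] t R_sub by auto
  have sc: "bdot (L t0) ((t ** t') *v y) = a * b * bdot (L t0) y" for y
    using parD(3)[OF t(1) assms(1)] parD(3)[OF t(2) assms(1)] t(3,4)
    by (simp add: matrix_vector_mul_assoc[symmetric])
  obtain y where y: "bdot (L t0) y = 1" using exists_bdot_eq_1[OF L_nz[OF assms(1)]] by blast
  show ?thesis
  proof (cases "t ** t' = mat 1")
    case True
    then have "a * b = 1" using sc[of y] y by simp
    then show ?thesis by (simp add: dset_def)
  next
    case False
    have fx: "(t ** t') *v y = y" if "bdot (L t0) y = 0" for y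
      using parD(2)[OF t(1) assms(1) that] parD(2)[OF t(2) assms(1) that]
      by (simp add: matrix_vector_mul_assoc[symmetric])
    have R: "t ** t' \<in> R"
      by (rule R_complete[OF _ False L_nz[OF assms(1)] fx]) (use mult tG in auto)
    then obtain c where c: "c \<noteq> 0" "L t0 = c *s L (t ** t')"
      using same_ker_proportional[OF R L_nz[OF assms(1)] fx] by blast
    then have "L (t ** t') = inverse c *s L t0" by simp
    then have P: "t ** t' \<in> par t0" using R by (auto simp: par_def)
    have "delta (t ** t') = a * b" using parD(3)[OF P assms(1), of y] sc[of y] y by simp
    then show ?thesis using P by (metis dset_def imageI insertCI)
  qed
qed

text \<open>Multiplication by \<open>a\<close> permutes \<open>dset t0\<close>; compare the products
  of all its elements.\<close>

lemma dset_power_card: assumes "t0 \<in> R" "a \<in> dset t0" shows "a ^ card (dset t0) = 1"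
proof -
  have nz: "d \<noteq> 0" if "d \<in> dset t0" for d
    using that delta_nz parD(1)[OF _ assms(1)] by (auto simp: dset_def)
  have inj: "inj_on ((*) a) (dset t0)" using nz[OF assms(2)] by (auto simp: inj_on_def)
  have "(*) a ` dset t0 = dset t0"
    by (rule card_subset_eq[OF finite_dset]) (use dset_mult[OF assms] card_image[OF inj] in auto)
  then have "(\<Prod>d\<in>dset t0. d) = (\<Prod>d\<in>dset t0. a * d)"
    using prod.reindex[OF inj, of "\<lambda>d. d"] by simp
  also have "\<dots> = a ^ card (dset t0) * (\<Prod>d\<in>dset t0. d)" by (simp add: prod.distrib)
  finally show ?thesis using nz finite_dset by simp
qed

text \<open>Split off the power of \<open>L t0\<close> contained in the product. It contributes
  \<open>delta t ^ j\<close>; the remaining factors are compared at a point \<open>z\<close> of the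
  hyperplane, which \<open>t\<close> fixes and at which none of them vanishes.\<close>

lemma scalar_on_hyperplane:
  assumes "t0 \<in> R" "A \<subseteq> R" "q \<in> polys" "bdot (L t0) b = 0" "q b \<noteq> 0" "t \<in> par t0"
    and p: "\<And>y. (\<Prod>r\<in>A. bdot (L r) (t *v y)) * q (t *v y) = k * ((\<Prod>r\<in>A. bdot (L r) y) * q y)"
  shows "k = delta t ^ card (A \<inter> par t0)"
proof -
  have finA: "finite A" using assms finR finite_subset by blast
  define j where "j = card (A \<inter> par t0)"
  define r where "r y = (\<Prod>r\<in>A - par t0. bdot (L r) y) * q y" for y
  have r_polys: "r \<in> polys" unfolding r_def[abs_def] using assms(3)
    by (intro polys.mult polys_prod polys_bdot)
  obtain c where c: "\<And>r. r \<in> par t0 \<Longrightarrow> c r \<noteq> 0" "\<And>r. r \<in> par t0 \<Longrightarrow> L r = c r *s L t0"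
    using parD(4)[OF _ assms(1)] by metis
  define C where "C = (\<Prod>r\<in>A \<inter> par t0. c r)"
  have C0: "C \<noteq> 0" unfolding C_def using c finA by simp
  have split: "(\<Prod>r\<in>A. bdot (L r) y) * q y = C * (bdot (L t0) y ^ j * r y)" for y
  proof -
    have "(\<Prod>r\<in>A. bdot (L r) y) = (\<Prod>r\<in>A \<inter> par t0. bdot (L r) y) * (\<Prod>r\<in>A - par t0. bdot (L r) y)"
      using prod.Int_Diff[OF finA] by blast
    moreover have "(\<Prod>r\<in>A \<inter> par t0. bdot (L r) y) = (\<Prod>r\<in>A \<inter> par t0. c r * bdot (L t0) y)"
      using c(2) by (intro prod.cong) (auto simp: bdot_linear)
    ultimately show ?thesis by (simp add: r_def C_def j_def prod.distrib)
  qed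
  let ?S = "{y. bdot (L t0) y = 0}"
  have "\<exists>y\<in>?S. \<forall>p\<in>insert q ((\<lambda>r. bdot (L r)) ` (A - par t0)). p y \<noteq> 0"
  proof (rule polys_generic_point_on)
    show "finite (insert q ((\<lambda>r. bdot (L r)) ` (A - par t0)))" using finA by simp
    show "?S \<noteq> {}" using assms by auto
    show "a + s *s (b - a) \<in> ?S" if "a \<in> ?S" "b \<in> ?S" for a b s using that by (simp add: bdot_linear)
    fix p assume "p \<in> insert q ((\<lambda>r. bdot (L r)) ` (A - par t0))"
    then consider "p = q" | r where "r \<in> A - par t0" "p = bdot (L r)" by blast
    then show "p \<in> polys \<and> (\<exists>y\<in>?S. p y \<noteq> 0)"
    proof cases
      case 1 then show ?thesis using assms by auto
    next
      case 2
      have "\<exists>y\<in>?S. p y \<noteq> 0"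
      proof (rule ccontr)
        assume "\<not> ?thesis"
        then obtain c where "L r = c *s L t0"
          using proportional_if_ker_subset[OF L_nz[OF assms(1)], of "L r"] 2 by blast
        then show False using 2 assms(2) by (auto simp: par_def)
      qed
      then show ?thesis using 2 polys_bdot by auto
    qed
  qed
  then obtain z where z: "bdot (L t0) z = 0" "q z \<noteq> 0" "\<forall>r\<in>A - par t0. bdot (L r) z \<noteq> 0" by auto
  then have rz: "r z \<noteq> 0" using finA by (simp add: r_def)
  \<comment> \<open>The identity has to be divided by the power of \<open>L t0\<close> before it is
    evaluated at \<open>z\<close>, since \<open>L t0\<close> vanishes there.\<close>
  have "(\<lambda>y. delta t ^ j * r (t *v y)) = (\<lambda>y. k * r y)"
  proof (rule polys_cancel[of "\<lambda>y. bdot (L t0) y ^ j"])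
    show "(\<lambda>y. bdot (L t0) y ^ j) \<in> polys" by (intro polys_power polys_bdot)
    show "(\<lambda>y. delta t ^ j * r (t *v y)) \<in> polys" by (intro polys_scale polys_matrix r_polys)
    show "(\<lambda>y. k * r y) \<in> polys" by (intro polys_scale r_polys)
    show "bdot (L t0) (SOME y. bdot (L t0) y = 1) ^ j \<noteq> 0"
      using exists_bdot_eq_1[OF L_nz[OF assms(1)]] by (metis (mono_tags, lifting) power_one someI_ex zero_neq_one)
    show "bdot (L t0) y ^ j * (delta t ^ j * r (t *v y)) = bdot (L t0) y ^ j * (k * r y)" for y
      using p[of y] C0 unfolding split parD(3)[OF assms(6,1)]
      by (simp add: power_mult_distrib algebra_simps)
  qed
  then have "delta t ^ j * r (t *v z) = k * r z" by meson
  then show ?thesis using parD(2)[OF assms(6,1) z(1)] rz j_def by simp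
qed

text \<open>\<open>f\<close> contains the linear form of the hyperplane once for every reflection in
  \<open>par t0\<close>, one time less than the order of the group \<open>dset t0\<close>. So the
  exponent of \<open>delta t\<close> is -1 modulo that order.\<close>

lemma kappa_delta: assumes "t0 \<in> R" "t \<in> par t0" shows "kappa t * delta t = 1"
proof -
  have tG: "t \<in> G" using assms R_sub by (auto simp: par_def)
  have "kappa t = delta t ^ card (R \<inter> par t0)"
    by (rule scalar_on_hyperplane[OF assms(1) subset_refl polys.const[of 1] _ _ assms(2), of 0])
       (use kappa(2)[OF tG] in \<open>auto simp: f_def bdot_linear\<close>)
  moreover have "R \<inter> par t0 = par t0" by (auto simp: par_def)
  moreover have "delta t ^ card (dset t0) = 1"
    using dset_power_card[OF assms(1)] assms(2) by (auto simp: dset_def)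
  ultimately show ?thesis using card_dset[OF assms(1)] by (simp add: mult.commute)
qed

definition skew where "skew p \<longleftrightarrow> (\<forall>g\<in>G. \<forall>y. p (g *v y) = kappa g * p y)"

text \<open>The linear forms are divided out one by one. If a quotient did not vanish on the
  hyperplane of \<open>t0\<close>, comparing characters there would make all elements of
  \<open>dset t0\<close> roots of unity for an exponent smaller than the size of
  \<open>dset t0\<close>.\<close>

lemma skew_dvd:
  assumes "p \<in> polys" "skew p"
  shows "\<exists>q\<in>polys. invariant G q \<and> (\<forall>y. p y = f y * q y)"
proof -
  have "\<exists>q\<in>polys. \<forall>y. p y = (\<Prod>r\<in>A. bdot (L r) y) * q y" if "A \<subseteq> R" for A
    using finite_subset[OF that finR] that
  proof (induction A rule: finite_induct)
    case empty then show ?case using assms by auto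
  next
    case (insert t0 A)
    then obtain q where q: "q \<in> polys" "\<And>y. p y = (\<Prod>r\<in>A. bdot (L r) y) * q y" by blast
    have t0: "t0 \<in> R" using insert by simp
    have "q b = 0" if b: "bdot (L t0) b = 0" for b
    proof (rule ccontr)
      assume qb: "q b \<noteq> 0"
      define j where "j = card (A \<inter> par t0)"
      have "t0 \<in> par t0" using t0 by (auto simp: par_def intro: exI[of _ 1])
      then have "A \<inter> par t0 \<subset> par t0" using insert by auto
      then have j: "j < card (par t0)" unfolding j_def by (rule psubset_card_mono[OF finite_par])
      have "x ^ Suc j = 1" if "x \<in> dset t0" for x
      proof (cases "x = 1")
        case False
        then obtain t where t: "t \<in> par t0" "x = delta t" using \<open>x \<in> dset t0\<close> by (auto simp: dset_def)
        have tG: "t \<in> G" using t parD(1)[OF _ t0] R_sub by auto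
        have "kappa t = delta t ^ j" unfolding j_def
          by (rule scalar_on_hyperplane[OF t0 _ q(1) b qb t(1)])
             (use insert assms(2) tG in \<open>auto simp: q(2)[symmetric] skew_def\<close>)
        then show ?thesis using kappa_delta[OF t0 t(1)] t(2) by (simp add: mult.commute)
      qed simp
      then have "dset t0 \<subseteq> {z. z ^ Suc j = 1}" by blast
      then have "card (dset t0) \<le> card {z::complex. z ^ Suc j = 1}"
        by (rule card_mono[rotated]) (rule finite_roots_unity, simp)
      also have "\<dots> \<le> Suc j" by (rule card_roots_unity) simp
      finally show False using j card_dset[OF t0] by simp
    qed
    then obtain q' where "q' \<in> polys" "\<forall>y. q y = bdot (L t0) y * q' y"
      using polys_dvd_bdot[OF q(1) L_nz[OF t0]] by blast
    then show ?case using q(2) insert.hyps by (intro bexI[of _ q']) (auto simp: mult_ac)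
  qed
  from this[OF subset_refl] obtain q where q: "q \<in> polys" "\<And>y. p y = f y * q y"
    unfolding f_def by blast
  obtain z where z: "f z \<noteq> 0" using f_nz by blast
  have "q (g *v y) = q y" if g: "g \<in> G" for g y
  proof -
    have "(\<lambda>y. q (g *v y)) = q"
    proof (rule polys_cancel[OF f_polys polys_matrix[OF q(1)] q(1) z])
      fix y
      have "p (g *v y) = kappa g * p y" using assms(2) g by (simp add: skew_def)
      then show "f y * q (g *v y) = f y * q y" using kappa[OF g] by (simp add: q(2))
    qed
    then show ?thesis by (rule fun_cong)
  qed
  then show ?thesis using q by (auto simp: invariant_def)
qed

text \<open>A skew form is \<open>f\<close> times an invariant form of complementary degree. Above
  degree \<open>N\<close> this cofactor has positive degree and puts the skew form in the
  ideal.\<close>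

lemma skew_hom:
  assumes "p \<in> hpolys k" "skew p"
  shows "k < N \<Longrightarrow> p y = 0" "k = N \<Longrightarrow> \<exists>c. \<forall>y. p y = c * f y" "N < k \<Longrightarrow> p \<in> iideal G k"
proof -
  obtain q where q: "q \<in> polys" "invariant G q" "\<And>y. p y = f y * q y"
    using skew_dvd[OF homD(1)[OF assms(1)] assms(2)] by blast
  obtain z where z: "f z \<noteq> 0" using f_nz by blast
  have h: "if N \<le> k then q \<in> hpolys (k - N) else (\<forall>y. q y = 0)"
    by (rule hom_quotient[OF f_hom z q(1)]) (use assms(1) q(3) in \<open>simp flip: q(3)\<close>)
  show "p y = 0" if "k < N" using h that q(3) by simp
  show "\<exists>c. \<forall>y. p y = c * f y" if "k = N"
  proof -
    have "q \<in> hpolys 0" using h that by simp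
    from hom_0_const[OF this] show ?thesis
      by (intro exI[of _ "q 0"] allI) (subst q(3), simp add: mult.commute)
  qed
  show "p \<in> iideal G k" if "N < k"
  proof -
    have "(\<lambda>y. q y * f y) \<in> iideal G k"
      by (rule iideal.gen[of q "k - N" G f N k]) (use h that q f_hom in auto)
    moreover have "p = (\<lambda>y. q y * f y)" using q(3) by (simp add: fun_eq_iff mult.commute)
    ultimately show ?thesis by simp
  qed
qed

end

section \<open>Skew functionals and their duality with the ideal\<close>

context refl_group
begin

lemma bij_right_mult: assumes "h \<in> G" shows "bij_betw (\<lambda>g. g ** h) G G"
proof -
  obtain h' where h': "h' \<in> G" "h' ** h = mat 1" "h ** h' = mat 1" using inv assms by blast
  show ?thesis
    by (rule bij_betw_byWitness[of _ "\<lambda>g. g ** h'"])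
       (use h' mult assms in \<open>auto simp: matrix_mul_assoc[symmetric]\<close>)
qed

lemma sum_right_mult: "h \<in> G \<Longrightarrow> (\<Sum>g\<in>G. F (g ** h)) = (\<Sum>g\<in>G. F g)"
  by (rule sum.reindex_bij_betw[OF bij_right_mult])

lemma iideal_compose: assumes "g \<in> G" "p \<in> iideal G k" shows "(\<lambda>y. p (g *v y)) \<in> iideal G k"
  using assms(2)
proof induction
  case zero show ?case by (rule iideal.zero)
next
  case (add p q) then show ?case by (intro iideal.add)
next
  case (gen u j s l)
  have "(\<lambda>y. u y * s (g *v y)) \<in> iideal G k"
    by (rule iideal.gen[OF gen(1,2,3) hom_matrix[OF gen(4)] gen(5)])
  then show ?case using gen(3) assms(1) by (simp add: invariant_def)
qed

text \<open>The monic polynomial with the roots \<open>p (g *v y)\<close>, for \<open>g\<close> in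
  \<open>G\<close>, has the invariants \<open>e m\<close> as coefficients up to sign, and
  \<open>p y\<close> is one of its roots. Every term but the leading power contains some
  \<open>e m\<close> of positive degree.\<close>

lemma power_card_in_iideal:
  assumes "p \<in> hpolys k" "0 < k"
  shows "(\<lambda>y. p y ^ card G) \<in> iideal G (card G * k)"
proof -
  let ?n = "card G"
  define e where "e m y = (\<Sum>B\<in>{B. B \<subseteq> G \<and> card B = m}. \<Prod>g\<in>B. p (g *v y))" for m y
  have e_hom: "e m \<in> hpolys (m * k)" for m
  proof -
    have "(\<lambda>y. \<Prod>g\<in>B. p (g *v y)) \<in> hpolys (m * k)" if "B \<subseteq> G" "card B = m" for B
    proof -
      have "(\<lambda>y. \<Prod>g\<in>B. p (g *v y)) \<in> hpolys (\<Sum>g\<in>B. k)"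
        by (intro hom_prod finite_subset[OF that(1) fin] hom_matrix assms(1))
      then show ?thesis using that(2) by simp
    qed
    then show ?thesis unfolding e_def[abs_def] by (intro hom_sum) auto
  qed
  have e_inv: "invariant G (e m)" for m
    unfolding invariant_def
  proof (intro ballI allI)
    fix h y assume h: "h \<in> G"
    then obtain h' where h': "h' \<in> G" "h' ** h = mat 1" "h ** h' = mat 1" using inv by blast
    let ?i = "\<lambda>B. (\<lambda>g. g ** h) ` B" and ?j = "\<lambda>B. (\<lambda>g. g ** h') ` B"
    have inj: "inj (\<lambda>g. g ** h)" "inj (\<lambda>g. g ** h')"
      by (intro injI, metis h' matrix_mul_assoc matrix_mul_rid)+
    show "e m (h *v y) = e m y" unfolding e_def
    proof (rule sum.reindex_bij_witness[of _ ?j ?i])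
      fix B assume B: "B \<in> {B. B \<subseteq> G \<and> card B = m}"
      show "?j (?i B) = B" by (simp add: image_image matrix_mul_assoc[symmetric] h')
      show "?i B \<in> {B. B \<subseteq> G \<and> card B = m}"
        using B mult h card_image[OF inj_on_subset[OF inj(1)], of B] by auto
      show "(\<Prod>g\<in>?i B. p (g *v y)) = (\<Prod>g\<in>B. p (g *v (h *v y)))"
        by (subst prod.reindex[OF inj_on_subset[OF inj(1)]]) (auto simp: matrix_vector_mul_assoc)
    next
      fix B assume B: "B \<in> {B. B \<subseteq> G \<and> card B = m}"
      show "?i (?j B) = B" by (simp add: image_image matrix_mul_assoc[symmetric] h')
      show "?j B \<in> {B. B \<subseteq> G \<and> card B = m}"
        using B mult h' card_image[OF inj_on_subset[OF inj(2)], of B] by auto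
    qed
  qed
  have expand: "(\<Sum>m\<le>?n. (-1) ^ m * e m y * p y ^ (?n - m)) = 0" for y
  proof -
    have "0 = (\<Prod>g\<in>G. - p (g *v y) + p y)"
      by (rule prod_zero[symmetric, OF fin]) (rule bexI[OF _ one], simp)
    also have "\<dots> = (\<Sum>B\<in>Pow G. (\<Prod>g\<in>B. - p (g *v y)) * (\<Prod>g\<in>G - B. p y))"
      by (rule prod_add[OF fin])
    also have "\<dots> = (\<Sum>B\<in>Pow G. (-1) ^ card B * (\<Prod>g\<in>B. p (g *v y)) * p y ^ (?n - card B))"
      using finite_subset[OF _ fin] by (intro sum.cong) (auto simp: prod_uminus card_Diff_subset)
    also have "\<dots> = (\<Sum>m\<le>?n. \<Sum>B\<in>{B \<in> Pow G. card B = m}.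
        (-1) ^ card B * (\<Prod>g\<in>B. p (g *v y)) * p y ^ (?n - card B))"
      by (rule sum.group[symmetric]) (use fin card_mono in auto)
    also have "\<dots> = (\<Sum>m\<le>?n. (-1) ^ m * e m y * p y ^ (?n - m))"
      by (auto simp: e_def sum_distrib_left sum_distrib_right Pow_def intro!: sum.cong)
    finally show ?thesis by simp
  qed
  have "p y ^ ?n = - (\<Sum>m\<in>{1..?n}. (-1) ^ m * e m y * p y ^ (?n - m))" for y
  proof -
    have "e 0 y = (\<Sum>B\<in>{{}}. \<Prod>g\<in>B. p (g *v y))" unfolding e_def
      using finite_subset[OF _ fin] by (intro sum.cong) auto
    moreover have "{..?n} = insert 0 {1..?n}" by auto
    ultimately show ?thesis using expand[of y] by (simp add: add_eq_0_iff)
  qed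
  moreover have "(\<lambda>y. - 1 * (\<Sum>m\<in>{1..?n}. (-1) ^ m * (e m y * p y ^ (?n - m)))) \<in> iideal G (?n * k)"
  proof (intro iideal_scale iideal_sum)
    fix m assume m: "m \<in> {1..?n}"
    show "(\<lambda>y. e m y * p y ^ (?n - m)) \<in> iideal G (?n * k)"
      by (rule iideal.gen[OF e_hom _ e_inv hom_power[OF assms(1)]])
         (use m assms(2) in \<open>auto simp: add_mult_distrib[symmetric]\<close>)
  qed
  ultimately show ?thesis by (simp add: mult.assoc)
qed

text \<open>By the pigeonhole principle a monomial of such a degree contains some variable to a
  power of at least \<open>card G\<close>. This starts the descending induction of
  \<open>perp_eq_iideal\<close>.\<close>

lemma hpolys_subset_iideal_if_large:
  assumes "CARD('n) * card G \<le> k" shows "hpolys k \<subseteq> iideal G k"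
proof
  fix p :: "complex ^ 'n \<Rightarrow> complex" assume "p \<in> hpolys k"
  from hom_expand[OF this] obtain S a where S: "finite S" "\<And>m. m \<in> S \<Longrightarrow> (\<Sum>i\<in>UNIV. m i) = k"
    "\<And>y. p y = (\<Sum>m\<in>S. a m * powprod m y)" by blast
  have "powprod m \<in> iideal G k" if m: "m \<in> S" for m
  proof -
    have "\<exists>i. card G \<le> m i"
    proof (rule ccontr)
      assume "\<not> ?thesis"
      then have "(\<Sum>i\<in>UNIV. m i) < (\<Sum>i\<in>(UNIV :: 'n set). card G)"
        by (intro sum_strict_mono) (auto simp: not_le)
      then show False using S(2)[OF m] assms by simp
    qed
    then obtain i where i: "card G \<le> m i" by blast
    define m' where "m' = m(i := m i - card G)"
    have "(\<Sum>i\<in>UNIV. m' i) + card G = k"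
      using i S(2)[OF m] unfolding m'_def by (subst (asm) sum.remove[of _ i], simp, simp)
        (subst sum.remove[of _ i], auto)
    then have k: "card G * Suc 0 + (\<Sum>i\<in>UNIV. m' i) = k" by simp
    have "powprod m = (\<lambda>y. y $ i ^ card G * powprod m' y)"
    proof
      fix y
      have "powprod m y = y $ i ^ m i * (\<Prod>j\<in>UNIV - {i}. y $ j ^ m j)"
        unfolding powprod_def by (rule prod.remove) auto
      also have "(\<Prod>j\<in>UNIV - {i}. y $ j ^ m j) = (\<Prod>j\<in>UNIV - {i}. y $ j ^ m' j)"
        by (intro prod.cong) (auto simp: m'_def)
      also have "y $ i ^ m i * \<dots> = y $ i ^ card G * (y $ i ^ m' i * (\<Prod>j\<in>UNIV - {i}. y $ j ^ m' j))"
        using i by (simp add: m'_def power_add[symmetric] mult.assoc[symmetric])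
      also have "y $ i ^ m' i * (\<Prod>j\<in>UNIV - {i}. y $ j ^ m' j) = powprod m' y"
        unfolding powprod_def by (rule prod.remove[symmetric]) auto
      finally show "powprod m y = y $ i ^ card G * powprod m' y" .
    qed
    moreover have "(\<lambda>y. y $ i ^ card G * powprod m' y) \<in> iideal G k"
      using iideal_mult[OF power_card_in_iideal[OF hom_coord] hom_mono, of i m'] k by simp
    ultimately show ?thesis by simp
  qed
  then have "(\<lambda>y. \<Sum>m\<in>S. a m * powprod m y) \<in> iideal G k" by (intro iideal_sum iideal_scale)
  moreover have "p = (\<lambda>y. \<Sum>m\<in>S. a m * powprod m y)" using S(3) by (simp add: fun_eq_iff)
  ultimately show "p \<in> iideal G k" by simp
qed

text \<open>The projection onto the skew functions, multiplied by \<open>card G\<close>.\<close>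

definition sk where "sk p y = (\<Sum>g\<in>G. inverse (kappa g) * p (g *v y))"

lemma sk_hom: "p \<in> hpolys k \<Longrightarrow> sk p \<in> hpolys k"
  unfolding sk_def[abs_def] by (intro hom_sum hom_scale hom_matrix)

lemma sk_skew: "skew (sk p)"
  unfolding skew_def
proof (intro ballI allI)
  fix h y assume h: "h \<in> G"
  have "sk p (h *v y) = (\<Sum>g\<in>G. kappa h * (inverse (kappa (g ** h)) * p ((g ** h) *v y)))"
    unfolding sk_def using kappa(1) h
    by (intro sum.cong) (auto simp: kappa_mult matrix_vector_mul_assoc field_simps)
  also have "\<dots> = (\<Sum>g\<in>G. kappa h * (inverse (kappa g) * p (g *v y)))"
    by (rule sum_right_mult[OF h])
  finally show "sk p (h *v y) = kappa h * sk p y" by (simp add: sk_def sum_distrib_left)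
qed

lemma sk_invariant_mult: "invariant G u \<Longrightarrow> sk (\<lambda>y. u y * s y) y = u y * sk s y"
  by (simp add: sk_def invariant_def sum_distrib_left algebra_simps)

lemma sk_low: "p \<in> hpolys k \<Longrightarrow> k < N \<Longrightarrow> sk p y = 0"
  using skew_hom(1)[OF sk_hom sk_skew] by blast

text \<open>Only forms of degree \<open>N\<close> matter, since the functional is applied to
  products of forms of complementary degrees. The last condition makes this pairing nondegenerate
  modulo the ideal.\<close>

definition skew_functional where "skew_functional Lam \<longleftrightarrow>
  (\<forall>p\<in>hpolys N. \<forall>q\<in>hpolys N. Lam (\<lambda>y. p y + q y) = Lam p + Lam q) \<and>
  (\<forall>p\<in>hpolys N. \<forall>c. Lam (\<lambda>y. c * p y) = c * Lam p) \<and>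
  (\<forall>p\<in>hpolys N. \<forall>g\<in>G. Lam (\<lambda>y. p (g *v y)) = kappa g * Lam p) \<and> Lam f \<noteq> (0::complex)"

lemma skew_functionalD:
  assumes "skew_functional Lam" "p \<in> hpolys N"
  shows "q \<in> hpolys N \<Longrightarrow> Lam (\<lambda>y. p y + q y) = Lam p + Lam q"
    "Lam (\<lambda>y. c * p y) = c * Lam p" "g \<in> G \<Longrightarrow> Lam (\<lambda>y. p (g *v y)) = kappa g * Lam p"
    "Lam f \<noteq> 0"
  using assms unfolding skew_functional_def by blast+

lemma skew_functional_sum:
  assumes "skew_functional Lam" "\<And>i. i \<in> A \<Longrightarrow> p i \<in> hpolys N"
  shows "Lam (\<lambda>y. \<Sum>i\<in>A. p i y) = (\<Sum>i\<in>A. Lam (p i))"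
  using assms(2)
proof (induction A rule: infinite_finite_induct)
  case (insert i A)
  have "Lam (\<lambda>y. p i y + (\<Sum>i\<in>A. p i y)) = Lam (p i) + Lam (\<lambda>y. \<Sum>i\<in>A. p i y)"
    by (rule skew_functionalD(1)[OF assms(1)]) (use insert in \<open>auto intro: hom_sum\<close>)
  then show ?case using insert by simp
qed (use skew_functionalD(2)[OF assms(1) hom_zero, of 0] in auto)

lemma skew_functional_sk:
  assumes "skew_functional Lam" "p \<in> hpolys N"
  shows "Lam (sk p) = of_nat (card G) * Lam p"
proof -
  have "Lam (sk p) = (\<Sum>g\<in>G. Lam (\<lambda>y. inverse (kappa g) * p (g *v y)))"
    unfolding sk_def[abs_def]
    by (rule skew_functional_sum[OF assms(1)]) (intro hom_scale hom_matrix assms(2))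
  also have "\<dots> = (\<Sum>g\<in>G. Lam p)"
    using kappa(1) by (intro sum.cong)
      (auto simp: skew_functionalD(2)[OF assms(1) hom_matrix[OF assms(2)]]
        skew_functionalD(3)[OF assms])
  finally show ?thesis by simp
qed

lemma card_G_pos: "0 < card G" using fin one by (auto simp: card_gt_0_iff)

text \<open>For an invariant \<open>u\<close> of positive degree, \<open>sk\<close> of the product u
  s is u times \<open>sk s\<close>, and \<open>sk s\<close> is 0 because \<open>s\<close> has degree
  below \<open>N\<close>. On the other hand applying \<open>sk\<close> only multiplies the value of
  \<open>Lam\<close> by \<open>card G\<close>.\<close>

lemma skew_functional_iideal:
  assumes "skew_functional Lam" "p \<in> iideal G N" shows "Lam p = 0"
proof -
  have "p \<in> hpolys k \<and> (N = k \<longrightarrow> Lam p = 0)" if "p \<in> iideal G k" for k p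
    using that
  proof induction
    case zero
    show ?case using skew_functionalD(2)[OF assms(1) hom_zero, of 0] hom_zero by auto
  next
    case (add p q)
    then show ?case using skew_functionalD(1)[OF assms(1)] hom_add by auto
  next
    case (gen u j s l)
    have us: "(\<lambda>y. u y * s y) \<in> hpolys k" using hom_mult gen by blast
    moreover have "Lam (\<lambda>y. u y * s y) = 0" if k: "N = k"
    proof -
      have "l < N" using gen k by simp
      have "sk (\<lambda>y. u y * s y) = (\<lambda>_. 0)"
        using sk_low[OF gen(4) \<open>l < N\<close>] sk_invariant_mult[OF gen(3)] by (simp add: fun_eq_iff)
      then have "of_nat (card G) * Lam (\<lambda>y. u y * s y) = Lam (\<lambda>_. 0)"
        using skew_functional_sk[OF assms(1), of "\<lambda>y. u y * s y"] us k by simp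
      moreover have "Lam (\<lambda>_. 0) = 0" using skew_functionalD(2)[OF assms(1) hom_zero, of 0] by simp
      ultimately show ?thesis using card_G_pos by simp
    qed
    ultimately show ?case by simp
  qed
  then show ?thesis using assms(2) by blast
qed

text \<open>The annihilator of the forms of complementary degree. For \<open>k > N\<close> no such
  degree exists and it is all of \<open>hpolys k\<close>.\<close>

definition perp :: "((complex ^ 'n \<Rightarrow> complex) \<Rightarrow> complex) \<Rightarrow> nat \<Rightarrow> (complex ^ 'n \<Rightarrow> complex) set" where
  "perp Lam k =
  {p \<in> hpolys k. \<forall>s l. s \<in> hpolys l \<longrightarrow> k + l = N \<longrightarrow> Lam (\<lambda>y. p y * s y) = (0::complex)}"

text \<open>The divided difference operator of \<open>t\<close>. It lowers the degree by one; degree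
  0 is separate, since \<open>l - 1\<close> would be 0 there although the result must
  vanish.\<close>

lemma divided_difference:
  assumes "t \<in> R" "s \<in> hpolys l"
  shows "\<exists>s'. (if l = 0 then s' = (\<lambda>_. 0) else s' \<in> hpolys (l - 1)) \<and>
    (\<forall>y. s y - s (t *v y) = bdot (L t) y * s' y)"
proof -
  have D: "(\<lambda>y. s y - s (t *v y)) \<in> hpolys l" by (intro hom_diff hom_matrix assms)
  moreover have "s y - s (t *v y) = 0" if "bdot (L t) y = 0" for y
    using R_fix[OF assms(1) that] by simp
  ultimately obtain q where q: "q \<in> polys" "\<And>y. s y - s (t *v y) = bdot (L t) y * q y"
    using polys_dvd_bdot[OF _ L_nz[OF assms(1)], of "\<lambda>y. s y - s (t *v y)"] homD(1) by metis
  obtain z where "bdot (L t) z = 1" using exists_bdot_eq_1[OF L_nz[OF assms(1)]] by blast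
  then have "if Suc 0 \<le> l then q \<in> hpolys (l - Suc 0) else (\<forall>y. q y = 0)"
    by (intro hom_quotient[OF hom_bdot[of "L t"] _ q(1), of z]) (use D in \<open>simp_all flip: q(2)\<close>)
  then show ?thesis using q(2) by (intro exI[of _ q]) (cases l; auto)
qed

text \<open>Divided differences are linear over the invariants, so they act on the second factor of
  a generator.\<close>

lemma iideal_divided_difference:
  assumes "t \<in> R" "p \<in> iideal G (Suc k)"
  shows "\<exists>q\<in>iideal G k. \<forall>y. p y - p (t *v y) = bdot (L t) y * q y"
  using assms(2)
proof (induction rule: iideal.induct)
  case zero then show ?case by (intro bexI[of _ "\<lambda>_. 0"]) (auto intro: iideal.zero)
next
  case (add p p')
  then obtain q q' where q: "q \<in> iideal G k" "q' \<in> iideal G k"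
    "\<And>y. p y - p (t *v y) = bdot (L t) y * q y" "\<And>y. p' y - p' (t *v y) = bdot (L t) y * q' y"
    by blast
  have "p y + p' y - (p (t *v y) + p' (t *v y)) = bdot (L t) y * (q y + q' y)" for y
    by (simp only: add_diff_add q(3,4) distrib_left)
  then show ?case using iideal.add[OF q(1,2)] by (intro bexI[of _ "\<lambda>y. q y + q' y"]) auto
next
  case (gen u j s l)
  obtain s' where s': "if l = 0 then s' = (\<lambda>_. 0) else s' \<in> hpolys (l - 1)"
    "\<And>y. s y - s (t *v y) = bdot (L t) y * s' y"
    using divided_difference[OF assms(1) gen(4)] by blast
  have u: "u (t *v y) = u y" for y using gen(3) assms(1) R_sub by (auto simp: invariant_def)
  have "(\<lambda>y. u y * s' y) \<in> iideal G k"
  proof (cases "l = 0")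
    case True then show ?thesis using s' by (simp add: iideal.zero)
  next
    case False then show ?thesis using s' gen by (intro iideal.gen[of u j G s' "l - 1"]) auto
  qed
  moreover have "u y * s y - u (t *v y) * s (t *v y) = bdot (L t) y * (u y * s' y)" for y
  proof -
    have "u y * s y - u (t *v y) * s (t *v y) = u y * (s y - s (t *v y))"
      by (simp add: u algebra_simps)
    then show ?thesis by (simp add: s'(2))
  qed
  ultimately show ?case by (intro bexI[of _ "\<lambda>y. u y * s' y"]) auto
qed

text \<open>For the hard inclusion take \<open>p\<close> in the annihilator of degree
  \<open>k\<close>. Its product with \<open>L t\<close> is in the annihilator of degree
  \<open>k + 1\<close>, hence in the ideal by induction from above, and a divided difference shows
  that modulo the ideal \<open>t\<close> multiplies \<open>p\<close> by \<open>kappa t\<close>.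
  Generation extends this to all of \<open>G\<close>, averaging makes \<open>card G * p\<close>
  congruent to \<open>sk p\<close>, and \<open>skew_hom\<close> is applied to
  \<open>sk p\<close>.\<close>

lemma perp_eq_iideal: assumes "skew_functional Lam" shows "perp Lam k = iideal G k"
proof
  show "iideal G k \<subseteq> perp Lam k"
  proof
    fix p assume p: "p \<in> iideal G k"
    have "Lam (\<lambda>y. p y * s y) = 0" if "s \<in> hpolys l" "k + l = N" for s l
      using skew_functional_iideal[OF assms] iideal_mult[OF p that(1)] that(2) by simp
    then show "p \<in> perp Lam k" using iideal_hpolys[OF p] by (simp add: perp_def)
  qed
next
  show "perp Lam k \<subseteq> iideal G k"
  proof (induction "CARD('n) * card G - k" arbitrary: k rule: less_induct)
    case (less k)
    show ?case
    proof (cases "CARD('n) * card G \<le> k")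
      case True
      then show ?thesis using hpolys_subset_iideal_if_large by (auto simp: perp_def)
    next
      case False
      then have IH: "perp Lam (Suc k) \<subseteq> iideal G (Suc k)" by (intro less) auto
      show ?thesis
      proof
        fix p assume p: "p \<in> perp Lam k"
        then have p_hom: "p \<in> hpolys k" by (simp add: perp_def)
        have t_step: "(\<lambda>y. p (t *v y) - kappa t * p y) \<in> iideal G k" if t: "t \<in> R" for t
        proof -
          have "(\<lambda>y. bdot (L t) y * p y) \<in> perp Lam (Suc k)"
            unfolding perp_def
          proof (intro CollectI conjI allI impI)
            show "(\<lambda>y. bdot (L t) y * p y) \<in> hpolys (Suc k)"
              using hom_mult[OF hom_bdot p_hom] by simp
            fix s :: "complex ^ 'n \<Rightarrow> complex" and l assume "s \<in> hpolys l" "Suc k + l = N"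
            then have "Lam (\<lambda>y. p y * (bdot (L t) y * s y)) = 0"
              using p hom_mult[OF hom_bdot, of s l] unfolding perp_def by fastforce
            then show "Lam (\<lambda>y. bdot (L t) y * p y * s y) = 0" by (simp add: mult_ac)
          qed
          then obtain q where q: "q \<in> iideal G k"
            "\<And>y. bdot (L t) y * p y - bdot (L t) (t *v y) * p (t *v y) = bdot (L t) y * q y"
            using iideal_divided_difference[OF t] IH by blast
          obtain z where z: "bdot (L t) z = 1" using exists_bdot_eq_1[OF L_nz[OF t]] by blast
          have "(\<lambda>y. p y - delta t * p (t *v y)) = q"
          proof (rule polys_cancel[of "bdot (L t)" _ _ z])
            show "(\<lambda>y. p y - delta t * p (t *v y)) \<in> polys"
              using homD(1)[OF p_hom] by (intro polys_diff polys_scale polys_matrix)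
            show "bdot (L t) y * (p y - delta t * p (t *v y)) = bdot (L t) y * q y" for y
              using q(2)[of y] delta(2)[OF t, of y] by (simp add: algebra_simps)
          qed (use polys_bdot z homD(1)[OF iideal_hpolys[OF q(1)]] in auto)
          then have "(\<lambda>y. - kappa t * (p y - delta t * p (t *v y))) \<in> iideal G k"
            using iideal_scale[OF q(1), of "- kappa t"] by (auto simp only: fun_eq_iff)
          moreover have "kappa t * delta t = 1"
            by (rule kappa_delta[OF t]) (use t in \<open>auto simp: par_def intro: exI[of _ 1]\<close>)
          then have "- kappa t * (p y - delta t * p (t *v y)) = p (t *v y) - kappa t * p y" for y
            by (simp add: algebra_simps)
          ultimately show ?thesis by simp
        qed
        have "{g\<in>G. (\<lambda>y. p (g *v y) - kappa g * p y) \<in> iideal G k} = G"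
        proof (rule gen)
          show "mat 1 \<in> {g\<in>G. (\<lambda>y. p (g *v y) - kappa g * p y) \<in> iideal G k}"
            using one by (simp add: kappa_one iideal.zero)
          fix t g assume t: "t \<in> R" and g: "g \<in> {g\<in>G. (\<lambda>y. p (g *v y) - kappa g * p y) \<in> iideal G k}"
          have tG: "t \<in> G" using t R_sub by blast
          have "(\<lambda>y. (p (t *v (g *v y)) - kappa t * p (g *v y)) + kappa t * (p (g *v y) - kappa g * p y))
              \<in> iideal G k"
            using iideal_compose[OF _ t_step[OF t]] g by (intro iideal.add iideal_scale) auto
          moreover have "t ** g \<in> G" using mult tG g by blast
          ultimately show "t ** g \<in> {g\<in>G. (\<lambda>y. p (g *v y) - kappa g * p y) \<in> iideal G k}"
            using kappa_mult[OF tG] g by (simp add: matrix_vector_mul_assoc algebra_simps)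
        qed auto
        then have g_step: "(\<lambda>y. p (g *v y) - kappa g * p y) \<in> iideal G k" if "g \<in> G" for g
          using that by blast
        have "(\<lambda>y. \<Sum>g\<in>G. inverse (kappa g) * (p (g *v y) - kappa g * p y)) \<in> iideal G k"
          by (intro iideal_sum iideal_scale g_step)
        moreover have "(\<Sum>g\<in>G. inverse (kappa g) * (p (g *v y) - kappa g * p y)) =
            sk p y - of_nat (card G) * p y" for y
        proof -
          have "(\<Sum>g\<in>G. inverse (kappa g) * (p (g *v y) - kappa g * p y)) =
              (\<Sum>g\<in>G. inverse (kappa g) * p (g *v y) - p y)"
            using kappa(1) by (intro sum.cong) (auto simp: algebra_simps)
          then show ?thesis by (simp add: sk_def sum_subtractf)
        qed
        ultimately have 1: "(\<lambda>y. sk p y - of_nat (card G) * p y) \<in> iideal G k" by simp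
        have "sk p \<in> iideal G k"
        proof -
          consider "k < N" | "k = N" | "N < k" by linarith
          then show ?thesis
          proof cases
            case 1
            then have "sk p = (\<lambda>_. 0)" using sk_low[OF p_hom] by auto
            then show ?thesis by (simp add: iideal.zero)
          next
            \<comment> \<open>Here \<open>Lam f \<noteq> 0\<close> is decisive: \<open>Lam\<close>
              annihilates \<open>sk p\<close>, which is a multiple of \<open>f\<close>, so the
              multiple is 0.\<close>
            case 2
            obtain c where c: "\<And>y. sk p y = c * f y"
              using skew_hom(2)[OF sk_hom[OF p_hom] sk_skew 2] by blast
            have "Lam (\<lambda>y. p y * 1) = 0" using p 2 hom_const[of 1] unfolding perp_def by fastforce
            then have "Lam (sk p) = 0" using skew_functional_sk[OF assms, of p] p_hom 2 by simp
            moreover have "Lam (sk p) = c * Lam f"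
            proof -
              have "sk p = (\<lambda>y. c * f y)" using c by (simp add: fun_eq_iff)
              then show ?thesis using skew_functionalD(2)[OF assms f_hom, of c] by simp
            qed
            ultimately have "c = 0" using skew_functionalD(4)[OF assms f_hom] by simp
            then have "sk p = (\<lambda>_. 0)" using c by auto
            then show ?thesis by (simp add: iideal.zero)
          next
            case 3
            then show ?thesis using skew_hom(3)[OF sk_hom[OF p_hom] sk_skew] by blast
          qed
        qed
        from iideal_scale[OF iideal_diff[OF this 1], of "inverse (of_nat (card G))"]
        show "p \<in> iideal G k" using card_G_pos by (simp add: mult.assoc[symmetric])
      qed
    qed
  qed
qed

end

context refl_group
begin

subsection \<open>Orbits of regular points and the coinvariants\<close>

lemma skew_functional_regular:
  assumes "f u \<noteq> 0" shows "skew_functional (\<lambda>p. sk p u)"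
proof -
  have "sk (\<lambda>y. p (g *v y)) u = kappa g * sk p u" if g: "g \<in> G" for p :: "complex ^ 'n \<Rightarrow> complex" and g
  proof -
    obtain h where h: "h \<in> G" "h ** g = mat 1" "g ** h = mat 1" using inv g by blast
    have bij: "bij_betw (\<lambda>x. g ** x) G G"
      by (rule bij_betw_byWitness[of _ "\<lambda>x. h ** x"])
         (use h mult g in \<open>auto simp: matrix_mul_assoc\<close>)
    have "kappa g * sk p u = kappa g * (\<Sum>x\<in>G. inverse (kappa (g ** x)) * p ((g ** x) *v u))"
      unfolding sk_def using sum.reindex_bij_betw[OF bij, of "\<lambda>x. inverse (kappa x) * p (x *v u)"] by simp
    also have "\<dots> = sk (\<lambda>y. p (g *v y)) u"
      unfolding sk_def sum_distrib_left using kappa(1) g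
      by (intro sum.cong) (auto simp: kappa_mult matrix_vector_mul_assoc)
    finally show ?thesis by simp
  qed
  moreover have "sk f u = of_nat (card G) * f u"
    using kappa by (simp add: sk_def mult.assoc[symmetric])
  ultimately show ?thesis using assms card_G_pos unfolding skew_functional_def
    by (auto simp: sk_def sum.distrib sum_distrib_left algebra_simps)
qed

text \<open>Multiply by a form \<open>s\<close> of degree \<open>N - k\<close> and skew-symmetrize.
  The components below the top stay in degrees below \<open>N\<close> and are killed, so the product
  with \<open>h k\<close> is killed too, and \<open>h k\<close> lies in the annihilator of the
  functional at \<open>u\<close>.\<close>

lemma leading_form_of_vanishing_on_orbit:
  assumes "f u \<noteq> 0" "\<And>j. j \<le> k \<Longrightarrow> h j \<in> hpolys j" "\<And>g. g \<in> G \<Longrightarrow> (\<Sum>j\<le>k. h j (g *v u)) = 0"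
  shows "h k \<in> iideal G k"
proof -
  have "Lam0 = Lam0 \<Longrightarrow> h k \<in> perp (\<lambda>p. sk p u) k" for Lam0 :: nat
    unfolding perp_def
  proof (intro CollectI conjI allI impI)
    show "h k \<in> hpolys k" using assms(2) by simp
    fix s :: "complex ^ 'n \<Rightarrow> complex" and l assume s: "s \<in> hpolys l" "k + l = N"
    have "(\<Sum>j\<le>k. sk (\<lambda>y. h j y * s y) u) = (\<Sum>g\<in>G. inverse (kappa g) * ((\<Sum>j\<le>k. h j (g *v u)) * s (g *v u)))"
      unfolding sk_def by (subst sum.swap) (simp add: sum_distrib_left sum_distrib_right)
    also have "\<dots> = 0" using assms(3) by simp
    finally have "(\<Sum>j\<le>k. sk (\<lambda>y. h j y * s y) u) = 0" .
    moreover have "sk (\<lambda>y. h j y * s y) u = 0" if "j < k" for j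
      by (rule sk_low[OF hom_mult[OF assms(2) s(1)]]) (use that s in auto)
    moreover have "{..k} = insert k {..<k}" by auto
    ultimately show "sk (\<lambda>y. h k y * s y) u = 0" by simp
  qed
  then show ?thesis using perp_eq_iideal[OF skew_functional_regular[OF assms(1)]] by simp
qed

definition orbit where "orbit u = (\<lambda>g. g *v u) ` G"

lemma finite_orbit: "finite (orbit u)" using fin by (simp add: orbit_def)

lemma card_orbit_le: "card (orbit u) \<le> card G" using fin by (simp add: orbit_def card_image_le)

text \<open>Independence in the degree \<open>k\<close> part of the coinvariants, expressed by
  representatives.\<close>

definition indep_mod where "indep_mod k B \<longleftrightarrow> finite B \<and> B \<subseteq> hpolys k \<and>
  (\<forall>c. (\<lambda>y. \<Sum>b\<in>B. c b * b y) \<in> iideal G k \<longrightarrow> (\<forall>b\<in>B. c b = 0))"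

definition span_mod where "span_mod k B \<longleftrightarrow>
  (\<forall>p\<in>hpolys k. \<exists>c. (\<lambda>y. p y - (\<Sum>b\<in>B. c b * b y)) \<in> iideal G k)"

text \<open>Besides the zeros of \<open>f\<close>, those of one nonzero coordinate of
  \<open>g *v y - y\<close> are avoided for each \<open>g\<close> other than 1. In
  \<open>regular_free\<close> the genericity disappears again.\<close>

lemma regular_point: "\<exists>u. f u \<noteq> 0 \<and> card (orbit u) = card G"
proof -
  define F where "F g i = (\<lambda>y::complex^'n. (g *v y - y) $ i)" for g :: "complex^'n^'n" and i
  have nz: "\<exists>i y. F g i y \<noteq> 0" if "g \<noteq> mat 1" for g
  proof (rule ccontr)
    assume "\<not> ?thesis"
    then have "g *v y = mat 1 *v y" for y by (simp add: F_def vec_eq_iff)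
    then show False using that by (metis matrix_eq)
  qed
  then obtain i where i: "\<And>g. g \<noteq> mat 1 \<Longrightarrow> \<exists>y. F g (i g) y \<noteq> 0" by metis
  have poly: "F g i \<in> polys" for g i
    unfolding F_def by (simp, intro polys_diff polys.coord polys_matrix[OF polys.coord])
  have "\<exists>y. \<forall>p\<in>insert f ((\<lambda>g. F g (i g)) ` (G - {mat 1})). p y \<noteq> 0"
    using fin f_polys f_nz poly i by (intro polys_generic_point) auto
  then obtain u where u: "f u \<noteq> 0" "\<And>g. g \<in> G \<Longrightarrow> g \<noteq> mat 1 \<Longrightarrow> F g (i g) u \<noteq> 0" by auto
  have "inj_on (\<lambda>g. g *v u) G"
  proof (rule inj_onI)
    fix g h assume gh: "g \<in> G" "h \<in> G" "g *v u = h *v u"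
    obtain h' where h': "h' \<in> G" "h' ** h = mat 1" "h ** h' = mat 1" using inv gh by blast
    have "(h' ** g) *v u = u"
      by (metis gh(3) h'(2) matrix_vector_mul_assoc matrix_vector_mul_lid)
    then have "h' ** g = mat 1" using u(2)[OF mult[OF h'(1) gh(1)]] by (auto simp: F_def)
    then show "g = h" by (metis h'(3) matrix_mul_assoc matrix_mul_lid matrix_mul_rid)
  qed
  then show ?thesis using u(1) by (auto simp: orbit_def card_image)
qed

text \<open>A relation on a regular orbit puts the combination in the ideal, so independent elements
  stay independent on the orbit. The bound guarantees that a maximal independent set exists.\<close>

lemma card_indep_mod_le: assumes "indep_mod k B" shows "card B \<le> card G"
proof -
  obtain u where u: "f u \<noteq> 0" using f_nz by blast
  have B: "finite B" "B \<subseteq> hpolys k"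
    "\<And>c b. (\<lambda>y. \<Sum>b\<in>B. c b * b y) \<in> iideal G k \<Longrightarrow> b \<in> B \<Longrightarrow> c b = 0"
    using assms by (auto simp: indep_mod_def)
  have "card B \<le> card (orbit u)"
  proof (rule card_le_if_independent_in_span[where S = "orbit u" and v = "\<lambda>b. b"
        and w = "\<lambda>o' x. if x = o' then 1 else 0"])
    fix c assume 0: "\<And>x. x \<in> orbit u \<Longrightarrow> (\<Sum>b\<in>B. c b * b x) = 0"
    define h where "h j = (if j = k then (\<lambda>y. \<Sum>b\<in>B. c b * b y) else (\<lambda>_. 0))" for j
    have "h k \<in> iideal G k"
    proof (rule leading_form_of_vanishing_on_orbit[OF u])
      show "h j \<in> hpolys j" for j
        unfolding h_def using B(2) hom_zero by (auto intro!: hom_sum hom_scale)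
      show "(\<Sum>j\<le>k. h j (g *v u)) = 0" if "g \<in> G" for g
        using 0[of "g *v u"] that by (intro sum.neutral) (auto simp: h_def orbit_def)
    qed
    then show "\<forall>b\<in>B. c b = 0" using B(3) by (auto simp: h_def)
  next
    show "\<exists>a. \<forall>x\<in>orbit u. b x = (\<Sum>j\<in>orbit u. a j * (if x = j then 1 else 0))" for b :: "complex^'n \<Rightarrow> complex"
      by (intro exI[of _ b]) (simp add: finite_orbit if_distrib[of "\<lambda>x. _ * x"] cong: if_cong)
  qed (use B finite_orbit in auto)
  then show ?thesis using card_orbit_le order_trans by blast
qed

lemma exists_basis_mod: "\<exists>B. indep_mod k B \<and> span_mod k B"
proof -
  have "indep_mod k {}" by (simp add: indep_mod_def)
  then obtain B where B: "indep_mod k B" "\<And>B'. indep_mod k B' \<Longrightarrow> card B' \<le> card B"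
    using ex_has_greatest_nat[of "indep_mod k" "{}" card "Suc (card G)"] card_indep_mod_le
    by (metis less_Suc_eq_le)
  have fB: "finite B" using B(1) by (simp add: indep_mod_def)
  have "\<exists>c. (\<lambda>y. p y - (\<Sum>b\<in>B. c b * b y)) \<in> iideal G k" if p: "p \<in> hpolys k" for p
  proof (cases "p \<in> B")
    case True
    have "p y - (\<Sum>b\<in>B. (if b = p then 1 else 0) * b y) = 0" for y
      using fB True by (simp add: if_distrib[of "\<lambda>x. x * _"] cong: if_cong)
    then show ?thesis
      by (intro exI[of _ "\<lambda>b. if b = p then 1 else 0"]) (simp add: iideal.zero)
  next
    case False
    have "\<not> indep_mod k (insert p B)" using B(2)[of "insert p B"] False fB by auto
    then obtain c b where c: "(\<lambda>y. \<Sum>b\<in>insert p B. c b * b y) \<in> iideal G k"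
      "b \<in> insert p B" "c b \<noteq> 0" using fB p B(1) by (auto simp: indep_mod_def)
    have c': "(\<lambda>y. c p * p y + (\<Sum>b\<in>B. c b * b y)) \<in> iideal G k" using c(1) False fB by simp
    have cp: "c p \<noteq> 0"
    proof
      assume "c p = 0"
      then have "\<forall>b\<in>B. c b = 0" using c' B(1) by (simp add: indep_mod_def)
      then show False using c \<open>c p = 0\<close> by auto
    qed
    have "(\<lambda>y. inverse (c p) * (c p * p y + (\<Sum>b\<in>B. c b * b y))) \<in> iideal G k"
      by (rule iideal_scale[OF c'])
    moreover have "inverse (c p) * (c p * p y + (\<Sum>b\<in>B. c b * b y)) =
        p y - (\<Sum>b\<in>B. (- inverse (c p) * c b) * b y)" for y
      using cp by (simp add: distrib_left sum_negf sum_distrib_left mult.assoc)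
    ultimately show ?thesis by (intro exI[of _ "\<lambda>b. - inverse (c p) * c b"]) simp
  qed
  then show ?thesis using B(1) by (auto simp: span_mod_def)
qed

definition cobasis_in where "cobasis_in k = (SOME B. indep_mod k B \<and> span_mod k B)"

lemma cobasis_in: "indep_mod k (cobasis_in k)" "span_mod k (cobasis_in k)"
  using someI_ex[OF exists_basis_mod] unfolding cobasis_in_def by blast+

lemma cobasis_in_hpolys: "b \<in> cobasis_in k \<Longrightarrow> b \<in> hpolys k"
  using cobasis_in(1) by (auto simp: indep_mod_def)

lemma finite_cobasis_in: "finite (cobasis_in k)"
  using cobasis_in(1) by (auto simp: indep_mod_def)

lemma cobasis_in_not_iideal: assumes "b \<in> cobasis_in k" shows "b \<notin> iideal G k"
proof
  assume b: "b \<in> iideal G k"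
  have "(\<Sum>x\<in>cobasis_in k. (if x = b then 1 else 0) * x y) = b y" for y
    using finite_cobasis_in assms by (simp add: if_distrib[of "\<lambda>x. x * _"] cong: if_cong)
  then have "(\<lambda>y. \<Sum>x\<in>cobasis_in k. (if x = b then 1 else 0) * x y) \<in> iideal G k" using b by simp
  then have "(if b = b then 1 else 0 :: complex) = 0"
    using cobasis_in(1)[of k] assms unfolding indep_mod_def by (metis (mono_tags))
  then show False by simp
qed

lemma iideal_above_N: assumes "N < k" shows "iideal G k = hpolys k"
proof -
  obtain u where "f u \<noteq> 0" using f_nz by blast
  from perp_eq_iideal[OF skew_functional_regular[OF this], of k] assms show ?thesis
    by (auto simp: perp_def)
qed

lemma cobasis_in_above_N: "N < k \<Longrightarrow> cobasis_in k = {}"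
  using cobasis_in_not_iideal cobasis_in_hpolys iideal_above_N by blast

lemma cobasis_in_N_nonempty: "cobasis_in N \<noteq> {}"
proof
  assume "cobasis_in N = {}"
  then have "f \<in> iideal G N" using cobasis_in(2)[of N] f_hom by (auto simp: span_mod_def)
  moreover obtain u where u: "f u \<noteq> 0" using f_nz by blast
  ultimately show False
    using skew_functional_iideal skew_functional_regular[OF u] skew_functionalD(4) f_hom by blast
qed

text \<open>Each element carries its degree, which is its weight in the Hilbert series.\<close>

definition cobasis where "cobasis = Sigma {..N} cobasis_in"

lemma finite_cobasis: "finite cobasis" by (simp add: cobasis_def finite_cobasis_in)

lemma cobasisD: assumes "x \<in> cobasis" shows "snd x \<in> hpolys (fst x)" "fst x \<le> N" "snd x \<in> polys"
proof -
  show "snd x \<in> hpolys (fst x)" "fst x \<le> N" using assms cobasis_in_hpolys by (auto simp: cobasis_def)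
  then show "snd x \<in> polys" using homD(1) by blast
qed

lemma sum_cobasis: "(\<Sum>x\<in>cobasis. F x) = (\<Sum>k\<le>N. \<Sum>b\<in>cobasis_in k. F (k, b))"
  using sum.Sigma[of "{..N}" cobasis_in "\<lambda>k b. F (k, b)"]
  by (simp add: cobasis_def finite_cobasis_in)

text \<open>The evaluations \<open>T\<close> only have to detect the top component of a sum of forms modulo the
  ideal, because the coefficients of a relation vanish from the highest degree downwards.\<close>

lemma cobasis_independent:
  assumes lead: "\<And>k h. k \<le> N \<Longrightarrow> (\<And>j. h j \<in> hpolys j) \<Longrightarrow> (\<And>x. x \<in> S \<Longrightarrow> (\<Sum>j\<le>k. T j (h j) x) = 0) \<Longrightarrow>
      h k \<in> iideal G k"
    and T_sum: "\<And>j c x. x \<in> S \<Longrightarrow> T j (\<lambda>y. \<Sum>b\<in>cobasis_in j. c b * b y) x = (\<Sum>b\<in>cobasis_in j. c b * T j b x)"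
    and 0: "\<And>x. x \<in> S \<Longrightarrow> (\<Sum>b\<in>cobasis. c b * T (fst b) (snd b) x) = 0"
  shows "\<forall>b\<in>cobasis. c b = 0"
proof (rule ccontr)
  assume "\<not> ?thesis"
  then obtain b0 where b0: "b0 \<in> cobasis" "c b0 \<noteq> 0" by blast
  define P where "P k \<longleftrightarrow> (\<exists>b\<in>cobasis. fst b = k \<and> c b \<noteq> 0)" for k
  have "P (fst b0)" using b0 by (auto simp: P_def)
  moreover have "P k \<Longrightarrow> k \<le> N" for k using cobasisD(2) by (auto simp: P_def)
  ultimately obtain k where k: "P k" "\<And>j. P j \<Longrightarrow> j \<le> k"
    using ex_has_greatest_nat[of P "fst b0" "\<lambda>x. x" "Suc N"] by (metis less_Suc_eq_le)
  have kN: "k \<le> N" using k(1) cobasisD(2) by (auto simp: P_def)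
  define h where "h j = (\<lambda>y. \<Sum>b\<in>cobasis_in j. c (j, b) * b y)" for j
  have "h k \<in> iideal G k"
  proof (rule lead[OF kN])
    show "h j \<in> hpolys j" for j unfolding h_def using cobasis_in_hpolys by (intro hom_sum hom_scale)
    fix x assume x: "x \<in> S"
    have "(\<Sum>j\<le>k. T j (h j) x) = (\<Sum>j\<le>k. \<Sum>b\<in>cobasis_in j. c (j, b) * T j b x)"
      unfolding h_def by (simp add: T_sum[OF x])
    also have "\<dots> = (\<Sum>j\<le>N. \<Sum>b\<in>cobasis_in j. c (j, b) * T j b x)"
    proof (rule sum.mono_neutral_left)
      show "\<forall>j\<in>{..N} - {..k}. (\<Sum>b\<in>cobasis_in j. c (j, b) * T j b x) = 0"
      proof
        fix j assume j: "j \<in> {..N} - {..k}"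
        then have "\<not> P j" using k(2) by fastforce
        then have "c (j, b) = 0" if "b \<in> cobasis_in j" for b
          using that j by (auto simp: P_def cobasis_def)
        then show "(\<Sum>b\<in>cobasis_in j. c (j, b) * T j b x) = 0" by simp
      qed
    qed (use kN in auto)
    also have "\<dots> = 0" using 0[OF x] by (simp add: sum_cobasis)
    finally show "(\<Sum>j\<le>k. T j (h j) x) = 0" .
  qed
  then have "\<forall>b\<in>cobasis_in k. c (k, b) = 0"
    using cobasis_in(1)[of k] unfolding indep_mod_def h_def
    by (elim conjE) (drule spec[of _ "\<lambda>b. c (k, b)"], blast)
  then show False using k(1) by (auto simp: P_def cobasis_def)
qed

lemma cobasis_independent_on_orbit:
  assumes "f u \<noteq> 0" "\<And>g. g \<in> G \<Longrightarrow> (\<Sum>b\<in>cobasis. c b * snd b (g *v u)) = 0"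
  shows "\<forall>b\<in>cobasis. c b = 0"
  by (rule cobasis_independent[where S = G and T = "\<lambda>j p g. p (g *v u)"])
     (use assms leading_form_of_vanishing_on_orbit[OF assms(1)] in auto)

lemma card_cobasis_le_orbit: assumes "f u \<noteq> 0" shows "card cobasis \<le> card (orbit u)"
proof (rule card_le_if_independent_in_span[where S = "orbit u" and v = "\<lambda>b. snd b"
        and w = "\<lambda>o' x. if x = o' then 1 else 0"])
  show "\<forall>b\<in>cobasis. c b = 0" if "\<And>x. x \<in> orbit u \<Longrightarrow> (\<Sum>b\<in>cobasis. c b * snd b x) = 0" for c
    by (rule cobasis_independent_on_orbit[OF assms]) (use that in \<open>auto simp: orbit_def\<close>)
  show "\<exists>a. \<forall>x\<in>orbit u. snd b x = (\<Sum>j\<in>orbit u. a j * (if x = j then 1 else 0))"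
    for b :: "nat \<times> (complex^'n \<Rightarrow> complex)"
    by (intro exI[of _ "snd b"]) (simp add: finite_orbit if_distrib[of "\<lambda>x. _ * x"] cong: if_cong)
qed (use finite_cobasis finite_orbit in auto)

text \<open>A graded form of Nakayama's lemma: subtracting a combination of basis elements leaves an
  element of the ideal, and the cofactors of its generators have smaller degree.\<close>

lemma cobasis_span:
  assumes "p \<in> hpolys k"
  shows "\<exists>v. (\<forall>x\<in>cobasis. invariant G (v x) \<and>
      (if fst x \<le> k then v x \<in> hpolys (k - fst x) else v x = (\<lambda>_. 0))) \<and>
    (\<forall>y. p y = (\<Sum>x\<in>cobasis. v x y * snd x y))"
  using assms
proof (induction k arbitrary: p rule: less_induct)
  case (less k)
  define good where "good p \<longleftrightarrow> (\<exists>v. (\<forall>x\<in>cobasis. invariant G (v x) \<and>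
      (if fst x \<le> k then v x \<in> hpolys (k - fst x) else v x = (\<lambda>_. 0))) \<and>
    (\<forall>y. p y = (\<Sum>x\<in>cobasis. v x y * snd x y)))" for p
  have good_add: "good (\<lambda>y. p y + q y)" if "good p" "good q" for p q
  proof -
    obtain v where v: "\<forall>x\<in>cobasis. invariant G (v x) \<and>
      (if fst x \<le> k then v x \<in> hpolys (k - fst x) else v x = (\<lambda>_. 0))"
      "\<forall>y. p y = (\<Sum>x\<in>cobasis. v x y * snd x y)" using \<open>good p\<close> unfolding good_def by blast
    obtain w where w: "\<forall>x\<in>cobasis. invariant G (w x) \<and>
      (if fst x \<le> k then w x \<in> hpolys (k - fst x) else w x = (\<lambda>_. 0))"
      "\<forall>y. q y = (\<Sum>x\<in>cobasis. w x y * snd x y)" using \<open>good q\<close> unfolding good_def by blast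
    show ?thesis unfolding good_def
      by (intro exI[of _ "\<lambda>x y. v x y + w x y"])
         (use v w in \<open>auto simp: sum.distrib distrib_right invariant_def intro!: hom_add split: if_splits\<close>)
  qed
  have "good q" if "q \<in> iideal G k" for q
    using that
  proof (induction rule: iideal.induct)
    case zero
    show ?case unfolding good_def
      by (intro exI[of _ "\<lambda>_ _. 0"]) (auto simp: invariant_def hom_zero)
  next
    case (add p q) then show ?case by (intro good_add)
  next
    case (gen u j s l)
    then have "l < k" by simp
    from less.IH[OF this gen(4)] obtain v where v: "\<And>x. x \<in> cobasis \<Longrightarrow> invariant G (v x)"
      "\<And>x. x \<in> cobasis \<Longrightarrow> if fst x \<le> l then v x \<in> hpolys (l - fst x) else v x = (\<lambda>_. 0)"
      "\<And>y. s y = (\<Sum>x\<in>cobasis. v x y * snd x y)" by blast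
    have "if fst x \<le> k then (\<lambda>y. u y * v x y) \<in> hpolys (k - fst x) else (\<lambda>y. u y * v x y) = (\<lambda>_. 0)"
      if x: "x \<in> cobasis" for x
    proof (cases "fst x \<le> l")
      case True
      then have "(\<lambda>y. u y * v x y) \<in> hpolys (j + (l - fst x))" using v(2)[OF x] gen(1) by (intro hom_mult) auto
      moreover have "j + (l - fst x) = k - fst x" using gen(5) True by simp
      ultimately show ?thesis using True gen(5) by simp
    next
      case False then show ?thesis using v(2)[OF x] by (auto intro: hom_zero)
    qed
    moreover have "invariant G (\<lambda>y. u y * v x y)" if "x \<in> cobasis" for x
      using v(1)[OF that] gen(3) by (simp add: invariant_def)
    moreover have "u y * s y = (\<Sum>x\<in>cobasis. u y * v x y * snd x y)" for y
      by (simp add: v(3) sum_distrib_left mult.assoc)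
    ultimately show ?case unfolding good_def by (intro exI[of _ "\<lambda>x y. u y * v x y"]) blast
  qed
  moreover obtain c where c: "(\<lambda>y. p y - (\<Sum>b\<in>cobasis_in k. c b * b y)) \<in> iideal G k"
    using cobasis_in(2)[of k] less.prems by (auto simp: span_mod_def)
  moreover have "good (\<lambda>y. \<Sum>b\<in>cobasis_in k. c b * b y)"
  proof -
    have "(\<Sum>x\<in>cobasis. (if fst x = k then c (snd x) else 0) * snd x y) = (\<Sum>b\<in>cobasis_in k. c b * b y)" for y
    proof -
      have "(\<Sum>x\<in>cobasis. (if fst x = k then c (snd x) else 0) * snd x y) =
          (\<Sum>j\<le>N. if j = k then (\<Sum>b\<in>cobasis_in k. c b * b y) else 0)"
        unfolding sum_cobasis by (intro sum.cong) auto
      also have "\<dots> = (\<Sum>b\<in>cobasis_in k. c b * b y)"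
        using cobasis_in_above_N[of k] by (cases "k \<le> N") auto
      finally show ?thesis .
    qed
    then show ?thesis unfolding good_def
      by (intro exI[of _ "\<lambda>x _. if fst x = k then c (snd x) else 0"])
         (auto simp: invariant_def hom_const hom_zero)
  qed
  ultimately have "good (\<lambda>y. (p y - (\<Sum>b\<in>cobasis_in k. c b * b y)) + (\<Sum>b\<in>cobasis_in k. c b * b y))"
    by (intro good_add) auto
  then show ?case by (simp add: good_def)
qed

text \<open>The coefficients supplied by \<open>cobasis_span\<close> are invariant, hence constant
  on the orbit.\<close>

lemma polys_on_orbit:
  assumes "p \<in> polys" shows "\<exists>a. \<forall>x\<in>orbit u. p x = (\<Sum>b\<in>cobasis. a b * snd b x)"
proof -
  obtain h K where h: "\<And>k. h k \<in> hpolys k" "\<And>y. p y = (\<Sum>k\<le>K. h k y)"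
    using polys_decompose[OF assms] by blast
  have "\<forall>k. \<exists>v. (\<forall>x\<in>cobasis. invariant G (v x)) \<and> (\<forall>y. h k y = (\<Sum>x\<in>cobasis. v x y * snd x y))"
    using cobasis_span[OF h(1)] by blast
  from choice[OF this] obtain v where v: "\<And>k x. x \<in> cobasis \<Longrightarrow> invariant G (v k x)"
    "\<And>k y. h k y = (\<Sum>x\<in>cobasis. v k x y * snd x y)" by blast
  show ?thesis
  proof (intro exI ballI)
    fix x assume "x \<in> orbit u"
    then obtain g where g: "g \<in> G" "x = g *v u" by (auto simp: orbit_def)
    have "p x = (\<Sum>k\<le>K. \<Sum>b\<in>cobasis. v k b u * snd b x)"
      unfolding h(2) v(2) using v(1) g by (intro sum.cong) (auto simp: invariant_def)
    also have "\<dots> = (\<Sum>b\<in>cobasis. (\<Sum>k\<le>K. v k b u) * snd b x)"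
      by (subst sum.swap) (simp add: sum_distrib_right)
    finally show "p x = (\<Sum>b\<in>cobasis. (\<Sum>k\<le>K. v k b u) * snd b x)" .
  qed
qed

text \<open>Lagrange interpolation, using for each other point a coordinate that separates it from
  \<open>o'\<close>.\<close>

lemma polys_indicator:
  assumes "finite S" "o' \<in> S"
  shows "\<exists>p\<in>polys. \<forall>x\<in>S. p x = (if x = o' then 1 else 0)"
proof -
  have "\<forall>z\<in>S - {o'}. \<exists>i. z $ i \<noteq> o' $ i" by (auto simp: vec_eq_iff)
  then obtain i where i: "\<And>z. z \<in> S - {o'} \<Longrightarrow> z $ i z \<noteq> o' $ i z" by metis
  define p where "p y = (\<Prod>z\<in>S - {o'}. (y $ i z - z $ i z) * inverse (o' $ i z - z $ i z))" for y
  have "p \<in> polys" unfolding p_def[abs_def] by (intro polys_prod polys.mult polys_diff polys.intros)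
  moreover have "p x = (if x = o' then 1 else 0)" if "x \<in> S" for x
  proof (cases "x = o'")
    case True
    have "(x $ i z - z $ i z) * inverse (o' $ i z - z $ i z) = 1" if "z \<in> S - {o'}" for z
      using i[OF that] True by simp
    then show ?thesis unfolding p_def using True by (simp add: prod.neutral)
  next
    case False
    then have "p x = 0" unfolding p_def using that assms by (intro prod_zero) auto
    then show ?thesis using False by simp
  qed
  ultimately show ?thesis by blast
qed

lemma card_orbit_le_cobasis: "card (orbit u) \<le> card cobasis"
proof (rule card_le_if_independent_in_span[where S = "orbit u" and w = "\<lambda>b. snd b"
        and v = "\<lambda>o' x. if x = o' then 1 else 0"])
  show "\<forall>i\<in>orbit u. c i = 0"
    if "\<And>x. x \<in> orbit u \<Longrightarrow> (\<Sum>i\<in>orbit u. c i * (if x = i then 1 else 0)) = 0" for c :: "complex^'n \<Rightarrow> complex"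
  proof
    fix i assume i: "i \<in> orbit u"
    have "(\<Sum>j\<in>orbit u. c j * (if i = j then 1 else 0)) = (\<Sum>j\<in>orbit u. if j = i then c j else 0)"
      by (intro sum.cong) auto
    then show "c i = 0" using that[OF i] i finite_orbit[of u] by simp
  qed
  show "\<exists>a. \<forall>x\<in>orbit u. (if x = i then 1 else 0) = (\<Sum>j\<in>cobasis. a j * snd j x)" if i: "i \<in> orbit u" for i
  proof -
    obtain p where p: "p \<in> polys" "\<forall>x\<in>orbit u. p x = (if x = i then 1 else 0)"
      using polys_indicator[OF finite_orbit i] by blast
    obtain a where "\<forall>x\<in>orbit u. p x = (\<Sum>b\<in>cobasis. a b * snd b x)"
      using polys_on_orbit[OF p(1)] by blast
    then show ?thesis using p(2) by (intro exI[of _ a]) auto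
  qed
qed (use finite_cobasis finite_orbit in auto)

lemma card_cobasis: "card cobasis = card G"
proof -
  obtain u where "f u \<noteq> 0" "card (orbit u) = card G" using regular_point by blast
  then show ?thesis using card_cobasis_le_orbit card_orbit_le_cobasis by (metis le_antisym)
qed

text \<open>The dimension \<open>card G\<close> of the coinvariants is at most the size of every
  regular orbit, which leaves no room for a stabilizer. This is the basic case of Steinberg's fixed
  point theorem.\<close>

lemma regular_free: assumes "f u \<noteq> 0" shows "inj_on (\<lambda>g. g *v u) G"
proof -
  have "card (orbit u) = card G"
    using card_cobasis_le_orbit[OF assms] card_orbit_le card_cobasis by (metis le_antisym)
  then show ?thesis using fin by (simp add: orbit_def eq_card_imp_inj_on)
qed

text \<open>At a regular point the coefficients are constant along the orbit and vanish by
  independence there; multiplying by \<open>f\<close> covers the other points.\<close>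

lemma cobasis_free:
  assumes "\<And>x. x \<in> cobasis \<Longrightarrow> v x \<in> polys \<and> invariant G (v x)"
    and "\<And>y. (\<Sum>x\<in>cobasis. v x y * snd x y) = 0" and "x \<in> cobasis"
  shows "v x y = 0"
proof -
  obtain z where z: "f z \<noteq> 0" using f_nz by blast
  have "f y * v x y = 0" for y
  proof (cases "f y = 0")
    case False
    have "\<forall>b\<in>cobasis. v b y = 0"
    proof (rule cobasis_independent_on_orbit[OF False])
      fix g assume g: "g \<in> G"
      have "(\<Sum>b\<in>cobasis. v b y * snd b (g *v y)) = (\<Sum>b\<in>cobasis. v b (g *v y) * snd b (g *v y))"
        using assms(1) g by (intro sum.cong) (auto simp: invariant_def)
      then show "(\<Sum>b\<in>cobasis. v b y * snd b (g *v y)) = 0" using assms(2) by simp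
    qed
    then show ?thesis using assms(3) by simp
  qed simp
  then show ?thesis using polys_no_zero_divisors[OF f_polys _ z] assms by blast
qed

end

section \<open>Counting monomials of a given weight\<close>

definition wmons :: "'n set \<Rightarrow> ('n::finite \<Rightarrow> nat) \<Rightarrow> nat \<Rightarrow> ('n \<Rightarrow> nat) set" where
  "wmons A d k = {m. (\<forall>i. i \<notin> A \<longrightarrow> m i = 0) \<and> (\<Sum>i\<in>UNIV. m i * d i) = k}"

lemma finite_wmons: assumes "\<And>i. 0 < d i" shows "finite (wmons A d k)"
proof (rule finite_subset)
  show "wmons A d k \<subseteq> (UNIV \<rightarrow> {..k})"
  proof
    fix m assume m: "m \<in> wmons A d k"
    have "m i \<le> k" for i
    proof -
      have "m i \<le> m i * d i" using assms[of i] by simp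
      also have "\<dots> \<le> (\<Sum>i\<in>UNIV. m i * d i)" by (rule member_le_sum) auto
      finally show ?thesis using m by (simp add: wmons_def)
    qed
    then show "m \<in> (UNIV \<rightarrow> {..k})" by auto
  qed
  have "UNIV \<rightarrow> {..k} = Pi\<^sub>E (UNIV :: 'a set) (\<lambda>_. {..k})" by (auto simp: PiE_def extensional_def)
  then show "finite ((UNIV :: 'a set) \<rightarrow> {..k})" by (simp add: finite_PiE)
qed

text \<open>Split according to whether the exponent of \<open>a\<close> is 0. For the generating
  functions this says that the factor \<open>1 - X ^ d a\<close> removes \<open>a\<close>.\<close>

lemma card_wmons_insert:
  assumes d: "\<And>i. 0 < d i" and a: "a \<notin> A"
  shows "card (wmons (insert a A) d k) =
    card (wmons A d k) + (if d a \<le> k then card (wmons (insert a A) d (k - d a)) else 0)"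
proof -
  let ?I = "wmons (insert a A) d"
  let ?s = "\<lambda>m::'a \<Rightarrow> nat. m(a := Suc (m a))"
  have split: "(\<Sum>i\<in>UNIV. m i * d i) = m a * d a + (\<Sum>i\<in>UNIV - {a}. m i * d i)" for m
    by (rule sum.remove) auto
  have s: "(\<Sum>i\<in>UNIV. ?s m i * d i) = d a + (\<Sum>i\<in>UNIV. m i * d i)" for m
    unfolding split[of m] split[of "?s m"] by (simp add: algebra_simps)
  have inj: "inj ?s" by (rule injI) (metis fun_upd_same fun_upd_triv fun_upd_upd nat.inject)
  have "?I k = wmons A d k \<union> {m \<in> ?I k. m a \<noteq> 0}"
    unfolding wmons_def by (auto, metis gr0I)
  moreover have "wmons A d k \<inter> {m \<in> ?I k. m a \<noteq> 0} = {}"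
    using a by (auto simp: wmons_def)
  moreover have "{m \<in> ?I k. m a \<noteq> 0} = (if d a \<le> k then ?s ` ?I (k - d a) else {})"
  proof -
    have "m \<in> ?s ` ?I (k - d a) \<and> d a \<le> k" if m: "m \<in> ?I k" "m a \<noteq> 0" for m
    proof -
      define m' where "m' = m(a := m a - 1)"
      have mm: "m = ?s m'" using m(2) by (auto simp: m'_def fun_eq_iff)
      have "k = d a + (\<Sum>i\<in>UNIV. m' i * d i)" using s[of m'] mm m(1) by (simp add: wmons_def)
      moreover have "\<forall>i. i \<notin> insert a A \<longrightarrow> m' i = 0" using m(1) by (simp add: wmons_def m'_def)
      ultimately show ?thesis using mm by (auto simp: wmons_def)
    qed
    moreover have "?s m \<in> ?I k" if "m \<in> ?I (k - d a)" "d a \<le> k" for m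
      using that s[of m] by (auto simp: wmons_def)
    ultimately show ?thesis by auto
  qed
  ultimately have "card (?I k) = card (wmons A d k) + card (if d a \<le> k then ?s ` ?I (k - d a) else {})"
    using card_Un_disjoint[of "wmons A d k" "{m \<in> ?I k. m a \<noteq> 0}"] finite_wmons[of d] d by auto
  then show ?thesis using card_image[OF inj_on_subset[OF inj]] by auto
qed

definition hilb :: "'n set \<Rightarrow> ('n::finite \<Rightarrow> nat) \<Rightarrow> int fps" where
  "hilb A d = Abs_fps (\<lambda>k. int (card (wmons A d k)))"

lemma hilb_prod:
  assumes d: "\<And>i. 0 < d i" shows "hilb A d * (\<Prod>i\<in>A. 1 - fps_X ^ d i) = 1"
  using finite[of A]
proof (induction A rule: finite_induct)
  case empty
  have "wmons {} d k = (if k = 0 then {\<lambda>_. 0} else {})" for k by (auto simp: wmons_def fun_eq_iff)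
  then show ?case by (intro fps_ext) (simp add: hilb_def)
next
  case (insert a A)
  have "hilb (insert a A) d * (1 - fps_X ^ d a) = hilb A d"
  proof (rule fps_ext)
    fix k
    have "fps_nth (hilb (insert a A) d * (1 - fps_X ^ d a)) k =
        fps_nth (hilb (insert a A) d) k - fps_nth (hilb (insert a A) d * fps_X ^ d a) k"
      by (simp add: algebra_simps)
    then show "fps_nth (hilb (insert a A) d * (1 - fps_X ^ d a)) k = fps_nth (hilb A d) k"
      using card_wmons_insert[OF d insert(2), where k = k]
      by (simp add: fps_X_power_mult_right_nth hilb_def)
  qed
  then show ?case using insert by (simp add: mult.assoc[symmetric])
qed

section \<open>Degrees, group order and number of reflections\<close>

locale refl_group_inv = refl_group G R L
  for G R :: "(complex ^ 'n::finite ^ 'n) set" and L +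
  fixes F :: "'n \<Rightarrow> complex ^ 'n \<Rightarrow> complex" and dg :: "'n \<Rightarrow> nat"
  assumes F_inv: "invariant G (F i)"
    and F_hom: "F i \<in> hpolys (dg i)"
    and F_indep: "\<And>Q y. Q \<in> polys \<Longrightarrow> (\<And>y. Q (\<chi> i. F i y) = 0) \<Longrightarrow> Q y = 0"
    and F_gen: "\<And>p. p \<in> polys \<Longrightarrow> invariant G p \<Longrightarrow> \<exists>Q\<in>polys. \<forall>y. p y = Q (\<chi> i. F i y)"
begin

text \<open>A constant \<open>F i\<close> would satisfy the nontrivial relation that equates the
  \<open>i\<close>-th variable with this constant.\<close>

lemma dg_pos: "0 < dg i"
proof (rule ccontr)
  assume "\<not> ?thesis"
  then have c: "F i y = F i 0" for y using F_hom[of i] hom_0_const by auto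
  have "(F i 0 + 1) - F i 0 = 0"
    using F_indep[of "\<lambda>y. y $ i - F i 0" "\<chi> j. F i 0 + 1"] c
    by (simp add: polys_diff polys.intros)
  then show False by simp
qed

definition Fmon where "Fmon m y = powprod m (\<chi> i. F i y)"

lemma Fmon_hom: "Fmon m \<in> hpolys (\<Sum>i\<in>UNIV. m i * dg i)"
  unfolding Fmon_def[abs_def] powprod_def
  using hom_prod[of UNIV "\<lambda>i y. F i y ^ m i" "\<lambda>i. m i * dg i"] hom_power[OF F_hom] by simp

lemma Fmon_inv: "invariant G (Fmon m)"
  using F_inv by (simp add: invariant_def Fmon_def)

abbreviation "wm \<equiv> wmons UNIV dg"

lemma wmD: "m \<in> wm k \<Longrightarrow> (\<Sum>i\<in>UNIV. m i * dg i) = k" by (simp add: wmons_def)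

lemma finite_wm: "finite (wm k)" using finite_wmons dg_pos by blast

lemma inv_expand:
  assumes "p \<in> hpolys k" "invariant G p"
  shows "\<exists>a. \<forall>y. p y = (\<Sum>m\<in>wm k. a m * Fmon m y)"
proof -
  obtain Q where Q: "Q \<in> polys" "\<And>y. p y = Q (\<chi> i. F i y)" using F_gen homD(1) assms by blast
  obtain P where P: "Q = ev P" using Q(1) polys_eq_range_ev by blast
  let ?L = "Poly_Mapping.lookup"
  let ?K = "Poly_Mapping.keys P"
  let ?deg = "\<lambda>m. \<Sum>i\<in>UNIV. ?L m i * dg i"
  define h where "h j = (\<lambda>y. \<Sum>m\<in>{m\<in>?K. ?deg m = j}. ?L P m * Fmon (?L m) y)" for j
  have h: "h j \<in> hpolys j" for j
    unfolding h_def using Fmon_hom by (intro hom_sum hom_scale) auto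
  have "p y = (\<Sum>j\<in>?deg ` ?K. h j y)" for y
    unfolding Q(2) P ev_def h_def Fmon_def by (rule sum.image_gen) simp
  from hom_component[OF h _ assms(1) this]
  have "p y = (if k \<in> ?deg ` ?K then h k y else 0)" for y by simp
  moreover have "h k y = 0" if "k \<notin> ?deg ` ?K" for y
    unfolding h_def using that by (intro sum.neutral) auto
  ultimately have 1: "p y = h k y" for y by auto
  let ?S = "{m\<in>?K. ?deg m = k}"
  have inj: "inj_on ?L ?S" by (auto simp: inj_on_def poly_mapping.lookup_inject)
  define a where "a m = (if m \<in> ?L ` ?S then ?L P (the_inv_into ?S ?L m) else 0)" for m
  have "p y = (\<Sum>m\<in>wm k. a m * Fmon m y)" for y
  proof -
    have "p y = (\<Sum>m\<in>?L ` ?S. a m * Fmon m y)"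
      by (subst sum.reindex[OF inj])
         (auto simp: 1 h_def a_def the_inv_into_f_f[OF inj] intro!: sum.cong)
    also have "\<dots> = (\<Sum>m\<in>wm k. a m * Fmon m y)"
      by (rule sum.mono_neutral_left[OF finite_wm]) (auto simp: wmons_def a_def)
    finally show ?thesis .
  qed
  then show ?thesis by blast
qed

lemma Fmon_indep:
  assumes "\<And>y. (\<Sum>m\<in>wm k. c m * Fmon m y) = 0" "m \<in> wm k" shows "c m = 0"
proof -
  have "(\<lambda>y. \<Sum>m\<in>wm k. c m * powprod m y) \<in> polys"
    by (intro polys_sum polys_scale homD(1)[OF hom_mono])
  from F_indep[OF this] have "(\<Sum>m\<in>wm k. c m * powprod m y) = 0" for y
    using assms(1) by (simp add: Fmon_def)
  from mono_independent[of "wm k" c "\<lambda>m. m", OF finite_wm this _ assms(2)] show ?thesis by simp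
qed

text \<open>The forms of degree \<open>k\<close> have two bases: the monomials, and the products of
  a monomial in the basic invariants with an element of \<open>cobasis\<close>. The second one
  expresses that polynomials are free over the invariants.\<close>

lemma card_weights: "card (wmons UNIV (\<lambda>_::'n. 1) k) = (\<Sum>x\<in>cobasis. if fst x \<le> k then card (wm (k - fst x)) else 0)"
proof -
  define X where "X = wmons UNIV (\<lambda>_::'n. 1) k"
  define C where "C = {x\<in>cobasis. fst x \<le> k}"
  define Y where "Y = Sigma C (\<lambda>x. wm (k - fst x))"
  have fX: "finite X" unfolding X_def by (rule finite_wmons) simp
  have fC: "finite C" by (simp add: C_def finite_cobasis)
  have fY: "finite Y" unfolding Y_def using fC finite_wm by auto
  have sumY: "(\<Sum>j\<in>Y. T j) = (\<Sum>x\<in>C. \<Sum>m\<in>wm (k - fst x). T (x, m))" for T :: "_ \<Rightarrow> complex"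
    unfolding Y_def using sum.Sigma[of C "\<lambda>x. wm (k - fst x)" "\<lambda>x m. T (x, m)"] fC finite_wm by simp
  have "card X \<le> card Y"
  proof (rule card_le_if_independent_in_span[where S = UNIV and v = powprod
        and w = "\<lambda>j y. Fmon (snd j) y * snd (fst j) y"])
    fix c :: "('n \<Rightarrow> nat) \<Rightarrow> complex" assume "\<And>x. x \<in> UNIV \<Longrightarrow> (\<Sum>i\<in>X. c i * powprod i x) = 0"
    then have "(\<Sum>i\<in>X. c i * powprod i x) = 0" for x by simp
    from mono_independent[of X c "\<lambda>m. m", OF fX this] show "\<forall>i\<in>X. c i = 0" by simp
  next
    fix m assume "m \<in> X"
    then have "powprod m \<in> hpolys k" using hom_mono[of m] by (simp add: X_def wmons_def)
    from cobasis_span[OF this] obtain v where v: "\<And>x. x \<in> cobasis \<Longrightarrow> invariant G (v x)"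
      "\<And>x. x \<in> cobasis \<Longrightarrow> if fst x \<le> k then v x \<in> hpolys (k - fst x) else v x = (\<lambda>_. 0)"
      "\<And>y. powprod m y = (\<Sum>x\<in>cobasis. v x y * snd x y)" by blast
    have "\<forall>x\<in>C. \<exists>a. \<forall>y. v x y = (\<Sum>m\<in>wm (k - fst x). a m * Fmon m y)"
    proof
      fix x assume "x \<in> C"
      then have "v x \<in> hpolys (k - fst x)" "invariant G (v x)" using v(1,2)[of x] by (auto simp: C_def)
      from inv_expand[OF this] show "\<exists>a. \<forall>y. v x y = (\<Sum>m\<in>wm (k - fst x). a m * Fmon m y)" .
    qed
    from bchoice[OF this] obtain a where a: "\<And>x y. x \<in> C \<Longrightarrow> v x y = (\<Sum>m\<in>wm (k - fst x). a x m * Fmon m y)"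
      by blast
    have "powprod m y = (\<Sum>j\<in>Y. a (fst j) (snd j) * (Fmon (snd j) y * snd (fst j) y))" for y
    proof -
      have "powprod m y = (\<Sum>x\<in>C. v x y * snd x y)"
        unfolding v(3)
      proof (rule sum.mono_neutral_right)
        show "\<forall>x\<in>cobasis - C. v x y * snd x y = 0" using v(2) by (auto simp: C_def)
      qed (auto simp: C_def finite_cobasis)
      also have "\<dots> = (\<Sum>x\<in>C. \<Sum>m\<in>wm (k - fst x). a x m * (Fmon m y * snd x y))"
        by (intro sum.cong) (auto simp: a sum_distrib_right mult.assoc)
      finally show ?thesis unfolding sumY by simp
    qed
    then show "\<exists>a. \<forall>x\<in>UNIV. powprod m x = (\<Sum>j\<in>Y. a j * (Fmon (snd j) x * snd (fst j) x))"
      by (intro exI[of _ "\<lambda>j. a (fst j) (snd j)"]) simp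
  qed (use fX fY in auto)
  moreover have "card Y \<le> card X"
  proof (rule card_le_if_independent_in_span[where S = UNIV and w = powprod
        and v = "\<lambda>j y. Fmon (snd j) y * snd (fst j) y"])
    fix c :: "(nat \<times> (complex ^ 'n \<Rightarrow> complex)) \<times> ('n \<Rightarrow> nat) \<Rightarrow> complex"
    assume 0: "\<And>y. y \<in> UNIV \<Longrightarrow> (\<Sum>i\<in>Y. c i * (Fmon (snd i) y * snd (fst i) y)) = 0"
    define v where "v x y = (if fst x \<le> k then (\<Sum>m\<in>wm (k - fst x). c (x, m) * Fmon m y) else 0)" for x y
    have "v x y = 0" if "x \<in> cobasis" for x y
    proof (rule cobasis_free[OF _ _ that])
      fix x
      show "v x \<in> polys \<and> invariant G (v x)"
      proof (cases "fst x \<le> k")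
        case True
        then have "v x = (\<lambda>y. \<Sum>m\<in>wm (k - fst x). c (x, m) * Fmon m y)" by (simp add: v_def fun_eq_iff)
        then show ?thesis using Fmon_inv homD(1)[OF Fmon_hom]
          by (simp add: polys_sum polys_scale invariant_def)
      next
        case False
        then have "v x = (\<lambda>y. 0)" by (simp add: v_def fun_eq_iff)
        then show ?thesis by (simp add: polys.const invariant_def)
      qed
    next
      fix y
      have "(\<Sum>x\<in>cobasis. v x y * snd x y) = (\<Sum>x\<in>C. v x y * snd x y)"
        unfolding C_def using finite_cobasis by (intro sum.mono_neutral_right) (auto simp: v_def)
      also have "\<dots> = (\<Sum>x\<in>C. \<Sum>m\<in>wm (k - fst x). c (x, m) * (Fmon m y * snd x y))"
        by (intro sum.cong) (auto simp: C_def v_def sum_distrib_right mult.assoc)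
      also have "\<dots> = 0" using 0[of y] unfolding sumY by simp
      finally show "(\<Sum>x\<in>cobasis. v x y * snd x y) = 0" .
    qed
    then have "(\<Sum>m\<in>wm (k - fst x). c (x, m) * Fmon m y) = 0" if "x \<in> C" for x y
      using that by (simp add: C_def v_def split: if_splits) (metis (mono_tags, lifting))
    then have "c (x, m) = 0" if "x \<in> C" "m \<in> wm (k - fst x)" for x m
      using Fmon_indep[where k = "k - fst x" and c = "\<lambda>m. c (x, m)"] that by blast
    then show "\<forall>i\<in>Y. c i = 0" by (auto simp: Y_def)
  next
    fix i assume "i \<in> Y"
    then obtain x m where i: "i = (x, m)" "x \<in> cobasis" "fst x \<le> k" "m \<in> wm (k - fst x)"
      by (auto simp: Y_def C_def)
    have "(\<lambda>y. Fmon m y * snd x y) \<in> hpolys ((k - fst x) + fst x)"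
      using Fmon_hom[of m] wmD[OF i(4)] cobasisD(1)[OF i(2)] by (intro hom_mult) auto
    then have "(\<lambda>y. Fmon m y * snd x y) \<in> hpolys k" using i(3) by simp
    from hom_expand[OF this] obtain S a where S: "finite S" "\<forall>m\<in>S. (\<Sum>i\<in>UNIV. m i) = k"
      "\<And>y. Fmon m y * snd x y = (\<Sum>m\<in>S. a m * powprod m y)" by blast
    have "Fmon m y * snd x y = (\<Sum>m\<in>X. (if m \<in> S then a m else 0) * powprod m y)" for y
      unfolding S(3) using fX S(2) by (intro sum.mono_neutral_cong_left) (auto simp: X_def wmons_def)
    then show "\<exists>a. \<forall>y\<in>UNIV. Fmon (snd i) y * snd (fst i) y = (\<Sum>j\<in>X. a j * powprod j y)"
      unfolding i(1) by (intro exI[of _ "\<lambda>m. if m \<in> S then a m else 0"]) simp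
  qed (use fX fY in auto)
  ultimately have "card X = card Y" by simp
  also have "card Y = (\<Sum>x\<in>C. card (wm (k - fst x)))" unfolding Y_def
    using fC finite_wm by (intro card_SigmaI) auto
  also have "\<dots> = (\<Sum>x\<in>cobasis. if fst x \<le> k then card (wm (k - fst x)) else 0)"
    unfolding C_def using finite_cobasis by (intro sum.mono_neutral_cong_left) auto
  finally show ?thesis by (simp add: X_def)
qed

text \<open>The Poincare polynomial of the coinvariant algebra.\<close>

definition cob_poly :: "int poly" where "cob_poly = (\<Sum>x\<in>cobasis. monom 1 (fst x))"

text \<open>\<open>card_weights\<close> is an identity of Hilbert series. Clearing its denominators
  gives \<open>cob_poly\<close> times the n-th power of 1 - X on one side and the product of the 1 -
  X ^ \<open>dg i\<close> on the other.\<close>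

lemma cob_poly_eq: "cob_poly = (\<Prod>i\<in>UNIV. \<Sum>k<dg i. monom 1 k)"
proof -
  have H: "hilb UNIV (\<lambda>_::'n. 1) = fps_of_poly cob_poly * hilb UNIV dg"
  proof (rule fps_ext)
    fix k
    have "fps_nth (fps_of_poly cob_poly * hilb UNIV dg) k = (\<Sum>x\<in>cobasis. fps_nth (fps_X ^ fst x * hilb UNIV dg) k)"
      by (simp add: cob_poly_def fps_of_poly_sum fps_of_poly_monom sum_distrib_right fps_sum_nth)
    also have "\<dots> = int (\<Sum>x\<in>cobasis. if fst x \<le> k then card (wm (k - fst x)) else 0)"
      by (auto simp: fps_X_power_mult_nth hilb_def intro!: sum.cong)
    also have "\<dots> = fps_nth (hilb UNIV (\<lambda>_::'n. 1)) k" by (simp only: card_weights[symmetric] hilb_def fps_nth_Abs_fps)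
    finally show "fps_nth (hilb UNIV (\<lambda>_::'n. 1)) k = fps_nth (fps_of_poly cob_poly * hilb UNIV dg) k" by simp
  qed
  let ?A = "(\<Prod>i\<in>(UNIV::'n set). 1 - fps_X ^ 1) :: int fps" and ?D = "\<Prod>i\<in>UNIV. 1 - fps_X ^ dg i :: int fps"
  have A: "hilb UNIV (\<lambda>_::'n. 1) * ?A = 1" by (rule hilb_prod) simp
  have D: "hilb UNIV dg * ?D = 1" using dg_pos by (rule hilb_prod)
  have "fps_of_poly cob_poly * ?A = fps_of_poly cob_poly * (hilb UNIV dg * ?D) * ?A"
    by (simp only: D mult_1_right)
  also have "\<dots> = (hilb UNIV (\<lambda>_::'n. 1) * ?A) * ?D" by (simp only: H mult_ac)
  finally have "fps_of_poly cob_poly * ?A = ?D" by (simp only: A mult_1)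
  moreover have "1 - fps_X ^ k = (fps_of_poly (1 - monom 1 k) :: int fps)" for k
    by (simp add: fps_of_poly_diff fps_of_poly_monom)
  ultimately have "fps_of_poly (cob_poly * (\<Prod>i\<in>(UNIV::'n set). 1 - monom 1 1)) = fps_of_poly (\<Prod>i\<in>UNIV. 1 - monom 1 (dg i))"
    by (simp only: fps_of_poly_mult fps_of_poly_prod)
  then have "cob_poly * (\<Prod>i\<in>(UNIV::'n set). 1 - monom 1 1) = (\<Prod>i\<in>UNIV. 1 - monom 1 (dg i))"
    by (simp only: fps_of_poly_eq_iff)
  also have "\<dots> = (\<Prod>i\<in>UNIV. (\<Sum>k<dg i. monom 1 k) * (1 - monom 1 1))"
  proof (rule prod.cong[OF refl])
    fix i
    have "(1 - monom 1 1 :: int poly) * (\<Sum>k<dg i. monom 1 1 ^ k) = 1 - monom 1 1 ^ dg i"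
      by (simp only: one_diff_power_eq)
    then show "1 - monom 1 (dg i) = (\<Sum>k<dg i. monom 1 k) * (1 - monom 1 1 :: int poly)"
      by (simp add: monom_power mult.commute)
  qed
  also have "\<dots> = (\<Prod>i\<in>UNIV. \<Sum>k<dg i. monom 1 k) * (\<Prod>i\<in>(UNIV::'n set). 1 - monom 1 1)"
    by (simp only: prod.distrib)
  finally have "cob_poly * (\<Prod>i\<in>(UNIV::'n set). 1 - monom 1 1) =
    (\<Prod>i\<in>UNIV. \<Sum>k<dg i. monom 1 k) * (\<Prod>i\<in>(UNIV::'n set). 1 - monom 1 1)" .
  moreover have "(\<Prod>i\<in>(UNIV::'n set). 1 - monom 1 1) \<noteq> (0 :: int poly)"
  proof -
    have "coeff (1 - monom 1 1 :: int poly) 0 = 1" by simp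
    then have "(1 - monom 1 1 :: int poly) \<noteq> 0" by (metis coeff_0 zero_neq_one)
    then show ?thesis by simp
  qed
  ultimately show ?thesis using mult_right_cancel by blast
qed

theorem card_G_eq_prod: "card G = (\<Prod>i\<in>UNIV. dg i)"
proof -
  have "poly cob_poly 1 = int (card cobasis)" by (simp add: cob_poly_def poly_sum poly_monom)
  moreover have "poly cob_poly 1 = int (\<Prod>i\<in>UNIV. dg i)"
    unfolding cob_poly_eq by (simp add: poly_prod poly_sum poly_monom of_nat_prod)
  ultimately have "int (card G) = int (\<Prod>i\<in>UNIV. dg i)" using card_cobasis by simp
  then show ?thesis by (simp only: of_nat_eq_iff)
qed

text \<open>Compare degrees in \<open>cob_poly_eq\<close>: the coinvariants vanish above degree
  \<open>N\<close>, and in degree \<open>N\<close> they contain the nonzero class of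
  \<open>f\<close>.\<close>

theorem N_eq_sum: "N = (\<Sum>i\<in>UNIV. dg i - 1)"
proof -
  have "degree cob_poly = N"
  proof (rule antisym)
    show "degree cob_poly \<le> N" unfolding cob_poly_def
      using cobasisD(2) by (intro degree_sum_le finite_cobasis) (auto simp: degree_monom_eq)
    obtain b where "b \<in> cobasis_in N" using cobasis_in_N_nonempty by blast
    then have b: "(N, b) \<in> cobasis" by (simp add: cobasis_def)
    have "coeff cob_poly N = (\<Sum>x\<in>cobasis. if fst x = N then 1 else 0)"
      by (simp add: cob_poly_def coeff_sum)
    also have "\<dots> > 0" using b finite_cobasis by (intro sum_pos2[of _ "(N, b)"]) auto
    finally show "N \<le> degree cob_poly" by (intro le_degree) simp
  qed
  moreover have "degree cob_poly = (\<Sum>i\<in>UNIV. dg i - 1)"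
  proof -
    have geo: "coeff (\<Sum>k<d. monom 1 k :: int poly) j = (if j < d then 1 else 0)" for d j
      by (simp add: coeff_sum)
    have deg: "degree (\<Sum>k<d. monom 1 k :: int poly) = d - 1" if "0 < d" for d
      by (rule antisym, rule degree_le, use geo that in force, rule le_degree, use geo that in force)
    have nz: "(\<Sum>k<dg i. monom 1 k :: int poly) \<noteq> 0" for i
      using geo[of "dg i" 0] dg_pos[of i] by (metis coeff_0 zero_neq_one)
    show ?thesis unfolding cob_poly_eq using nz deg dg_pos
      by (subst degree_prod_eq_sum_degree) auto
  qed
  ultimately show ?thesis by simp
qed

end

section \<open>Gradients of the basic invariants at regular points\<close>

lemma polys_grad:
  assumes "p \<in> polys"
  shows "\<exists>g. \<forall>\<xi>. ((\<lambda>s. p (y + s *s \<xi>)) has_field_derivative bdot g \<xi>) (at 0)"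
  using assms
proof induction
  case (const c) show ?case by (intro exI[of _ 0]) (simp add: bdot_linear)
next
  case (coord i)
  show ?case
    by (intro exI[of _ "axis i 1"] allI) (auto intro!: derivative_eq_intros)
next
  case (add p q)
  then obtain g h where "\<And>\<xi>. ((\<lambda>s. p (y + s *s \<xi>)) has_field_derivative bdot g \<xi>) (at 0)"
    "\<And>\<xi>. ((\<lambda>s. q (y + s *s \<xi>)) has_field_derivative bdot h \<xi>) (at 0)" by blast
  then show ?case by (intro exI[of _ "g + h"]) (auto simp: bdot_linear intro: DERIV_add)
next
  case (mult p q)
  then obtain g h where "\<And>\<xi>. ((\<lambda>s. p (y + s *s \<xi>)) has_field_derivative bdot g \<xi>) (at 0)"
    "\<And>\<xi>. ((\<lambda>s. q (y + s *s \<xi>)) has_field_derivative bdot h \<xi>) (at 0)" by blast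
  from DERIV_mult[OF this] show ?case
    by (intro exI[of _ "q y *s g + p y *s h"]) (simp add: bdot_linear algebra_simps)
qed

definition grad where
  "grad p y = (SOME g. \<forall>\<xi>. ((\<lambda>s. p (y + s *s \<xi>)) has_field_derivative bdot g \<xi>) (at 0))"

lemma grad:
  "p \<in> polys \<Longrightarrow> ((\<lambda>s. p (y + s *s \<xi>)) has_field_derivative bdot (grad p y) \<xi>) (at 0)"
  using someI_ex[OF polys_grad, of p y] unfolding grad_def by blast

lemma polys_chain_zero:
  assumes "Q \<in> polys" "\<And>i. ((\<lambda>s. c s $ i) has_field_derivative 0) (at (0::complex))"
  shows "((\<lambda>s. Q (c s)) has_field_derivative 0) (at 0)"
  using assms(1)
proof induction
  case (const c) show ?case by simp
next
  case (coord i) show ?case using assms(2) .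
next
  case (add p q) from DERIV_add[OF add.IH] show ?case by simp
next
  case (mult p q) from DERIV_mult[OF mult.IH] show ?case by simp
qed

context refl_group_inv
begin

lemma F_polys: "F i \<in> polys" using F_hom homD(1) by blast

text \<open>Otherwise every invariant would have derivative 0 at \<open>u\<close> in the direction
  \<xi>. But the stabilizer of \<open>u\<close> is trivial, so an invariant with derivative 1 can be
  built by summing over the orbit.\<close>

lemma gradients_independent:
  assumes u: "f u \<noteq> 0" and \<xi>: "\<And>i. bdot (grad (F i) u) \<xi> = 0" shows "\<xi> = 0"
proof (rule ccontr)
  assume "\<xi> \<noteq> 0"
  then obtain \<eta> where \<eta>: "bdot \<eta> \<xi> = 1" using exists_bdot_eq_1 bdot_commute by metis
  have "u \<in> orbit u" using one by (auto simp: orbit_def intro!: image_eqI[of _ _ "mat 1"])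
  then obtain r where r: "r \<in> polys" "\<And>x. x \<in> orbit u \<Longrightarrow> r x = (if x = u then 1 else 0)"
    using polys_indicator[OF finite_orbit] by blast
  \<comment> \<open>The square of \<open>r\<close> vanishes to second order at the other points of
    the orbit, so only the identity contributes to the derivative of the sum over
    \<open>G\<close>.\<close>
  define q where "q y = bdot \<eta> (y - u) * (r y * r y)" for y
  have q: "q \<in> polys" unfolding q_def[abs_def]
    by (intro polys.mult r polys_compose[OF polys_bdot]) (simp, intro polys_diff polys.intros)
  define P where "P y = (\<Sum>g\<in>G. q (g *v y))" for y
  have "P \<in> polys" unfolding P_def[abs_def] by (intro polys_sum polys_matrix q)
  moreover have "invariant G P"
    unfolding invariant_def P_def
    using sum_right_mult[of _ "\<lambda>g. q (g *v _)"] by (simp add: matrix_vector_mul_assoc)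
  ultimately obtain Q where Q: "Q \<in> polys" "\<And>y. P y = Q (\<chi> i. F i y)" using F_gen by blast
  have "((\<lambda>s. F i (u + s *s \<xi>)) has_field_derivative 0) (at 0)" for i
    using grad[OF F_polys, of i u \<xi>] \<xi> by simp
  then have "((\<lambda>s. Q (\<chi> i. F i (u + s *s \<xi>))) has_field_derivative 0) (at 0)"
    by (intro polys_chain_zero[OF Q(1)]) simp
  then have P0: "((\<lambda>s. P (u + s *s \<xi>)) has_field_derivative 0) (at 0)" by (simp add: Q(2))
  have "((\<lambda>s. q (g *v (u + s *s \<xi>))) has_field_derivative (if g = mat 1 then 1 else 0)) (at 0)"
    if g: "g \<in> G" for g
  proof -
    let ?r = "\<lambda>s. r (g *v u + s *s (g *v \<xi>))"
    let ?r' = "bdot (grad r (g *v u)) (g *v \<xi>)"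
    have l: "((\<lambda>s. bdot \<eta> (g *v u - u) + s * bdot \<eta> (g *v \<xi>)) has_field_derivative bdot \<eta> (g *v \<xi>)) (at 0)"
      by (auto intro!: derivative_eq_intros)
    have "((\<lambda>s. (bdot \<eta> (g *v u - u) + s * bdot \<eta> (g *v \<xi>)) * (?r s * ?r s)) has_field_derivative
        bdot \<eta> (g *v \<xi>) * (?r 0 * ?r 0) +
        (?r' * ?r 0 + ?r' * ?r 0) * (bdot \<eta> (g *v u - u) + 0 * bdot \<eta> (g *v \<xi>))) (at 0)"
      by (rule DERIV_mult[OF l DERIV_mult[OF grad[OF r(1)] grad[OF r(1)]]])
    moreover have "q (g *v (u + s *s \<xi>)) = (bdot \<eta> (g *v u - u) + s * bdot \<eta> (g *v \<xi>)) * (?r s * ?r s)" for s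
      by (simp add: q_def matrix_vector_right_distrib vector_scalar_commute bdot_linear algebra_simps)
    moreover have "r (g *v u) = (if g = mat 1 then 1 else 0)"
    proof -
      have "g *v u = u \<longleftrightarrow> g = mat 1"
        using inj_onD[OF regular_free[OF u], of g "mat 1"] g one by auto
      then show ?thesis using r(2)[of "g *v u"] g by (auto simp: orbit_def)
    qed
    ultimately show ?thesis by (cases "g = mat 1") (simp_all add: \<eta> bdot_linear)
  qed
  then have "((\<lambda>s. P (u + s *s \<xi>)) has_field_derivative (\<Sum>g\<in>G. if g = mat 1 then 1 else 0)) (at 0)"
    unfolding P_def by (rule DERIV_sum)
  then have "((\<lambda>s. P (u + s *s \<xi>)) has_field_derivative 1) (at 0)" using fin one by simp
  with P0 show False using DERIV_unique zero_neq_one by blast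
qed

text \<open>Springer's theorem on eigenvalues. Differentiating the invariance of \<open>F i\<close>
  under \<open>g\<close> at \<open>u\<close>, and using homogeneity, shows that the invertible
  matrix of gradients conjugates \<open>g\<close> to a diagonal matrix.\<close>

lemma det_regular_eigenvector:
  assumes u: "f u \<noteq> 0" and g: "g \<in> G" and gu: "g *v u = \<zeta> *s u" and \<zeta>: "\<zeta> \<noteq> 0"
  shows "det (mat x - g) = (\<Prod>i\<in>UNIV. x - inverse \<zeta> ^ (dg i - 1))"
proof -
  define A where "A = (\<chi> i. grad (F i) u)"
  define D :: "complex ^ 'n ^ 'n" where "D = (\<chi> i j. if i = j then inverse \<zeta> ^ (dg i - 1) else 0)"
  have Av: "(A *v \<xi>) $ i = bdot (grad (F i) u) \<xi>" for \<xi> i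
    by (simp add: A_def matrix_vector_mult_def bdot_def)
  have "\<xi> = 0" if "A *v \<xi> = 0" for \<xi>
    using gradients_independent[OF u, of \<xi>] that Av by (metis zero_index)
  then have "\<exists>B. B ** A = mat 1" by (simp add: matrix_left_invertible_ker)
  then have "invertible A" using matrix_left_right_inverse unfolding invertible_def by blast
  then have detA: "det A \<noteq> 0" by (simp add: invertible_det_nz)
  have eig: "bdot (grad (F i) u) (g *v \<xi>) = inverse \<zeta> ^ (dg i - 1) * bdot (grad (F i) u) \<xi>" for i \<xi>
  proof -
    let ?\<xi> = "inverse \<zeta> *s (g *v \<xi>)"
    have "F i (u + s *s \<xi>) = \<zeta> ^ dg i * F i (u + s *s ?\<xi>)" for s
    proof -
      have "g *v (u + s *s \<xi>) = \<zeta> *s (u + s *s ?\<xi>)"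
        using \<zeta> by (simp add: matrix_vector_right_distrib vector_scalar_commute gu vector_add_ldistrib
            vector_smult_assoc)
      then have "F i (\<zeta> *s (u + s *s ?\<xi>)) = F i (u + s *s \<xi>)"
        using F_inv[of i] g by (metis invariant_def)
      then show ?thesis using homD(2)[OF F_hom] by metis
    qed
    moreover have "((\<lambda>s. \<zeta> ^ dg i * F i (u + s *s ?\<xi>)) has_field_derivative
        \<zeta> ^ dg i * bdot (grad (F i) u) ?\<xi>) (at 0)"
      by (rule DERIV_cmult[OF grad[OF F_polys]])
    ultimately have "((\<lambda>s. F i (u + s *s \<xi>)) has_field_derivative
        \<zeta> ^ dg i * bdot (grad (F i) u) ?\<xi>) (at 0)" by simp
    from DERIV_unique[OF this grad[OF F_polys]]
    have "\<zeta> ^ dg i * (inverse \<zeta> * bdot (grad (F i) u) (g *v \<xi>)) = bdot (grad (F i) u) \<xi>"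
      by (simp add: bdot_linear)
    moreover have "\<zeta> ^ dg i = \<zeta> ^ (dg i - 1) * \<zeta>" using dg_pos[of i] by (metis power_minus_mult)
    ultimately have "\<zeta> ^ (dg i - 1) * bdot (grad (F i) u) (g *v \<xi>) = bdot (grad (F i) u) \<xi>"
      using \<zeta> by (simp add: mult.assoc[symmetric]) (simp add: mult.assoc)
    then show ?thesis using \<zeta> by (simp add: power_inverse field_simps)
  qed
  have "A ** (mat x - g) = (mat x - D) ** A"
  proof -
    have "(A ** (mat x - g)) *v \<xi> = ((mat x - D) ** A) *v \<xi>" for \<xi>
    proof (subst vec_eq_iff, rule allI)
      fix i
      have m: "mat x *v \<xi> = x *s \<xi>" for \<xi> :: "complex ^ 'n"
        by (simp add: vec_eq_iff matrix_vector_mult_def mat_def if_distrib[of "\<lambda>a. a * _"] cong: if_cong)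
      have dd: "(D *v \<xi>) $ i = inverse \<zeta> ^ (dg i - 1) * \<xi> $ i" for \<xi>
        by (simp add: D_def matrix_vector_mult_def if_distrib[of "\<lambda>a. a * _"] cong: if_cong)
      show "((A ** (mat x - g)) *v \<xi>) $ i = (((mat x - D) ** A) *v \<xi>) $ i"
        by (simp add: matrix_vector_mul_assoc[symmetric] matrix_vector_mult_diff_rdistrib m dd Av
            bdot_linear eig)
    qed
    then show ?thesis by (simp add: matrix_eq)
  qed
  then have "det A * det (mat x - g) = det (mat x - D) * det A" by (metis det_mul)
  then have "det (mat x - g) = det (mat x - D)" using detA by simp
  also have "\<dots> = (\<Prod>i\<in>UNIV. (mat x - D) $ i $ i)"
    by (rule det_diagonal) (simp add: D_def mat_def)
  also have "\<dots> = (\<Prod>i\<in>UNIV. x - inverse \<zeta> ^ (dg i - 1))" by (simp add: D_def mat_def)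
  finally show ?thesis .
qed

section \<open>The lower bound\<close>

text \<open>At a common zero of the basic invariants every form in the ideal vanishes, in particular
  a power of each coordinate.\<close>

lemma exists_nonzero_F: assumes "u \<noteq> 0" shows "\<exists>i. F i u \<noteq> 0"
proof (rule ccontr)
  assume "\<not> ?thesis"
  then have 0: "F i u = 0" for i by blast
  have "p u = 0" if "p \<in> iideal G k" for p k
    using that
  proof induction
    case (gen v j s l)
    obtain a where a: "v u = (\<Sum>m\<in>wm j. a m * Fmon m u)" using inv_expand gen by blast
    have "Fmon m u = 0" if m: "m \<in> wm j" for m
    proof -
      have "\<exists>i. m i \<noteq> 0"
      proof (rule ccontr)
        assume "\<not> ?thesis"
        then show False using wmD[OF m] gen(2) by simp
      qed
      then show ?thesis using 0 by (simp add: Fmon_def powprod_def)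
    qed
    then show ?case using a by simp
  qed auto
  from this[OF power_card_in_iideal[OF hom_coord]] have "u $ i = 0" for i by simp
  then show False using assms by (simp add: vec_eq_iff)
qed

text \<open>A basic invariant that is nonzero at a point is multiplied by a power of a linear form
  up to degree \<open>d\<close>, which requires all degrees to be at most \<open>d\<close>. A
  combination with a generic coefficient serves all points.\<close>

lemma iideal_nonvanishing:
  assumes "finite J" "\<And>j. j \<in> J \<Longrightarrow> u j \<noteq> 0" "\<And>i. dg i \<le> d"
  shows "\<exists>p\<in>iideal G d. \<forall>j\<in>J. p (u j) \<noteq> 0"
  using assms(1,2)
proof (induction J rule: finite_induct)
  case empty then show ?case by (auto intro: iideal.zero)
next
  case (insert j J)
  have "u k \<noteq> 0" if "k \<in> J" for k using insert.prems that by simp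
  from insert.IH[OF this] obtain p where p: "p \<in> iideal G d" "\<forall>j\<in>J. p (u j) \<noteq> 0" by blast
  obtain i where i: "F i (u j) \<noteq> 0" using exists_nonzero_F insert.prems by blast
  obtain \<eta> where \<eta>: "bdot \<eta> (u j) = 1" proof -
    obtain y where "bdot (u j) y = 1" using exists_bdot_eq_1[of "u j"] insert.prems by auto
    then show ?thesis using that[of y] by (simp add: bdot_commute)
  qed
  define q where "q y = F i y * bdot \<eta> y ^ (d - dg i)" for y
  have q: "q \<in> iideal G d" unfolding q_def[abs_def]
    by (rule iideal.gen[OF F_hom dg_pos F_inv hom_power[OF hom_bdot]]) (use assms(3) in simp)
  have qj: "q (u j) \<noteq> 0" using i \<eta> by (simp add: q_def)
  have "finite ((\<lambda>k. - q (u k) / p (u k)) ` J \<union> {- p (u j) / q (u j), 0})" using insert by simp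
  then obtain s where s: "s \<notin> (\<lambda>k. - p (u k) / q (u k)) ` J \<union> {- p (u j) / q (u j)}"
    using ex_new_if_finite[OF infinite_UNIV_char_0, of "(\<lambda>k. - p (u k) / q (u k)) ` J \<union> {- p (u j) / q (u j)}"]
      insert by auto
  have "p (u k) + s * q (u k) \<noteq> 0" if "k \<in> insert j J" for k
  proof
    assume 0: "p (u k) + s * q (u k) = 0"
    show False
    proof (cases "q (u k) = 0")
      case True then show False using 0 that p qj by auto
    next
      case False
      then have "s = - p (u k) / q (u k)" using 0 by (simp add: field_simps add_eq_0_iff)
      then show False using s that by blast
    qed
  qed
  moreover have "(\<lambda>y. p y + s * q y) \<in> iideal G d" by (intro iideal.add iideal_scale p q)
  ultimately show ?case by (intro bexI[of _ "\<lambda>y. p y + s * q y"]) auto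
qed

lemma iideal_power: assumes "p \<in> iideal G d" "0 < e" shows "(\<lambda>y. p y ^ e) \<in> iideal G (e * d)"
proof -
  obtain e' where "e = Suc e'" using assms(2) gr0_implies_Suc by blast
  then show ?thesis using iideal_mult[OF assms(1) hom_power[OF iideal_hpolys[OF assms(1)]], of e']
    by simp
qed

text \<open>If the functional is a sum of \<open>r\<close> point evaluations and \<open>\<gamma>\<close> is an element of the ideal of
  degree \<open>d\<close> that vanishes at none of the points, the coinvariants embed into the \<open>d * r\<close>-dimensional
  space of functions of pairs (residue class of the degree modulo \<open>d\<close>, point): on each of the lines
  through the points, multiplication by \<open>\<gamma>\<close> identifies the degrees \<open>k\<close> and \<open>k + d\<close>.\<close>

theorem card_le_if_sum_of_evaluations:
  fixes u :: "nat \<Rightarrow> complex ^ 'n"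
  assumes Lam: "skew_functional (\<lambda>q. \<Sum>j<r. q (u j))" and d: "\<And>i. dg i \<le> d"
  shows "card G \<le> d * r"
\<comment> \<open>The zero vectors among the \<open>u j\<close> are discarded below; this does not
  change the sum for forms of positive degree. In degree 0 the group is trivial.\<close>
proof (cases "N = 0")
  case True
  then have "dg i = 1" for i using N_eq_sum dg_pos[of i] by (simp add: le_antisym Suc_leI)
  then have 1: "card G = 1" using card_G_eq_prod by simp
  have "0 < r" using skew_functionalD(4)[OF Lam f_hom] by (cases r) auto
  moreover have "0 < d" using d dg_pos order_less_le_trans by blast
  ultimately show ?thesis using 1 by (simp add: Suc_leI)
next
  case False
  let ?Lam = "\<lambda>q. \<Sum>j<r. q (u j)"
  define J where "J = {j. j < r \<and> u j \<noteq> 0}"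
  have fJ: "finite J" by (simp add: J_def)
  have LamJ: "?Lam q = (\<Sum>j\<in>J. q (u j))" if "q \<in> hpolys N" for q
  proof (rule sum.mono_neutral_right)
    have "q 0 = 0" using homD(2)[OF that, of 0 0] False by (simp add: zero_power)
    then show "\<forall>i\<in>{..<r} - J. q (u i) = 0" by (auto simp: J_def)
  qed (auto simp: J_def)
  have dpos: "0 < d" using d dg_pos order_less_le_trans by blast
  have "u j \<noteq> 0" if "j \<in> J" for j using that by (simp add: J_def)
  from iideal_nonvanishing[of J u d, OF fJ this d] obtain \<gamma>
    where \<gamma>: "\<gamma> \<in> iideal G d" "\<And>j. j \<in> J \<Longrightarrow> \<gamma> (u j) \<noteq> 0" by blast
  define S where "S = {..<d} \<times> J"
  define T where "T k p x = (if k mod d = fst x then p (u (snd x)) * inverse (\<gamma> (u (snd x))) ^ (k div d) else 0)"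
    for k and p :: "complex ^ 'n \<Rightarrow> complex" and x
  have "card cobasis \<le> card S"
  proof (rule card_le_if_independent_in_span[where S = S and v = "\<lambda>b x. T (fst b) (snd b) x"
        and w = "\<lambda>o' x. if x = o' then 1 else 0"])
    fix c assume 0: "\<And>x. x \<in> S \<Longrightarrow> (\<Sum>b\<in>cobasis. c b * T (fst b) (snd b) x) = 0"
    show "\<forall>b\<in>cobasis. c b = 0"
    proof (rule cobasis_independent[where S = S and T = T])
      fix k and h :: "nat \<Rightarrow> complex ^ 'n \<Rightarrow> complex"
      assume k: "k \<le> N" and h: "\<And>j. h j \<in> hpolys j" and T0: "\<And>x. x \<in> S \<Longrightarrow> (\<Sum>j\<le>k. T j (h j) x) = 0"
      define I where "I = {i. i \<le> k \<and> i mod d = k mod d}"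
      define e where "e i = k div d - i div d" for i
      have e: "i + e i * d = k" if "i \<in> I" for i
      proof -
        have "i div d \<le> k div d" using that by (simp add: I_def div_le_mono)
        then have "i div d * d + e i * d = k div d * d"
          by (simp add: e_def add_mult_distrib[symmetric])
        moreover have "i = i div d * d + k mod d" using that div_mult_mod_eq[of i d] by (simp add: I_def)
        moreover have "k = k div d * d + k mod d" by simp
        ultimately show ?thesis by linarith
      qed
      have vanish: "(\<Sum>i\<in>I. h i (u j) * \<gamma> (u j) ^ e i) = 0" if j: "j \<in> J" for j
      proof -
        have "0 = \<gamma> (u j) ^ (k div d) * (\<Sum>i\<le>k. T i (h i) (k mod d, j))"
          using T0[of "(k mod d, j)"] j dpos by (simp add: S_def)
        also have "(\<Sum>i\<le>k. T i (h i) (k mod d, j)) = (\<Sum>i\<in>I. h i (u j) * inverse (\<gamma> (u j)) ^ (i div d))"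
          by (intro sum.mono_neutral_cong_right) (auto simp: I_def T_def)
        also have "\<gamma> (u j) ^ (k div d) * \<dots> = (\<Sum>i\<in>I. h i (u j) * \<gamma> (u j) ^ e i)"
          unfolding sum_distrib_left
        proof (rule sum.cong[OF refl])
          fix i assume "i \<in> I"
          then have "i div d \<le> k div d" by (simp add: I_def div_le_mono)
          then show "\<gamma> (u j) ^ (k div d) * (h i (u j) * inverse (\<gamma> (u j)) ^ (i div d)) =
              h i (u j) * \<gamma> (u j) ^ e i"
            using \<gamma>(2)[OF j] by (simp add: e_def power_diff power_inverse field_simps)
        qed
        finally show ?thesis by simp
      qed
      have "h k \<in> perp ?Lam k"
        unfolding perp_def
      proof (intro CollectI conjI allI impI)
        show "h k \<in> hpolys k" by (rule h)
        fix s :: "complex ^ 'n \<Rightarrow> complex" and l assume s: "s \<in> hpolys l" "k + l = N"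
        have hs: "(\<lambda>y. h i y * \<gamma> y ^ e i * s y) \<in> hpolys N" if i: "i \<in> I" for i
        proof -
          have "(\<lambda>y. h i y * \<gamma> y ^ e i * s y) \<in> hpolys (i + e i * d + l)"
            by (intro hom_mult h s hom_power iideal_hpolys[OF \<gamma>(1)])
          then show ?thesis using e[OF i] s by simp
        qed
        have "(\<Sum>i\<in>I. ?Lam (\<lambda>y. h i y * \<gamma> y ^ e i * s y)) =
            (\<Sum>i\<in>I. \<Sum>j\<in>J. h i (u j) * \<gamma> (u j) ^ e i * s (u j))"
          by (intro sum.cong refl LamJ hs)
        also have "\<dots> = (\<Sum>j\<in>J. (\<Sum>i\<in>I. h i (u j) * \<gamma> (u j) ^ e i) * s (u j))"
          by (subst sum.swap) (simp add: sum_distrib_right)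
        also have "\<dots> = 0" using vanish by simp
        finally have sum0: "(\<Sum>i\<in>I. ?Lam (\<lambda>y. h i y * \<gamma> y ^ e i * s y)) = 0" .
        \<comment> \<open>For \<open>i\<close> other than \<open>k\<close> a positive power of
          \<gamma> occurs, so the product is in the ideal and the functional annihilates it. Of the
          relation only the term of degree \<open>k\<close> survives.\<close>
        have "?Lam (\<lambda>y. h i y * \<gamma> y ^ e i * s y) = 0" if i: "i \<in> I - {k}" for i
        proof -
          have "0 < e i" using e[of i] i by (cases "e i") auto
          then have "(\<lambda>y. \<gamma> y ^ e i * (h i y * s y)) \<in> iideal G (e i * d + (i + l))"
            by (intro iideal_mult iideal_power \<gamma> hom_mult h s)
          moreover have "e i * d + (i + l) = N" using e[of i] i s by simp
          ultimately have "?Lam (\<lambda>y. \<gamma> y ^ e i * (h i y * s y)) = 0"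
            using skew_functional_iideal[OF Lam] by simp
          then show ?thesis by (simp add: mult_ac)
        qed
        moreover have "finite I" "k \<in> I" by (auto simp: I_def)
        ultimately have "?Lam (\<lambda>y. h k y * \<gamma> y ^ e k * s y) = 0"
          using sum0 by (simp add: sum.remove)
        then show "?Lam (\<lambda>y. h k y * s y) = 0" by (simp add: e_def)
      qed
      then show "h k \<in> iideal G k" using perp_eq_iideal[OF Lam] by simp
    next
      show "T j (\<lambda>y. \<Sum>b\<in>cobasis_in j. c b * b y) x = (\<Sum>b\<in>cobasis_in j. c b * T j b x)" for j c x
        by (simp add: T_def sum_distrib_right mult.assoc)
    qed (use 0 in auto)
  next
    show "\<exists>a. \<forall>x\<in>S. T (fst b) (snd b) x = (\<Sum>j\<in>S. a j * (if x = j then 1 else 0))"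
      for b :: "nat \<times> (complex^'n \<Rightarrow> complex)"
      using fJ by (intro exI[of _ "T (fst b) (snd b)"])
        (simp add: S_def if_distrib[of "\<lambda>x. _ * x"] cong: if_cong)
  qed (use finite_cobasis fJ in \<open>auto simp: S_def\<close>)
  also have "card S = d * card J" by (simp add: S_def card_cartesian_product)
  also have "card J \<le> r" unfolding J_def using card_mono[of "{..<r}" "{j. j < r \<and> u j \<noteq> 0}"] by auto
  finally show ?thesis using card_cobasis by (simp add: mult_le_mono2 order_trans)
qed

end

section \<open>Complex reflection groups acting on the dual space\<close>

declare transpose_matrix_vector [simp del]

lemma GL_simps [simp]:
  "carrier GL = {A. invertible A}" "x \<otimes>\<^bsub>GL\<^esub> y = x ** y" "\<one>\<^bsub>GL\<^esub> = mat 1"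
  by (simp_all add: GL_def)

lemma group_GL: "group (GL :: (complex ^ 'n::finite ^ 'n) monoid)"
proof (rule groupI)
  fix x :: "complex ^ 'n ^ 'n" assume "x \<in> carrier GL"
  then obtain y where "x ** y = mat 1" "y ** x = mat 1" by (auto simp: invertible_def)
  then show "\<exists>y\<in>carrier GL. y \<otimes>\<^bsub>GL\<^esub> x = \<one>\<^bsub>GL\<^esub>" by (auto simp: invertible_def)
next
  show "\<one>\<^bsub>GL\<^esub> \<in> carrier (GL :: (complex ^ 'n ^ 'n) monoid)"
    by (auto simp: invertible_def intro: exI[of _ "mat 1"])
qed (auto simp: invertible_mult matrix_mul_assoc)

lemma inj_on_transpose: "inj_on transpose A"
  by (metis inj_onI transpose_transpose)

lemma dim_insert_hyperplane:
  fixes H :: "(complex ^ 'n) set"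
  assumes "vec.subspace H" "z \<notin> H"
  shows "vec.dim (insert z H) = Suc (vec.dim H)"
proof -
  have "vec.span H = H" using assms(1) by (simp only: vec.span_eq_iff)
  then show ?thesis using assms(2) by (metis vec.dim_insert Suc_eq_plus1)
qed

lemma bdot_hyperplane:
  fixes \<phi> :: "complex ^ 'n::finite"
  assumes "\<phi> \<noteq> 0"
  shows "vec.subspace {v. bdot \<phi> v = 0}" "vec.dim {v. bdot \<phi> v = 0} = CARD('n) - 1"
proof -
  let ?H = "{v. bdot \<phi> v = 0}"
  show sub: "vec.subspace ?H" by (simp add: vec.subspace_def bdot_linear)
  obtain z where z: "bdot \<phi> z = 1" using exists_bdot_eq_1[OF assms] by blast
  have "v \<in> vec.span (insert z ?H)" for v
    unfolding vec.span_breakdown_eq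
    by (intro exI[of _ "bdot \<phi> v"] vec.span_base) (simp add: bdot_linear z)
  then have "vec.span (insert z ?H) = UNIV" by blast
  then have "vec.dim (insert z ?H) = CARD('n)" using vec.dim_span vec_dim_card by metis
  moreover have "vec.dim (insert z ?H) = Suc (vec.dim ?H)"
    using dim_insert_hyperplane[OF sub, of z] z by simp
  ultimately show "vec.dim ?H = CARD('n) - 1" by simp
qed

text \<open>The fixed hyperplane and \<open>l\<close> together span the space, and on both the
  values of \<open>t - mat 1\<close> lie on the line of \<open>l\<close>.\<close>

lemma pseudo_reflection_form:
  fixes t :: "complex ^ 'n::finite ^ 'n"
  assumes "pseudo_reflection t" "t *v l = c *s l" "c \<noteq> 1" "l \<noteq> 0"
  shows "\<exists>\<phi>. \<forall>v. t *v v = v + bdot \<phi> v *s l"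
proof -
  obtain H where H: "vec.subspace H" "vec.dim H = CARD('n) - 1" "\<And>v. v \<in> H \<Longrightarrow> t *v v = v"
    using assms(1) by (auto simp: pseudo_reflection_def)
  have "l \<notin> H"
  proof
    assume "l \<in> H"
    then have "c *s l = l" using H(3) assms(2) by metis
    then have "(c - 1) * l $ i = 0" for i by (metis eq_iff_diff_eq_0 left_diff_distrib mult_1 vector_smult_component)
    then show False using assms by (auto simp: vec_eq_iff)
  qed
  then have "vec.dim (insert l H) = CARD('n)" using dim_insert_hyperplane[OF H(1)] H(2) by simp
  then have "vec.span (insert l H) = vec.span UNIV"
    by (intro vec.dim_eq_span subset_UNIV) (simp only: vec_dim_card order_refl)
  then have span: "v \<in> vec.span (insert l H)" for v by simp
  have ex: "\<exists>k. t *v v - v = k *s l" for v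
  proof -
    obtain k where "v - k *s l \<in> H"
      using span[of v] vec.span_eq_iff[of H] H(1) by (metis vec.span_breakdown_eq)
    then have "t *v (v - k *s l) = v - k *s l" by (rule H(3))
    then have "t *v v - v = (k * (c - 1)) *s l"
      by (simp add: matrix_vector_mult_diff_distrib vector_scalar_commute assms(2) algebra_simps
          vector_ssub_ldistrib vector_sub_rdistrib vector_smult_assoc)
    then show ?thesis by blast
  qed
  obtain i where i: "l $ i \<noteq> 0" using assms(4) by (auto simp: vec_eq_iff)
  define \<phi> where "\<phi> = inverse (l $ i) *s (transpose (t - mat 1) *v axis i 1)"
  have \<phi>: "bdot \<phi> v = inverse (l $ i) * (t *v v - v) $ i" for v
    unfolding \<phi>_def bdot_scale_left bdot_matrix[symmetric]
    by (simp add: matrix_vector_mult_diff_rdistrib)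
  have "t *v v = v + bdot \<phi> v *s l" for v
  proof -
    obtain k where k: "t *v v - v = k *s l" using ex by blast
    then have "bdot \<phi> v = k" using i unfolding \<phi> by simp
    then show ?thesis using k by (metis add.commute diff_add_cancel)
  qed
  then show ?thesis by blast
qed

text \<open>Transposition exchanges the direction and the linear form of a reflection: the
  exceptional eigenvector of \<open>t\<close> becomes the equation of the hyperplane fixed by the
  transpose.\<close>

lemma transpose_rank_one:
  assumes "\<And>v. t *v v = v + bdot \<phi> v *s l"
  shows "transpose t *v y = y + bdot l y *s \<phi>"
proof -
  have "bdot v (transpose t *v y - (y + bdot l y *s \<phi>)) = 0" for v
  proof -
    have "bdot v (transpose t *v y) = bdot (t *v v) y"
      using bdot_matrix[of v "transpose t" y] by (simp only: transpose_transpose)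
    then show ?thesis by (simp add: assms bdot_linear bdot_commute[of v \<phi>])
  qed
  then have "bdot (transpose t *v y - (y + bdot l y *s \<phi>)) v = 0" for v by (simp add: bdot_commute)
  then show ?thesis using bdot_eq_zero_imp eq_iff_diff_eq_0 by blast
qed

locale complex_refl =
  fixes W :: "(complex ^ 'n::finite ^ 'n) set" and L :: "complex ^ 'n ^ 'n \<Rightarrow> complex ^ 'n"
  assumes W: "complex_reflection_group W"
    and L: "\<And>t. t \<in> reflections W \<Longrightarrow> L t \<noteq> 0 \<and> (\<exists>c. c \<noteq> 1 \<and> t *v L t = c *s L t)"
begin

lemma finW: "finite W" using W by (simp add: complex_reflection_group_def)

lemma subW: "subgroup W GL" using W by (simp add: complex_reflection_group_def)

lemma W_one: "mat 1 \<in> W" using subgroup.one_closed[OF subW] by simp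

lemma W_mult: "g \<in> W \<Longrightarrow> h \<in> W \<Longrightarrow> g ** h \<in> W" using subgroup.m_closed[OF subW] by simp

lemma W_invertible: "g \<in> W \<Longrightarrow> invertible g" using subgroup.subset[OF subW] by auto

lemma W_inv: assumes "g \<in> W"
  shows "inv\<^bsub>GL\<^esub> g \<in> W" "inv\<^bsub>GL\<^esub> g ** g = mat 1" "g ** inv\<^bsub>GL\<^esub> g = mat 1"
proof -
  interpret group "GL :: (complex ^ 'n ^ 'n) monoid" by (rule group_GL)
  show "inv\<^bsub>GL\<^esub> g \<in> W" using subgroup.m_inv_closed[OF subW assms] .
  have "g \<in> carrier GL" using W_invertible[OF assms] by simp
  from l_inv[OF this] r_inv[OF this] show "inv\<^bsub>GL\<^esub> g ** g = mat 1" "g ** inv\<^bsub>GL\<^esub> g = mat 1" by auto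
qed

lemma W_finite_order: assumes "g \<in> W" shows "\<exists>k::nat. k > 0 \<and> g [^]\<^bsub>GL\<^esub> k = \<one>\<^bsub>GL\<^esub>"
proof -
  interpret group "GL :: (complex ^ 'n ^ 'n) monoid" by (rule group_GL)
  have g: "g \<in> carrier GL" using W_invertible[OF assms] by simp
  have "g [^]\<^bsub>GL\<^esub> (k::nat) \<in> W" for k
    by (induction k) (use W_one W_mult assms in auto)
  then have "range (\<lambda>k::nat. g [^]\<^bsub>GL\<^esub> k) \<subseteq> W" by blast
  then have "finite (range (\<lambda>k::nat. g [^]\<^bsub>GL\<^esub> k))" using finW finite_subset by blast
  then have "\<not> inj (\<lambda>k::nat. g [^]\<^bsub>GL\<^esub> k)" using finite_imageD by blast
  then obtain i j :: nat where "i \<noteq> j" "g [^]\<^bsub>GL\<^esub> i = g [^]\<^bsub>GL\<^esub> j" by (auto simp: inj_def)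
  then have "\<exists>i j :: nat. i < j \<and> g [^]\<^bsub>GL\<^esub> i = g [^]\<^bsub>GL\<^esub> j" by (metis linorder_neqE_nat)
  then obtain i j :: nat where ij: "i < j" "g [^]\<^bsub>GL\<^esub> i = g [^]\<^bsub>GL\<^esub> j" by blast
  then have "g [^]\<^bsub>GL\<^esub> i \<otimes>\<^bsub>GL\<^esub> g [^]\<^bsub>GL\<^esub> (j - i) = g [^]\<^bsub>GL\<^esub> i"
    by (subst nat_pow_mult[OF g]) simp
  then have "g [^]\<^bsub>GL\<^esub> (j - i) = \<one>\<^bsub>GL\<^esub>" using g l_cancel_one nat_pow_closed by blast
  then show ?thesis using ij(1) by (intro exI[of _ "j - i"]) simp
qed

lemma reflectionI:
  assumes "g \<in> W" "g \<noteq> mat 1" "vec.subspace H" "vec.dim H = CARD('n) - 1" "\<And>v. v \<in> H \<Longrightarrow> g *v v = v"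
  shows "g \<in> reflections W"
  using assms W_invertible W_finite_order unfolding reflections_def pseudo_reflection_def by auto

lemma refl_form: assumes "t \<in> reflections W"
  shows "\<exists>\<phi>. (\<forall>v. t *v v = v + bdot \<phi> v *s L t) \<and> (\<forall>y. transpose t *v y = y + bdot (L t) y *s \<phi>)"
proof -
  obtain c where "c \<noteq> 1" "t *v L t = c *s L t" "L t \<noteq> 0" using L assms by blast
  then obtain \<phi> where "\<And>v. t *v v = v + bdot \<phi> v *s L t"
    using pseudo_reflection_form[of t "L t" c] assms by (auto simp: reflections_def)
  then show ?thesis using transpose_rank_one by blast
qed

text \<open>Inverses of reflections are reflections, which covers the inverse generators in
  \<open>generate\<close>. Right multiplication becomes left multiplication after transposing, as
  \<open>refl_group\<close> demands.\<close>

lemma right_mult_closed_eq_W: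
  assumes "X \<subseteq> W" "mat 1 \<in> X" "\<And>t w. t \<in> reflections W \<Longrightarrow> w \<in> X \<Longrightarrow> w ** t \<in> X"
  shows "X = W"
proof -
  have inv_refl: "inv\<^bsub>GL\<^esub> t \<in> reflections W" if t: "t \<in> reflections W" for t
  proof -
    have tW: "t \<in> W" using t by (simp add: reflections_def)
    obtain H where H: "vec.subspace H" "vec.dim H = CARD('n) - 1" "\<And>v. v \<in> H \<Longrightarrow> t *v v = v"
      using t by (auto simp: reflections_def pseudo_reflection_def)
    show ?thesis
    proof (rule reflectionI[OF W_inv(1)[OF tW] _ H(1,2)])
      show "inv\<^bsub>GL\<^esub> t \<noteq> mat 1"
        using W_inv(3)[OF tW] t by (auto simp: reflections_def pseudo_reflection_def)
      show "inv\<^bsub>GL\<^esub> t *v v = v" if "v \<in> H" for v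
        by (metis H(3) that W_inv(2)[OF tW] matrix_vector_mul_assoc matrix_vector_mul_lid)
    qed
  qed
  have "\<forall>w\<in>X. w ** h \<in> X" if "h \<in> generate GL (reflections W)" for h
    using that
  proof induction
    case (eng h1 h2) then show ?case by (simp add: matrix_mul_assoc)
  qed (use assms inv_refl in auto)
  then have "h \<in> X" if "h \<in> W" for h
    using assms(2) W that by (metis complex_reflection_group_def matrix_mul_lid)
  then show ?thesis using assms(1) by auto
qed

definition "G = transpose ` W"

lemma G_iff: "g \<in> G \<longleftrightarrow> transpose g \<in> W"
  unfolding G_def by (metis imageE imageI transpose_transpose)

text \<open>For completeness: an element that fixes a hyperplane is the identity plus a map of rank
  one, so its transpose fixes the hyperplane given by the image vector \<phi> and is a reflection of
  \<open>W\<close>.\<close>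

lemma refl_group_G: "refl_group G (transpose ` reflections W) (\<lambda>t. L (transpose t))"
proof
  show "finite G" by (simp add: G_def finW)
  show "mat 1 \<in> G" by (simp add: G_iff W_one transpose_mat)
  show "g ** h \<in> G" if "g \<in> G" "h \<in> G" for g h
    using that by (simp add: G_iff W_mult matrix_transpose_mul)
  show "\<exists>h\<in>G. h ** g = mat 1 \<and> g ** h = mat 1" if "g \<in> G" for g
  proof (intro bexI conjI)
    let ?w = "transpose g"
    have w: "?w \<in> W" using that by (simp add: G_iff)
    show "transpose (inv\<^bsub>GL\<^esub> ?w) \<in> G" using W_inv(1)[OF w] by (simp add: G_iff transpose_transpose)
    show "transpose (inv\<^bsub>GL\<^esub> ?w) ** g = mat 1"
      using W_inv(3)[OF w] by (metis matrix_transpose_mul transpose_mat transpose_transpose)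
    show "g ** transpose (inv\<^bsub>GL\<^esub> ?w) = mat 1"
      using W_inv(2)[OF w] by (metis matrix_transpose_mul transpose_mat transpose_transpose)
  qed
  show "transpose ` reflections W \<subseteq> G" by (auto simp: G_def reflections_def)
  fix t assume "t \<in> transpose ` reflections W"
  then have t: "transpose t \<in> reflections W" by (auto simp: transpose_transpose)
  obtain \<phi> where \<phi>: "\<And>y. t *v y = y + bdot (L (transpose t)) y *s \<phi>"
    using refl_form[OF t] by (auto simp: transpose_transpose)
  show "L (transpose t) \<noteq> 0" using L t by blast
  show "t *v y = y" if "bdot (L (transpose t)) y = 0" for y using \<phi>[of y] that by simp
  obtain c where c: "c \<noteq> 1" "transpose t *v L (transpose t) = c *s L (transpose t)" using L t by blast
  show "\<exists>c. c \<noteq> 1 \<and> (\<forall>y. bdot (L (transpose t)) (t *v y) = c * bdot (L (transpose t)) y)"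
    using c by (intro exI[of _ c]) (simp add: bdot_matrix bdot_linear)
next
  fix g u assume g: "g \<in> G" "g \<noteq> mat 1" "u \<noteq> 0" "\<And>y. bdot u y = 0 \<Longrightarrow> g *v y = y"
  obtain z where z: "bdot u z = 1" using exists_bdot_eq_1[OF g(3)] by blast
  define \<phi> where "\<phi> = g *v z - z"
  have gy: "g *v y = y + bdot u y *s \<phi>" for y
  proof -
    have "g *v (y - bdot u y *s z) = y - bdot u y *s z" by (rule g(4)) (simp add: bdot_linear z)
    then show ?thesis
      by (simp add: \<phi>_def matrix_vector_mult_diff_distrib vector_scalar_commute algebra_simps vector_ssub_ldistrib)
  qed
  have "\<phi> \<noteq> 0"
  proof
    assume "\<phi> = 0"
    then have "g *v y = mat 1 *v y" for y using gy by simp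
    then show False using g(2) by (metis matrix_eq)
  qed
  have "transpose g *v v = v + bdot \<phi> v *s u" for v
    by (rule transpose_rank_one) (simp add: gy)
  then have "transpose g \<in> reflections W"
    using g(1,2) by (intro reflectionI[OF _ _ bdot_hyperplane[OF \<open>\<phi> \<noteq> 0\<close>]])
      (auto simp: G_iff, metis transpose_mat transpose_transpose)
  then show "g \<in> transpose ` reflections W" by (metis image_eqI transpose_transpose)
next
  fix X assume X: "X \<subseteq> G" "mat 1 \<in> X"
    "\<And>t g. t \<in> transpose ` reflections W \<Longrightarrow> g \<in> X \<Longrightarrow> t ** g \<in> X"
  have "transpose ` X = W"
  proof (rule right_mult_closed_eq_W)
    show "transpose ` X \<subseteq> W" using X(1) by (auto simp: G_iff)
    show "mat 1 \<in> transpose ` X" using X(2) by (metis image_eqI transpose_mat)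
    show "w ** t \<in> transpose ` X" if "t \<in> reflections W" "w \<in> transpose ` X" for t w
    proof -
      have "transpose t ** transpose w \<in> X" using that X(3) by (auto simp: transpose_transpose)
      then show ?thesis by (metis image_eqI matrix_transpose_mul transpose_transpose)
    qed
  qed
  then show "X = G" unfolding G_def by (metis (no_types, lifting) image_ident image_image transpose_transpose image_cong)
qed

sublocale refl_group G "transpose ` reflections W" "\<lambda>t. L (transpose t)"
  by (rule refl_group_G)

lemma card_G: "card G = card W"
  unfolding G_def by (rule card_image[OF inj_on_transpose])

lemma f_eq: "f y = (\<Prod>t\<in>reflections W. bdot (L t) y)"
  unfolding f_def by (subst prod.reindex[OF inj_on_transpose]) (simp add: transpose_transpose)

lemma N_eq: "N = card (reflections W)"
  unfolding N_def by (rule card_image[OF inj_on_transpose])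

subsection \<open>An equivariant antilinear isomorphism with the dual space\<close>

definition cv :: "complex ^ 'n \<Rightarrow> complex ^ 'n" where "cv v = (\<chi> i. cnj (v $ i))"

text \<open>\<open>bdot u (sigma v)\<close> is the averaged, hence invariant, Hermitian product of
  \<open>u\<close> and \<open>v\<close>. So \<open>sigma\<close> turns vectors of \<open>V\<close>
  into points at which polynomials are evaluated.\<close>

definition sigma :: "complex ^ 'n \<Rightarrow> complex ^ 'n" where
  "sigma v = (\<Sum>w\<in>W. transpose w *v cv (w *v v))"

lemma cv_linear: "cv (u + v) = cv u + cv v" "cv (u - v) = cv u - cv v" "cv (c *s v) = cnj c *s cv v"
  by (simp_all add: cv_def vec_eq_iff)

lemma cnj_bdot: "cnj (bdot u v) = bdot (cv u) (cv v)"
  by (simp add: bdot_def cv_def)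

lemma cv_cv [simp]: "cv (cv v) = v" by (simp add: cv_def vec_eq_iff)

lemma bdot_sum_right: "bdot u (\<Sum>i\<in>A. v i) = (\<Sum>i\<in>A. bdot u (v i))"
  by (induction A rule: infinite_finite_induct) (auto simp: bdot_linear)

lemma sigma_linear: "sigma (u - v) = sigma u - sigma v" "sigma (c *s v) = cnj c *s sigma v"
  by (simp_all add: sigma_def cv_linear matrix_vector_mult_diff_distrib vector_scalar_commute
      sum_subtractf vec.scale_sum_right)

lemma bdot_sigma: "bdot u (sigma v) = (\<Sum>w\<in>W. bdot (w *v u) (cv (w *v v)))"
  by (simp add: sigma_def bdot_sum_right bdot_matrix transpose_transpose)

lemma bdot_sigma_swap: "cnj (bdot u (sigma v)) = bdot v (sigma u)"
  by (simp add: bdot_sigma cnj_bdot bdot_commute)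

lemma sigma_eq_0: assumes "sigma v = 0" shows "v = 0"
proof -
  have "(\<Sum>w\<in>W. bdot (w *v v) (cv (w *v v))) = 0"
    using bdot_sigma[of v v] assms by (simp add: bdot_linear)
  moreover have pos: "bdot u (cv u) = complex_of_real ((norm u)\<^sup>2)" for u :: "complex ^ 'n"
    by (simp add: bdot_def cv_def complex_norm_square[symmetric] norm_vec_def L2_set_def sum_nonneg
        del: of_real_power)
  ultimately have "complex_of_real (\<Sum>w\<in>W. (norm (w *v v))\<^sup>2) = 0" by simp
  then have "(\<Sum>w\<in>W. (norm (w *v v))\<^sup>2) = 0" by (simp only: of_real_eq_0_iff)
  then have "\<forall>w\<in>W. (norm (w *v v))\<^sup>2 = 0" by (subst (asm) sum_nonneg_eq_0_iff) (auto simp: finW)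
  from bspec[OF this W_one] show ?thesis by simp
qed

lemma sigma_equivariant: assumes "x \<in> W" shows "transpose x *v sigma (x *v v) = sigma v"
proof -
  have bij: "bij_betw (\<lambda>w. w ** x) W W"
    by (rule bij_betw_byWitness[of _ "\<lambda>w. w ** inv\<^bsub>GL\<^esub> x"])
       (use W_mult assms W_inv[OF assms] in \<open>auto simp: matrix_mul_assoc[symmetric]\<close>)
  have "transpose x *v sigma (x *v v) = (\<Sum>w\<in>W. transpose (w ** x) *v cv ((w ** x) *v v))"
    unfolding sigma_def
    by (simp add: vec.linear_sum[OF matrix_vector_mul_linear_gen] matrix_vector_mul_assoc matrix_transpose_mul)
  also have "\<dots> = sigma v" unfolding sigma_def by (rule sum.reindex_bij_betw[OF bij])
  finally show ?thesis .
qed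

text \<open>Value and argument are both conjugated, so the result is again a polynomial, to which
  \<open>apolarity\<close> can be applied at points of \<open>V\<close>.\<close>

lemma hom_cnj_sigma: assumes "p \<in> hpolys k" shows "(\<lambda>v. cnj (p (sigma v))) \<in> hpolys k"
  unfolding hpolys_def
proof (intro CollectI conjI allI)
  have "(\<lambda>v. cnj (p (cv (cv (sigma v))))) \<in> polys"
  proof (rule polys_compose[OF polys_cnj[OF homD(1)[OF assms], folded cv_def]])
    fix i
    have "(\<lambda>v. \<Sum>w\<in>W. \<Sum>j\<in>UNIV. cnj (w $ j $ i) * (w *v v) $ j) \<in> polys"
      by (intro polys_sum polys_scale polys_matrix[OF polys.coord])
    moreover have "cv (sigma v) $ i = (\<Sum>w\<in>W. \<Sum>j\<in>UNIV. cnj (w $ j $ i) * (w *v v) $ j)" for v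
      by (simp add: cv_def[of "sigma v"] sigma_def matrix_vector_mult_def[of "transpose _"])
         (simp add: cv_def transpose_def)
    ultimately show "(\<lambda>v. cv (sigma v) $ i) \<in> polys" by simp
  qed
  then show "(\<lambda>v. cnj (p (sigma v))) \<in> polys" by simp
  show "cnj (p (sigma (s *s y))) = s ^ k * cnj (p (sigma y))" for s y
    by (simp add: sigma_linear homD(2)[OF assms])
qed

text \<open>If \<open>L t\<close> vanishes at \<open>sigma v\<close>, the transpose of
  \<open>t\<close> fixes \<open>sigma v\<close>; equivariance and injectivity of
  \<open>sigma\<close> carry this back to \<open>v\<close>.\<close>

lemma sigma_regular:
  assumes "regular_vector W v" shows "f (sigma v) \<noteq> 0"
proof
  assume "f (sigma v) = 0"
  then obtain t where t: "t \<in> reflections W" "bdot (L t) (sigma v) = 0"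
    using finW unfolding f_eq by (auto simp: reflections_def)
  obtain \<phi> where "\<And>y. transpose t *v y = y + bdot (L t) y *s \<phi>" using refl_form[OF t(1)] by blast
  then have fx: "transpose t *v sigma v = sigma v" using t(2) by simp
  have tW: "t \<in> W" using t(1) by (simp add: reflections_def)
  have "transpose (inv\<^bsub>GL\<^esub> t) *v sigma v = sigma (t *v v)"
    using sigma_equivariant[OF tW, of v] W_inv(3)[OF tW]
    by (metis matrix_transpose_mul matrix_vector_mul_assoc matrix_vector_mul_lid transpose_mat)
  moreover have "transpose (inv\<^bsub>GL\<^esub> t) *v sigma v = sigma v"
    using fx W_inv(3)[OF tW]
    by (metis matrix_transpose_mul matrix_vector_mul_assoc matrix_vector_mul_lid transpose_mat)
  ultimately have "sigma (t *v v - v) = 0" by (simp add: sigma_linear)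
  then have "t *v v = v" using sigma_eq_0 by fastforce
  then show False using assms t(1) by (auto simp: regular_vector_def reflecting_hyperplane_def)
qed

text \<open>The conjugation by \<open>sigma\<close> and the inversion in its equivariance cancel for
  an eigenvalue of modulus 1.\<close>

lemma sigma_eigenvector:
  assumes "x \<in> W" "x *v v = \<zeta> *s v" "cnj \<zeta> * \<zeta> = 1"
  shows "transpose x *v sigma v = \<zeta> *s sigma v"
proof -
  have "sigma v = cnj \<zeta> *s (transpose x *v sigma v)"
    using sigma_equivariant[OF assms(1), of v] by (simp add: assms(2) sigma_linear vector_scalar_commute)
  then have "\<zeta> *s sigma v = (\<zeta> * cnj \<zeta>) *s (transpose x *v sigma v)"
    by (metis vector_smult_assoc)
  then show ?thesis using assms(3) by (simp add: mult.commute)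
qed

end

section \<open>Apolarity\<close>

lemma powprod_remove_one:
  assumes "m i \<noteq> 0" shows "powprod m y = y $ i * powprod (m(i := m i - 1)) y"
    "(\<Sum>j\<in>UNIV. m j) = Suc (\<Sum>j\<in>UNIV. (m(i := m i - 1)) j)"
proof -
  let ?m = "m(i := m i - 1)"
  have "powprod m y = y $ i ^ m i * (\<Prod>j\<in>UNIV - {i}. y $ j ^ m j)"
    unfolding powprod_def by (rule prod.remove) auto
  also have "y $ i ^ m i = y $ i * y $ i ^ ?m i" using assms by (simp add: power_eq_if)
  also have "(\<Prod>j\<in>UNIV - {i}. y $ j ^ m j) = (\<Prod>j\<in>UNIV - {i}. y $ j ^ ?m j)"
    by (intro prod.cong) auto
  also have "y $ i * y $ i ^ ?m i * \<dots> = y $ i * (y $ i ^ ?m i * \<dots>)" by (rule mult.assoc)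
  also have "y $ i ^ ?m i * (\<Prod>j\<in>UNIV - {i}. y $ j ^ ?m j) = powprod ?m y"
    unfolding powprod_def by (rule prod.remove[symmetric]) auto
  finally show "powprod m y = y $ i * powprod ?m y" .
  have "(\<Sum>j\<in>UNIV. m j) = m i + (\<Sum>j\<in>UNIV - {i}. m j)" by (rule sum.remove) auto
  also have "(\<Sum>j\<in>UNIV - {i}. m j) = (\<Sum>j\<in>UNIV - {i}. ?m j)" by (intro sum.cong) auto
  also have "m i + \<dots> = Suc (?m i + \<dots>)" using assms by simp
  also have "?m i + (\<Sum>j\<in>UNIV - {i}. ?m j) = (\<Sum>j\<in>UNIV. ?m j)" by (rule sum.remove[symmetric]) auto
  finally show "(\<Sum>j\<in>UNIV. m j) = Suc (\<Sum>j\<in>UNIV. ?m j)" .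
qed

text \<open>Differentiating the vanishing power sum along the \<open>i\<close>-th axis lowers the
  exponent and multiplies the coefficients by the \<open>i\<close>-th coordinates. After
  \<open>k\<close> steps only values of a monomial remain.\<close>

lemma apolarity:
  assumes "\<And>y. (\<Sum>j\<in>J. c j * bdot (v j) y ^ k) = 0" "p \<in> hpolys k"
  shows "(\<Sum>j\<in>J. c j * p (v j)) = 0"
proof -
  have mono: "(\<Sum>j\<in>J. c j * powprod m (v j)) = 0"
    if "(\<Sum>i\<in>UNIV. m i) = k" "\<And>y. (\<Sum>j\<in>J. c j * bdot (v j) y ^ k) = 0" for m k c
    using that
  proof (induction k arbitrary: m c)
    case 0
    then have "powprod m y = 1" for y by (simp add: powprod_def)
    then show ?case using 0(2)[of 0] by simp
  next
    case (Suc k)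
    then obtain i where i: "m i \<noteq> 0" by (metis nat.distinct(1) sum.neutral)
    have "(\<Sum>j\<in>J. (c j * v j $ i) * powprod (m(i := m i - 1)) (v j)) = 0"
    proof (rule Suc.IH)
      show "(\<Sum>j\<in>UNIV. (m(i := m i - 1)) j) = k"
        using Suc.prems(1) powprod_remove_one(2)[of m i, OF i] by simp
      fix y
      have "((\<lambda>s. \<Sum>j\<in>J. c j * (bdot (v j) y + s * v j $ i) ^ Suc k) has_field_derivative
          (\<Sum>j\<in>J. c j * (of_nat (Suc k) * v j $ i * bdot (v j) y ^ k))) (at 0)"
      proof (intro DERIV_sum DERIV_cmult)
        fix j
        have "((\<lambda>s. bdot (v j) y + s * v j $ i) has_field_derivative v j $ i) (at 0)"
          by (auto intro!: derivative_eq_intros)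
        from DERIV_power[OF this, of "Suc k"]
        show "((\<lambda>s. (bdot (v j) y + s * v j $ i) ^ Suc k) has_field_derivative
            of_nat (Suc k) * v j $ i * bdot (v j) y ^ k) (at 0)" by (simp add: mult.assoc del: power_Suc)
      qed
      moreover have "(\<Sum>j\<in>J. c j * (bdot (v j) y + s * v j $ i) ^ Suc k) = 0" for s
        using Suc.prems(2)[of "y + s *s axis i 1"] by (simp add: bdot_linear bdot_commute[of _ "axis i 1"])
      ultimately have "((\<lambda>_. 0) has_field_derivative
          (\<Sum>j\<in>J. c j * (of_nat (Suc k) * v j $ i * bdot (v j) y ^ k))) (at (0::complex))" by simp
      from DERIV_unique[OF this DERIV_const]
      have "of_nat (Suc k) * (\<Sum>j\<in>J. c j * v j $ i * bdot (v j) y ^ k) = 0"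
        by (simp add: sum_distrib_left mult_ac del: of_nat_Suc)
      then show "(\<Sum>j\<in>J. c j * v j $ i * bdot (v j) y ^ k) = 0" by (simp del: of_nat_Suc)
    qed
    then show ?case unfolding powprod_remove_one(1)[of m i, OF i] by (simp add: mult.assoc)
  qed
  obtain S a where S: "finite S" "\<And>m. m \<in> S \<Longrightarrow> (\<Sum>i\<in>UNIV. m i) = k"
    "\<And>y. p y = (\<Sum>m\<in>S. a m * powprod m y)" using hom_expand[OF assms(2)] by blast
  have "(\<Sum>j\<in>J. c j * p (v j)) = (\<Sum>m\<in>S. a m * (\<Sum>j\<in>J. c j * powprod m (v j)))"
    unfolding S(3) sum_distrib_left by (subst sum.swap) (simp add: mult_ac)
  also have "\<dots> = 0" using mono[OF S(2) assms(1)] by simp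
  finally show ?thesis .
qed

lemma apolarity2:
  assumes "\<And>y. (\<Sum>j\<in>J. bdot (v j) y ^ k) = b * (\<Sum>j\<in>J. bdot (w j) y ^ k)" "p \<in> hpolys k" "finite J"
  shows "(\<Sum>j\<in>J. p (v j)) = b * (\<Sum>j\<in>J. p (w j))"
proof -
  \<comment> \<open>One index set carries both families; its second copy of \<open>J\<close> gets
    the coefficient \<open>- b\<close>.\<close>
  have "(\<Sum>j\<in>J <+> J. case_sum (\<lambda>_. 1) (\<lambda>_. - b) j * p (case_sum v w j)) = 0"
    by (rule apolarity[OF _ assms(2)])
       (simp add: sum.Plus assms(1,3) sum_distrib_left sum_negf)
  then show ?thesis using assms(3) by (simp add: sum.Plus sum_distrib_left sum_negf)
qed

lemma hpolys_degree_unique: assumes "p \<in> hpolys k" "p \<in> hpolys l" "p y \<noteq> 0" shows "k = l"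
proof -
  have "2 ^ k * p y = 2 ^ l * p y" using homD(2)[OF assms(1), of 2 y] homD(2)[OF assms(2), of 2 y] by metis
  then have "(2::complex) ^ k = 2 ^ l" using assms(3) mult_right_cancel by blast
  then have "(2::nat) ^ k = 2 ^ l" by (metis of_nat_eq_iff of_nat_numeral of_nat_power)
  then show ?thesis by simp
qed

lemma hom_imp_homogeneous:
  fixes p :: "'n::finite cpoly"
  assumes "ev p \<in> hpolys k" shows "homogeneous k p"
proof -
  from hom_expand[OF assms] obtain S a where S: "finite S" "\<And>m. m \<in> S \<Longrightarrow> (\<Sum>i\<in>UNIV. m i) = k"
    "\<And>y. ev p y = (\<Sum>m\<in>S. a m * powprod m y)" by blast
  define Q where "Q = (\<Sum>m\<in>S. Poly_Mapping.single (Abs_poly_mapping m) (a m))"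
  have look: "Poly_Mapping.lookup (Abs_poly_mapping m) = m" for m :: "'n \<Rightarrow> nat" by simp
  have "ev Q = ev p" by (rule ext) (simp add: Q_def S(3) ev_sum ev_single look)
  then have "p = Q" by (simp add: ev_inject)
  moreover have "Poly_Mapping.keys Q \<subseteq> Abs_poly_mapping ` S"
    unfolding Q_def
    by (rule order_trans[OF Poly_Mapping.keys_sum]) (use S(1) in \<open>auto split: if_splits\<close>)
  ultimately show ?thesis using S(2) unfolding homogeneous_def by (auto simp: look dest!: subsetD)
qed

section \<open>Power sum decompositions of \<open>f\<close>\<close>

context complex_refl
begin

lemma kappa_power_card: assumes "g \<in> G" shows "kappa g ^ card G = 1"
proof -
  obtain h where h: "h \<in> G" "h ** g = mat 1" "g ** h = mat 1" using inv assms by blast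
  have bij: "bij_betw (\<lambda>x. g ** x) G G"
    by (rule bij_betw_byWitness[of _ "\<lambda>x. h ** x"])
       (use h mult assms in \<open>auto simp: matrix_mul_assoc\<close>)
  have "(\<Prod>x\<in>G. kappa x) = (\<Prod>x\<in>G. kappa (g ** x))"
    by (rule prod.reindex_bij_betw[OF bij, symmetric])
  also have "\<dots> = (\<Prod>x\<in>G. kappa g * kappa x)" using kappa_mult[OF assms] by (intro prod.cong) auto
  also have "\<dots> = kappa g ^ card G * (\<Prod>x\<in>G. kappa x)" by (simp add: prod.distrib)
  finally show ?thesis using kappa(1) fin by simp
qed

lemma cnj_kappa: assumes "g \<in> G" shows "cnj (kappa g) * kappa g = 1"
proof -
  have "norm (kappa g) = 1" using power_eq_1_iff[OF kappa_power_card[OF assms]] card_G_pos by auto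
  then show ?thesis by (simp add: complex_norm_square[symmetric] mult.commute[of "cnj _"])
qed

lemma sigma_equivariant_G: assumes "g \<in> G" "h \<in> G" "h ** g = mat 1"
  shows "sigma (transpose g *v v) = h *v sigma v"
proof -
  have "g *v sigma (transpose g *v v) = sigma v"
    using sigma_equivariant[of "transpose g" v] assms(1) by (simp add: G_iff transpose_transpose)
  then show ?thesis by (metis assms(3) matrix_vector_mul_assoc matrix_vector_mul_lid)
qed

text \<open>By Hermitian symmetry the value of \<open>L t\<close> at \<open>sigma z\<close> is the
  conjugate of the pairing of \<open>z\<close> with the nonzero vector \<open>sigma (L t)\<close>,
  so a generic \<open>z\<close> works.\<close>

lemma f_sigma_nonzero: "\<exists>z. f (sigma z) \<noteq> 0"
proof -
  have "\<exists>z. \<forall>p\<in>(\<lambda>t. bdot (sigma (L t))) ` reflections W. p z \<noteq> 0"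
  proof (rule polys_generic_point)
    show "finite ((\<lambda>t. bdot (sigma (L t))) ` reflections W)" using finW by (simp add: reflections_def)
    fix p assume "p \<in> (\<lambda>t. bdot (sigma (L t))) ` reflections W"
    then obtain t where t: "t \<in> reflections W" "p = bdot (sigma (L t))" by blast
    then have "sigma (L t) \<noteq> 0" using L sigma_eq_0 by blast
    then show "p \<in> polys \<and> (\<exists>y. p y \<noteq> 0)"
      using t(2) polys_bdot exists_bdot_eq_1 by (metis zero_neq_one)
  qed
  then obtain z where z: "\<And>t. t \<in> reflections W \<Longrightarrow> bdot (sigma (L t)) z \<noteq> 0" by blast
  have "bdot (L t) (sigma z) \<noteq> 0" if "t \<in> reflections W" for t
  proof
    assume "bdot (L t) (sigma z) = 0"
    then have "bdot z (sigma (L t)) = 0" using bdot_sigma_swap[of "L t" z] by simp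
    then show False using z[OF that] by (simp add: bdot_commute)
  qed
  then show ?thesis using finW unfolding f_eq by (intro exI[of _ z]) (auto simp: reflections_def)
qed

text \<open>The functional inherits the character of \<open>f\<close> by apolarity. If it
  annihilated \<open>f\<close>, it would annihilate all forms of degree \<open>N\<close>, since
  their skew-symmetrizations are multiples of \<open>f\<close>. The \<open>N\<close>-th power of a
  suitable linear form \<open>z\<close> refutes this: its value is the conjugate of
  \<open>f (sigma z)\<close>.\<close>

lemma power_sum_skew_functional:
  fixes r :: nat
  assumes "\<And>y. f y = (\<Sum>j<r. bdot (v j) y ^ N)"
  shows "skew_functional (\<lambda>q. \<Sum>j<r. q (sigma (v j)))"
proof -
  let ?Lam = "\<lambda>q. \<Sum>j<r. q (sigma (v j))"
  have skew: "?Lam (\<lambda>y. q (h *v y)) = kappa h * ?Lam q" if q: "q \<in> hpolys N" and h: "h \<in> G" for q h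
  proof -
    obtain g where g: "g \<in> G" "h ** g = mat 1" "g ** h = mat 1" using inv[OF h] by blast
    have "(\<Sum>j<r. bdot (transpose g *v v j) y ^ N) = kappa g * (\<Sum>j<r. bdot (v j) y ^ N)" for y
      using kappa(2)[OF g(1), of y] by (simp add: assms bdot_matrix)
    from apolarity2[OF this hom_cnj_sigma[OF q] finite_lessThan]
    have "(\<Sum>j<r. cnj (q (h *v sigma (v j)))) = kappa g * (\<Sum>j<r. cnj (q (sigma (v j))))"
      by (simp add: sigma_equivariant_G[OF g(1) h g(2)])
    then have "cnj (?Lam (\<lambda>y. q (h *v y))) = kappa g * cnj (?Lam q)" by simp
    then have "?Lam (\<lambda>y. q (h *v y)) = cnj (kappa g) * ?Lam q"
      by (metis complex_cnj_cnj complex_cnj_mult)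
    moreover have "kappa h * kappa g = 1" using kappa_mult[OF h g(1)] g(2) kappa_one by simp
    then have "cnj (kappa g) = kappa h" using cnj_kappa[OF g(1)] kappa(1)[OF g(1)]
      by (metis mult_right_cancel)
    ultimately show ?thesis by simp
  qed
  moreover have "?Lam f \<noteq> 0"
  proof
    assume 0: "?Lam f = 0"
    have Lam0: "?Lam q = 0" if q: "q \<in> hpolys N" for q
    proof -
      have "?Lam (sk q) = (\<Sum>g\<in>G. inverse (kappa g) * ?Lam (\<lambda>y. q (g *v y)))"
        unfolding sk_def sum_distrib_left by (rule sum.swap)
      also have "\<dots> = (\<Sum>g\<in>G. ?Lam q)" using skew[OF q] kappa(1) by (intro sum.cong) auto
      finally have "?Lam (sk q) = of_nat (card G) * ?Lam q" by simp
      moreover obtain c where "\<And>y. sk q y = c * f y"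
        using skew_hom(2)[OF sk_hom[OF q] sk_skew] by blast
      then have "?Lam (sk q) = c * ?Lam f" by (simp add: sum_distrib_left)
      ultimately show ?thesis using 0 card_G_pos by simp
    qed
    obtain z where z: "f (sigma z) \<noteq> 0" using f_sigma_nonzero by blast
    have hz: "(\<lambda>y. bdot z y ^ N) \<in> hpolys N" using hom_power[OF hom_bdot, of z N] by simp
    have "cnj (\<Sum>j<r. bdot z (sigma (v j)) ^ N) = 0" using Lam0[OF hz] by simp
    then show False using z by (simp add: assms bdot_sigma_swap)
  qed
  ultimately show ?thesis
    unfolding skew_functional_def by (auto simp: sum.distrib sum_distrib_left)
qed

text \<open>The skew-symmetrized power of \<open>v\<close> is a multiple of \<open>f\<close>. Were
  the factor 0, pairing with \<open>f\<close> by apolarity would make \<open>card G\<close> times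
  the conjugate of \<open>f (sigma v)\<close> vanish.\<close>

lemma regular_power_orbit_sum:
  assumes "f (sigma v) \<noteq> 0"
  shows "\<exists>c. \<forall>y. f y = (\<Sum>x\<in>W. c x * bdot (x *v v) y ^ N)"
proof -
  define p where "p y = bdot v y ^ N" for y
  have p: "p \<in> hpolys N" using hom_power[OF hom_bdot, of v N] by (simp add: p_def[abs_def])
  obtain c where c: "\<And>y. sk p y = c * f y" using skew_hom(2)[OF sk_hom[OF p] sk_skew] by blast
  have skp: "sk p y = (\<Sum>g\<in>G. inverse (kappa g) * bdot (transpose g *v v) y ^ N)" for y
    by (simp add: sk_def p_def bdot_matrix)
  have "c \<noteq> 0"
  proof
    assume "c = 0"
    then have "(\<Sum>g\<in>G. inverse (kappa g) * bdot (transpose g *v v) y ^ N) = 0" for y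
      using skp c by simp
    from apolarity[OF this hom_cnj_sigma[OF f_hom]]
    have "0 = (\<Sum>g\<in>G. inverse (kappa g) * cnj (f (sigma (transpose g *v v))))" by simp
    also have "\<dots> = (\<Sum>g\<in>G. cnj (f (sigma v)))"
    proof (rule sum.cong[OF refl])
      fix g assume g: "g \<in> G"
      obtain h where h: "h \<in> G" "h ** g = mat 1" "g ** h = mat 1" using inv[OF g] by blast
      have "kappa h * kappa g = 1" using kappa_mult[OF h(1) g] h(2) kappa_one by simp
      then have "cnj (kappa h) = kappa g" using cnj_kappa[OF h(1)] kappa(1)[OF h(1)]
        by (metis mult.commute mult_right_cancel)
      then show "inverse (kappa g) * cnj (f (sigma (transpose g *v v))) = cnj (f (sigma v))"
        using kappa[OF h(1)] kappa(1)[OF g] by (simp add: sigma_equivariant_G[OF g h(1,2)])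
    qed
    finally show False using assms card_G_pos by simp
  qed
  then have "f y = (\<Sum>g\<in>G. inverse c * inverse (kappa g) * bdot (transpose g *v v) y ^ N)" for y
    using c[of y] skp[of y] by (simp add: mult.assoc sum_distrib_left[symmetric])
  also have "(\<Sum>g\<in>G. inverse c * inverse (kappa g) * bdot (transpose g *v v) y ^ N) =
      (\<Sum>x\<in>W. inverse c * inverse (kappa (transpose x)) * bdot (x *v v) y ^ N)" for y
    unfolding G_def by (subst sum.reindex[OF inj_on_transpose]) (simp add: transpose_transpose)
  finally show ?thesis by (intro exI[of _ "\<lambda>x. inverse c * inverse (kappa (transpose x))"]) simp
qed

text \<open>The powers of \<open>g\<close> preserve the line of its eigenvector \<open>v\<close>, so
  at least \<open>d\<close> elements \<open>x\<close> of \<open>W\<close> give the same line through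
  \<open>x *v v\<close>. The summands on one line combine into a single power.\<close>

lemma power_sum_upper:
  assumes "regular_number W d" "0 < N"
  shows "\<exists>r v. r * d \<le> card W \<and> (\<forall>y. f y = (\<Sum>j<r. bdot (v j) y ^ N))"
proof -
  obtain g v where d: "0 < d" and g: "g \<in> W" and v: "v \<noteq> 0" "regular_vector W v"
    "g *v v = cis (2 * pi / real d) *s v" using assms(1) by (auto simp: regular_number_def)
  obtain c where c: "\<And>y. f y = (\<Sum>x\<in>W. c x * bdot (x *v v) y ^ N)"
    using regular_power_orbit_sum[OF sigma_regular[OF v(2)]] by blast
  define line where "line x = {s *s (x *v v) | s. s \<noteq> 0}" for x :: "complex ^ 'n ^ 'n"
  define gp where "gp j = ((\<lambda>x. x ** g) ^^ j) (mat 1)" for j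
  have gp_W: "gp j \<in> W" for j unfolding gp_def by (induction j) (auto simp: W_one W_mult g)
  have gp_v: "gp j *v v = cis (2 * pi * real j / real d) *s v" for j
  proof (induction j)
    case (Suc j)
    have "gp (Suc j) *v v = gp j *v (g *v v)" by (simp add: gp_def matrix_vector_mul_assoc)
    then show ?case
      by (simp add: v(3) vector_scalar_commute Suc vector_smult_assoc cis_mult add_divide_distrib algebra_simps)
  qed (simp add: gp_def)
  have inv: "\<exists>x'. x' ** x = mat 1" if "x \<in> W" for x using W_inv(2)[OF that] by blast
  have xv: "x *v v \<noteq> 0" if "x \<in> W" for x
    using inv[OF that] v(1) by (metis matrix_vector_mul_assoc matrix_vector_mul_lid matrix_vector_mult_0_right)
  have gp_inj: "inj_on gp {..<d}"
  proof (rule inj_onI)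
    fix i j assume ij: "i \<in> {..<d}" "j \<in> {..<d}" "gp i = gp j"
    then have "cis (2 * pi * real i / real d) *s v = cis (2 * pi * real j / real d) *s v"
      using gp_v by metis
    then have "cis (2 * pi * real i / real d) = cis (2 * pi * real j / real d)"
      using v(1) by (metis vector_mul_rcancel)
    then have "exp (2 * of_real pi * \<i> * of_nat i / of_nat d) = exp (2 * of_real pi * \<i> * of_nat j / of_nat d)"
      by (simp add: cis_conv_exp mult_ac)
    then have "i mod d = j mod d" using complex_root_unity_eq[of d i j] d by simp
    then show "i = j" using ij by simp
  qed
  have fibre: "d \<le> card {x \<in> W. line x = line x0}" if x0: "x0 \<in> W" for x0
  proof -
    have "inj_on (\<lambda>j. x0 ** gp j) {..<d}"
      using inv[OF x0] gp_inj unfolding inj_on_def by (metis matrix_mul_assoc matrix_mul_lid)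
    then have "card ((\<lambda>j. x0 ** gp j) ` {..<d}) = d" by (simp add: card_image)
    moreover have "(\<lambda>j. x0 ** gp j) ` {..<d} \<subseteq> {x \<in> W. line x = line x0}"
    proof clarsimp
      fix j
      let ?z = "cis (2 * pi * real j / real d)"
      have z: "?z \<noteq> 0" by simp
      have "(x0 ** gp j) *v v = ?z *s (x0 *v v)"
        by (simp add: matrix_vector_mul_assoc[symmetric] gp_v vector_scalar_commute)
      then have "line (x0 ** gp j) = {(s * ?z) *s (x0 *v v) | s. s \<noteq> 0}"
        by (simp add: line_def vector_smult_assoc)
      also have "\<dots> = line x0"
      proof -
        have 1: "\<exists>s'. s *s (x0 *v v) = (s' * ?z) *s (x0 *v v) \<and> s' \<noteq> 0" if "s \<noteq> 0" for s
          using that z by (intro exI[of _ "s / ?z"]) simp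
        have 2: "\<exists>s'. (s * ?z) *s (x0 *v v) = s' *s (x0 *v v) \<and> s' \<noteq> 0" if "s \<noteq> 0" for s
          using that z by (intro exI[of _ "s * ?z"]) simp
        show ?thesis unfolding line_def using 1 2 by (intro equalityI subsetI) blast+
      qed
      finally show "x0 ** gp j \<in> W \<and> line (x0 ** gp j) = line x0" using W_mult[OF x0 gp_W] by simp
    qed
    moreover have "finite {x \<in> W. line x = line x0}" using finW by simp
    ultimately show ?thesis using card_mono[of "{x \<in> W. line x = line x0}" "(\<lambda>j. x0 ** gp j) ` {..<d}"]
      by simp
  qed
  define m where "m = card (line ` W)"
  have fl: "finite (line ` W)" using finW by simp
  have "m * d = (\<Sum>C\<in>line ` W. d)" by (simp add: m_def)
  also have "\<dots> \<le> (\<Sum>C\<in>line ` W. card {x \<in> W. line x = C})"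
    by (rule sum_mono) (use fibre in auto)
  also have "\<dots> = (\<Sum>C\<in>line ` W. \<Sum>x\<in>{x \<in> W. line x = C}. 1)" by simp
  also have "\<dots> = (\<Sum>x\<in>W. 1)" by (rule sum.image_gen[OF finW, symmetric])
  finally have md: "m * d \<le> card W" by simp
  define rep where "rep C = (SOME x. x \<in> W \<and> line x = C)" for C
  have rep: "rep C \<in> W \<and> line (rep C) = C" if "C \<in> line ` W" for C
    unfolding rep_def by (rule someI_ex) (use that in auto)
  have "\<exists>s. x *v v = s *s (rep (line x) *v v)" if "x \<in> W" for x
  proof -
    have "x *v v \<in> line x" unfolding line_def by (intro CollectI exI[of _ 1]) simp
    then have "x *v v \<in> line (rep (line x))" using rep[of "line x"] that by simp
    then show ?thesis by (auto simp: line_def)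
  qed
  then obtain s where s: "\<And>x. x \<in> W \<Longrightarrow> x *v v = s x *s (rep (line x) *v v)" by metis
  define A where "A C = (\<Sum>x\<in>{x \<in> W. line x = C}. c x * s x ^ N)" for C
  \<comment> \<open>The coefficient of a line is absorbed into its vector by an \<open>N\<close>-th
    root, which exists because \<open>N\<close> is positive.\<close>
  have "\<exists>a. a ^ N = A C" for C
    using exists_complex_root[of N "A C"] assms(2) by (metis neq0_conv)
  then obtain a where a: "\<And>C. a C ^ N = A C" by metis
  have f: "f y = (\<Sum>C\<in>line ` W. bdot (a C *s (rep C *v v)) y ^ N)" for y
  proof -
    have "f y = (\<Sum>C\<in>line ` W. \<Sum>x\<in>{x \<in> W. line x = C}. c x * bdot (x *v v) y ^ N)"
      unfolding c by (rule sum.image_gen[OF finW])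
    also have "\<dots> = (\<Sum>C\<in>line ` W. A C * bdot (rep C *v v) y ^ N)"
    proof (rule sum.cong[OF refl])
      fix C
      have "(\<Sum>x\<in>{x \<in> W. line x = C}. c x * bdot (x *v v) y ^ N) =
          (\<Sum>x\<in>{x \<in> W. line x = C}. c x * s x ^ N * bdot (rep C *v v) y ^ N)"
      proof (rule sum.cong[OF refl])
        fix x assume x: "x \<in> {x \<in> W. line x = C}"
        then have "bdot (x *v v) y = s x * bdot (rep C *v v) y"
          using s[of x] by (metis (mono_tags, lifting) bdot_scale_left mem_Collect_eq)
        then show "c x * bdot (x *v v) y ^ N = c x * s x ^ N * bdot (rep C *v v) y ^ N"
          by (simp add: power_mult_distrib)
      qed
      then show "(\<Sum>x\<in>{x \<in> W. line x = C}. c x * bdot (x *v v) y ^ N) = A C * bdot (rep C *v v) y ^ N"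
        by (simp add: A_def sum_distrib_right)
    qed
    finally show ?thesis by (simp add: a bdot_scale_left power_mult_distrib)
  qed
  obtain b where b: "bij_betw b {..<m} (line ` W)"
    using ex_bij_betw_nat_finite[OF fl] by (metis atLeast0LessThan m_def)
  have "f y = (\<Sum>j<m. bdot (a (b j) *s (rep (b j) *v v)) y ^ N)" for y
    unfolding f by (rule sum.reindex_bij_betw[OF b, symmetric])
  then show ?thesis using md
    by (intro exI[of _ m] exI[of _ "\<lambda>j. a (b j) *s (rep (b j) *v v)"]) simp
qed

end

section \<open>The Waring rank in terms of the degrees\<close>

locale complex_refl_deg = complex_refl W L
  for W :: "(complex ^ 'n::finite ^ 'n) set" and L +
  fixes P :: "'n \<Rightarrow> 'n cpoly" and dg :: "'n \<Rightarrow> nat"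
  assumes P_inv: "P i \<in> invariants W"
    and P_hom: "homogeneous (dg i) (P i)"
    and P_indep: "algebraically_independent P"
    and P_gen: "invariants W = range (psubst P)"
begin

lemma invariants_iff: "p \<in> invariants W \<longleftrightarrow> invariant G (ev p)"
proof
  assume p: "p \<in> invariants W"
  show "invariant G (ev p)" unfolding invariant_def
  proof (intro ballI allI)
    fix g y assume g: "g \<in> G"
    then have "act (transpose g) p = p" using p by (auto simp: invariants_def G_iff)
    then show "ev p (g *v y) = ev p y" using ev_act[of "transpose g" p y] by (simp add: transpose_transpose)
  qed
next
  assume p: "invariant G (ev p)"
  have "act w p = p" if "w \<in> W" for w
  proof -
    have "ev (act w p) = ev p"
      by (rule ext) (use p that in \<open>simp add: ev_act invariant_def G_iff transpose_transpose\<close>)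
    then show ?thesis by (simp add: ev_inject)
  qed
  then show "p \<in> invariants W" by (simp add: invariants_def)
qed

sublocale refl_group_inv G "transpose ` reflections W" "\<lambda>t. L (transpose t)" "\<lambda>i. ev (P i)" dg
proof
  show "invariant G (ev (P i))" for i using P_inv invariants_iff by blast
  show "ev (P i) \<in> hpolys (dg i)" for i by (rule homogeneous_imp_hom[OF P_hom])
next
  fix Q :: "complex ^ 'n \<Rightarrow> complex" and y
  assume Q: "Q \<in> polys" "\<And>y. Q (\<chi> i. ev (P i) y) = 0"
  then obtain q where q: "Q = ev q" using polys_eq_range_ev by blast
  then have "ev (psubst P q) y = 0" for y using Q(2) by (simp add: ev_psubst)
  then have "psubst P q = 0" by (rule ev_eq_zero_imp)
  then have "q = 0" using P_indep unfolding algebraically_independent_def by blast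
  then show "Q y = 0" using q by simp
next
  fix p :: "complex ^ 'n \<Rightarrow> complex"
  assume p: "p \<in> polys" "invariant G p"
  then obtain p' where p': "p = ev p'" using polys_eq_range_ev by blast
  then have "p' \<in> invariants W" using p(2) invariants_iff by blast
  then obtain q where "p' = psubst P q" using P_gen by blast
  then show "\<exists>Q\<in>polys. \<forall>y. p y = Q (\<chi> i. ev (P i) y)"
    using p' ev_in_polys by (intro bexI[of _ "ev q"]) (auto simp: ev_psubst)
qed

text \<open>\<open>D_iff\<close> fixes the exponent left open by the Waring rank, since the nonzero
  \<open>f\<close> has only one degree. The case \<open>N = 0\<close> is separate because
  coefficients cannot be absorbed by roots; there the group is trivial and
  \<open>d = 1\<close>.\<close>

theorem waring_rank_times_degree:
  assumes reg: "regular_number W d" and d: "\<And>i. dg i \<le> d"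
  shows "waring_rank (\<Prod>t\<in>reflections W. lin (L t)) * d = card W"
proof -
  define q where "q = (\<Prod>t\<in>reflections W. lin (L t))"
  have qf: "ev q = f" by (rule ext) (simp add: q_def ev_prod ev_lin f_eq)
  obtain z where z: "f z \<noteq> 0" using f_nz by blast
  define D where "D r \<longleftrightarrow> 0 < r \<and> (\<exists>d v. homogeneous d q \<and> q = (\<Sum>j<r. lin (v j) ^ d))" for r :: nat
  have D_iff: "D r \<longleftrightarrow> 0 < r \<and> (\<exists>v. \<forall>y. f y = (\<Sum>j<r. bdot (v j) y ^ N))" for r
  proof
    assume "D r"
    then obtain k v where k: "0 < r" "homogeneous k q" "q = (\<Sum>j<r. lin (v j) ^ k)" by (auto simp: D_def)
    have "f \<in> hpolys k" using homogeneous_imp_hom[OF k(2)] qf by simp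
    then have "k = N" using hpolys_degree_unique[OF _ f_hom z] by blast
    moreover have "f y = (\<Sum>j<r. bdot (v j) y ^ k)" for y
      unfolding qf[symmetric] by (subst k(3)) (simp add: ev_sum ev_power ev_lin)
    ultimately show "0 < r \<and> (\<exists>v. \<forall>y. f y = (\<Sum>j<r. bdot (v j) y ^ N))" using k(1) by blast
  next
    assume "0 < r \<and> (\<exists>v. \<forall>y. f y = (\<Sum>j<r. bdot (v j) y ^ N))"
    then obtain v where v: "0 < r" "\<And>y. f y = (\<Sum>j<r. bdot (v j) y ^ N)" by blast
    have "ev q = ev (\<Sum>j<r. lin (v j) ^ N)"
      unfolding qf by (rule ext) (simp add: v(2) ev_sum ev_power ev_lin)
    then have "q = (\<Sum>j<r. lin (v j) ^ N)" by (simp only: ev_inject)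
    moreover have "homogeneous N q" by (rule hom_imp_homogeneous) (simp add: qf f_hom)
    ultimately show "D r" using v(1) unfolding D_def by blast
  qed
  have lower: "card W \<le> d * r" if "D r" for r
  proof -
    from that[unfolded D_iff] obtain v where "\<And>y. f y = (\<Sum>j<r. bdot (v j) y ^ N)" by auto
    from card_le_if_sum_of_evaluations[OF power_sum_skew_functional[OF this] d]
    show ?thesis by (simp add: card_G)
  qed
  have "\<exists>r. D r \<and> r * d \<le> card W"
  proof (cases "N = 0")
    case True
    then have R: "reflections W = {}" using N_eq finW by (simp add: reflections_def)
    have "mat 1 = g" if "g \<in> W" for g
      using right_mult_closed_eq_W[of "{mat 1}"] R W_one that by auto
    then have "W = {mat 1}" using W_one by blast
    then have cW: "card W = 1" by simp
    have "dg i = 1" for i using N_eq_sum True dg_pos[of i] by (simp add: le_antisym Suc_leI)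
    moreover obtain g v where g: "0 < d" "g \<in> W" "v \<noteq> 0" "g *v v = cis (2 * pi / real d) *s v"
      using reg by (auto simp: regular_number_def)
    have "d = 1"
    proof -
      have "v = cis (2 * pi / real d) *s v" using g \<open>W = {mat 1}\<close> by simp
      then have "cis (2 * pi / real d) = 1" using g(3) by (metis vector_mul_rcancel vector_smult_lid)
      then have "exp (2 * of_real pi * \<i> * of_nat 1 / of_nat d) = 1" by (simp add: cis_conv_exp mult_ac)
      then have "d dvd 1" using complex_root_unity_eq_1[of d 1] g(1) by (simp add: mult_ac)
      then show ?thesis by simp
    qed
    moreover have "D 1"
    proof -
      have "f y = 1" for y unfolding f_eq by (simp add: R)
      then show ?thesis unfolding D_iff True by simp
    qed
    ultimately show ?thesis using cW by auto
  next
    case False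
    then obtain r v where r: "r * d \<le> card W" "\<And>y. f y = (\<Sum>j<r. bdot (v j) y ^ N)"
      using power_sum_upper[OF reg] by auto
    moreover have "0 < r" using r(2)[of z] z by (cases r) auto
    ultimately show ?thesis unfolding D_iff by blast
  qed
  then obtain r where r: "D r" "r * d \<le> card W" by blast
  then have rd: "r * d = card W" using lower[OF r(1)] by (simp add: mult.commute)
  have dpos: "0 < d" using reg by (simp add: regular_number_def)
  have "(LEAST r. D r) = r"
  proof (rule Least_equality, rule r(1))
    fix r' assume "D r'"
    then have "r * d \<le> r' * d" using lower[of r'] rd by (simp add: mult.commute)
    then show "r \<le> r'" using dpos by simp
  qed
  then show ?thesis using rd unfolding waring_rank_def D_def[abs_def] q_def[symmetric] by simp
qed

end

section \<open>Finite real root systems and the Coxeter plane\<close>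

text \<open>Roots have length 1 and no integrality is assumed, so that noncrystallographic groups
  are included. The form \<open>ip\<close> is abstract because it will be an averaged inner
  product.\<close>

locale root_base =
  fixes ip :: "real ^ 'n::finite \<Rightarrow> real ^ 'n \<Rightarrow> real" and Phi :: "(real ^ 'n) set"
  assumes ip_add: "ip (x + y) u = ip x u + ip y u"
    and ip_scale: "ip (c *\<^sub>R x) u = c * ip x u"
    and ip_sym: "ip x y = ip y x"
    and ip_pos: "x \<noteq> 0 \<Longrightarrow> 0 < ip x x"
    and fin: "finite Phi"
    and unit: "\<alpha> \<in> Phi \<Longrightarrow> ip \<alpha> \<alpha> = 1"
    and neg: "\<alpha> \<in> Phi \<Longrightarrow> - \<alpha> \<in> Phi"
    and refl: "\<alpha> \<in> Phi \<Longrightarrow> \<beta> \<in> Phi \<Longrightarrow> \<beta> - (2 * ip \<beta> \<alpha>) *\<^sub>R \<alpha> \<in> Phi"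
    and total: "(\<And>\<alpha>. \<alpha> \<in> Phi \<Longrightarrow> ip x \<alpha> = 0) \<Longrightarrow> x = 0"
begin

lemma ip_add_right: "ip u (x + y) = ip u x + ip u y" by (metis ip_add ip_sym)
lemma ip_scale_right: "ip u (c *\<^sub>R x) = c * ip u x" by (metis ip_scale ip_sym)
lemma ip_minus: "ip (- x) u = - ip x u" using ip_scale[of "-1" x u] by simp
lemma ip_minus_right: "ip u (- x) = - ip u x" by (metis ip_minus ip_sym)
lemma ip_diff: "ip (x - y) u = ip x u - ip y u" using ip_add[of x "- y" u] by (simp add: ip_minus)
lemma ip_diff_right: "ip u (x - y) = ip u x - ip u y" by (metis ip_diff ip_sym)
lemma ip_zero: "ip 0 u = 0" using ip_scale[of 0 0 u] by simp
lemma ip_zero_right: "ip u 0 = 0" by (metis ip_zero ip_sym)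
lemma ip_sum: "ip (\<Sum>i\<in>A. x i) u = (\<Sum>i\<in>A. ip (x i) u)"
  by (induction A rule: infinite_finite_induct) (auto simp: ip_zero ip_add)
lemma ip_sum_right: "ip u (\<Sum>i\<in>A. x i) = (\<Sum>i\<in>A. ip u (x i))"
  by (induction A rule: infinite_finite_induct) (auto simp: ip_zero_right ip_add_right)

lemmas ip_simps = ip_add ip_scale ip_add_right ip_scale_right ip_minus ip_minus_right ip_diff
  ip_diff_right ip_zero ip_zero_right ip_sum ip_sum_right

lemma generic_functional: "\<exists>\<rho>. \<forall>\<alpha>\<in>Phi. ip \<rho> \<alpha> \<noteq> 0"
proof -
  have "\<exists>\<rho>. \<forall>\<alpha>\<in>A. ip \<rho> \<alpha> \<noteq> 0" if "A \<subseteq> Phi" for A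
    using finite_subset[OF that fin] that
  proof (induction A rule: finite_induct)
    case (insert \<alpha> A)
    then obtain \<rho> where \<rho>: "\<forall>\<beta>\<in>A. ip \<rho> \<beta> \<noteq> 0" by auto
    have "finite (insert (- ip \<rho> \<alpha>) ((\<lambda>\<beta>. - ip \<rho> \<beta> / ip \<alpha> \<beta>) ` A))" using insert by simp
    from ex_new_if_finite[OF infinite_UNIV_char_0 this]
    obtain s where s: "s \<noteq> - ip \<rho> \<alpha>" "s \<notin> (\<lambda>\<beta>. - ip \<rho> \<beta> / ip \<alpha> \<beta>) ` A" by blast
    have "ip (\<rho> + s *\<^sub>R \<alpha>) \<beta> \<noteq> 0" if "\<beta> \<in> insert \<alpha> A" for \<beta>
    proof
      assume 0: "ip (\<rho> + s *\<^sub>R \<alpha>) \<beta> = 0"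
      show False
      proof (cases "\<beta> = \<alpha>")
        case True then show False using 0 s(1) insert.prems unit by (auto simp: ip_simps)
      next
        case False
        then have \<beta>: "\<beta> \<in> A" using that by simp
        then have "ip \<alpha> \<beta> \<noteq> 0" using 0 \<rho> by (auto simp: ip_simps)
        then have "s = - ip \<rho> \<beta> / ip \<alpha> \<beta>" using 0 by (simp add: ip_simps field_simps)
        then show False using s(2) \<beta> by blast
      qed
    qed
    then show ?case by blast
  qed simp
  then show ?thesis by blast
qed

definition cone :: "(real ^ 'n) set \<Rightarrow> (real ^ 'n) set" where
  "cone D = {\<Sum>\<delta>\<in>D. c \<delta> *\<^sub>R \<delta> | c. \<forall>\<delta>\<in>D. (0::real) \<le> c \<delta>}"

lemma cone_add: assumes "x \<in> cone D" "y \<in> cone D" shows "x + y \<in> cone D"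
proof -
  obtain c d where "x = (\<Sum>\<delta>\<in>D. c \<delta> *\<^sub>R \<delta>)" "\<forall>\<delta>\<in>D. 0 \<le> c \<delta>" "y = (\<Sum>\<delta>\<in>D. d \<delta> *\<^sub>R \<delta>)" "\<forall>\<delta>\<in>D. 0 \<le> d \<delta>"
    using assms by (auto simp: cone_def)
  then show ?thesis unfolding cone_def
    by (intro CollectI exI[of _ "\<lambda>\<delta>. c \<delta> + d \<delta>"]) (simp add: sum.distrib scaleR_add_left)
qed

lemma cone_scale: assumes "x \<in> cone D" "0 \<le> s" shows "s *\<^sub>R x \<in> cone D"
proof -
  obtain c where "x = (\<Sum>\<delta>\<in>D. c \<delta> *\<^sub>R \<delta>)" "\<forall>\<delta>\<in>D. 0 \<le> c \<delta>" using assms by (auto simp: cone_def)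
  then show ?thesis unfolding cone_def using assms(2)
    by (intro CollectI exI[of _ "\<lambda>\<delta>. s * c \<delta>"]) (simp add: scaleR_sum_right)
qed

lemma cone_base: assumes "finite D" "\<delta> \<in> D" shows "\<delta> \<in> cone D"
proof -
  have "(\<Sum>\<gamma>\<in>D. (if \<gamma> = \<delta> then 1 else 0) *\<^sub>R \<gamma>) = (\<Sum>\<gamma>\<in>D. if \<gamma> = \<delta> then \<gamma> else 0)"
    by (intro sum.cong) auto
  also have "\<dots> = \<delta>" using assms by simp
  finally show ?thesis unfolding cone_def
    by (intro CollectI exI[of _ "\<lambda>\<gamma>. if \<gamma> = \<delta> then 1 else 0"]) auto
qed

lemma cone_sum: "finite A \<Longrightarrow> (\<And>i. i \<in> A \<Longrightarrow> x i \<in> cone D) \<Longrightarrow> (\<Sum>i\<in>A. x i) \<in> cone D"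
proof (induction A rule: finite_induct)
  case empty show ?case unfolding cone_def by (intro CollectI exI[of _ "\<lambda>_. 0"]) simp
qed (auto intro: cone_add)

text \<open>A smallest set \<open>D\<close> of positive roots whose cone contains all positive roots
  is a simple system. If two members formed an acute angle, reflecting one in the other would
  express one of them by the rest, against minimality.\<close>

theorem exists_simple_roots:
  "\<exists>a :: 'n \<Rightarrow> real ^ 'n. inj a \<and> range a \<subseteq> Phi \<and> (\<forall>i j. i \<noteq> j \<longrightarrow> ip (a i) (a j) \<le> 0) \<and>
    (\<forall>c. (\<Sum>i\<in>UNIV. c i *\<^sub>R a i) = 0 \<longrightarrow> (\<forall>i. c i = 0)) \<and>
    (\<forall>\<beta>\<in>Phi. \<exists>b. \<beta> = (\<Sum>i\<in>UNIV. b i *\<^sub>R a i) \<and> ((\<forall>i. 0 \<le> b i) \<or> (\<forall>i. b i \<le> 0)))"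
proof -
  obtain \<rho> where \<rho>: "\<And>\<alpha>. \<alpha> \<in> Phi \<Longrightarrow> ip \<rho> \<alpha> \<noteq> 0" using generic_functional by blast
  define Pos where "Pos = {\<alpha>\<in>Phi. 0 < ip \<rho> \<alpha>}"
  have Pos: "\<alpha> \<in> Phi" "0 < ip \<rho> \<alpha>" if "\<alpha> \<in> Pos" for \<alpha> using that by (auto simp: Pos_def)
  have Phi_cases: "\<alpha> \<in> Pos \<or> - \<alpha> \<in> Pos" if "\<alpha> \<in> Phi" for \<alpha>
    using \<rho>[OF that] neg[OF that] that by (auto simp: Pos_def ip_simps)
  have finPos: "finite Pos" using fin by (simp add: Pos_def)
  define good where "good D \<longleftrightarrow> D \<subseteq> Pos \<and> Pos \<subseteq> cone D" for D
  have "good Pos" unfolding good_def using cone_base finPos by blast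
  then obtain D where D: "good D" "\<And>D'. good D' \<Longrightarrow> card D \<le> card D'"
    using ex_has_least_nat[of good Pos card] by blast
  have DP: "D \<subseteq> Pos" and cone: "Pos \<subseteq> cone D" using D(1) by (auto simp: good_def)
  have fD: "finite D" using DP finPos finite_subset by blast
  have irredundant: False if \<delta>: "\<delta> \<in> D" and x: "x \<in> cone (D - {\<delta>})" "0 < ip \<rho> x" "e *\<^sub>R \<delta> = x" for \<delta> x e
  proof -
    have "0 < e * ip \<rho> \<delta>" using x(2,3) by (metis ip_scale_right)
    moreover have "0 < ip \<rho> \<delta>" using \<delta> DP Pos by blast
    ultimately have e: "0 < e" by (simp add: zero_less_mult_iff)
    then have "\<delta> = inverse e *\<^sub>R x" using x(3) by auto
    then have \<delta>c: "\<delta> \<in> cone (D - {\<delta>})" using cone_scale[OF x(1), of "inverse e"] e by simp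
    have "y \<in> cone (D - {\<delta>})" if y: "y \<in> cone D" for y
    proof -
      obtain c where c: "y = (\<Sum>\<gamma>\<in>D. c \<gamma> *\<^sub>R \<gamma>)" "\<forall>\<gamma>\<in>D. 0 \<le> c \<gamma>" using y by (auto simp: cone_def)
      show ?thesis unfolding c(1)
      proof (rule cone_sum[OF fD])
        fix \<gamma> assume "\<gamma> \<in> D"
        then show "c \<gamma> *\<^sub>R \<gamma> \<in> cone (D - {\<delta>})"
          using \<delta>c c(2) cone_base[of "D - {\<delta>}" \<gamma>] fD by (cases "\<gamma> = \<delta>") (auto intro: cone_scale)
      qed
    qed
    then have "good (D - {\<delta>})" using DP cone by (auto simp: good_def)
    from D(2)[OF this] show False using card_Diff1_less[OF fD \<delta>] by simp
  qed
  have split: "(\<Sum>\<gamma>\<in>D. c \<gamma> *\<^sub>R \<gamma>) = c \<delta> *\<^sub>R \<delta> + (\<Sum>\<gamma>\<in>D - {\<delta>}. c \<gamma> *\<^sub>R \<gamma>)" if "\<delta> \<in> D" for c \<delta>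
    using fD that by (rule sum.remove)
  have rest: "(\<Sum>\<gamma>\<in>D - {\<delta>}. c \<gamma> *\<^sub>R \<gamma>) \<in> cone (D - {\<delta>})" "0 \<le> ip \<rho> (\<Sum>\<gamma>\<in>D - {\<delta>}. c \<gamma> *\<^sub>R \<gamma>)"
    if "\<forall>\<gamma>\<in>D. 0 \<le> c \<gamma>" for c \<delta>
  proof -
    show "(\<Sum>\<gamma>\<in>D - {\<delta>}. c \<gamma> *\<^sub>R \<gamma>) \<in> cone (D - {\<delta>})" using that by (auto simp: cone_def)
    show "0 \<le> ip \<rho> (\<Sum>\<gamma>\<in>D - {\<delta>}. c \<gamma> *\<^sub>R \<gamma>)"
      unfolding ip_sum_right ip_scale_right
      using that DP Pos(2) by (intro sum_nonneg mult_nonneg_nonneg) (auto simp: less_imp_le)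
  qed
  have obtuse: "ip \<alpha> \<beta> \<le> 0" if \<alpha>: "\<alpha> \<in> D" and \<beta>: "\<beta> \<in> D" and ne: "\<alpha> \<noteq> \<beta>" for \<alpha> \<beta>
  proof (rule ccontr)
    assume acute: "\<not> ?thesis"
    define k where "k = 2 * ip \<beta> \<alpha>"
    have k: "0 < k" using acute by (simp add: k_def ip_sym)
    have pos: "0 < ip \<rho> \<alpha>" "0 < ip \<rho> \<beta>" using \<alpha> \<beta> DP Pos by auto
    have "\<beta> - k *\<^sub>R \<alpha> \<in> Phi" unfolding k_def using refl \<alpha> \<beta> DP Pos by blast
    then consider "\<beta> - k *\<^sub>R \<alpha> \<in> cone D" | "k *\<^sub>R \<alpha> - \<beta> \<in> cone D"
      using Phi_cases[of "\<beta> - k *\<^sub>R \<alpha>"] cone by auto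
    then show False
    proof cases
      case 1
      then obtain c where c: "\<beta> - k *\<^sub>R \<alpha> = (\<Sum>\<gamma>\<in>D. c \<gamma> *\<^sub>R \<gamma>)" "\<forall>\<gamma>\<in>D. 0 \<le> c \<gamma>" by (auto simp: cone_def)
      let ?y = "\<Sum>\<gamma>\<in>D - {\<beta>}. c \<gamma> *\<^sub>R \<gamma>"
      have "(1 - c \<beta>) *\<^sub>R \<beta> = k *\<^sub>R \<alpha> + ?y"
        using c(1) split[OF \<beta>, of c] by (simp add: algebra_simps)
      moreover have "k *\<^sub>R \<alpha> + ?y \<in> cone (D - {\<beta>})"
        using cone_base[of "D - {\<beta>}" \<alpha>] \<alpha> ne fD k rest(1)[OF c(2)] by (intro cone_add cone_scale) auto
      moreover have "0 < ip \<rho> (k *\<^sub>R \<alpha> + ?y)"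
        using rest(2)[OF c(2), of \<beta>] k pos by (simp add: ip_add_right ip_scale_right add_pos_nonneg)
      ultimately show False using irredundant[OF \<beta>] by blast
    next
      case 2
      then obtain c where c: "k *\<^sub>R \<alpha> - \<beta> = (\<Sum>\<gamma>\<in>D. c \<gamma> *\<^sub>R \<gamma>)" "\<forall>\<gamma>\<in>D. 0 \<le> c \<gamma>" by (auto simp: cone_def)
      let ?y = "\<Sum>\<gamma>\<in>D - {\<alpha>}. c \<gamma> *\<^sub>R \<gamma>"
      have "(k - c \<alpha>) *\<^sub>R \<alpha> = \<beta> + ?y"
        using c(1) split[OF \<alpha>, of c] by (simp add: algebra_simps)
      moreover have "\<beta> + ?y \<in> cone (D - {\<alpha>})"
        using cone_base[of "D - {\<alpha>}" \<beta>] \<beta> ne fD rest(1)[OF c(2)] by (intro cone_add) auto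
      moreover have "0 < ip \<rho> (\<beta> + ?y)"
        using rest(2)[OF c(2), of \<alpha>] pos by (simp add: ip_add_right add_pos_nonneg)
      ultimately show False using irredundant[OF \<alpha>] by blast
    qed
  qed
  have indep: "\<forall>\<delta>\<in>D. c \<delta> = 0" if 0: "(\<Sum>\<delta>\<in>D. c \<delta> *\<^sub>R \<delta>) = 0" for c
  proof -
    \<comment> \<open>The positive and the negative part of a relation are equal vectors whose inner
      product is nonpositive, hence both are 0; positivity under \<rho> then leaves no
      terms.\<close>
    define A where "A = {\<delta>\<in>D. 0 < c \<delta>}"
    define B where "B = {\<delta>\<in>D. c \<delta> < 0}"
    have AB: "A \<subseteq> D" "B \<subseteq> D" "A \<inter> B = {}" "finite A" "finite B" using fD by (auto simp: A_def B_def)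
    define x where "x = (\<Sum>\<delta>\<in>A. c \<delta> *\<^sub>R \<delta>)"
    define y where "y = (\<Sum>\<delta>\<in>B. (- c \<delta>) *\<^sub>R \<delta>)"
    have "(\<Sum>\<delta>\<in>D. c \<delta> *\<^sub>R \<delta>) = (\<Sum>\<delta>\<in>A \<union> B. c \<delta> *\<^sub>R \<delta>)"
      using fD by (intro sum.mono_neutral_right) (auto simp: A_def B_def)
    also have "\<dots> = x - y" using AB by (simp add: sum.union_disjoint x_def y_def sum_negf)
    finally have xy: "x = y" using 0 by simp
    have "ip x y = (\<Sum>\<beta>\<in>B. \<Sum>\<alpha>\<in>A. c \<alpha> * (- c \<beta>) * ip \<alpha> \<beta>)"
      unfolding x_def y_def ip_sum ip_sum_right ip_scale ip_scale_right by (simp add: mult_ac sum_distrib_left)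
    also have "\<dots> \<le> 0"
    proof (intro sum_nonpos)
      fix \<beta> \<alpha> assume "\<beta> \<in> B" "\<alpha> \<in> A"
      then have "ip \<alpha> \<beta> \<le> 0" "0 \<le> c \<alpha> * (- c \<beta>)" using obtuse AB
        by (auto simp: A_def B_def mult_nonneg_nonpos)
      then show "c \<alpha> * (- c \<beta>) * ip \<alpha> \<beta> \<le> 0" by (rule mult_nonneg_nonpos[rotated])
    qed
    finally have "x = 0" using xy ip_pos[of x] by fastforce
    then have "ip \<rho> x = 0" "ip \<rho> y = 0" using xy by (auto simp: ip_simps)
    then have s: "(\<Sum>\<delta>\<in>A. c \<delta> * ip \<rho> \<delta>) = 0" "(\<Sum>\<delta>\<in>B. (- c \<delta>) * ip \<rho> \<delta>) = 0"
      unfolding x_def y_def by (simp_all only: ip_sum_right ip_scale_right)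
    have "A = {}"
    proof (rule ccontr)
      assume "A \<noteq> {}"
      then have "0 < (\<Sum>\<delta>\<in>A. c \<delta> * ip \<rho> \<delta>)"
        using AB DP Pos(2) by (intro sum_pos) (auto simp: A_def)
      then show False using s by simp
    qed
    moreover have "B = {}"
    proof (rule ccontr)
      assume "B \<noteq> {}"
      then have "0 < (\<Sum>\<delta>\<in>B. (- c \<delta>) * ip \<rho> \<delta>)"
        using AB DP Pos(2) by (intro sum_pos mult_pos_pos) (auto simp: B_def)
      then show False using s by simp
    qed
    ultimately show ?thesis unfolding A_def B_def by force
  qed
  have cardD: "card D = CARD('n)"
  proof -
    let ?T = "\<lambda>x. \<Sum>\<delta>\<in>D. ip x \<delta> *\<^sub>R \<delta>"
    have lin: "linear ?T"
      by (rule linearI) (simp_all add: ip_add ip_scale scaleR_add_left sum.distrib scaleR_sum_right)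
    \<comment> \<open>Injectivity comes from totality of the roots; the image, which lies in the
      span of \<open>D\<close>, is then the whole space.\<close>
    have "inj ?T"
    proof (rule linear_injective_0[OF lin, THEN iffD2, rule_format])
      fix x assume "?T x = 0"
      then have xD: "\<forall>\<delta>\<in>D. ip x \<delta> = 0" by (rule indep)
      have xP: "ip x \<alpha> = 0" if "\<alpha> \<in> Pos" for \<alpha>
      proof -
        obtain c where "\<alpha> = (\<Sum>\<gamma>\<in>D. c \<gamma> *\<^sub>R \<gamma>)" using \<open>\<alpha> \<in> Pos\<close> cone by (auto simp: cone_def)
        then show ?thesis using xD by (simp add: ip_sum_right ip_scale_right)
      qed
      show "x = 0"
      proof (rule total)
        fix \<alpha> assume "\<alpha> \<in> Phi"
        then show "ip x \<alpha> = 0" using Phi_cases[of \<alpha>] xP[of \<alpha>] xP[of "- \<alpha>"] by (auto simp: ip_minus_right)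
      qed
    qed
    then have "surj ?T" using linear_injective_imp_surjective[OF lin] by blast
    then have "x \<in> span D" for x
      by (metis (no_types, lifting) span_base span_scale span_sum surjD)
    then have sp: "span D = UNIV" by blast
    have "independent D" using indep fD by (auto simp: dependent_finite)
    then have "dim (UNIV :: (real ^ 'n) set) = card D" using sp by (metis dim_span dim_eq_card_independent)
    then show ?thesis by simp
  qed
  then obtain a where a: "bij_betw a (UNIV :: 'n set) D"
    using fD by (metis finite_class.finite_UNIV finite_same_card_bij)
  have re: "(\<Sum>i\<in>UNIV. c (a i) *\<^sub>R a i) = (\<Sum>\<delta>\<in>D. c \<delta> *\<^sub>R \<delta>)" for c
    by (rule sum.reindex_bij_betw[OF a])
  have inj: "inj a" and ran: "range a = D" using a by (auto simp: bij_betw_def)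
  show ?thesis
  proof (intro exI[of _ a] conjI allI impI ballI)
    show "inj a" by (rule inj)
    show "range a \<subseteq> Phi" using ran DP Pos by auto
    show "ip (a i) (a j) \<le> 0" if "i \<noteq> j" for i j using obtuse[of "a i" "a j"] ran inj that
      by (auto dest: injD)
    show "c i = 0" if "(\<Sum>i\<in>UNIV. c i *\<^sub>R a i) = 0" for c i
    proof -
      have "(\<Sum>\<delta>\<in>D. c (inv_into UNIV a \<delta>) *\<^sub>R \<delta>) = 0" using that re[of "\<lambda>\<delta>. c (inv_into UNIV a \<delta>)"] inj by simp
      then have "c (inv_into UNIV a (a i)) = 0" using indep[of "\<lambda>\<delta>. c (inv_into UNIV a \<delta>)"] ran by blast
      then show ?thesis using inj by simp
    qed
    fix \<beta> assume "\<beta> \<in> Phi"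
    then consider "\<beta> \<in> cone D" | "- \<beta> \<in> cone D" using Phi_cases cone by blast
    then show "\<exists>b. \<beta> = (\<Sum>i\<in>UNIV. b i *\<^sub>R a i) \<and> ((\<forall>i. 0 \<le> b i) \<or> (\<forall>i. b i \<le> 0))"
    proof cases
      case 1
      then obtain c where "\<beta> = (\<Sum>\<gamma>\<in>D. c \<gamma> *\<^sub>R \<gamma>)" "\<forall>\<gamma>\<in>D. 0 \<le> c \<gamma>" by (auto simp: cone_def)
      then show ?thesis using re[of c] ran by (intro exI[of _ "\<lambda>i. c (a i)"]) auto
    next
      case 2
      then obtain c where c: "- \<beta> = (\<Sum>\<gamma>\<in>D. c \<gamma> *\<^sub>R \<gamma>)" "\<forall>\<gamma>\<in>D. 0 \<le> c \<gamma>" by (auto simp: cone_def)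
      then have "\<beta> = - (\<Sum>i\<in>UNIV. c (a i) *\<^sub>R a i)" using re[of c] by (metis minus_minus)
      then show ?thesis using c(2) ran by (intro exI[of _ "\<lambda>i. - c (a i)"]) (auto simp: sum_negf)
    qed
  qed
qed

end

section \<open>Simple roots and the Coxeter graph\<close>

locale root_simple = root_base ip Phi
  for ip :: "real ^ 'n::finite \<Rightarrow> real ^ 'n \<Rightarrow> real" and Phi +
  fixes a :: "'n \<Rightarrow> real ^ 'n"
  assumes a_inj: "inj a" and a_Phi: "a i \<in> Phi"
    and obtuse: "i \<noteq> j \<Longrightarrow> ip (a i) (a j) \<le> 0"
    and indep: "(\<Sum>i\<in>UNIV. c i *\<^sub>R a i) = 0 \<Longrightarrow> c i = 0"
    and signs: "\<beta> \<in> Phi \<Longrightarrow> \<exists>b. \<beta> = (\<Sum>i\<in>UNIV. b i *\<^sub>R a i) \<and> ((\<forall>i. 0 \<le> b i) \<or> (\<forall>i. b i \<le> 0))"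
    and irred: "A \<union> B = Phi \<Longrightarrow> (\<And>\<alpha> \<beta>. \<alpha> \<in> A \<Longrightarrow> \<beta> \<in> B \<Longrightarrow> ip \<alpha> \<beta> = 0) \<Longrightarrow> A = {} \<or> B = {}"
    and rank: "2 \<le> CARD('n)"
begin

abbreviation "g i j \<equiv> ip (a i) (a j)"

lemma g_sym: "g i j = g j i" by (rule ip_sym)
lemma g_diag [simp]: "g i i = 1" by (rule unit[OF a_Phi])

definition co :: "real ^ 'n \<Rightarrow> 'n \<Rightarrow> real" where "co x = (SOME b. x = (\<Sum>i\<in>UNIV. b i *\<^sub>R a i))"

lemma co_eqI: assumes "x = (\<Sum>i\<in>UNIV. b i *\<^sub>R a i)" shows "co x = b"
proof -
  have "x = (\<Sum>i\<in>UNIV. co x i *\<^sub>R a i)" unfolding co_def by (rule someI[of _ b]) (rule assms)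
  then have "(\<Sum>i\<in>UNIV. (co x i - b i) *\<^sub>R a i) = 0"
    using assms by (simp add: scaleR_diff_left sum_subtractf)
  then have "co x i - b i = 0" for i by (rule indep)
  then show ?thesis by (auto simp: fun_eq_iff)
qed

lemma co: "\<beta> \<in> Phi \<Longrightarrow> \<beta> = (\<Sum>i\<in>UNIV. co \<beta> i *\<^sub>R a i)"
  using signs co_eqI by metis

lemma co_sign: "\<beta> \<in> Phi \<Longrightarrow> (\<forall>i. 0 \<le> co \<beta> i) \<or> (\<forall>i. co \<beta> i \<le> 0)"
  using signs co_eqI by metis

lemma co_add_simple:
  assumes "\<beta> \<in> Phi" shows "co (\<beta> - (\<Sum>i\<in>S. d i *\<^sub>R a i)) = (\<lambda>i. co \<beta> i - (if i \<in> S then d i else 0))"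
proof (rule co_eqI)
  have "(\<Sum>i\<in>S. d i *\<^sub>R a i) = (\<Sum>i\<in>UNIV. (if i \<in> S then d i else 0) *\<^sub>R a i)"
    by (intro sum.mono_neutral_cong_left) auto
  then show "\<beta> - (\<Sum>i\<in>S. d i *\<^sub>R a i) = (\<Sum>i\<in>UNIV. (co \<beta> i - (if i \<in> S then d i else 0)) *\<^sub>R a i)"
    using co[OF assms] by (simp add: scaleR_diff_left sum_subtractf)
qed

definition s where "s i x = x - (2 * ip x (a i)) *\<^sub>R a i"

lemma s_Phi: "\<beta> \<in> Phi \<Longrightarrow> s i \<beta> \<in> Phi" unfolding s_def by (rule refl[OF a_Phi])

lemma co_s: "\<beta> \<in> Phi \<Longrightarrow> co (s i \<beta>) = (\<lambda>j. co \<beta> j - (if j = i then 2 * ip \<beta> (a i) else 0))"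
  using co_add_simple[of \<beta> "\<lambda>_. 2 * ip \<beta> (a i)" "{i}"] by (simp add: s_def)

lemma co_a: "co (a i) = (\<lambda>j. if j = i then 1 else 0)"
  by (rule co_eqI) (simp add: if_distrib[of "\<lambda>x. x *\<^sub>R _"] cong: if_cong)

lemma ip_co: "\<beta> \<in> Phi \<Longrightarrow> ip \<beta> x = (\<Sum>i\<in>UNIV. co \<beta> i * ip (a i) x)"
  by (subst co) (simp_all add: ip_sum ip_scale)

text \<open>With \<open>k = - 2 * g i j\<close>, the root \<open>s j (s i (a j))\<close> has the coefficients \<open>k\<close> and \<open>k\<^sup>2 - 1\<close>.\<close>

lemma gap: assumes "i \<noteq> j" "g i j \<noteq> 0" shows "g i j \<le> - 1 / 2"
proof (rule ccontr)
  assume big: "\<not> ?thesis"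
  define k where "k = - 2 * g i j"
  have k: "0 < k" "k < 1" using obtuse[OF assms(1)] assms(2) big by (auto simp: k_def)
  have 1: "s i (a j) = a j + k *\<^sub>R a i" by (simp add: s_def k_def g_sym)
  let ?r = "s j (s i (a j))"
  have r: "?r \<in> Phi" by (intro s_Phi a_Phi)
  have "co ?r i = k" "co ?r j = k * k - 1"
    using assms(1) unfolding co_s[OF s_Phi[OF a_Phi]] co_s[OF a_Phi] co_a unfolding 1
    by (auto simp: ip_simps k_def g_sym[of j i])
  moreover have "k * k < 1" using k by (metis less_eq_real_def mult_strict_mono mult_1 zero_less_one)
  ultimately show False using co_sign[OF r] k by (metis diff_less_0_iff_less not_le)
qed

text \<open>The Coxeter graph is a forest. If every vertex of \<open>X\<close> had two neighbours in
  \<open>X\<close>, the entries of at most - 1 / 2 given by \<open>gap\<close> would make the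
  squared length of the sum of these simple roots nonpositive.\<close>

lemma leaf: assumes "X \<noteq> {}" shows "\<exists>i\<in>X. card {j\<in>X. j \<noteq> i \<and> g i j \<noteq> 0} \<le> 1"
proof (rule ccontr)
  assume "\<not> ?thesis"
  then have deg: "2 \<le> card {j\<in>X. j \<noteq> i \<and> g i j \<noteq> 0}" if "i \<in> X" for i using that by force
  define v where "v = (\<Sum>i\<in>X. a i)"
  have "ip v v = (\<Sum>i\<in>X. \<Sum>j\<in>X. g i j)" by (simp add: v_def ip_sum ip_sum_right g_sym)
  also have "\<dots> \<le> (\<Sum>i\<in>X. 0)"
  proof (rule sum_mono)
    fix i assume i: "i \<in> X"
    let ?N = "{j\<in>X. j \<noteq> i \<and> g i j \<noteq> 0}"
    have "(\<Sum>j\<in>X. g i j) = 1 + (\<Sum>j\<in>X - {i}. g i j)" using i by (simp add: sum.remove[of X i])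
    also have "(\<Sum>j\<in>X - {i}. g i j) = (\<Sum>j\<in>?N. g i j)"
      by (intro sum.mono_neutral_right) auto
    also have "\<dots> \<le> (\<Sum>j\<in>?N. - 1 / 2)" using gap by (intro sum_mono) auto
    also have "\<dots> \<le> - 1" using deg[OF i] by simp
    finally show "(\<Sum>j\<in>X. g i j) \<le> 0" by simp
  qed
  finally have "v = 0" using ip_pos[of v] by fastforce
  moreover have "v = (\<Sum>i\<in>UNIV. (if i \<in> X then 1 else 0) *\<^sub>R a i)"
    unfolding v_def by (intro sum.mono_neutral_cong_left) auto
  ultimately have "(if i \<in> X then 1 else 0 :: real) = 0" for i
    using indep[of "\<lambda>i. if i \<in> X then 1 else 0" i] by simp
  then show False using assms by (metis all_not_in_conv zero_neq_one)
qed

text \<open>Remove a vertex with at most one neighbour, colour the rest, and give the vertex the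
  colour opposite to its neighbour.\<close>

lemma two_colouring: "\<exists>col :: 'n \<Rightarrow> bool. \<forall>i j. i \<noteq> j \<longrightarrow> g i j \<noteq> 0 \<longrightarrow> col i \<noteq> col j"
proof -
  have "\<exists>col :: 'n \<Rightarrow> bool. \<forall>i\<in>X. \<forall>j\<in>X. i \<noteq> j \<longrightarrow> g i j \<noteq> 0 \<longrightarrow> col i \<noteq> col j" for X
    using finite[of X]
  proof (induction X rule: finite_psubset_induct)
    case (psubset X)
    show ?case
    proof (cases "X = {}")
      case False
      then obtain i where i: "i \<in> X" "card {j\<in>X. j \<noteq> i \<and> g i j \<noteq> 0} \<le> 1" using leaf by blast
      have "X - {i} \<subset> X" using i by blast
      from psubset(2)[OF this] obtain col :: "'n \<Rightarrow> bool"
        where col: "\<forall>k\<in>X - {i}. \<forall>j\<in>X - {i}. k \<noteq> j \<longrightarrow> g k j \<noteq> 0 \<longrightarrow> col k \<noteq> col j" by blast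
      let ?N = "{j\<in>X. j \<noteq> i \<and> g i j \<noteq> 0}"
      have "\<exists>j0. ?N \<subseteq> {j0}"
      proof (cases "?N = {}")
        case False
        then obtain j0 where "j0 \<in> ?N" by blast
        then have "?N = {j0}" using i(2) card_le_Suc0_iff_eq[of ?N] by auto
        then show ?thesis by blast
      qed blast
      then obtain j0 where j0: "?N \<subseteq> {j0}" by blast
      show ?thesis
      proof (intro exI[of _ "col(i := \<not> col j0)"] ballI impI)
        fix k j assume kj: "k \<in> X" "j \<in> X" "k \<noteq> j" "g k j \<noteq> 0"
        consider "k = i" | "j = i" | "k \<noteq> i" "j \<noteq> i" by blast
        then show "(col(i := \<not> col j0)) k \<noteq> (col(i := \<not> col j0)) j"
        proof cases
          case 1
          then have "j = j0" using j0 kj by blast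
          then show ?thesis using 1 kj(3) by simp
        next
          case 2
          then have "g i k \<noteq> 0" using kj(4) g_sym[of k i] by simp
          then have "k = j0" using j0 kj 2 by blast
          then show ?thesis using 2 kj(3) by simp
        next
          case 3
          then show ?thesis using col kj by simp
        qed
      qed
    qed simp
  qed
  from this[of UNIV] show ?thesis by simp
qed

text \<open>A positive mixed root of minimal height has a positive product with some simple root
  that it involves. Reflecting in this root lowers the height, and the result is still positive and
  mixed.\<close>

lemma root_not_mixed:
  assumes orth: "\<And>i j. i \<in> X \<Longrightarrow> j \<notin> X \<Longrightarrow> g i j = 0" and \<beta>: "\<beta> \<in> Phi"
  shows "(\<forall>i\<in>X. co \<beta> i = 0) \<or> (\<forall>i. i \<notin> X \<longrightarrow> co \<beta> i = 0)"
proof (rule ccontr)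
  define mix where "mix \<gamma> \<longleftrightarrow> \<gamma> \<in> Phi \<and> (\<forall>i. 0 \<le> co \<gamma> i) \<and> (\<exists>i\<in>X. co \<gamma> i \<noteq> 0) \<and> (\<exists>j. j \<notin> X \<and> co \<gamma> j \<noteq> 0)" for \<gamma>
  assume neg': "\<not> ?thesis"
  have "\<exists>\<gamma>. mix \<gamma>"
  proof (cases "\<forall>i. 0 \<le> co \<beta> i")
    case True then show ?thesis using neg' \<beta> by (auto simp: mix_def)
  next
    case False
    then have "\<forall>i. co \<beta> i \<le> 0" using co_sign[OF \<beta>] by blast
    moreover have "co (- \<beta>) = (\<lambda>i. - co \<beta> i)"
      by (rule co_eqI) (use co[OF \<beta>] in \<open>simp add: sum_negf\<close>)
    ultimately have "mix (- \<beta>)" using neg' neg[OF \<beta>] by (auto simp: mix_def)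
    then show ?thesis by blast
  qed
  then obtain \<gamma>0 where \<gamma>0: "mix \<gamma>0" by blast
  define M where "M = {\<gamma>. mix \<gamma>}"
  have M: "finite M" "M \<noteq> {}" using fin \<gamma>0 by (auto simp: M_def mix_def)
  define ht where "ht \<gamma> = (\<Sum>i\<in>UNIV. co \<gamma> i)" for \<gamma>
  obtain \<gamma> where \<gamma>: "\<gamma> \<in> M" "\<And>\<gamma>'. \<gamma>' \<in> M \<Longrightarrow> ht \<gamma> \<le> ht \<gamma>'"
    using ex_min_if_finite[of "ht ` M"] M by (auto simp: not_less)
  have g1: "\<gamma> \<in> Phi" "\<And>i. 0 \<le> co \<gamma> i" using \<gamma>(1) by (auto simp: M_def mix_def)
  have "0 < ip \<gamma> \<gamma>" using unit[OF g1(1)] by simp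
  then have "0 < (\<Sum>i\<in>UNIV. co \<gamma> i * ip (a i) \<gamma>)" using ip_co[OF g1(1)] by simp
  then have "\<not> (\<forall>i. co \<gamma> i * ip (a i) \<gamma> \<le> 0)" using sum_nonpos[of UNIV "\<lambda>i. co \<gamma> i * ip (a i) \<gamma>"] by auto
  then obtain i where i: "0 < co \<gamma> i * ip (a i) \<gamma>" by (auto simp: not_le)
  then have ci: "0 < co \<gamma> i" "0 < ip \<gamma> (a i)" using g1(2)[of i] by (auto simp: zero_less_mult_iff ip_sym)
  let ?\<gamma> = "s i \<gamma>"
  have p: "?\<gamma> \<in> Phi" by (rule s_Phi[OF g1(1)])
  have cs: "co ?\<gamma> j = co \<gamma> j - (if j = i then 2 * ip \<gamma> (a i) else 0)" for j
    by (simp add: co_s[OF g1(1)])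
  have ss: "s i ?\<gamma> = \<gamma>" by (simp add: s_def ip_simps)
  \<comment> \<open>If the reflected root had no coefficient on the side of \<open>i\<close>, it
    would be orthogonal to \<open>a i\<close> and thus not changed by the reflection.\<close>
  have unchanged: False if "ip ?\<gamma> (a i) = 0"
  proof -
    have "s i ?\<gamma> = ?\<gamma>" using that by (simp add: s_def)
    then show False using ss ci(2) cs[of i] by simp
  qed
  have side: "mix ?\<gamma>"
  proof -
    have both: "(\<exists>k\<in>X. co ?\<gamma> k \<noteq> 0) \<and> (\<exists>k. k \<notin> X \<and> co ?\<gamma> k \<noteq> 0)"
    proof (cases "i \<in> X")
      case True
      obtain j where "j \<notin> X" "co \<gamma> j \<noteq> 0" using \<gamma>(1) by (auto simp: M_def mix_def)
      then have "\<exists>k. k \<notin> X \<and> co ?\<gamma> k \<noteq> 0" using cs[of j] True by (intro exI[of _ j]) auto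
      moreover have "\<exists>k\<in>X. co ?\<gamma> k \<noteq> 0"
      proof (rule ccontr)
        assume "\<not> ?thesis"
        then have "co ?\<gamma> k * g k i = 0" for k using orth[OF True, of k] by (cases "k \<in> X") (auto simp: g_sym[of k i])
        then have "ip ?\<gamma> (a i) = 0" by (simp only: ip_co[OF p] sum.neutral_const)
        then show False by (rule unchanged)
      qed
      ultimately show ?thesis by blast
    next
      case False
      obtain j where "j \<in> X" "co \<gamma> j \<noteq> 0" using \<gamma>(1) by (auto simp: M_def mix_def)
      then have "\<exists>k\<in>X. co ?\<gamma> k \<noteq> 0" using cs[of j] False by (intro bexI[of _ j]) auto
      moreover have "\<exists>k. k \<notin> X \<and> co ?\<gamma> k \<noteq> 0"
      proof (rule ccontr)
        assume "\<not> ?thesis"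
        then have "co ?\<gamma> k * g k i = 0" for k using orth[of k, OF _ False] by (cases "k \<in> X") auto
        then have "ip ?\<gamma> (a i) = 0" by (simp only: ip_co[OF p] sum.neutral_const)
        then show False by (rule unchanged)
      qed
      ultimately show ?thesis by blast
    qed
    obtain j where j: "j \<noteq> i" "0 < co \<gamma> j"
    proof -
      obtain k l where "k \<in> X" "co \<gamma> k \<noteq> 0" "l \<notin> X" "co \<gamma> l \<noteq> 0" using \<gamma>(1) by (auto simp: M_def mix_def)
      then show ?thesis using that[of k] that[of l] g1(2)[of k] g1(2)[of l] by (metis less_eq_real_def)
    qed
    have "\<forall>k. 0 \<le> co ?\<gamma> k" using co_sign[OF p] cs[of j] j by (auto simp: not_le) (metis not_le)
    then show ?thesis using both p by (simp add: mix_def)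
  qed
  have "ht ?\<gamma> = ht \<gamma> - 2 * ip \<gamma> (a i)" by (simp add: ht_def cs sum_subtractf)
  then show False using \<gamma>(2)[of ?\<gamma>] side ci by (simp add: M_def)
qed

lemma connected:
  assumes "\<And>i j. i \<in> X \<Longrightarrow> j \<notin> X \<Longrightarrow> g i j = 0" shows "X = {} \<or> X = UNIV"
proof -
  define A where "A = {\<beta>\<in>Phi. \<forall>i. i \<notin> X \<longrightarrow> co \<beta> i = 0}"
  define B where "B = {\<beta>\<in>Phi. \<forall>i\<in>X. co \<beta> i = 0}"
  have "A \<union> B = Phi" using root_not_mixed[OF assms] by (auto simp: A_def B_def)
  moreover have "ip \<alpha> \<beta> = 0" if "\<alpha> \<in> A" "\<beta> \<in> B" for \<alpha> \<beta>
  proof -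
    have "ip \<alpha> \<beta> = (\<Sum>i\<in>UNIV. co \<alpha> i * (\<Sum>j\<in>UNIV. co \<beta> j * g i j))"
      using that ip_co[of \<alpha>] ip_co[of \<beta>] by (simp add: A_def B_def ip_sym[of "a _" \<beta>] ip_sym[of "a _" "a _"])
    also have "\<dots> = 0"
    proof (intro sum.neutral ballI)
      fix i
      show "co \<alpha> i * (\<Sum>j\<in>UNIV. co \<beta> j * g i j) = 0"
      proof (cases "i \<in> X")
        case True
        then have "co \<beta> j * g i j = 0" for j using that assms[OF True, of j] by (cases "j \<in> X") (auto simp: B_def)
        then show ?thesis by (simp only: sum.neutral_const mult_zero_right)
      next
        case False then show ?thesis using that by (simp add: A_def)
      qed
    qed
    finally show ?thesis .
  qed
  ultimately have "A = {} \<or> B = {}" by (rule irred)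
  moreover have "a i \<in> A" if "i \<in> X" for i using that a_Phi by (auto simp: A_def co_a)
  moreover have "a i \<in> B" if "i \<notin> X" for i using that a_Phi by (auto simp: B_def co_a)
  ultimately show ?thesis by blast
qed

lemma quadratic_nonneg_imp_linear_zero:
  fixes b c :: real assumes "\<And>t. 0 \<le> 2 * t * b + t\<^sup>2 * c" shows "b = 0"
proof (rule ccontr)
  assume b: "b \<noteq> 0"
  define C where "C = \<bar>c\<bar> + 1"
  have C: "0 < C" "c < C" by (auto simp: C_def)
  have "2 * (- b / C) * b + (- b / C)\<^sup>2 * c < 2 * (- b / C) * b + (- b / C)\<^sup>2 * C"
    using b C by (intro add_strict_left_mono mult_strict_left_mono) auto
  also have "\<dots> = - (b\<^sup>2 / C)" using C by (simp add: power2_eq_square field_simps)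
  also have "\<dots> < 0" using b C by simp
  finally show False using assms[of "- b / C"] by simp
qed

text \<open>A minimizer of the Gram form on the unit sphere; its coordinates can be taken nonnegative since
  the off-diagonal entries of the Gram matrix are nonpositive.\<close>

lemma perron: "\<exists>z \<mu>. (\<forall>i. 0 < z i) \<and> 0 < \<mu> \<and> \<mu> < 1 \<and> (\<forall>i. (\<Sum>j\<in>UNIV. g i j * z j) = \<mu> * z i)"
proof -
  define q where "q y = (\<Sum>i\<in>UNIV. \<Sum>j\<in>UNIV. y $ i * y $ j * g i j)" for y :: "real ^ 'n"
  define nn where "nn y = (\<Sum>i\<in>UNIV. (y $ i)\<^sup>2)" for y :: "real ^ 'n"
  have norm1: "norm y = 1 \<longleftrightarrow> nn y = 1" for y :: "real ^ 'n"
    by (simp add: norm_vec_def L2_set_def nn_def)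
  have qip: "q y = ip (\<Sum>i\<in>UNIV. y $ i *\<^sub>R a i) (\<Sum>i\<in>UNIV. y $ i *\<^sub>R a i)" for y
    by (simp add: q_def ip_simps sum_distrib_left mult_ac g_sym)
  have "continuous_on (sphere 0 1) q" unfolding q_def by (intro continuous_intros)
  moreover have "sphere (0 :: real ^ 'n) 1 \<noteq> {}" by simp
  ultimately obtain x0 where x0: "norm x0 = 1" "\<And>y. norm y = 1 \<Longrightarrow> q x0 \<le> q y"
    using continuous_attains_inf[OF compact_sphere, of 0 1 q] by auto
  define z where "z = (\<chi> i. \<bar>x0 $ i\<bar>)"
  have nz: "nn z = 1" using x0(1) norm1[of x0] by (simp add: nn_def z_def)
  define \<mu> where "\<mu> = q z"
  have "q z \<le> q x0" unfolding q_def
  proof (intro sum_mono)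
    fix i j
    show "z $ i * z $ j * g i j \<le> x0 $ i * x0 $ j * g i j"
    proof (cases "i = j")
      case False
      have "x0 $ i * x0 $ j \<le> z $ i * z $ j" by (simp add: z_def abs_mult[symmetric])
      then show ?thesis using obtuse[OF False] by (rule mult_right_mono_neg)
    qed (simp add: z_def)
  qed
  then have min1: "\<mu> \<le> q y" if "nn y = 1" for y using x0(2)[of y] that norm1[of y] by (simp add: \<mu>_def)
  have min: "\<mu> * nn y \<le> q y" for y
  proof (cases "nn y = 0")
    case True
    then have "y = 0" by (simp add: nn_def sum_nonneg_eq_0_iff vec_eq_iff)
    then show ?thesis using True by (simp add: q_def)
  next
    case False
    have nn0: "0 < nn y" using False by (simp add: nn_def sum_nonneg less_le)
    define r where "r = 1 / sqrt (nn y)"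
    have r: "r\<^sup>2 = 1 / nn y" using nn0 by (simp add: r_def power_divide)
    have "nn (r *\<^sub>R y) = r\<^sup>2 * nn y" by (simp add: nn_def power_mult_distrib sum_distrib_left)
    then have "\<mu> \<le> q (r *\<^sub>R y)" using min1 r nn0 by simp
    also have "q (r *\<^sub>R y) = r\<^sup>2 * q y" by (simp add: q_def sum_distrib_left power2_eq_square mult_ac)
    finally show ?thesis using r nn0 by (simp add: field_simps)
  qed
  have eig: "(\<Sum>j\<in>UNIV. g i j * z $ j) = \<mu> * z $ i" for i
  proof -
    \<comment> \<open>The minimizer is varied along the \<open>i\<close>-th axis; the linear part of
      the variation must vanish.\<close>
    have "0 \<le> 2 * t * ((\<Sum>j\<in>UNIV. g i j * z $ j) - \<mu> * z $ i) + t\<^sup>2 * (1 - \<mu>)" for t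
    proof -
      let ?y = "z + t *\<^sub>R axis i 1"
      have sm: "(\<Sum>k\<in>UNIV. ?y $ k *\<^sub>R a k) = (\<Sum>k\<in>UNIV. z $ k *\<^sub>R a k) + t *\<^sub>R a i"
        by (simp add: scaleR_add_left sum.distrib axis_def if_distrib[of "\<lambda>x. (_ * x) *\<^sub>R _"] cong: if_cong)
      have "q ?y = q z + 2 * t * (\<Sum>j\<in>UNIV. g i j * z $ j) + t\<^sup>2"
      proof -
        have "ip (\<Sum>k\<in>UNIV. z $ k *\<^sub>R a k) (a i) = (\<Sum>j\<in>UNIV. g i j * z $ j)"
          by (simp add: ip_sum ip_scale g_sym[of i] mult.commute)
        then show ?thesis unfolding qip sm
          by (simp add: ip_add ip_add_right ip_scale ip_scale_right ip_sym[of "a i" "\<Sum>k\<in>UNIV. _ k"] power2_eq_square algebra_simps)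
      qed
      moreover have "nn ?y = nn z + 2 * t * z $ i + t\<^sup>2"
      proof -
        have "nn ?y = (\<Sum>k\<in>UNIV. (z $ k)\<^sup>2 + (if k = i then 2 * t * z $ i + t\<^sup>2 else 0))"
          unfolding nn_def by (intro sum.cong) (auto simp: axis_def power2_sum algebra_simps)
        then show ?thesis by (simp add: sum.distrib nn_def)
      qed
      ultimately show ?thesis using min[of ?y] nz by (simp add: \<mu>_def algebra_simps)
    qed
    from quadratic_nonneg_imp_linear_zero[OF this] show ?thesis by simp
  qed
  have z0: "0 \<le> z $ i" for i by (simp add: z_def)
  define Z where "Z = {i. z $ i = 0}"
  \<comment> \<open>At a zero coordinate of \<open>z\<close> the eigenvalue equation is a vanishing
    sum of terms of one sign, so no edge joins \<open>Z\<close> to its complement.\<close>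
  have "g i j = 0" if "i \<in> Z" "j \<notin> Z" for i j
  proof -
    have "(\<Sum>j\<in>UNIV. - (g i j * z $ j)) = 0" using eig[of i] that by (simp add: Z_def sum_negf)
    moreover have "0 \<le> - (g i j * z $ j)" for j
      using obtuse[of i j] z0[of j] that by (cases "i = j") (auto simp: Z_def mult_nonpos_nonneg)
    ultimately have "- (g i j * z $ j) = 0" by (subst (asm) sum_nonneg_eq_0_iff) auto
    then show ?thesis using that by (simp add: Z_def)
  qed
  then have "Z = {} \<or> Z = UNIV" by (rule connected)
  moreover have "Z \<noteq> UNIV"
  proof
    assume "Z = UNIV"
    then have "z $ i = 0" for i by (auto simp: Z_def)
    then show False using nz by (simp add: nn_def)
  qed
  ultimately have zpos: "0 < z $ i" for i using z0[of i] by (auto simp: Z_def less_le)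
  have "(\<Sum>i\<in>UNIV. z $ i *\<^sub>R a i) \<noteq> 0" using indep[of "\<lambda>i. z $ i"] zpos by (metis less_irrefl)
  then have \<mu>0: "0 < \<mu>" unfolding \<mu>_def qip by (rule ip_pos)
  obtain i :: 'n where True by simp
  have "{i} \<noteq> UNIV" using rank by (metis card.empty card_insert_disjoint empty_iff finite.emptyI not_less_eq_eq numeral_2_eq_2 order_refl One_nat_def)
  then obtain j where j: "j \<noteq> i" "g i j \<noteq> 0" using connected[of "{i}"] by blast
  \<comment> \<open>Strict because the vertex \<open>i\<close> has a neighbour \<open>j\<close>,
    where the Gram matrix is negative.\<close>
  have "\<mu> * z $ i < z $ i"
  proof -
    have "(\<Sum>k\<in>UNIV. g i k * z $ k) = z $ i + (\<Sum>k\<in>UNIV - {i}. g i k * z $ k)"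
      by (simp add: sum.remove[of UNIV i])
    moreover have "(\<Sum>k\<in>UNIV - {i}. g i k * z $ k) < (\<Sum>k\<in>UNIV - {i}. 0)"
    proof (rule sum_strict_mono_ex1)
      show "\<forall>k\<in>UNIV - {i}. g i k * z $ k \<le> 0" using obtuse z0 by (auto simp: mult_nonpos_nonneg)
      have "g i j < 0" using obtuse[of i j] j by auto
      then show "\<exists>k\<in>UNIV - {i}. g i k * z $ k < 0" using j zpos[of j] by (auto intro!: bexI[of _ j] mult_neg_pos)
    qed simp
    ultimately show ?thesis using eig[of i] by simp
  qed
  then have "\<mu> < 1" using zpos[of i] by simp
  then show ?thesis using zpos \<mu>0 eig by blast
qed

end

section \<open>The Coxeter plane\<close>

locale coxeter_data = root_simple ip Phi a
  for ip :: "real ^ 'n::finite \<Rightarrow> real ^ 'n \<Rightarrow> real" and Phi and a +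
  fixes col :: "'n \<Rightarrow> bool" and z :: "'n \<Rightarrow> real" and k :: real
  assumes col: "i \<noteq> j \<Longrightarrow> g i j \<noteq> 0 \<Longrightarrow> col i \<noteq> col j"
    and z_pos: "0 < z i" and k: "0 < k" "k < 1"
    and eig: "(\<Sum>j\<in>UNIV. g i j * z j) = (1 - k) * z i"
begin

text \<open>The two monochromatic parts of the positive eigenvector of the Gram matrix; they span
  the Coxeter plane.\<close>

definition xb :: "bool \<Rightarrow> real ^ 'n" where "xb b = (\<Sum>i | col i = b. z i *\<^sub>R a i)"

text \<open>The product of the reflections in the simple roots of one colour. These roots are
  mutually orthogonal, so all components can be subtracted at once.\<close>

definition r :: "bool \<Rightarrow> real ^ 'n \<Rightarrow> real ^ 'n" where
  "r b x = x - (\<Sum>i | col i = b. (2 * ip x (a i)) *\<^sub>R a i)"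

lemma same_colour: "i \<noteq> j \<Longrightarrow> col i = col j \<Longrightarrow> g i j = 0" using col by blast

lemma sum_same_colour: "(\<Sum>j | col j = col i. c j * g j i) = c i"
proof -
  have "(\<Sum>j | col j = col i. c j * g j i) = (\<Sum>j\<in>{i}. c j * g j i)"
    by (intro sum.mono_neutral_right) (auto simp: same_colour)
  then show ?thesis by simp
qed

lemma sum_bool_split: "(\<Sum>i\<in>UNIV. f i) = (\<Sum>i | col i = b. f i) + (\<Sum>i | col i = (\<not> b). f i)" for f :: "'n \<Rightarrow> real"
proof -
  have "UNIV = {i. col i = b} \<union> {i. col i = (\<not> b)}" by auto
  then have "(\<Sum>i\<in>UNIV. f i) = (\<Sum>i\<in>{i. col i = b} \<union> {i. col i = (\<not> b)}. f i)" by simp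
  also have "\<dots> = (\<Sum>i | col i = b. f i) + (\<Sum>i | col i = (\<not> b). f i)"
    by (rule sum.union_disjoint) auto
  finally show ?thesis .
qed

text \<open>Within one colour the Gram matrix is the identity, so the eigenvalue equation determines
  the contribution of the other colour.\<close>

lemma ip_xb: "ip (a i) (xb b) = (if col i = b then z i else - k * z i)"
proof (cases "col i = b")
  case True
  then show ?thesis using sum_same_colour[of z i]
    by (simp add: xb_def ip_sum_right ip_scale_right g_sym[of i])
next
  case False
  have "(1 - k) * z i = (\<Sum>j | col j = b. g i j * z j) + (\<Sum>j | col j = (\<not> b). g i j * z j)"
    using eig[of i] sum_bool_split[of "\<lambda>j. g i j * z j" b] by simp
  moreover have "(\<Sum>j | col j = (\<not> b). g i j * z j) = z i"
    using sum_same_colour[of z i] False by (simp add: g_sym[of i] mult.commute)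
  ultimately have "(\<Sum>j | col j = b. g i j * z j) = - k * z i" by (simp add: algebra_simps)
  then show ?thesis using False by (simp add: xb_def ip_sum_right ip_scale_right mult.commute)
qed

lemma r_add: "r b (x + y) = r b x + r b y"
  by (simp add: r_def ip_add distrib_left scaleR_add_left sum.distrib)

lemma r_scale: "r b (c *\<^sub>R x) = c *\<^sub>R r b x"
  by (simp add: r_def ip_scale scaleR_diff_right scaleR_sum_right mult.left_commute)

lemma r_zero: "r b 0 = 0" using r_scale[of b 0 0] by simp

lemma r_sum: "r b (\<Sum>i\<in>A. x i) = (\<Sum>i\<in>A. r b (x i))"
  by (induction A rule: infinite_finite_induct) (auto simp: r_zero r_add)

lemma ip_r: assumes "col i = b" shows "ip (r b x) (a i) = - ip x (a i)"
proof -
  have "ip (r b x) (a i) = ip x (a i) - (\<Sum>j | col j = col i. (2 * ip x (a j)) * g j i)"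
    using assms by (simp add: r_def ip_diff ip_sum ip_scale)
  then show ?thesis using sum_same_colour[of "\<lambda>j. 2 * ip x (a j)" i] by simp
qed

lemma r_r [simp]: "r b (r b x) = x"
proof -
  have "r b (r b x) = r b x - (\<Sum>i | col i = b. (2 * ip (r b x) (a i)) *\<^sub>R a i)" by (rule r_def)
  also have "(\<Sum>i | col i = b. (2 * ip (r b x) (a i)) *\<^sub>R a i) = (\<Sum>i | col i = b. - ((2 * ip x (a i)) *\<^sub>R a i))"
    by (intro sum.cong) (auto simp: ip_r)
  finally show ?thesis by (simp add: r_def sum_negf)
qed

lemma ip_xb_sum: "ip x (xb b) = (\<Sum>i | col i = b. ip x (a i) * z i)"
  by (simp add: xb_def ip_sum_right ip_scale_right mult.commute)

lemma ip_r_xb_same: "ip (r b x) (xb b) = - ip x (xb b)"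
  by (simp add: ip_xb_sum ip_r sum_negf)

lemma ip_r_xb_other: "ip (r b x) (xb (\<not> b)) = ip x (xb (\<not> b)) + 2 * k * ip x (xb b)"
proof -
  have "ip (r b x) (xb (\<not> b)) = ip x (xb (\<not> b)) - (\<Sum>i | col i = b. (2 * ip x (a i)) * ip (a i) (xb (\<not> b)))"
    by (simp add: r_def ip_diff ip_sum ip_scale)
  also have "(\<Sum>i | col i = b. (2 * ip x (a i)) * ip (a i) (xb (\<not> b))) = (\<Sum>i | col i = b. - 2 * k * (ip x (a i) * z i))"
    by (intro sum.cong) (auto simp: ip_xb)
  also have "\<dots> = - 2 * k * ip x (xb b)" by (simp add: ip_xb_sum sum_distrib_left sum_negf)
  finally show ?thesis by simp
qed

lemma r_xb_same: "r b (xb b) = - xb b"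
proof -
  have "(\<Sum>i | col i = b. (2 * ip (xb b) (a i)) *\<^sub>R a i) = (\<Sum>i | col i = b. 2 *\<^sub>R (z i *\<^sub>R a i))"
    by (intro sum.cong) (auto simp: ip_sym[of "xb b"] ip_xb)
  also have "\<dots> = 2 *\<^sub>R xb b" unfolding xb_def by (simp only: scaleR_sum_right)
  finally show ?thesis by (simp add: r_def scaleR_2)
qed

lemma r_xb_other: "r b (xb (\<not> b)) = xb (\<not> b) + (2 * k) *\<^sub>R xb b"
proof -
  have "(\<Sum>i | col i = b. (2 * ip (xb (\<not> b)) (a i)) *\<^sub>R a i) = (\<Sum>i | col i = b. (- 2 * k) *\<^sub>R (z i *\<^sub>R a i))"
    by (intro sum.cong) (auto simp: ip_sym[of "xb _"] ip_xb)
  also have "\<dots> = (- 2 * k) *\<^sub>R xb b" unfolding xb_def by (simp only: scaleR_sum_right)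
  finally show ?thesis by (simp add: r_def)
qed

text \<open>Stated for a class \<open>C\<close> because it is applied twice: to the maps that
  preserve \<open>Phi\<close> and, through \<open>coxeter_plane\<close>, to the maps given by group
  elements.\<close>

lemma r_in_closed_class:
  assumes "id \<in> C" "\<And>f f'. f \<in> C \<Longrightarrow> f' \<in> C \<Longrightarrow> f \<circ> f' \<in> C"
    and "\<And>\<alpha>. \<alpha> \<in> Phi \<Longrightarrow> (\<lambda>x. x - (2 * ip x \<alpha>) *\<^sub>R \<alpha>) \<in> C"
  shows "r b \<in> C"
proof -
  have "(\<lambda>x. x - (\<Sum>i\<in>A. (2 * ip x (a i)) *\<^sub>R a i)) \<in> C" if "A \<subseteq> {i. col i = b}" for A
    using finite[of A] that
  proof (induction A rule: finite_induct)
    case empty then show ?case using assms(1) by (simp add: id_def)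
  next
    case (insert j A)
    let ?f = "\<lambda>x. x - (\<Sum>i\<in>A. (2 * ip x (a i)) *\<^sub>R a i)"
    have "ip (?f x) (a j) = ip x (a j)" for x
    proof -
      have "(\<Sum>i\<in>A. 2 * ip x (a i) * g i j) = 0"
      proof (intro sum.neutral ballI)
        fix i assume "i \<in> A"
        then have "i \<noteq> j" "col i = col j" using insert by auto
        then show "2 * ip x (a i) * g i j = 0" by (simp add: same_colour)
      qed
      then show ?thesis by (simp add: ip_diff ip_sum ip_scale)
    qed
    then have "(\<lambda>x. x - (2 * ip x (a j)) *\<^sub>R a j) \<circ> ?f = (\<lambda>x. x - (\<Sum>i\<in>insert j A. (2 * ip x (a i)) *\<^sub>R a i))"
      using insert.hyps by (auto simp: fun_eq_iff)
    then show ?case using assms(2)[OF assms(3)[OF a_Phi[of j]] insert.IH] insert.prems by simp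
  qed
  then show ?thesis unfolding r_def[abs_def] by blast
qed

lemma r_Phi: "\<beta> \<in> Phi \<Longrightarrow> r b \<beta> \<in> Phi"
  using r_in_closed_class[of "{f. f ` Phi \<subseteq> Phi}" b] refl by fastforce

lemma co_r: "\<beta> \<in> Phi \<Longrightarrow> co (r b \<beta>) = (\<lambda>i. co \<beta> i - (if col i = b then 2 * ip \<beta> (a i) else 0))"
  using co_add_simple[of \<beta> "\<lambda>i. 2 * ip \<beta> (a i)" "{i. col i = b}"] by (simp add: r_def)

text \<open>Up to a common positive factor, \<open>wt True\<close> and \<open>wt False\<close> are
  the coordinates of the projection to the Coxeter plane in the basis \<open>xb True\<close>,
  \<open>xb False\<close>. So positive roots project into the cone of these two vectors.\<close>

definition wt :: "bool \<Rightarrow> real ^ 'n \<Rightarrow> real" where "wt b \<beta> = (\<Sum>i | col i = b. co \<beta> i * z i)"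

lemma ip_wt: assumes "\<beta> \<in> Phi" shows "ip \<beta> (xb b) = wt b \<beta> - k * wt (\<not> b) \<beta>"
proof -
  have "ip \<beta> (xb b) = (\<Sum>i | col i = b. co \<beta> i * ip (a i) (xb b)) + (\<Sum>i | col i = (\<not> b). co \<beta> i * ip (a i) (xb b))"
    using ip_co[OF assms] sum_bool_split by simp
  also have "(\<Sum>i | col i = b. co \<beta> i * ip (a i) (xb b)) = wt b \<beta>"
    unfolding wt_def by (intro sum.cong) (auto simp: ip_xb)
  also have "(\<Sum>i | col i = (\<not> b). co \<beta> i * ip (a i) (xb b)) = - k * wt (\<not> b) \<beta>"
    unfolding wt_def sum_distrib_left by (intro sum.cong) (auto simp: ip_xb)
  finally show ?thesis by simp
qed

lemma wt_nonneg: "(\<And>i. 0 \<le> co \<beta> i) \<Longrightarrow> 0 \<le> wt b \<beta>"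
  unfolding wt_def using z_pos by (intro sum_nonneg mult_nonneg_nonneg) (auto simp: less_imp_le)

lemma wt_nonpos: "(\<And>i. co \<beta> i \<le> 0) \<Longrightarrow> wt b \<beta> \<le> 0"
  unfolding wt_def using z_pos by (intro sum_nonpos mult_nonpos_nonneg) (auto simp: less_imp_le)

lemma wt_sign: "\<beta> \<in> Phi \<Longrightarrow> (0 \<le> wt True \<beta> \<and> 0 \<le> wt False \<beta>) \<or> (wt True \<beta> \<le> 0 \<and> wt False \<beta> \<le> 0)"
  using co_sign[of \<beta>] wt_nonneg[of \<beta>] wt_nonpos[of \<beta>] by blast

lemma wt_not_both_zero:
  assumes \<beta>: "\<beta> \<in> Phi" and wt: "wt True \<beta> = 0" "wt False \<beta> = 0" shows False
proof -
  have s: "(\<Sum>i\<in>UNIV. co \<beta> i * z i) = 0"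
    using sum_bool_split[of "\<lambda>i. co \<beta> i * z i" True] wt by (simp add: wt_def)
  have "co \<beta> i * z i = 0" for i
  proof (cases "\<forall>i. 0 \<le> co \<beta> i")
    case True
    then show ?thesis using s z_pos by (subst (asm) sum_nonneg_eq_0_iff) (auto simp: less_imp_le)
  next
    case False
    then have np: "\<forall>i. co \<beta> i \<le> 0" using co_sign[OF \<beta>] by blast
    have "(\<Sum>i\<in>UNIV. - (co \<beta> i * z i)) = 0" using s by (simp add: sum_negf)
    then have "- (co \<beta> i * z i) = 0"
      using np z_pos by (subst (asm) sum_nonneg_eq_0_iff) (auto simp: less_imp_le mult_nonpos_nonneg)
    then show ?thesis by simp
  qed
  then have "co \<beta> i = 0" for i using z_pos[of i] by (metis less_irrefl mult_eq_0_iff)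
  then have "\<beta> = 0" using co[OF \<beta>] by simp
  then show False using unit[OF \<beta>] by (simp add: ip_zero)
qed

definition theta where "theta = arccos k"

lemma theta: "cos theta = k" "0 < theta" "theta < pi / 2" "0 < sin theta"
proof -
  show c: "cos theta = k" using k by (simp add: theta_def)
  show 0: "0 < theta" unfolding theta_def using k arccos_lt_bounded[of k] by simp
  show "theta < pi / 2"
  proof (rule ccontr)
    assume "\<not> ?thesis"
    moreover have "theta \<le> pi" unfolding theta_def using k by (intro arccos_ubound) auto
    ultimately have "cos theta \<le> 0" by (intro cos_monotone_0_pi_le[of "pi/2" theta, simplified]) auto
    then show False using c k by simp
  qed
  then show "0 < sin theta" using 0 by (intro sin_gt_zero) auto
qed

text \<open>A complex coordinate on the Coxeter plane, zero on its orthogonal complement, in which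
  \<open>c\<close> acts as a rotation.\<close>

definition psi :: "real ^ 'n \<Rightarrow> complex" where
  "psi x = of_real (ip x (xb True)) + cis theta * of_real (ip x (xb False))"

lemma psi_wt: assumes "\<beta> \<in> Phi"
  shows "psi \<beta> = \<i> * sin theta * (of_real (wt False \<beta>) - of_real (wt True \<beta>) * cis theta)"
proof -
  have s: "sin theta * sin theta = 1 - k * k" using sin_cos_squared_add[of theta] theta(1)
    by (simp add: power2_eq_square algebra_simps)
  define K S T F where "K = complex_of_real k" "S = complex_of_real (sin theta)"
    "T = complex_of_real (wt True \<beta>)" "F = complex_of_real (wt False \<beta>)"
  have e: "cis theta = K + \<i> * S" by (simp add: K_S_T_F_def complex_eq_iff theta(1))
  have S: "S * S = 1 - K * K" unfolding K_S_T_F_def using s by (simp flip: of_real_mult)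
  have "T - K * F + (K + \<i> * S) * (F - K * T) = \<i> * S * F + T * (1 - K * K) - \<i> * S * K * T"
    by (simp add: algebra_simps)
  also have "\<dots> = \<i> * S * (F - T * (K + \<i> * S))"
    unfolding S[symmetric] by (simp add: algebra_simps)
  finally show ?thesis unfolding psi_def ip_wt[OF assms] e by (simp add: K_S_T_F_def)
qed

text \<open>No root is orthogonal to the Coxeter plane, since both of its weights would vanish. This
  will make the eigenvector of the Coxeter element regular.\<close>

lemma psi_nonzero: assumes "\<beta> \<in> Phi" shows "psi \<beta> \<noteq> 0"
proof
  assume "psi \<beta> = 0"
  then have 0: "complex_of_real (wt False \<beta>) - of_real (wt True \<beta>) * cis theta = 0"
    using psi_wt[OF assms] theta(4) by simp
  then have "Im (complex_of_real (wt False \<beta>) - of_real (wt True \<beta>) * cis theta) = 0" by simp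
  then have "wt True \<beta> = 0" using theta(4) by simp
  moreover from this have "wt False \<beta> = 0" using 0 by simp
  ultimately show False using wt_not_both_zero[OF assms] by blast
qed

definition c where "c = r False \<circ> r True"

lemma psi_c: "psi (c x) = cis (- (2 * theta)) * psi x"
proof -
  have e: "cis theta * cis (- theta) = 1" "2 * complex_of_real k = cis theta + cis (- theta)"
    by (simp_all add: cis_mult complex_eq_iff theta(1))
  have e2: "cis (- (2 * theta)) = cis (- theta) * cis (- theta)" by (simp add: cis_mult)
  define p where "p = complex_of_real (ip x (xb True))"
  define q where "q = complex_of_real (ip x (xb False))"
  have rp: "ip (r True x) (xb True) = - ip x (xb True)"
    "ip (r True x) (xb False) = ip x (xb False) + 2 * k * ip x (xb True)"
    using ip_r_xb_same[of True x] ip_r_xb_other[of True x] by auto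
  have "ip (c x) (xb True) = ip (r True x) (xb True) + 2 * k * ip (r True x) (xb False)"
    "ip (c x) (xb False) = - ip (r True x) (xb False)"
    using ip_r_xb_same[of False "r True x"] ip_r_xb_other[of False "r True x"] by (auto simp: c_def)
  then have AB: "ip (c x) (xb True) = - ip x (xb True) + 2 * k * (ip x (xb False) + 2 * k * ip x (xb True))"
    "ip (c x) (xb False) = - (ip x (xb False) + 2 * k * ip x (xb True))"
    unfolding rp by auto
  have "psi (c x) = - p + 2 * of_real k * (q + 2 * of_real k * p) - cis theta * (q + 2 * of_real k * p)"
    unfolding psi_def AB by (simp add: p_def q_def algebra_simps)
  also have "\<dots> = - p + (2 * of_real k - cis theta) * (q + 2 * of_real k * p)" by (simp add: algebra_simps)
  also have "\<dots> = - p + cis (- theta) * (q + (cis theta + cis (- theta)) * p)" unfolding e(2) by simp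
  also have "\<dots> = - p + (cis theta * cis (- theta)) * p + cis (- theta) * q + cis (- theta) * cis (- theta) * p"
    by (simp add: algebra_simps del: cis_mult)
  also have "\<dots> = cis (- theta) * (1 * q) + cis (- theta) * cis (- theta) * p" by (simp add: e(1) del: cis_mult)
  also have "\<dots> = cis (- theta) * cis (- theta) * (p + cis theta * q)"
    unfolding e(1)[symmetric] by (simp add: algebra_simps del: cis_mult)
  finally show ?thesis unfolding e2 by (simp add: psi_def p_def q_def del: cis_mult)
qed

lemma psi_c_pow: "psi ((c ^^ j) x) = cis (- (2 * real j * theta)) * psi x"
proof (induction j)
  case (Suc j)
  have "psi ((c ^^ Suc j) x) = cis (- (2 * theta)) * (cis (- (2 * real j * theta)) * psi x)"
    by (simp add: psi_c Suc)
  moreover have "cis (- (2 * theta)) * cis (- (2 * real j * theta)) = cis (- (2 * real (Suc j) * theta))"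
    by (simp add: cis_mult algebra_simps)
  ultimately show ?case by (simp only: mult.assoc[symmetric])
qed simp

lemma c_Phi: "\<beta> \<in> Phi \<Longrightarrow> c \<beta> \<in> Phi" by (simp add: c_def r_Phi)

lemma c_pow_Phi: "\<beta> \<in> Phi \<Longrightarrow> (c ^^ j) \<beta> \<in> Phi" by (induction j) (auto simp: c_Phi)

lemma both_colours: "\<exists>i. col i = b"
proof -
  obtain i :: 'n where True by simp
  have "{i} \<noteq> UNIV"
  proof
    assume "{i} = UNIV"
    then have "CARD('n) = 1" by (metis card.empty card_insert_disjoint empty_iff finite.emptyI One_nat_def)
    then show False using rank by simp
  qed
  have "\<not> (\<forall>j. j \<noteq> i \<longrightarrow> g i j = 0)"
  proof
    assume 0: "\<forall>j. j \<noteq> i \<longrightarrow> g i j = 0"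
    have "{i} = {} \<or> {i} = UNIV" by (rule connected) (use 0 in auto)
    then show False using \<open>{i} \<noteq> UNIV\<close> by simp
  qed
  then obtain j where j: "j \<noteq> i" "g i j \<noteq> 0" by blast
  then have "col i \<noteq> col j" using col[of i j] by simp
  then show ?thesis by (metis (full_types))
qed

lemma psi_a: "psi (a i) = (if col i then - (\<i> * sin theta * z i * cis theta) else \<i> * sin theta * z i)"
proof -
  have "wt b (a i) = (if col i = b then z i else 0)" for b
  proof -
    have "wt b (a i) = (\<Sum>j | col j = b. if j = i then z i else 0)"
      unfolding wt_def co_a by (intro sum.cong) auto
    then show ?thesis by simp
  qed
  then show ?thesis using psi_wt[OF a_Phi[of i]] by simp
qed

text \<open>The Coxeter number. The rounding is provisional: \<open>h_theta\<close> shows that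
  \<open>pi / theta\<close> is an integer.\<close>

definition h :: nat where "h = nat \<lceil>pi / theta\<rceil>"

text \<open>Write h = m + 1. If \<open>pi\<close> lay strictly between m theta and h theta, the
  image of some simple root under a power of \<open>c\<close> would have weights in the ratio of sin
  (m theta) to sin (h theta), which have opposite signs.\<close>

lemma h_theta: "real h * theta = pi" "2 \<le> h"
proof -
  have ratio: "2 < pi / theta" using theta by (simp add: field_simps)
  have hr: "real h = of_int \<lceil>pi / theta\<rceil>" unfolding h_def using ratio by simp
  have up: "pi / theta \<le> real h" unfolding hr by (rule le_of_int_ceiling)
  have lo: "real h - 1 < pi / theta" unfolding hr using ceiling_correct[of "pi / theta"] by simp
  show h2: "2 \<le> h" using ratio up by simp
  obtain m where m: "h = Suc m" using h2 by (cases h) auto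
  have m1: "1 \<le> m" using h2 m by simp
  have lo': "real m * theta < pi" using lo theta(2) m by (simp add: field_simps)
  have up': "pi \<le> real h * theta" using up theta(2) by (simp add: field_simps)
  show "real h * theta = pi"
  proof (rule ccontr)
    assume "real h * theta \<noteq> pi"
    then have gt: "pi < real h * theta" using up' by simp
    have lt: "real h * theta < 2 * pi" using lo' theta m by (simp add: field_simps)
    have "\<exists>\<beta>\<in>Phi. \<exists>R. R \<noteq> 0 \<and> psi \<beta> = \<i> * sin theta * (of_real R * cis (- (real m * theta)))"
    \<comment> \<open>Powers of \<open>c\<close> rotate by even multiples of \<open>theta\<close>;
      the colour of the initial simple root supplies the parity of \<open>m\<close>.\<close>
    proof (cases "even m")
      case True
      then obtain j where j: "m = 2 * j" by blast
      obtain i where i: "col i = False" using both_colours by blast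
      have "psi ((c ^^ j) (a i)) = \<i> * sin theta * (of_real (z i) * cis (- (real m * theta)))"
        unfolding psi_c_pow psi_a using i j by simp
      then show ?thesis using c_pow_Phi[OF a_Phi] z_pos[of i] by (metis less_irrefl)
    next
      case False
      then obtain j where j: "Suc m = 2 * j" by (metis even_Suc evenE)
      then have j': "2 * real j = real m + 1" by (metis of_nat_Suc of_nat_mult of_nat_numeral add.commute)
      obtain i where i: "col i = True" using both_colours by blast
      have "cis (- (2 * real j * theta)) * cis theta = cis (- (real m * theta))"
        unfolding j' by (simp add: cis_mult algebra_simps)
      then have "psi ((c ^^ j) (a i)) = \<i> * sin theta * (of_real (- z i) * cis (- (real m * theta)))"
        unfolding psi_c_pow psi_a using i by (simp add: algebra_simps)
      then show ?thesis using c_pow_Phi[OF a_Phi] z_pos[of i] by (metis less_irrefl neg_equal_0_iff_equal)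
    qed
    then obtain \<beta> R where \<beta>: "\<beta> \<in> Phi" "R \<noteq> 0"
      "psi \<beta> = \<i> * sin theta * (of_real R * cis (- (real m * theta)))" by blast
    then have "complex_of_real (wt False \<beta>) - of_real (wt True \<beta>) * cis theta = of_real R * cis (- (real m * theta))"
      using psi_wt[OF \<beta>(1)] theta(4) by simp
    then have im: "wt True \<beta> * sin theta = R * sin (real m * theta)"
      and re: "wt False \<beta> - wt True \<beta> * cos theta = R * cos (real m * theta)"
      by (auto simp: complex_eq_iff)
    have "wt False \<beta> * sin theta = R * (sin (real m * theta) * cos theta + cos (real m * theta) * sin theta)"
    proof -
      have "wt False \<beta> * sin theta = (R * cos (real m * theta)) * sin theta + (wt True \<beta> * sin theta) * cos theta"
        using re by (simp add: algebra_simps)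
      then show ?thesis unfolding im by (simp add: algebra_simps)
    qed
    also have "sin (real m * theta) * cos theta + cos (real m * theta) * sin theta = sin (real h * theta)"
      by (simp add: m sin_add distrib_right)
    finally have f: "wt False \<beta> * sin theta = R * sin (real h * theta)" .
    have s1: "0 < sin (real m * theta)" using m1 theta(2) lo' by (intro sin_gt_zero mult_pos_pos) auto
    have s2: "sin (real h * theta) < 0" by (rule sin_lt_zero[OF gt lt])
    have "(wt True \<beta> * wt False \<beta>) * (sin theta * sin theta) = (R * R) * (sin (real m * theta) * sin (real h * theta))"
      using im f by (metis mult.assoc mult.left_commute)
    moreover have "(R * R) * (sin (real m * theta) * sin (real h * theta)) < 0"
      using \<beta>(2) s1 s2 by (intro mult_pos_neg) (auto simp: zero_less_mult_iff not_less_iff_gr_or_eq)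
    moreover have "0 \<le> (wt True \<beta> * wt False \<beta>) * (sin theta * sin theta)"
    proof (intro mult_nonneg_nonneg[OF _ zero_le_square])
      show "0 \<le> wt True \<beta> * wt False \<beta>"
        using wt_sign[OF \<beta>(1)] by (auto intro: mult_nonneg_nonneg mult_nonpos_nonpos)
    qed
    ultimately show False by simp
  qed
qed

text \<open>A fixed vector satisfies \<open>r True x = r False x\<close>, which is a linear relation
  among the simple roots; independence makes \<open>x\<close> orthogonal to all of them.\<close>

lemma c_no_fixed: assumes "c x = x" shows "x = 0"
proof -
  have "r True x = r False x" using arg_cong[OF assms, of "r False"] by (simp add: c_def)
  then have eq: "(\<Sum>i | col i = True. (2 * ip x (a i)) *\<^sub>R a i) = (\<Sum>i | col i = False. (2 * ip x (a i)) *\<^sub>R a i)"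
    by (simp add: r_def)
  have "(\<Sum>i\<in>UNIV. (if col i then 2 * ip x (a i) else - (2 * ip x (a i))) *\<^sub>R a i) =
      (\<Sum>i | col i = True. (2 * ip x (a i)) *\<^sub>R a i) - (\<Sum>i | col i = False. (2 * ip x (a i)) *\<^sub>R a i)"
  proof -
    have "UNIV = {i. col i = True} \<union> {i. col i = False}" by auto
    then have "(\<Sum>i\<in>UNIV. (if col i then 2 * ip x (a i) else - (2 * ip x (a i))) *\<^sub>R a i) =
        (\<Sum>i\<in>{i. col i = True} \<union> {i. col i = False}. (if col i then 2 * ip x (a i) else - (2 * ip x (a i))) *\<^sub>R a i)" by simp
    also have "\<dots> = (\<Sum>i | col i = True. (2 * ip x (a i)) *\<^sub>R a i) + (\<Sum>i | col i = False. - ((2 * ip x (a i)) *\<^sub>R a i))"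
      by (subst sum.union_disjoint) (auto intro!: arg_cong2[where f = "(+)"] sum.cong)
    finally show ?thesis by (simp add: sum_negf)
  qed
  then have "(\<Sum>i\<in>UNIV. (if col i then 2 * ip x (a i) else - (2 * ip x (a i))) *\<^sub>R a i) = 0" using eq by simp
  then have "(if col i then 2 * ip x (a i) else - (2 * ip x (a i))) = 0" for i by (rule indep)
  then have ai: "ip x (a i) = 0" for i by (metis mult_eq_0_iff neg_equal_0_iff_equal zero_neq_numeral)
  show "x = 0"
  proof (rule total)
    fix \<beta> assume "\<beta> \<in> Phi"
    from ip_co[OF this, of x] have "ip \<beta> x = 0" using ai by (simp add: ip_sym[of "a _" x])
    then show "ip x \<beta> = 0" by (subst ip_sym)
  qed
qed

subsection \<open>The number of roots\<close>

text \<open>The positive roots that \<open>c\<close> makes negative, one for each simple root; they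
  represent the orbits of \<open>c\<close> on the roots.\<close>

definition gam where "gam i = (if col i then a i else r True (a i))"

lemma gam_Phi: "gam i \<in> Phi" by (simp add: gam_def a_Phi r_Phi)

lemma psi_gam: "psi (gam i) = - (\<i> * sin theta * z i * cis (real (if col i then 1 else 2) * theta))"
proof (cases "col i")
  case True then show ?thesis using psi_a[of i] by (simp add: gam_def)
next
  case False
  have "ip (r True (a i)) (xb True) = k * z i"
    using ip_r_xb_same[of True "a i"] ip_xb[of i True] False by simp
  moreover have "ip (r True (a i)) (xb False) = z i - 2 * k * (k * z i)"
    using ip_r_xb_other[of True "a i"] ip_xb[of i True] ip_xb[of i False] False by simp
  ultimately have p: "psi (gam i) = of_real (k * z i) + cis theta * of_real (z i - 2 * k * (k * z i))"
    using False by (simp add: gam_def psi_def)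
  have s: "sin theta * sin theta = 1 - k * k" using sin_cos_squared_add[of theta] theta(1)
    by (simp add: power2_eq_square algebra_simps)
  have c2: "cos (2 * theta) = 2 * k * k - 1" "sin (2 * theta) = 2 * sin theta * k"
    using cos_double[of theta] sin_double[of theta] s theta(1) by (auto simp: power2_eq_square)
  have "sin theta * z i * sin (2 * theta) = (sin theta * sin theta) * (2 * k * z i)"
    unfolding c2 by (simp add: algebra_simps)
  then have re: "k * z i + k * (z i - 2 * k * (k * z i)) = sin theta * z i * sin (2 * theta)"
    unfolding s by (simp add: algebra_simps)
  have im: "sin theta * (z i - 2 * k * (k * z i)) = - (sin theta * z i * cos (2 * theta))"
    unfolding c2 by (simp add: algebra_simps)
  show ?thesis unfolding p
    by (rule complex_eqI) (use False re im in \<open>simp_all add: theta(1) algebra_simps\<close>)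
qed

lemma c_inj: "inj c"
proof -
  have "inj (r b)" for b by (metis injI r_r)
  then show ?thesis unfolding c_def by (intro inj_compose)
qed

lemma cis_theta_eq:
  assumes "cis (real m * theta) = cis (real n * theta)" shows "m mod (2 * h) = n mod (2 * h)"
proof -
  have "real h * theta = pi" "0 < h" using h_theta by auto
  then have th: "theta = pi / real h" by (simp add: field_simps)
  have "exp (2 * of_real pi * \<i> * of_nat m / of_nat (2 * h)) = exp (2 * of_real pi * \<i> * of_nat n / of_nat (2 * h))"
    using assms unfolding th cis_conv_exp by (simp add: field_simps)
  then show ?thesis using complex_root_unity_eq[of "2 * h" m n] \<open>0 < h\<close> by simp
qed

text \<open>In the coordinate \<open>psi\<close> the root has a modulus proportional to
  \<open>z i\<close> and, up to a constant, the argument (d - 2 j) theta, where d is 1 or 2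
  according to the colour. Parity gives the colour, then the argument gives \<open>j\<close>, and
  injectivity of \<open>c\<close> gives the root.\<close>

lemma orbit_inj: "inj_on (\<lambda>(i, j). (c ^^ j) (gam i)) (UNIV \<times> {..<h})"
proof (rule inj_onI, clarsimp)
  fix i j i' j' assume j: "j < h" "j' < h" and eq: "(c ^^ j) (gam i) = (c ^^ j') (gam i')"
  define d where "d i = (if col i then 1 else 2 :: nat)" for i
  have d: "d i = 1 \<or> d i = 2" for i by (simp add: d_def)
  have "cis (- (2 * real j * theta)) * (of_real (z i) * cis (real (d i) * theta)) =
      cis (- (2 * real j' * theta)) * (of_real (z i') * cis (real (d i') * theta))"
  proof -
    have "- (\<i> * sin theta) * (cis (- (2 * real j * theta)) * (of_real (z i) * cis (real (d i) * theta))) = psi ((c ^^ j) (gam i))"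
      for i j by (simp add: psi_c_pow psi_gam d_def)
    from this[of j i] this[of j' i'] eq
    have "- (\<i> * sin theta) * (cis (- (2 * real j * theta)) * (of_real (z i) * cis (real (d i) * theta))) =
      - (\<i> * sin theta) * (cis (- (2 * real j' * theta)) * (of_real (z i') * cis (real (d i') * theta)))"
      by metis
    then show ?thesis by (subst (asm) mult_cancel_left) (use theta(4) in auto)
  qed
  then have e: "of_real (z i) * cis (real (d i) * theta - 2 * real j * theta) =
      of_real (z i') * cis (real (d i') * theta - 2 * real j' * theta)"
    by (simp add: cis_mult mult.left_commute[of "cis _"] add.commute[of "- _"])
  then have "norm (complex_of_real (z i) * cis (real (d i) * theta - 2 * real j * theta)) =
      norm (complex_of_real (z i') * cis (real (d i') * theta - 2 * real j' * theta))" by simp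
  then have "z i = z i'" using z_pos[of i] z_pos[of i'] by (simp add: norm_mult)
  then have "cis (real (d i) * theta - 2 * real j * theta) = cis (real (d i') * theta - 2 * real j' * theta)"
    using e z_pos[of i'] by simp
  then have "cis (real (d i) * theta - 2 * real j * theta) * cis (2 * real j * theta + 2 * real j' * theta) =
      cis (real (d i') * theta - 2 * real j' * theta) * cis (2 * real j * theta + 2 * real j' * theta)" by simp
  then have "cis (real (d i + 2 * j') * theta) = cis (real (d i' + 2 * j) * theta)"
    by (simp add: cis_mult algebra_simps)
  then have "(d i + 2 * j') mod (2 * h) = (d i' + 2 * j) mod (2 * h)" by (rule cis_theta_eq)
  then obtain q1 q2 where q: "d i + 2 * j' + 2 * h * q1 = d i' + 2 * j + 2 * h * q2"
    using nat_mod_eq_iff by blast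
  define u v where "u = h * q1" "v = h * q2"
  have q': "d i + 2 * j' + 2 * u = d i' + 2 * j + 2 * v" using q by (simp add: u_v_def)
  \<comment> \<open>Only \<open>d i\<close> and \<open>d i'\<close> remain modulo 2.\<close>
  then have di: "d i = d i'" using d[of i] d[of i'] by presburger
  then have "j' + h * q1 = j + h * q2" using q' by (simp add: u_v_def)
  then have "j' mod h = j mod h" by (metis mod_mult_self2)
  then have jj: "j = j'" using j by simp
  then have "gam i = gam i'" using eq injD[OF inj_fn[OF c_inj]] by blast
  moreover have "col i = col i'" using di by (simp add: d_def split: if_splits)
  ultimately have "a i = a i'" unfolding gam_def by (metis r_r)
  then show "i = i' \<and> j = j'" using a_inj jj by (simp add: inj_eq)
qed

text \<open>Reflecting in \<open>a i\<close> changes the sign of the \<open>i\<close>-th coefficient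
  alone, so a second positive coefficient would leave a root of mixed signs. The remaining factor is
  1 since roots have length 1.\<close>

lemma root_in_colour_class:
  assumes \<beta>: "\<beta> \<in> Phi" "\<And>i. 0 \<le> co \<beta> i" "\<And>i. col i \<noteq> b \<Longrightarrow> co \<beta> i = 0"
  shows "\<exists>i. col i = b \<and> \<beta> = a i"
proof -
  have ipb: "ip \<beta> (a i) = co \<beta> i" if "col i = b" for i
  proof -
    have "ip \<beta> (a i) = (\<Sum>j | col j = col i. co \<beta> j * g j i)"
      unfolding ip_co[OF \<beta>(1)] using \<beta>(3) that by (intro sum.mono_neutral_right) auto
    then show ?thesis by (simp add: sum_same_colour)
  qed
  have "\<not> (\<forall>i. co \<beta> i = 0)"
  proof
    assume "\<forall>i. co \<beta> i = 0"
    then have "\<beta> = 0" using co[OF \<beta>(1)] by simp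
    then show False using unit[OF \<beta>(1)] by (simp add: ip_zero)
  qed
  then obtain i where i: "0 < co \<beta> i" using \<beta>(2) by (metis less_eq_real_def)
  have ci: "col i = b" using i \<beta>(3)[of i] by fastforce
  have other: "co \<beta> j = 0" if "j \<noteq> i" for j
  proof (rule ccontr)
    assume "co \<beta> j \<noteq> 0"
    then have j: "0 < co \<beta> j" using \<beta>(2)[of j] by simp
    have "co (s i \<beta>) i = - co \<beta> i" "co (s i \<beta>) j = co \<beta> j"
      using that by (auto simp: co_s[OF \<beta>(1)] ipb[OF ci])
    then show False using co_sign[OF s_Phi[OF \<beta>(1), of i]] i j
      by (metis neg_0_le_iff_le not_le)
  qed
  have \<beta>i: "\<beta> = co \<beta> i *\<^sub>R a i"
  proof -
    have "(\<Sum>j\<in>UNIV. co \<beta> j *\<^sub>R a j) = (\<Sum>j\<in>{i}. co \<beta> j *\<^sub>R a j)"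
      using other by (intro sum.mono_neutral_right) auto
    then show ?thesis using co[OF \<beta>(1)] by simp
  qed
  then have "1 = co \<beta> i * co \<beta> i" using unit[OF \<beta>(1)] by (metis g_diag ip_scale ip_scale_right mult.right_neutral)
  then have "co \<beta> i = 1" using i by (metis less_eq_real_def mult_cancel_left1 real_sqrt_mult_self real_sqrt_one abs_of_nonneg real_sqrt_abs2)
  then show ?thesis using \<beta>i ci by (intro exI[of _ i]) simp
qed

text \<open>The two factors of \<open>c\<close> change coefficients of one colour each. If
  \<open>r True\<close> leaves the root positive, the sign change by \<open>r False\<close> shows
  that the intermediate root is supported on the colour \<open>False\<close>; otherwise \<gamma>
  itself is supported on the colour \<open>True\<close>.\<close>

lemma descent_is_gam:
  assumes \<gamma>: "\<gamma> \<in> Phi" "\<And>i. 0 \<le> co \<gamma> i" and neg': "\<And>i. co (c \<gamma>) i \<le> 0"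
  shows "\<exists>i. \<gamma> = gam i"
proof -
  let ?\<delta> = "r True \<gamma>"
  have \<delta>: "?\<delta> \<in> Phi" by (rule r_Phi[OF \<gamma>(1)])
  show ?thesis
  proof (cases "\<forall>i. 0 \<le> co ?\<delta> i")
    case True
    have "co ?\<delta> i = 0" if "col i \<noteq> False" for i
    proof -
      have "co (c \<gamma>) i = co ?\<delta> i" using that by (simp add: c_def co_r[OF \<delta>])
      then show ?thesis using neg'[of i] True by (metis antisym)
    qed
    then obtain i where i: "col i = False" "?\<delta> = a i" using root_in_colour_class[OF \<delta>, of False] True by blast
    then have "\<gamma> = r True (a i)" by (metis r_r)
    then show ?thesis using i by (intro exI[of _ i]) (simp add: gam_def)
  next
    case False
    then have np: "\<forall>i. co ?\<delta> i \<le> 0" using co_sign[OF \<delta>] by blast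
    have "co \<gamma> i = 0" if "col i \<noteq> True" for i
    proof -
      have "co ?\<delta> i = co \<gamma> i" using that by (simp add: co_r[OF \<gamma>(1)])
      then show ?thesis using np \<gamma>(2)[of i] by (metis antisym)
    qed
    then obtain i where "col i = True" "\<gamma> = a i" using root_in_colour_class[OF \<gamma>, of True] by blast
    then show ?thesis by (intro exI[of _ i]) (simp add: gam_def)
  qed
qed

text \<open>The orbit sums of \<open>c\<close> vanish, so every orbit contains a positive root that \<open>c\<close> makes negative.\<close>

lemma orbit_surj:
  assumes ch: "c ^^ h = id" and \<beta>: "\<beta> \<in> Phi"
  shows "\<exists>i. \<exists>j<h. \<beta> = (c ^^ j) (gam i)"
proof -
  have h0: "0 < h" using h_theta by simp
  define b where "b j = (c ^^ j) \<beta>" for j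
  have bP: "b j \<in> Phi" for j unfolding b_def by (rule c_pow_Phi[OF \<beta>])
  have per: "b (j + h) = b j" for j by (simp add: b_def funpow_add ch)
  define pos where "pos j \<longleftrightarrow> (\<forall>i. 0 \<le> co (b j) i)" for j
  \<comment> \<open>Positive on positive roots and negative on negative ones, so a vanishing orbit
    sum contains both kinds.\<close>
  define val where "val x = ip x (xb True + xb False)" for x
  have val: "val \<gamma> = (1 - k) * (wt True \<gamma> + wt False \<gamma>)" if "\<gamma> \<in> Phi" for \<gamma>
    using ip_wt[OF that, of True] ip_wt[OF that, of False] by (simp add: val_def ip_add_right algebra_simps)
  have vpos: "0 < val (b j)" if "pos j" for j
  proof -
    have "0 \<le> wt True (b j)" "0 \<le> wt False (b j)" using that wt_nonneg by (auto simp: pos_def)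
    moreover have "wt True (b j) \<noteq> 0 \<or> wt False (b j) \<noteq> 0" using wt_not_both_zero[OF bP[of j]] by blast
    ultimately have "0 < wt True (b j) + wt False (b j)" by linarith
    then show ?thesis using val[OF bP] k by simp
  qed
  have vneg: "val (b j) < 0" if "\<not> pos j" for j
  proof -
    have "\<forall>i. co (b j) i \<le> 0" using that co_sign[OF bP[of j]] by (auto simp: pos_def)
    then have "wt True (b j) \<le> 0" "wt False (b j) \<le> 0" using wt_nonpos by auto
    moreover have "wt True (b j) \<noteq> 0 \<or> wt False (b j) \<noteq> 0" using wt_not_both_zero[OF bP[of j]] by blast
    ultimately have "wt True (b j) + wt False (b j) < 0" by linarith
    then show ?thesis using val[OF bP] k by (simp add: mult_pos_neg)
  qed
  have c_sum: "c (\<Sum>j<h. b j) = (\<Sum>j<h. b j)"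
  proof -
    have "c (\<Sum>j<h. b j) = (\<Sum>j<h. b (Suc j))" by (simp add: c_def r_sum b_def)
    also have "\<dots> = (\<Sum>j<h. b j) + b h - b 0"
      using sum.lessThan_Suc_shift[of b h] by simp
    finally show ?thesis using per[of 0] by simp
  qed
  then have "(\<Sum>j<h. b j) = 0" by (rule c_no_fixed)
  then have v0: "(\<Sum>j<h. val (b j)) = 0" by (simp add: val_def ip_sum[symmetric] ip_zero)
  have "\<exists>j1<h. \<not> pos j1"
  proof (rule ccontr)
    assume "\<not> ?thesis"
    then have "0 < (\<Sum>j<h. val (b j))" using vpos h0 by (intro sum_pos) auto
    then show False using v0 by simp
  qed
  then obtain j1 where j1: "j1 < h" "\<not> pos j1" by blast
  have "\<exists>j2<h. pos j2"
  proof (rule ccontr)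
    assume "\<not> ?thesis"
    then have "0 < (\<Sum>j<h. - val (b j))" using vneg h0 by (intro sum_pos) auto
    then show False using v0 by (simp add: sum_negf)
  qed
  then obtain j2 where j2: "j2 < h" "pos j2" by blast
  have "\<not> pos (j2 + (j1 + h - j2))" using j1 j2 per[of j1] by (simp add: pos_def)
  then have ex: "\<exists>d. \<not> pos (j2 + d)" by blast
  define d where "d = (LEAST d. \<not> pos (j2 + d))"
  have d: "\<not> pos (j2 + d)" unfolding d_def by (rule LeastI_ex[OF ex])
  then have "d \<noteq> 0" using j2 by (metis add_0_right)
  then obtain d' where d': "d = Suc d'" using not0_implies_Suc by blast
  have "pos (j2 + d')" using not_less_Least[of d' "\<lambda>d. \<not> pos (j2 + d)"] d' by (auto simp: d_def)
  define m where "m = j2 + d'"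
  have m: "pos m" "\<not> pos (Suc m)" using \<open>pos (j2 + d')\<close> d d' by (auto simp: m_def)
  have "co (c (b m)) i \<le> 0" for i
    using m(2) co_sign[OF bP[of "Suc m"]] by (auto simp: pos_def b_def)
  then obtain i where i: "b m = gam i" using descent_is_gam[OF bP[of m]] m(1) by (auto simp: pos_def)
  \<comment> \<open>\<open>l\<close> further steps complete a multiple of the period and lead from
    \<open>b m\<close> back to \<beta>.\<close>
  define l where "l = (h - m mod h) mod h"
  have "(l + m) mod h = 0"
  proof -
    have "(l + m) mod h = ((h - m mod h) + m mod h) mod h" by (simp only: l_def mod_add_left_eq mod_add_right_eq)
    also have "(h - m mod h) + m mod h = h" using h0 by (simp add: less_imp_le)
    finally show ?thesis by simp
  qed
  then obtain q where q: "l + m = h * q" by auto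
  have "(c ^^ (h * q)) = id"
    by (induction q) (auto simp: funpow_add ch)
  then have "(c ^^ l) (b m) = \<beta>" using q by (simp add: b_def funpow_add[symmetric] flip: comp_apply[of "c ^^ l"])
  moreover have "l < h" using h0 by (simp add: l_def)
  ultimately show ?thesis using i by metis
qed

text \<open>On the Coxeter plane \<open>c ^^ h\<close> is the identity by \<open>h_theta\<close>; on
  the whole space this is supplied later by the freeness of regular orbits.\<close>

lemma card_Phi: assumes "c ^^ h = id" shows "card Phi = CARD('n) * h"
proof -
  have "(\<lambda>(i, j). (c ^^ j) (gam i)) ` (UNIV \<times> {..<h}) = Phi"
  proof
    show "(\<lambda>(i, j). (c ^^ j) (gam i)) ` (UNIV \<times> {..<h}) \<subseteq> Phi" using c_pow_Phi[OF gam_Phi] by auto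
    show "Phi \<subseteq> (\<lambda>(i, j). (c ^^ j) (gam i)) ` (UNIV \<times> {..<h})" using orbit_surj[OF assms] by fastforce
  qed
  then show ?thesis using card_image[OF orbit_inj] by (simp add: card_cartesian_product)
qed

end

text \<open>Collects what the complex group needs. The class \<open>C\<close> lets the two
  involutions be recognized as group elements, and the number of roots stays conditional on the
  order of their product.\<close>

theorem (in root_base) coxeter_plane:
  assumes irred: "\<And>A B. A \<union> B = Phi \<Longrightarrow> (\<And>\<alpha> \<beta>. \<alpha> \<in> A \<Longrightarrow> \<beta> \<in> B \<Longrightarrow> ip \<alpha> \<beta> = 0) \<Longrightarrow> A = {} \<or> B = {}"
    and rank: "2 \<le> CARD('n)"
    and C: "id \<in> C" "\<And>f f'. f \<in> C \<Longrightarrow> f' \<in> C \<Longrightarrow> f \<circ> f' \<in> C"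
      "\<And>\<alpha>. \<alpha> \<in> Phi \<Longrightarrow> (\<lambda>x. x - (2 * ip x \<alpha>) *\<^sub>R \<alpha>) \<in> C"
  shows "\<exists>h x1 x2 r1 r2. 2 \<le> h \<and> r1 \<in> C \<and> r2 \<in> C \<and> (\<forall>x. r1 (r1 x) = x) \<and> (\<forall>x. r2 (r2 x) = x) \<and>
    r1 x1 = - x1 \<and> r1 x2 = x2 + (2 * cos (pi / real h)) *\<^sub>R x1 \<and>
    r2 x2 = - x2 \<and> r2 x1 = x1 + (2 * cos (pi / real h)) *\<^sub>R x2 \<and>
    (\<forall>\<beta>\<in>Phi. of_real (ip \<beta> x1) + cis (pi / real h) * of_real (ip \<beta> x2) \<noteq> 0) \<and>
    (\<forall>x. r2 (r1 x) = x \<longrightarrow> x = 0) \<and>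
    ((r2 \<circ> r1) ^^ h = id \<longrightarrow> card Phi = CARD('n) * h)"
proof -
  obtain a :: "'n \<Rightarrow> real ^ 'n" where a: "inj a" "range a \<subseteq> Phi" "\<forall>i j. i \<noteq> j \<longrightarrow> ip (a i) (a j) \<le> 0"
    "\<forall>c. (\<Sum>i\<in>UNIV. c i *\<^sub>R a i) = 0 \<longrightarrow> (\<forall>i. c i = 0)"
    "\<forall>\<beta>\<in>Phi. \<exists>b. \<beta> = (\<Sum>i\<in>UNIV. b i *\<^sub>R a i) \<and> ((\<forall>i. 0 \<le> b i) \<or> (\<forall>i. b i \<le> 0))"
    using exists_simple_roots by (elim exE conjE) (rule that, assumption+)
  interpret root_simple ip Phi a
    by unfold_locales (use a irred rank in auto)
  obtain col :: "'n \<Rightarrow> bool" where col: "\<And>i j. i \<noteq> j \<Longrightarrow> ip (a i) (a j) \<noteq> 0 \<Longrightarrow> col i \<noteq> col j"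
    using two_colouring by blast
  obtain z \<mu> where z: "\<And>i. 0 < z i" "0 < \<mu>" "\<mu> < 1" "\<And>i. (\<Sum>j\<in>UNIV. ip (a i) (a j) * z j) = \<mu> * z i"
    using perron by blast
  interpret coxeter_data ip Phi a col z "1 - \<mu>"
    by unfold_locales (use col z in auto)
  have th: "theta = pi / real h" using h_theta by (simp add: field_simps)
  have k: "1 - \<mu> = cos (pi / real h)" using theta(1) th by simp
  show ?thesis
  proof (intro exI conjI allI ballI impI)
    show "2 \<le> h" by (rule h_theta)
    show "r True \<in> C" "r False \<in> C" using r_in_closed_class C by blast+
    show "r True (r True x) = x" "r False (r False x) = x" for x by simp_all
    show "r True (xb True) = - xb True" "r False (xb False) = - xb False" by (rule r_xb_same)+
    show "r True (xb False) = xb False + (2 * cos (pi / real h)) *\<^sub>R xb True"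
      "r False (xb True) = xb True + (2 * cos (pi / real h)) *\<^sub>R xb False"
      using r_xb_other[of True] r_xb_other[of False] k by auto
    show "of_real (ip \<beta> (xb True)) + cis (pi / real h) * of_real (ip \<beta> (xb False)) \<noteq> 0" if "\<beta> \<in> Phi" for \<beta>
      using psi_nonzero[OF that] by (simp add: psi_def th)
    show "x = 0" if "r False (r True x) = x" for x using c_no_fixed[of x] that by (simp add: c_def)
    show "card Phi = CARD('n) * h" if "(r False \<circ> r True) ^^ h = id" using card_Phi that by (simp add: c_def)
  qed
qed

section \<open>Irreducible real reflection groups\<close>

definition cx :: "real ^ 'n \<Rightarrow> complex ^ 'n" where "cx x = (\<chi> i. of_real (x $ i))"

lemma cx_linear: "cx (x + y) = cx x + cx y" "cx (x - y) = cx x - cx y" "cx (c *\<^sub>R x) = of_real c *s cx x"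
  by (simp_all add: cx_def vec_eq_iff)

lemma cx_eq_combination: assumes "cx x + \<i> *s cx y = cx x' + \<i> *s cx y'" shows "x = x' \<and> y = y'"
proof -
  have "complex_of_real (x $ i) + \<i> * of_real (y $ i) = of_real (x' $ i) + \<i> * of_real (y' $ i)" for i
    using arg_cong[OF assms, of "\<lambda>v. v $ i"] by (simp add: cx_def)
  then show ?thesis by (simp add: complex_eq_iff vec_eq_iff)
qed

text \<open>Rank one is excluded because it has no Coxeter plane;
  \<open>max_degree_regular_rank_one\<close> treats it.\<close>

locale real_irr = complex_refl_deg W L P dg
  for W :: "(complex ^ 'n::finite ^ 'n) set" and L P dg +
  fixes B :: "complex ^ 'n ^ 'n"
  assumes B: "invertible B"
    and real: "g \<in> W \<Longrightarrow> (matrix_inv B ** g ** B) $ i $ j \<in> \<real>"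
    and irr: "irreducible_group W"
    and n2: "2 \<le> CARD('n)"
begin

lemma B_inv: "B ** matrix_inv B = mat 1" "matrix_inv B ** B = mat 1"
  using someI_ex[OF B[unfolded invertible_def]] unfolding matrix_inv_def by auto

text \<open>The embedding of the real form of \<open>V\<close>: every vector is uniquely
  \<open>em x + \<i> *s em y\<close>.\<close>

definition em :: "real ^ 'n \<Rightarrow> complex ^ 'n" where "em x = B *v cx x"

lemma em_linear: "em (x + y) = em x + em y" "em (x - y) = em x - em y" "em (c *\<^sub>R x) = of_real c *s em x"
  by (simp_all add: em_def cx_linear matrix_vector_right_distrib matrix_vector_mult_diff_distrib
      vector_scalar_commute)

lemma B_cancel: "B *v u = B *v v \<Longrightarrow> u = v"
  by (metis B_inv(2) matrix_vector_mul_assoc matrix_vector_mul_lid)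

lemma em_combination: assumes "em x + \<i> *s em y = em x' + \<i> *s em y'" shows "x = x'" "y = y'"
proof -
  have "B *v (cx x + \<i> *s cx y) = B *v (cx x' + \<i> *s cx y')"
    using assms by (simp add: em_def matrix_vector_right_distrib vector_scalar_commute)
  from cx_eq_combination[OF B_cancel[OF this]] show "x = x'" "y = y'" by auto
qed

lemma em_0 [simp]: "em 0 = 0" by (simp add: em_def cx_def matrix_vector_mult_def vec_eq_iff)

lemma em_inj: "em x = em y \<longleftrightarrow> x = y" using em_combination[of x 0 y 0] by auto

lemma em_surj: "\<exists>x y. v = em x + \<i> *s em y"
proof -
  define w where "w = matrix_inv B *v v"
  have "v = B *v w" by (simp add: w_def matrix_vector_mul_assoc B_inv)
  also have "w = cx (\<chi> i. Re (w $ i)) + \<i> *s cx (\<chi> i. Im (w $ i))"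
    by (simp add: vec_eq_iff cx_def complex_eq[symmetric])
  finally show ?thesis
    by (metis em_def matrix_vector_right_distrib vector_scalar_commute)
qed

definition ra :: "complex ^ 'n ^ 'n \<Rightarrow> real ^ 'n \<Rightarrow> real ^ 'n" where
  "ra g x = (\<chi> i. \<Sum>j\<in>UNIV. Re ((matrix_inv B ** g ** B) $ i $ j) * x $ j)"

lemma em_ra: assumes "g \<in> W" shows "em (ra g x) = g *v em x"
proof -
  have "cx (ra g x) = (matrix_inv B ** g ** B) *v cx x"
    using real[OF assms] by (auto simp: cx_def ra_def matrix_vector_mult_def vec_eq_iff intro!: sum.cong)
  then show ?thesis
    by (simp add: em_def matrix_vector_mul_assoc matrix_mul_assoc B_inv)
qed

lemma ra_one: "ra (mat 1) x = x" using em_ra[OF W_one, of x] by (simp add: em_inj)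

lemma ra_mult: assumes "g \<in> W" "h \<in> W" shows "ra (g ** h) x = ra g (ra h x)"
proof -
  have "em (ra (g ** h) x) = em (ra g (ra h x))"
    using assms W_mult by (simp add: em_ra matrix_vector_mul_assoc)
  then show ?thesis by (simp add: em_inj)
qed

lemma ra_add: "ra g (x + y) = ra g x + ra g y"
  by (simp add: ra_def vec_eq_iff sum.distrib distrib_left)

lemma ra_scale: "ra g (c *\<^sub>R x) = c *\<^sub>R ra g x"
  by (simp add: ra_def vec_eq_iff sum_distrib_left mult.left_commute)

lemma ra_faithful: assumes "g \<in> W" "h \<in> W" "\<And>x. ra g x = ra h x" shows "g = h"
proof -
  have "g *v v = h *v v" for v
  proof -
    obtain x y where "v = em x + \<i> *s em y" using em_surj by blast
    then show ?thesis using assms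
      by (simp add: matrix_vector_right_distrib vector_scalar_commute em_ra[symmetric])
  qed
  then show ?thesis by (simp add: matrix_eq)
qed

definition form :: "real ^ 'n \<Rightarrow> real ^ 'n \<Rightarrow> real" where "form x y = (\<Sum>g\<in>W. ra g x \<bullet> ra g y)"

lemma form_add: "form (x + y) u = form x u + form y u"
  by (simp add: form_def ra_add inner_add_left sum.distrib)

lemma form_scale: "form (c *\<^sub>R x) u = c * form x u"
  by (simp add: form_def ra_scale sum_distrib_left)

lemma form_sym: "form x y = form y x" by (simp add: form_def inner_commute)

lemma form_pos: assumes "x \<noteq> 0" shows "0 < form x x"
  unfolding form_def using finW W_one assms
  by (intro sum_pos2[of _ "mat 1"]) (auto simp: ra_one)

lemma form_invariant: assumes "h \<in> W" shows "form (ra h x) (ra h y) = form x y"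
proof -
  have bij: "bij_betw (\<lambda>w. w ** h) W W"
    by (rule bij_betw_byWitness[of _ "\<lambda>w. w ** inv\<^bsub>GL\<^esub> h"])
       (use W_mult assms W_inv[OF assms] in \<open>auto simp: matrix_mul_assoc[symmetric]\<close>)
  have "form (ra h x) (ra h y) = (\<Sum>g\<in>W. ra (g ** h) x \<bullet> ra (g ** h) y)"
    unfolding form_def using assms by (intro sum.cong) (auto simp: ra_mult)
  also have "\<dots> = form x y" unfolding form_def by (rule sum.reindex_bij_betw[OF bij])
  finally show ?thesis .
qed

lemma form_zero: "form 0 u = 0" "form u 0 = 0" using form_scale[of 0 0 u] form_sym by auto
lemma form_scale_right: "form u (c *\<^sub>R x) = c * form u x" by (metis form_scale form_sym)
lemma form_add_right: "form u (x + y) = form u x + form u y" by (metis form_add form_sym)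
lemma form_minus: "form (- x) u = - form x u" "form u (- x) = - form u x"
  using form_scale[of "-1" x u] form_scale_right[of u "-1" x] by simp_all

text \<open>Expanding the isometry property relates the values of \<kappa> at two points. With both
  points equal to \<open>x0\<close> this determines \<kappa> at \<open>x0\<close>, and then the pair
  \<open>x\<close>, \<open>x0\<close> determines it at \<open>x\<close>.\<close>

lemma isometry_rank_one:
  assumes "\<And>x. T x = x + \<kappa> x *\<^sub>R \<alpha>" "form \<alpha> \<alpha> = 1" "\<And>x y. form (T x) (T y) = form x y" "\<kappa> x0 \<noteq> 0"
  shows "\<kappa> x = - 2 * form x \<alpha>"
proof -
  have key: "\<kappa> y * form x \<alpha> + \<kappa> x * form y \<alpha> + \<kappa> x * \<kappa> y = 0" for x y
    using assms(3)[of x y] assms(2)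
    by (simp add: assms(1) form_add form_add_right form_scale form_scale_right form_sym[of \<alpha> y] algebra_simps)
  have k0: "\<kappa> x0 = - 2 * form x0 \<alpha>" using key[of x0 x0] assms(4) by (simp add: field_simps) algebra
  have "(\<kappa> x + 2 * form x \<alpha>) * form x0 \<alpha> = 0" using key[of x x0] unfolding k0 by (simp add: algebra_simps)
  then show ?thesis using k0 assms(4) by auto
qed

definition is_root where "is_root t \<alpha> \<longleftrightarrow> form \<alpha> \<alpha> = 1 \<and> (\<forall>x. ra t x = x - (2 * form x \<alpha>) *\<^sub>R \<alpha>)"

text \<open>The differences \<open>ra t x - x\<close> are real vectors on a single complex line, so
  their ratios are real and \<open>ra t\<close> moves all vectors along one real direction.\<close>

lemma exists_root: assumes t: "t \<in> reflections W" shows "\<exists>\<alpha>. is_root t \<alpha>"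
proof -
  have tW: "t \<in> W" and t1: "t \<noteq> mat 1" using t by (auto simp: reflections_def pseudo_reflection_def)
  obtain \<phi> where \<phi>: "\<And>v. t *v v = v + bdot \<phi> v *s L t" using refl_form[OF t] by blast
  obtain x0 where x0: "ra t x0 \<noteq> x0" using ra_faithful[OF tW W_one] t1 ra_one by metis
  define ell where "ell = ra t x0 - x0"
  have ell: "ell \<noteq> 0" using x0 by (simp add: ell_def)
  have eml: "em (ra t x - x) = bdot \<phi> (em x) *s L t" for x
    by (simp add: em_linear em_ra[OF tW] \<phi>)
  have b0: "bdot \<phi> (em x0) \<noteq> 0" using eml[of x0] ell em_inj[of ell 0] by (auto simp: ell_def)
  have "\<exists>\<kappa>. ra t x = x + \<kappa> *\<^sub>R ell" for x
  proof -
    define q where "q = bdot \<phi> (em x) / bdot \<phi> (em x0)"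
    have "em (ra t x - x) = q *s em ell"
      unfolding ell_def eml q_def using b0 by (simp add: vector_smult_assoc)
    then have "B *v cx (ra t x - x) = B *v (q *s cx ell)" by (simp add: em_def vector_scalar_commute)
    then have c: "cx (ra t x - x) = q *s cx ell" by (rule B_cancel)
    obtain i where i: "ell $ i \<noteq> 0" using ell by (auto simp: vec_eq_iff)
    have "complex_of_real ((ra t x - x) $ i) = q * of_real (ell $ i)"
      using arg_cong[OF c, of "\<lambda>v. v $ i"] by (simp add: cx_def)
    then have "q = of_real ((ra t x - x) $ i / ell $ i)" using i by (simp add: field_simps)
    then obtain \<kappa> where q: "q = of_real \<kappa>" by blast
    have "em (ra t x - x) = em (\<kappa> *\<^sub>R ell)" using \<open>em (ra t x - x) = q *s em ell\<close> by (simp add: q em_linear)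
    then have "ra t x - x = \<kappa> *\<^sub>R ell" by (simp only: em_inj)
    then show ?thesis by (metis add.commute diff_add_cancel)
  qed
  then obtain \<kappa> where \<kappa>: "\<And>x. ra t x = x + \<kappa> x *\<^sub>R ell" by metis
  define m where "m = sqrt (form ell ell)"
  have m: "0 < m" "m * m = form ell ell" using form_pos[OF ell] by (auto simp: m_def)
  define \<alpha> where "\<alpha> = (1 / m) *\<^sub>R ell"
  have \<alpha>: "form \<alpha> \<alpha> = 1" using m form_pos[OF ell] by (simp add: \<alpha>_def form_scale form_scale_right flip: m(2))
  have ra: "ra t x = x + (m * \<kappa> x) *\<^sub>R \<alpha>" for x using \<kappa>[of x] m by (simp add: \<alpha>_def)
  have "m * \<kappa> x0 \<noteq> 0" using x0 ra[of x0] by auto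
  from isometry_rank_one[OF ra \<alpha> form_invariant[OF tW] this]
  have "is_root t \<alpha>" using \<alpha> ra by (simp add: is_root_def)
  then show ?thesis by blast
qed

lemma is_root_em:
  assumes "is_root t \<alpha>" "t \<in> W"
  shows "t *v (em x + c *s em y) = (em x + c *s em y) - (2 * (of_real (form x \<alpha>) + c * of_real (form y \<alpha>))) *s em \<alpha>"
proof -
  have emt: "t *v em x = em x - of_real (2 * form x \<alpha>) *s em \<alpha>" for x
    using assms by (simp add: em_ra[symmetric] is_root_def em_linear del: of_real_mult)
  then show ?thesis
    by (simp only: matrix_vector_right_distrib vector_scalar_commute emt)
      (simp add: vec_eq_iff algebra_simps)
qed

definition Phi where "Phi = {\<alpha>. \<exists>t\<in>reflections W. is_root t \<alpha>}"

lemma is_root_minus: "is_root t \<alpha> \<Longrightarrow> is_root t (- \<alpha>)"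
  by (simp add: is_root_def form_minus)

lemma is_root_unique: assumes "is_root t \<alpha>" "is_root t \<beta>" shows "\<beta> = \<alpha> \<or> \<beta> = - \<alpha>"
proof -
  have "\<beta> - (2 * form \<beta> \<beta>) *\<^sub>R \<beta> = \<beta> - (2 * form \<beta> \<alpha>) *\<^sub>R \<alpha>" using assms unfolding is_root_def by metis
  then have "2 *\<^sub>R \<beta> = (2 * form \<beta> \<alpha>) *\<^sub>R \<alpha>" using assms by (simp add: is_root_def)
  then have "(1/2::real) *\<^sub>R (2 *\<^sub>R \<beta>) = (1/2::real) *\<^sub>R ((2 * form \<beta> \<alpha>) *\<^sub>R \<alpha>)" by (rule arg_cong)
  then have \<beta>: "\<beta> = form \<beta> \<alpha> *\<^sub>R \<alpha>" by simp
  then have "1 = form \<beta> \<alpha> * form \<beta> \<alpha>"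
    using assms by (metis form_scale form_scale_right is_root_def mult.right_neutral)
  then have "form \<beta> \<alpha> = 1 \<or> form \<beta> \<alpha> = - 1" by (metis square_eq_1_iff)
  then show ?thesis using \<beta> by (metis scaleR_minus1_left scaleR_one)
qed

lemma is_root_determines: assumes "is_root t \<alpha>" "is_root t' \<alpha>" "t \<in> W" "t' \<in> W" shows "t = t'"
  by (rule ra_faithful) (use assms in \<open>auto simp: is_root_def\<close>)

text \<open>A reflection has exactly two roots, opposite to each other, and a root determines its
  reflection.\<close>

lemma Phi_finite_card: "finite Phi" "card Phi = 2 * card (reflections W)"
proof -
  obtain \<rho> where \<rho>: "\<And>t. t \<in> reflections W \<Longrightarrow> is_root t (\<rho> t)" using exists_root by metis
  have fR: "finite (reflections W)" using finW by (simp add: reflections_def)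
  have RW: "t \<in> W" if "t \<in> reflections W" for t using that by (simp add: reflections_def)
  let ?f = "\<lambda>(b, t). if b then \<rho> t else - \<rho> t"
  have Phi: "Phi = ?f ` (UNIV \<times> reflections W)"
  proof
    show "Phi \<subseteq> ?f ` (UNIV \<times> reflections W)"
    proof
      fix \<alpha> assume "\<alpha> \<in> Phi"
      then obtain t where t: "t \<in> reflections W" "is_root t \<alpha>" by (auto simp: Phi_def)
      then have "\<alpha> = \<rho> t \<or> \<alpha> = - \<rho> t" using is_root_unique[OF \<rho>[OF t(1)]] by blast
      then show "\<alpha> \<in> ?f ` (UNIV \<times> reflections W)"
        using t by (auto intro!: image_eqI[of _ _ "(\<alpha> = \<rho> t, t)"])
    qed
    show "?f ` (UNIV \<times> reflections W) \<subseteq> Phi"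
      using \<rho> is_root_minus[OF \<rho>] unfolding Phi_def by fastforce
  qed
  have "inj_on ?f (UNIV \<times> reflections W)"
  proof (rule inj_onI)
    fix p q assume p: "p \<in> UNIV \<times> reflections W" and q: "q \<in> UNIV \<times> reflections W" and eq: "?f p = ?f q"
    obtain b t b' t' where pq: "p = (b, t)" "q = (b', t')" by (metis surj_pair)
    have t: "t \<in> reflections W" "t' \<in> reflections W" using p q pq by auto
    have "is_root t (?f p)" using \<rho>[OF t(1)] is_root_minus[OF \<rho>[OF t(1)]] by (simp add: pq)
    moreover have "is_root t' (?f p)"
      using \<rho>[OF t(2)] is_root_minus[OF \<rho>[OF t(2)]] unfolding eq by (simp add: pq)
    ultimately have tt: "t = t'" using is_root_determines RW t by blast
    have "\<rho> t \<noteq> - \<rho> t"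
    proof
      assume "\<rho> t = - \<rho> t"
      then have "form (\<rho> t) (\<rho> t) = - form (\<rho> t) (\<rho> t)" using form_minus(2) by metis
      then show False using \<rho>[OF t(1)] by (simp add: is_root_def)
    qed
    then have "b = b'" using eq tt pq by (auto split: if_splits)
    then show "p = q" using tt pq by simp
  qed
  then show "finite Phi" "card Phi = 2 * card (reflections W)"
    unfolding Phi using fR by (simp_all add: card_image card_cartesian_product card_UNIV_bool)
qed

text \<open>A common fixed vector would span an invariant line, which is a proper subspace in rank
  at least 2.\<close>

lemma fixed_zero:
  assumes "\<And>t. t \<in> reflections W \<Longrightarrow> t *v u = u" shows "u = 0"
proof (rule ccontr)
  assume u: "u \<noteq> 0"
  have "{w \<in> W. w *v u = u} = W"
    by (rule right_mult_closed_eq_W)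
       (use assms W_one W_mult in \<open>auto simp: matrix_vector_mul_assoc[symmetric] reflections_def\<close>)
  then have fx: "w *v u = u" if "w \<in> W" for w using that by blast
  let ?U = "range (\<lambda>c. c *s u)"
  have "vec.subspace ?U"
    unfolding vec.subspace_def
  proof (intro conjI ballI allI)
    show "0 \<in> ?U" by (rule range_eqI[of _ _ 0]) simp
    show "x + y \<in> ?U" if xy: "x \<in> ?U" "y \<in> ?U" for x y
    proof -
      obtain a b where "x = a *s u" "y = b *s u" using xy by blast
      then show ?thesis by (intro range_eqI[of _ _ "a + b"]) (simp add: vector_sadd_rdistrib)
    qed
    show "c *s x \<in> ?U" if x: "x \<in> ?U" for c x
    proof -
      obtain a where "x = a *s u" using x by blast
      then show ?thesis by (intro range_eqI[of _ _ "c * a"]) (simp add: vector_smult_assoc)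
    qed
  qed
  moreover have "\<forall>g\<in>W. \<forall>v\<in>?U. g *v v \<in> ?U"
    using fx by (auto simp: vector_scalar_commute)
  ultimately have "?U = {0} \<or> ?U = UNIV" using irr unfolding irreducible_group_def by blast
  moreover have "u \<in> ?U" by (rule range_eqI[of _ _ 1]) simp
  ultimately have U: "?U = UNIV" using u by auto
  obtain i :: 'n where True by simp
  have "UNIV \<noteq> {i}"
  proof
    assume "UNIV = {i}"
    then have "CARD('n) = card {i}" by (rule arg_cong)
    then show False using n2 by simp
  qed
  then obtain j where j: "j \<noteq> i" by blast
  have "axis i (1::complex) \<in> ?U" "axis j (1::complex) \<in> ?U" using U by auto
  then obtain c d where cd: "axis i (1::complex) = c *s u" "axis j (1::complex) = d *s u" by blast
  have "1 = c * u $ i" using arg_cong[OF cd(1), of "\<lambda>v. v $ i"] by (simp add: axis_def)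
  moreover have "0 = d * u $ i" using arg_cong[OF cd(2), of "\<lambda>v. v $ i"] j by (simp add: axis_def)
  ultimately have "d = 0" by auto
  then show False using arg_cong[OF cd(2), of "\<lambda>v. v $ j"] by (simp add: axis_def)
qed

lemma Phi_total: assumes "\<And>\<alpha>. \<alpha> \<in> Phi \<Longrightarrow> form x \<alpha> = 0" shows "x = 0"
proof -
  have "em x = 0"
  proof (rule fixed_zero)
    fix t assume t: "t \<in> reflections W"
    then have tW: "t \<in> W" by (simp add: reflections_def)
    obtain \<alpha> where \<alpha>: "is_root t \<alpha>" using exists_root[OF t] by blast
    then have "form x \<alpha> = 0" using assms t by (auto simp: Phi_def)
    then show "t *v em x = em x" using is_root_em[OF \<alpha> tW, of x 0 0] by simp
  qed
  then show ?thesis using em_inj[of x 0] by simp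
qed

text \<open>Conjugating the reflection of \<beta> by that of \<alpha> gives a reflection whose root
  is the reflected vector.\<close>

lemma Phi_refl: assumes "\<alpha> \<in> Phi" "\<beta> \<in> Phi" shows "\<beta> - (2 * form \<beta> \<alpha>) *\<^sub>R \<alpha> \<in> Phi"
proof -
  obtain t t' where t: "t \<in> reflections W" "is_root t \<alpha>" and t': "t' \<in> reflections W" "is_root t' \<beta>"
    using assms by (auto simp: Phi_def)
  have tW: "t \<in> W" "t' \<in> W" using t t' by (auto simp: reflections_def)
  define u where "u = inv\<^bsub>GL\<^esub> t"
  have u: "u \<in> W" "u ** t = mat 1" "t ** u = mat 1" using W_inv[OF tW(1)] by (auto simp: u_def)
  have tt: "transpose u ** transpose t = mat 1" "transpose t ** transpose u = mat 1"
    using u by (metis matrix_transpose_mul transpose_mat)+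
  have "transpose t ** transpose t' ** transpose u \<in> transpose ` reflections W \<or>
      transpose u ** transpose t' ** transpose t \<in> transpose ` reflections W"
    using conj_refl(1)[of "transpose t'" "transpose t" "transpose u"] t' tW u tt
    by (auto simp: G_iff transpose_transpose)
  moreover have "transpose u ** transpose t' ** transpose t \<in> transpose ` reflections W"
    using conj_refl(1)[of "transpose t'" "transpose t" "transpose u"] t' tW u tt
    by (auto simp: G_iff transpose_transpose)
  then have "transpose (transpose u ** transpose t' ** transpose t) \<in> reflections W"
    by (metis imageE transpose_transpose)
  then have R: "t ** t' ** u \<in> reflections W"
    by (simp add: matrix_transpose_mul transpose_transpose matrix_mul_assoc)
  define \<gamma> where "\<gamma> = ra t \<beta>"
  have "is_root (t ** t' ** u) \<gamma>"
    unfolding is_root_def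
  proof (intro conjI allI)
    show "form \<gamma> \<gamma> = 1" using t'(2) by (simp add: \<gamma>_def form_invariant[OF tW(1)] is_root_def)
    fix x
    have "ra t (ra u x) = x" using ra_mult[OF tW(1) u(1), of x] u(3) ra_one by simp
    then have f: "form (ra u x) \<beta> = form x \<gamma>" using form_invariant[OF tW(1), of "ra u x" \<beta>] by (simp add: \<gamma>_def)
    have "ra (t ** t' ** u) x = ra t (ra t' (ra u x))"
      using ra_mult W_mult tW u by simp
    also have "ra t' (ra u x) = ra u x + (- 2 * form (ra u x) \<beta>) *\<^sub>R \<beta>" using t'(2) by (simp add: is_root_def)
    also have "ra t \<dots> = x + (- 2 * form x \<gamma>) *\<^sub>R \<gamma>"
      using \<open>ra t (ra u x) = x\<close> by (simp only: ra_add ra_scale f \<gamma>_def)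
    finally show "ra (t ** t' ** u) x = x - (2 * form x \<gamma>) *\<^sub>R \<gamma>" by simp
  qed
  then have "\<gamma> \<in> Phi" using R by (auto simp: Phi_def)
  moreover have "\<gamma> = \<beta> - (2 * form \<beta> \<alpha>) *\<^sub>R \<alpha>" using t(2) by (simp add: \<gamma>_def is_root_def)
  ultimately show ?thesis by simp
qed

text \<open>The complexified orthogonal complement of \<open>C\<close> is stable under all
  reflections, contains the roots in \<open>A\<close> and none of those in \<open>C\<close>, which
  contradicts irreducibility if both sets are nonempty.\<close>

lemma Phi_irred:
  assumes "A \<union> C = Phi" "\<And>\<alpha> \<beta>. \<alpha> \<in> A \<Longrightarrow> \<beta> \<in> C \<Longrightarrow> form \<alpha> \<beta> = 0"
  shows "A = {} \<or> C = {}"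
proof (rule ccontr)
  assume "\<not> ?thesis"
  then obtain \<alpha>0 \<beta>0 where ab: "\<alpha>0 \<in> A" "\<beta>0 \<in> C" by blast
  have unit: "form \<alpha> \<alpha> = 1" if "\<alpha> \<in> A \<union> C" for \<alpha> using that assms(1) by (auto simp: Phi_def is_root_def)
  define Y where "Y = {x. \<forall>\<beta>\<in>C. form x \<beta> = 0}"
  define U where "U = {em x + \<i> *s em y | x y. x \<in> Y \<and> y \<in> Y}"
  have Y_add: "x + y \<in> Y" if "x \<in> Y" "y \<in> Y" for x y using that by (simp add: Y_def form_add)
  have Y_scale: "c *\<^sub>R x \<in> Y" if "x \<in> Y" for x c using that by (simp add: Y_def form_scale)
  have Y0: "0 \<in> Y" by (simp add: Y_def form_zero)
  have "vec.subspace U"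
    unfolding vec.subspace_def
  proof (intro conjI ballI allI)
    show "0 \<in> U" unfolding U_def using Y0 by (intro CollectI exI[of _ 0]) simp
    show "u + v \<in> U" if uv: "u \<in> U" "v \<in> U" for u v
    proof -
      obtain x y x' y' where "u = em x + \<i> *s em y" "v = em x' + \<i> *s em y'" "x \<in> Y" "y \<in> Y" "x' \<in> Y" "y' \<in> Y"
        using uv by (auto simp: U_def)
      then show ?thesis unfolding U_def
        by (intro CollectI exI[of _ "x + x'"] exI[of _ "y + y'"])
           (simp add: em_linear Y_add vector_add_ldistrib)
    qed
    show "c *s u \<in> U" if cu: "u \<in> U" for c u
    proof -
      obtain x y where u: "u = em x + \<i> *s em y" "x \<in> Y" "y \<in> Y" using cu by (auto simp: U_def)
      have "c *s u = em (Re c *\<^sub>R x + (- Im c) *\<^sub>R y) + \<i> *s em (Im c *\<^sub>R x + Re c *\<^sub>R y)"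
        by (simp add: u(1) em_linear vec_eq_iff complex_eq_iff algebra_simps)
      then show ?thesis unfolding U_def using u(2,3) Y_add Y_scale by blast
    qed
  qed
  moreover have "\<forall>w\<in>W. \<forall>u\<in>U. w *v u \<in> U"
  proof -
    have refl_U: "t *v u \<in> U" if t: "t \<in> reflections W" and u: "u \<in> U" for t u
    proof -
      have tW: "t \<in> W" using t by (simp add: reflections_def)
      obtain x y where xy: "u = em x + \<i> *s em y" "x \<in> Y" "y \<in> Y" using u by (auto simp: U_def)
      obtain \<alpha> where \<alpha>: "is_root t \<alpha>" using exists_root[OF t] by blast
      have raY: "ra t x \<in> Y" if x: "x \<in> Y" for x
      proof (cases "\<alpha> \<in> C")
        case True
        then have "ra t x = x" using x \<alpha> by (simp add: Y_def is_root_def)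
        then show ?thesis using x by simp
      next
        case False
        then have "\<alpha> \<in> A" using \<alpha> t assms(1) by (auto simp: Phi_def)
        then have "\<alpha> \<in> Y" using assms(2) by (simp add: Y_def)
        then have "x + (- 2 * form x \<alpha>) *\<^sub>R \<alpha> \<in> Y" using x Y_add Y_scale by blast
        then show ?thesis using \<alpha> by (simp add: is_root_def)
      qed
      have "t *v u = em (ra t x) + \<i> *s em (ra t y)"
        by (simp add: xy(1) matrix_vector_right_distrib vector_scalar_commute em_ra[OF tW])
      then show ?thesis unfolding U_def using raY xy by blast
    qed
    have "{w \<in> W. \<forall>u\<in>U. w *v u \<in> U} = W"
      by (rule right_mult_closed_eq_W)
         (use refl_U W_one W_mult in \<open>auto simp: matrix_vector_mul_assoc[symmetric] reflections_def\<close>)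
    then show ?thesis by blast
  qed
  ultimately have "U = {0} \<or> U = UNIV" using irr unfolding irreducible_group_def by blast
  moreover have "em \<alpha>0 \<in> U" unfolding U_def using ab(1) assms(2) Y0
    by (intro CollectI exI[of _ \<alpha>0] exI[of _ 0]) (simp add: Y_def form_zero)
  moreover have "em \<alpha>0 \<noteq> 0" using em_inj[of \<alpha>0 0] unit[of \<alpha>0] ab(1) by (auto simp: form_zero)
  ultimately have "em \<beta>0 \<in> U" by auto
  then obtain x y where xy: "em \<beta>0 = em x + \<i> *s em y" "x \<in> Y" by (auto simp: U_def)
  then have "em \<beta>0 + \<i> *s em 0 = em x + \<i> *s em y" by simp
  then have "\<beta>0 = x" by (rule em_combination)
  then show False using xy(2) ab(2) unit[of \<beta>0] by (auto simp: Y_def)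
qed

lemma root_base_Phi: "root_base form Phi"
proof
  show "form (x + y) u = form x u + form y u" for x y u by (rule form_add)
  show "form (c *\<^sub>R x) u = c * form x u" for c x u by (rule form_scale)
  show "form x y = form y x" for x y by (rule form_sym)
  show "0 < form x x" if "x \<noteq> 0" for x using that by (rule form_pos)
  show "finite Phi" by (rule Phi_finite_card)
  show "form \<alpha> \<alpha> = 1" if "\<alpha> \<in> Phi" for \<alpha> using that by (auto simp: Phi_def is_root_def)
  show "- \<alpha> \<in> Phi" if "\<alpha> \<in> Phi" for \<alpha> using that is_root_minus by (auto simp: Phi_def)
  show "\<beta> - (2 * form \<beta> \<alpha>) *\<^sub>R \<alpha> \<in> Phi" if "\<alpha> \<in> Phi" "\<beta> \<in> Phi" for \<alpha> \<beta> using that by (rule Phi_refl)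
  show "x = 0" if "\<And>\<alpha>. \<alpha> \<in> Phi \<Longrightarrow> form x \<alpha> = 0" for x using that by (rule Phi_total)
qed

lemma regular_fixed_imp_one:
  assumes "regular_vector W v" "g \<in> W" "g *v v = v" shows "g = mat 1"
proof -
  have "transpose g *v sigma v = 1 *s sigma v"
    by (rule sigma_eigenvector[OF assms(2)]) (use assms(3) in auto)
  then have "transpose g *v sigma v = mat 1 *v sigma v" by simp
  moreover have "transpose g \<in> G" using assms(2) by (simp add: G_iff transpose_transpose)
  ultimately have "transpose g = mat 1"
    using inj_onD[OF regular_free[OF sigma_regular[OF assms(1)]]] one by blast
  then show ?thesis by (metis transpose_mat transpose_transpose)
qed

end

lemma mset_eq_if_linear_products_eq:
  fixes a b :: "'i \<Rightarrow> complex"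
  assumes "finite A" "\<And>x. (\<Prod>i\<in>A. x - a i) = (\<Prod>i\<in>A. x - b i)"
  shows "image_mset a (mset_set A) = image_mset b (mset_set A)"
proof -
  have roots: "proots (\<Prod>i\<in>A. [:- c i, 1:]) = image_mset c (mset_set A)" for c :: "'i \<Rightarrow> complex"
    using assms(1) by (subst proots_prod) (auto simp: sum_unfold_sum_mset)
  have "poly (\<Prod>i\<in>A. [:- a i, 1:]) x = poly (\<Prod>i\<in>A. [:- b i, 1:]) x" for x
    using assms(2)[of x] by (simp add: poly_prod)
  then have "(\<Prod>i\<in>A. [:- a i, 1:]) = (\<Prod>i\<in>A. [:- b i, 1:])"
    by (intro poly_eq_poly_eq_iff[THEN iffD1] ext)
  then show ?thesis using roots by metis
qed

section \<open>The Coxeter element and the largest degree\<close>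

context real_irr
begin

text \<open>The two involutions are kept besides their product: they will show that the Coxeter
  element is conjugate to its inverse.\<close>

lemma exists_coxeter_element:
  "\<exists>h w1 w2 v. 2 \<le> h \<and> w1 \<in> W \<and> w2 \<in> W \<and> w1 ** w1 = mat 1 \<and> w2 ** w2 = mat 1 \<and> v \<noteq> 0 \<and>
    regular_vector W v \<and> (w2 ** w1) *v v = cis (2 * pi / real h) *s v \<and>
    (\<forall>u. (w2 ** w1) *v u = u \<longrightarrow> u = 0) \<and> 2 * N = CARD('n) * h"
proof -
  interpret rb: root_base form Phi by (rule root_base_Phi)
  let ?C = "{F. \<exists>w\<in>W. F = ra w}"
  have C: "id \<in> ?C" "\<And>f f'. f \<in> ?C \<Longrightarrow> f' \<in> ?C \<Longrightarrow> f \<circ> f' \<in> ?C"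
    "\<And>\<alpha>. \<alpha> \<in> Phi \<Longrightarrow> (\<lambda>x. x - (2 * form x \<alpha>) *\<^sub>R \<alpha>) \<in> ?C"
  proof -
    show "id \<in> ?C" using W_one ra_one by (intro CollectI bexI[of _ "mat 1"]) auto
    show "f \<circ> f' \<in> ?C" if ff: "f \<in> ?C" "f' \<in> ?C" for f f'
    proof -
      obtain w w' where "w \<in> W" "f = ra w" "w' \<in> W" "f' = ra w'" using ff by blast
      then show ?thesis using W_mult ra_mult by (intro CollectI bexI[of _ "w ** w'"]) auto
    qed
    show "(\<lambda>x. x - (2 * form x \<alpha>) *\<^sub>R \<alpha>) \<in> ?C" if \<alpha>: "\<alpha> \<in> Phi" for \<alpha>
    proof -
      obtain t where "t \<in> reflections W" "is_root t \<alpha>" using \<alpha> by (auto simp: Phi_def)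
      then show ?thesis by (intro CollectI bexI[of _ t]) (auto simp: is_root_def reflections_def)
    qed
  qed
  obtain h x1 x2 r1 r2 where h: "2 \<le> h" and r: "r1 \<in> ?C" "r2 \<in> ?C" and
    inv1: "\<forall>x. r1 (r1 x) = x" and inv2: "\<forall>x. r2 (r2 x) = x" and
    r1: "r1 x1 = - x1" "r1 x2 = x2 + (2 * cos (pi / real h)) *\<^sub>R x1" and
    r2: "r2 x2 = - x2" "r2 x1 = x1 + (2 * cos (pi / real h)) *\<^sub>R x2" and
    reg: "\<forall>\<beta>\<in>Phi. of_real (form \<beta> x1) + cis (pi / real h) * of_real (form \<beta> x2) \<noteq> 0" and
    nofix: "\<forall>x. r2 (r1 x) = x \<longrightarrow> x = 0" and
    count: "(r2 \<circ> r1) ^^ h = id \<longrightarrow> card Phi = CARD('n) * h"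
    by (rule rb.coxeter_plane[of ?C, THEN exE], erule Phi_irred, assumption, rule n2, rule C(1), erule C(2), assumption, erule C(3),
        elim exE conjE, rule that, assumption+)
  obtain w1 w2 where w: "w1 \<in> W" "r1 = ra w1" "w2 \<in> W" "r2 = ra w2" using r by blast
  define k where "k = 2 * cos (pi / real h)"
  define z where "z = cis (pi / real h)"
  define z' where "z' = cis (- (pi / real h))"
  have zz: "z * z' = 1" by (simp add: z_def z'_def cis_mult)
  have k: "complex_of_real k = z + z'" by (simp add: k_def z_def z'_def complex_eq_iff)
  define c where "c = w2 ** w1"
  have cW: "c \<in> W" unfolding c_def by (rule W_mult[OF w(3,1)])
  \<comment> \<open>The rotation of the real plane is diagonalized over the complex numbers. With
    this coefficient \<open>z\<close>, regularity of \<open>v\<close> is the nonvanishing condition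
    provided by \<open>coxeter_plane\<close>.\<close>
  define v where "v = em x1 + z *s em x2"
  have rac: "ra c x = r2 (r1 x)" for x using ra_mult[OF w(3,1), of x] w by (simp add: c_def)
  have r2lin: "r2 (x + y) = r2 x + r2 y" "r2 (s *\<^sub>R x) = s *\<^sub>R r2 x" for x y s
    by (simp_all add: w ra_add ra_scale)
  have e1: "c *v em x1 = - em x1 - of_real k *s em x2"
  proof -
    have "r2 (r1 x1) = (- 1) *\<^sub>R (x1 + k *\<^sub>R x2)"
      unfolding r1 using r2lin(2)[of "-1" x1] r2 by (simp add: k_def)
    then show ?thesis
      unfolding em_ra[OF cW, symmetric] rac by (simp only: em_linear) (simp add: vec_eq_iff)
  qed
  have e2: "c *v em x2 = of_real k *s em x1 + of_real (k * k - 1) *s em x2"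
  proof -
    have "r2 (r1 x2) = k *\<^sub>R x1 + (k * k - 1) *\<^sub>R x2"
      unfolding r1 r2lin r2 by (simp add: k_def[symmetric] algebra_simps)
    then show ?thesis unfolding em_ra[OF cW, symmetric] rac by (simp only: em_linear)
  qed
  have cv: "c *v v = (z * z) *s v"
  proof -
    have "c *v v = (- 1 + z * of_real k) *s em x1 + (- of_real k + z * of_real (k * k - 1)) *s em x2"
      unfolding v_def matrix_vector_right_distrib vector_scalar_commute e1 e2
      by (simp add: vec_eq_iff algebra_simps)
    moreover have "- 1 + z * of_real k = z * z" unfolding k using zz by (simp add: algebra_simps)
    moreover have "- complex_of_real k + z * of_real (k * k - 1) = z * z * z"
    proof -
      have "- complex_of_real k + z * of_real (k * k - 1) = - (z + z') + z * ((z + z') * (z + z') - 1)"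
        by (simp add: k[symmetric])
      also have "\<dots> = z * z * z + (z * z') * z + (z * z') * z + (z * z') * z' - z - z - z'"
        by (simp add: algebra_simps)
      finally show ?thesis unfolding zz by simp
    qed
    moreover have "(z * z) *s v = (z * z) *s em x1 + (z * z * z) *s em x2"
      by (simp add: v_def vec_eq_iff algebra_simps)
    ultimately show ?thesis by (simp only:)
  qed
  have zz2: "z * z = cis (2 * pi / real h)" by (simp add: z_def cis_mult)
  have Phi_ne: "Phi \<noteq> {}"
  proof
    assume "Phi = {}"
    then have "axis undefined 1 = (0 :: real ^ 'n)" by (intro Phi_total) auto
    then show False by simp
  qed
  have regv: "t *v v \<noteq> v" if t: "t \<in> reflections W" for t
  proof
    assume tv: "t *v v = v"
    have tW: "t \<in> W" using t by (simp add: reflections_def)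
    obtain \<alpha> where \<alpha>: "is_root t \<alpha>" using exists_root[OF t] by blast
    have "(2 * (of_real (form x1 \<alpha>) + z * of_real (form x2 \<alpha>))) *s em \<alpha> = 0"
      using tv unfolding v_def is_root_em[OF \<alpha> tW] by (simp add: algebra_simps)
    moreover have "em \<alpha> \<noteq> 0" using em_inj[of \<alpha> 0] \<alpha> by (auto simp: is_root_def form_zero)
    ultimately have "of_real (form x1 \<alpha>) + z * of_real (form x2 \<alpha>) = 0"
      by (metis vector_mul_eq_0 mult_eq_0_iff zero_neq_numeral)
    moreover have "\<alpha> \<in> Phi" using \<alpha> t by (auto simp: Phi_def)
    ultimately show False using reg by (simp add: form_sym[of _ \<alpha>] z_def)
  qed
  have regular: "regular_vector W v" using regv by (simp add: regular_vector_def reflecting_hyperplane_def)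
  have v0: "v \<noteq> 0"
  proof
    assume "v = 0"
    moreover obtain t where "t \<in> reflections W" using Phi_ne by (auto simp: Phi_def)
    ultimately show False using regv[of t] by simp
  qed
  define p where "p j = (((**) c) ^^ j) (mat 1)" for j
  have pW: "p j \<in> W" for j unfolding p_def by (induction j) (auto simp: W_one W_mult cW)
  have pv: "p j *v v = (z * z) ^ j *s v" for j
  proof (induction j)
    case (Suc j)
    have "p (Suc j) *v v = c *v (p j *v v)" by (simp add: p_def matrix_vector_mul_assoc)
    then show ?case by (simp add: Suc vector_scalar_commute cv vector_smult_assoc mult_ac)
  qed (simp add: p_def)
  have rap: "ra (p j) x = ((r2 \<circ> r1) ^^ j) x" for j x
  proof (induction j)
    case (Suc j)
    have "ra (p (Suc j)) x = ra c (ra (p j) x)" using ra_mult[OF cW pW] by (simp add: p_def)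
    then show ?case by (simp add: rac Suc)
  qed (simp add: p_def ra_one)
  have "(z * z) ^ h = 1" using h unfolding zz2 by (simp add: Complex.DeMoivre)
  then have "p h *v v = v" using pv[of h] by simp
  \<comment> \<open>A power that fixes a regular vector is the identity; this discharges the
    condition for counting the roots.\<close>
  then have "p h = mat 1" by (rule regular_fixed_imp_one[OF regular pW])
  then have "(r2 \<circ> r1) ^^ h = id" using rap[of h] ra_one by auto
  then have "card Phi = CARD('n) * h" using count by blast
  then have N: "2 * N = CARD('n) * h" using Phi_finite_card(2) N_eq by simp
  have fixed: "u = 0" if u: "c *v u = u" for u
  proof -
    obtain x y where xy: "u = em x + \<i> *s em y" using em_surj by blast
    have "em (ra c x) + \<i> *s em (ra c y) = em x + \<i> *s em y"
      using u by (simp add: xy matrix_vector_right_distrib vector_scalar_commute em_ra[OF cW])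
    from em_combination[OF this] have "x = 0" "y = 0" using nofix rac by auto
    then show ?thesis by (simp add: xy)
  qed
  have sq: "w1 ** w1 = mat 1" "w2 ** w2 = mat 1"
  proof -
    show "w1 ** w1 = mat 1"
      by (rule ra_faithful[OF W_mult[OF w(1,1)] W_one]) (use inv1 w ra_mult ra_one in auto)
    show "w2 ** w2 = mat 1"
      by (rule ra_faithful[OF W_mult[OF w(3,3)] W_one]) (use inv2 w ra_mult ra_one in auto)
  qed
  show ?thesis
    using h w sq v0 regular cv fixed N unfolding zz2 c_def by blast
qed

text \<open>The eigenvalues of the Coxeter element are \<open>\<zeta> ^ (1 - dg i)\<close>. They are closed under
  inversion, because the Coxeter element is a product of two involutions, and do not include \<open>1\<close>.
  So the residues of the \<open>dg i - 1\<close> modulo \<open>h\<close> are positive and have the sum \<open>n * h / 2\<close>, which is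
  also the sum of the \<open>dg i - 1\<close> themselves.\<close>

theorem max_degree_regular: "\<exists>d. regular_number W d \<and> (\<forall>i. dg i \<le> d) \<and> (\<exists>i. dg i = d)"
proof -
  obtain h w1 w2 v where h: "2 \<le> h" and w: "w1 \<in> W" "w2 \<in> W" "w1 ** w1 = mat 1" "w2 ** w2 = mat 1"
    and v: "v \<noteq> 0" "regular_vector W v" "(w2 ** w1) *v v = cis (2 * pi / real h) *s v"
    and nofix: "\<forall>u. (w2 ** w1) *v u = u \<longrightarrow> u = 0" and N2: "2 * N = CARD('n) * h"
    using exists_coxeter_element by (elim exE conjE) (rule that, assumption+)
  define \<zeta> where "\<zeta> = cis (2 * pi / real h)"
  define c where "c = w2 ** w1"
  define c' where "c' = w1 ** w2"
  have cW: "c \<in> W" "c' \<in> W" using W_mult w by (auto simp: c_def c'_def)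
  have c'c: "c' ** c = mat 1" unfolding c_def c'_def by (metis w(3,4) matrix_mul_assoc matrix_mul_rid)
  have \<zeta>: "\<zeta> \<noteq> 0" "cnj \<zeta> * \<zeta> = 1" "cnj (inverse \<zeta>) * inverse \<zeta> = 1"
  proof -
    show "\<zeta> \<noteq> 0" by (simp add: \<zeta>_def)
    show "cnj \<zeta> * \<zeta> = 1" by (simp add: \<zeta>_def cis_cnj cis_mult)
    then show "cnj (inverse \<zeta>) * inverse \<zeta> = 1" by (metis complex_cnj_inverse inverse_1 inverse_mult_distrib)
  qed
  have root_unity: "\<zeta> ^ a = \<zeta> ^ b \<longleftrightarrow> a mod h = b mod h" for a b
  proof -
    have e: "\<zeta> ^ a = exp (2 * of_real pi * \<i> * of_nat a / of_nat h)" for a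
      by (simp add: \<zeta>_def DeMoivre cis_conv_exp mult_ac flip: exp_of_nat_mult)
    show ?thesis unfolding e by (rule complex_root_unity_eq) (use h in simp)
  qed
  have cv: "c *v v = \<zeta> *s v" using v by (simp add: c_def \<zeta>_def)
  have c'v: "c' *v v = inverse \<zeta> *s v"
  proof -
    have "v = c' *v (\<zeta> *s v)" using c'c by (metis cv matrix_vector_mul_assoc matrix_vector_mul_lid)
    then have "inverse \<zeta> *s v = inverse \<zeta> *s (\<zeta> *s (c' *v v))" by (simp add: vector_scalar_commute)
    then show ?thesis using \<zeta>(1) by (simp add: vector_smult_assoc)
  qed
  define e where "e i = dg i - 1" for i
  let ?g = "transpose c" and ?g' = "transpose c'" and ?u = "sigma v"
  have gG: "?g \<in> G" "?g' \<in> G" using cW by (auto simp: G_iff transpose_transpose)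
  have u: "f ?u \<noteq> 0" by (rule sigma_regular[OF v(2)])
  have gu: "?g *v ?u = \<zeta> *s ?u" "?g' *v ?u = inverse \<zeta> *s ?u"
    using sigma_eigenvector cW cv c'v \<zeta> by auto
  have det1: "det (mat x - ?g) = (\<Prod>i\<in>UNIV. x - inverse \<zeta> ^ e i)" for x
    unfolding e_def by (rule det_regular_eigenvector[OF u gG(1) gu(1) \<zeta>(1)])
  have det2: "det (mat x - ?g') = (\<Prod>i\<in>UNIV. x - \<zeta> ^ e i)" for x
    using det_regular_eigenvector[OF u gG(2) gu(2), of x] \<zeta>(1) by (simp add: e_def)
  have det12: "det (mat x - ?g') = det (mat x - ?g)" for x
  proof -
    let ?T = "transpose w1"
    have TT: "?T ** ?T = mat 1" using w(3) by (metis matrix_transpose_mul transpose_mat)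
    have "?g' = ?T ** ?g ** ?T"
      unfolding c_def c'_def matrix_transpose_mul using TT by (metis matrix_mul_assoc matrix_mul_lid)
    moreover have "mat x = ?T ** mat x ** ?T"
    proof -
      have "(?T ** mat x ** ?T) *v y = mat x *v y" for y
      proof -
        have m: "mat x *v \<xi> = x *s \<xi>" for \<xi> :: "complex ^ 'n"
          by (simp add: vec_eq_iff matrix_vector_mult_def mat_def if_distrib[of "\<lambda>a. a * _"] cong: if_cong)
        have "?T *v (?T *v y) = y" using TT by (metis matrix_vector_mul_assoc matrix_vector_mul_lid)
        then show ?thesis by (simp add: matrix_vector_mul_assoc[symmetric] m vector_scalar_commute)
      qed
      then show ?thesis by (metis matrix_eq)
    qed
    moreover have "?T ** (mat x - ?g) ** ?T = ?T ** mat x ** ?T - ?T ** ?g ** ?T"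
      by (intro matrix_eq[THEN iffD2] allI) (simp add: matrix_vector_mul_assoc[symmetric]
        matrix_vector_mult_diff_rdistrib matrix_vector_mult_diff_distrib)
    ultimately have "mat x - ?g' = ?T ** (mat x - ?g) ** ?T" by simp
    moreover have "det ?T * det ?T = 1" using TT by (metis det_I det_mul)
    ultimately show ?thesis by (metis det_mul mult.commute mult.left_commute mult_1)
  qed
  have ms: "image_mset (\<lambda>i. inverse \<zeta> ^ e i) (mset_set (UNIV :: 'n set)) = image_mset (\<lambda>i. \<zeta> ^ e i) (mset_set UNIV)"
    by (rule mset_eq_if_linear_products_eq) (use det1 det2 det12 in auto)
  define r where "r i = e i mod h" for i
  have hr: "r i < h" for i using h by (simp add: r_def)
  have r0: "r i \<noteq> 0" for i
  proof
    assume "r i = 0"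
    then have "\<zeta> ^ e i = \<zeta> ^ 0" unfolding root_unity by (simp add: r_def)
    then have "1 - inverse \<zeta> ^ e i = 0" by (simp add: power_inverse)
    then have "det (mat 1 - ?g) = 0" unfolding det1 by (intro prod_zero) auto
    moreover have "mat 1 - ?g = transpose (mat 1 - c)"
      by (simp add: transpose_def mat_def vec_eq_iff)
    ultimately have "det (mat 1 - c) = 0" by (simp add: det_transpose)
    then have "\<not> invertible (mat 1 - c)" by (simp add: invertible_det_nz)
    then have "\<not> (\<exists>A. A ** (mat 1 - c) = mat 1)"
      using matrix_left_right_inverse unfolding invertible_def by blast
    then obtain y where "(mat 1 - c) *v y = 0" "y \<noteq> 0" by (auto simp: matrix_left_invertible_ker)
    then show False using nofix by (simp add: matrix_vector_mult_diff_rdistrib c_def)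
  qed
  \<comment> \<open>Reads the exponent modulo \<open>h\<close> off an eigenvalue, so that equal
    multisets of eigenvalues give equal sums of residues.\<close>
  define val where "val x = (THE k. k < h \<and> x = \<zeta> ^ k)" for x
  have val: "val (\<zeta> ^ k) = k mod h" for k
    unfolding val_def
    by (rule the_equality) (use root_unity[of k "k mod h"] root_unity[of k] h in auto)
  have "inverse \<zeta> ^ e i = \<zeta> ^ (h - r i)" for i
  proof -
    have "\<zeta> ^ (h - r i) * \<zeta> ^ r i = \<zeta> ^ h" using hr[of i] by (simp flip: power_add)
    also have "\<zeta> ^ h = \<zeta> ^ 0" unfolding root_unity by simp
    also have "\<zeta> ^ r i = \<zeta> ^ e i" unfolding root_unity by (simp add: r_def)
    finally show ?thesis using \<zeta>(1) by (simp add: power_inverse field_simps)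
  qed
  then have "(\<Sum>i\<in>UNIV. val (inverse \<zeta> ^ e i)) = (\<Sum>i\<in>(UNIV :: 'n set). h - r i)"
    using val r0 h by (intro sum.cong) (auto intro!: mod_less diff_less)
  moreover have "(\<Sum>i\<in>UNIV. val (inverse \<zeta> ^ e i)) = (\<Sum>i\<in>UNIV. val (\<zeta> ^ e i))"
  proof -
    have "(\<Sum>i\<in>UNIV. val (a i)) = sum_mset (image_mset val (image_mset a (mset_set (UNIV :: 'n set))))" for a
      by (simp add: sum_unfold_sum_mset image_mset.compositionality comp_def)
    then show ?thesis using ms by simp
  qed
  moreover have "(\<Sum>i\<in>UNIV. val (\<zeta> ^ e i)) = (\<Sum>i\<in>UNIV. r i)" by (simp add: val r_def)
  ultimately have "2 * (\<Sum>i\<in>UNIV. r i) = (\<Sum>i\<in>UNIV. (h - r i) + r i)" by (simp add: sum.distrib)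
  also have "\<dots> = CARD('n) * h" using hr by (simp add: less_imp_le)
  finally have sum_eq: "(\<Sum>i\<in>UNIV. r i) = (\<Sum>i\<in>UNIV. e i)" using N2 N_eq_sum by (simp add: e_def)
  have re: "r i = e i" for i
  proof (rule ccontr)
    assume "r i \<noteq> e i"
    then have "r i < e i" unfolding r_def by (metis le_neq_implies_less mod_less_eq_dividend)
    moreover have "r j \<le> e j" for j unfolding r_def by simp
    ultimately have "(\<Sum>i\<in>UNIV. r i) < (\<Sum>i\<in>UNIV. e i)" by (intro sum_strict_mono_ex1) auto
    then show False using sum_eq by simp
  qed
  have le: "dg i \<le> h" for i using re[of i] hr[of i] dg_pos[of i] by (simp add: e_def)
  \<comment> \<open>\<zeta> itself is an eigenvalue, so some \<open>dg i\<close> is divisible by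
    \<open>h\<close>; being positive and at most \<open>h\<close>, it equals
    \<open>h\<close>.\<close>
  have "\<exists>i. \<zeta> - inverse \<zeta> ^ e i = 0"
  proof (rule ccontr)
    assume "\<not> ?thesis"
    then have "det (mat \<zeta> - ?g) \<noteq> 0" unfolding det1 by simp
    then have "invertible (mat \<zeta> - ?g)" by (simp add: invertible_det_nz)
    then obtain A where "A ** (mat \<zeta> - ?g) = mat 1" by (auto simp: invertible_def)
    then have "?u = A *v ((mat \<zeta> - ?g) *v ?u)" by (simp add: matrix_vector_mul_assoc)
    moreover have "mat \<zeta> *v ?u = \<zeta> *s ?u"
      by (simp add: vec_eq_iff matrix_vector_mult_def mat_def if_distrib[of "\<lambda>a. a * _"] cong: if_cong)
    ultimately have "?u = 0" 
      by (simp only: matrix_vector_mult_diff_rdistrib gu diff_self matrix_vector_mult_0_right)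
    then show False using sigma_eq_0 v(1) by blast
  qed
  then obtain i where "\<zeta> = inverse \<zeta> ^ e i" by auto
  then have "\<zeta> * \<zeta> ^ e i = 1" using \<zeta>(1) by (metis left_inverse power_inverse power_not_zero)
  then have "\<zeta> ^ dg i = \<zeta> ^ 0" using dg_pos[of i] by (simp add: e_def power_eq_if)
  then have "dg i mod h = 0" unfolding root_unity by simp
  then have "dg i = h" using le[of i] dg_pos[of i] by (metis mod_less le_neq_implies_less less_irrefl)
  moreover have "regular_number W h"
    unfolding regular_number_def using h cW v by (auto simp: c_def intro!: bexI[of _ "w2 ** w1"] exI[of _ v])
  ultimately show ?thesis using le by blast
qed

end

section \<open>Rank one and the final statement\<close>

context complex_refl_deg
begin

text \<open>In rank one the change of basis does nothing, and a real number of finite order is 1 or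
  -1. So \<open>W\<close> has at most two elements, and its order is the only degree.\<close>

lemma max_degree_regular_rank_one:
  fixes B :: "complex ^ 'n ^ 'n"
  assumes n1: "CARD('n) = 1" and B: "invertible B"
    and real: "\<And>g i j. g \<in> W \<Longrightarrow> (matrix_inv B ** g ** B) $ i $ j \<in> \<real>"
  shows "regular_number W (dg i)"
proof -
  obtain i0 :: 'n where U: "(UNIV :: 'n set) = {i0}" using n1 card_1_singletonE by blast
  then have all: "j = i0" for j by auto
  have mul: "(M ** M') $ i0 $ i0 = M $ i0 $ i0 * M' $ i0 $ i0" for M M' :: "complex ^ 'n ^ 'n"
    by (simp add: matrix_matrix_mult_def U)
  have eqI: "M = M'" if "M $ i0 $ i0 = M' $ i0 $ i0" for M M' :: "complex ^ 'n ^ 'n"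
    using that all by (metis (full_types) vec_eq_iff)
  have mat: "(mat x :: complex ^ 'n ^ 'n) $ i0 $ i0 = x" for x by (simp add: mat_def)
  have vec: "(M *v y) = M $ i0 $ i0 *s y" for M :: "complex ^ 'n ^ 'n" and y
    using all by (simp add: vec_eq_iff matrix_vector_mult_def U) (metis (full_types))
  have pm: "g = mat 1 \<or> g = mat (- 1)" if g: "g \<in> W" for g
  proof -
    let ?l = "g $ i0 $ i0"
    have "matrix_inv B ** B = mat 1"
      using someI_ex[OF B[unfolded invertible_def]] unfolding matrix_inv_def by auto
    then have "matrix_inv B $ i0 $ i0 * B $ i0 $ i0 = 1" by (metis mul mat)
    then have "(matrix_inv B ** g ** B) $ i0 $ i0 = ?l" by (simp add: mul mult.commute mult.left_commute)
    then have re: "?l \<in> \<real>" using real[OF g, of i0 i0] by simp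
    obtain k :: nat where k: "k > 0" "g [^]\<^bsub>GL\<^esub> k = \<one>\<^bsub>GL\<^esub>" using W_finite_order[OF g] by blast
    interpret group "GL :: (complex ^ 'n ^ 'n) monoid" by (rule group_GL)
    have "(g [^]\<^bsub>GL\<^esub> (j::nat)) $ i0 $ i0 = ?l ^ j" for j
      by (induction j) (auto simp: mul mat mult.commute)
    from this[of k] have "?l ^ k = 1" using k(2) by (simp add: mat)
    then have "norm ?l = 1" using power_eq_1_iff k(1) by blast
    moreover obtain x where x: "?l = complex_of_real x" using re by (elim Reals_cases)
    ultimately have "x = 1 \<or> x = - 1" by auto
    then have "?l = 1 \<or> ?l = - 1" using x by auto
    then show ?thesis using eqI[of g "mat 1"] eqI[of g "mat (- 1)"] by (auto simp: mat)
  qed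
  have cW: "card W = dg i0" using card_G_eq_prod card_G by (simp add: U)
  have ii: "i = i0" by (rule all)
  have not_refl: "mat 1 \<notin> reflections W" by (simp add: reflections_def pseudo_reflection_def)
  show ?thesis
  proof (cases "mat (- 1) \<in> W")
    case True
    have ne: "mat 1 \<noteq> (mat (- 1) :: complex ^ 'n ^ 'n)" using mat[of 1] mat[of "- 1"] by (metis one_neq_neg_one)
    have "W = {mat 1, mat (- 1)}" using pm True W_one by blast
    then have d: "dg i = 2" using cW ne by (simp add: ii)
    have "regular_vector W (axis i0 1)"
      unfolding regular_vector_def reflecting_hyperplane_def
    proof (intro ballI notI)
      fix t assume t: "t \<in> reflections W" "axis i0 1 \<in> {v. t *v v = v}"
      then have "t = mat (- 1)" using pm[of t] not_refl by (auto simp: reflections_def)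
      then have "(- 1) *s axis i0 1 = (axis i0 1 :: complex ^ 'n)" using t(2) vec mat by auto
      then have "(- 1 :: complex) = 1" by (metis vector_smult_component axis_nth mult.right_neutral)
      then show False by simp
    qed
    moreover have "mat (- 1) *v axis i0 1 = cis (2 * pi / real 2) *s (axis i0 1 :: complex ^ 'n)"
      unfolding vec mat by simp
    moreover have "axis i0 1 \<noteq> (0 :: complex ^ 'n)" by simp
    ultimately show ?thesis unfolding regular_number_def d
      by (intro conjI bexI[of _ "mat (- 1)"] exI[of _ "axis i0 1"] True) simp_all
  next
    case False
    then have Wt: "W = {mat 1}" using pm W_one by blast
    then have d: "dg i = 1" using cW by (simp add: ii)
    have "reflections W = {}" using not_refl Wt by (auto simp: reflections_def)
    then have "regular_vector W (axis i0 1)" by (simp add: regular_vector_def)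
    moreover have "mat 1 *v axis i0 1 = cis (2 * pi / real 1) *s (axis i0 1 :: complex ^ 'n)" by simp
    moreover have "axis i0 1 \<noteq> (0 :: complex ^ 'n)" by simp
    ultimately show ?thesis unfolding regular_number_def d
      by (intro conjI bexI[of _ "mat 1"] exI[of _ "axis i0 1"] W_one) simp_all
  qed
qed

end

theorem theorem1:
  fixes W :: "(complex ^ 'n::finite ^ 'n) set"
    and ds :: "nat list"
    and f :: "'n cpoly"
  assumes "complex_reflection_group W"
    and "degrees_of W ds"
    and "defining_equation W f"
  shows "(regular_number W (last ds) \<longrightarrow>
            waring_rank f = prod_list (butlast ds) \<and>
            real (prod_list (butlast ds)) = real (card W) / real (last ds)) \<and>
         (irreducible_group W \<and> real_group W \<longrightarrow> regular_number W (last ds))"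
proof -
  obtain L where L: "\<And>t. t \<in> reflections W \<Longrightarrow> L t \<noteq> 0 \<and> (\<exists>c. c \<noteq> 1 \<and> t *v L t = c *s L t)"
    and f: "f = (\<Prod>t\<in>reflections W. lin (L t))"
    using assms(3) unfolding defining_equation_def by blast
  obtain P :: "'n \<Rightarrow> 'n cpoly" and dg where P: "\<And>i. P i \<in> invariants W" "\<And>i. homogeneous (dg i) (P i)"
    "algebraically_independent P" "invariants W = range (psubst P)"
    and ds: "sorted ds" "mset ds = image_mset dg (mset_set UNIV)"
    using assms(2) unfolding degrees_of_def by blast
  interpret complex_refl_deg W L P dg
    by unfold_locales (use assms(1) L P in auto)
  have set_ds: "set ds = range dg" using arg_cong[OF ds(2), of set_mset] by simp
  then have ne: "ds \<noteq> []" by auto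
  have le: "dg i \<le> last ds" for i
  proof -
    have "dg i \<in> set ds" using set_ds by blast
    then obtain k where "k < length ds" "ds ! k = dg i" by (auto simp: in_set_conv_nth)
    then show ?thesis using sorted_nth_mono[OF ds(1), of k "length ds - 1"] ne by (simp add: last_conv_nth)
  qed
  have "last ds \<in> range dg" using set_ds ne last_in_set by blast
  then obtain im where im: "last ds = dg im" by blast
  have "prod_list ds = (\<Prod>i\<in>UNIV. dg i)"
    using arg_cong[OF ds(2), of prod_mset] by (simp add: prod_mset_prod_list prod_unfold_prod_mset)
  then have pc: "prod_list ds = card W" using card_G_eq_prod card_G by simp
  have "prod_list ds = prod_list (butlast ds) * last ds"
    using ne by (metis append_butlast_last_id prod_list.append prod_list.Cons prod_list.Nil mult.right_neutral)
  then have pb: "prod_list (butlast ds) * last ds = card W" using pc by simp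
  have lpos: "0 < last ds" using im dg_pos by simp
  have "waring_rank f = prod_list (butlast ds)" if "regular_number W (last ds)"
    using waring_rank_times_degree[OF that le] pb lpos unfolding f by (metis mult_right_cancel less_irrefl)
  moreover have "real (prod_list (butlast ds)) = real (card W) / real (last ds)"
    using pb lpos by (simp add: field_simps flip: of_nat_mult)
  moreover have "regular_number W (last ds)" if ir: "irreducible_group W" "real_group W"
  proof -
    obtain B :: "complex ^ 'n ^ 'n" where B: "invertible B" "\<And>g i j. g \<in> W \<Longrightarrow> (matrix_inv B ** g ** B) $ i $ j \<in> \<real>"
      using ir(2) unfolding real_group_def by (elim exE conjE) (rule that, auto)
    show ?thesis
    proof (cases "2 \<le> CARD('n)")
      case True
      interpret real_irr W L P dg B
        by unfold_locales (use B ir(1) True in auto)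
      obtain d where "regular_number W d" "\<forall>i. dg i \<le> d" "\<exists>i. dg i = d" using max_degree_regular by blast
      \<comment> \<open>Both are the maximum of the values of \<open>dg\<close>.\<close>
      then have "d = last ds" using le im by (metis antisym)
      then show ?thesis using \<open>regular_number W d\<close> by simp
    next
      case False
      moreover have "0 < CARD('n)" by simp
      ultimately have "CARD('n) = 1" by linarith
      from max_degree_regular_rank_one[OF this B] show ?thesis unfolding im .
    qed
  qed
  ultimately show ?thesis by blast
qed

end
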